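(* Let $G$ be a Lie groupoid over $M$ with multiplication map $m_G:G_{(2)}\to G$, and let $m_{\mathbb{T}}:(\mathbb{T}G)_{(2)}\to\mathbb{T}G$ denote the groupoid multiplication on $\mathbb{T}G=TG\oplus T^*G$. Then $\mathrm{graph}(m_{\mathbb{T}})\subseteq \mathbb{T}G\times\overline{\mathbb{T}G\times\mathbb{T}G}$ is a Dirac structure supported on $\mathrm{graph}(m_G)\subseteq G\times G\times G$. That is, $\mathrm{graph}(m_{\mathbb{T}})$ is a Courant algebroid morphism from $\mathbb{T}G\times\mathbb{T}G$ to $\mathbb{T}G$.
   Context: $\mathbb{T}G=TG\oplus T^*G$ carries the standard Courant algebroid structure over $G$: pairing $\langle (X,\alpha),(Y,\beta)\rangle=\alpha(Y)+\beta(X)$, bracket $[\![(X,\alpha),(Y,\beta)]\!]=([X,Y],\mathcal{L}_X\beta-i_Yd\alpha)$, anchor the projection to $TG$. $\mathbb{T}G\times\mathbb{T}G\to G\times G$ is the direct product Courant algebroid (componentwise pairing, anchor, bracket). For a Courant algebroid $\mathbb{E}$, $\overline{\mathbb{E}}$ is the same vector bundle with the same bracket and anchor but minus the pairing. Groupoid conventions: $G_{(2)}=\{(g,h):s(g)=t(h)\}$; $AG=\ker(Ts)|_M$. $TG$ is a Lie groupoid over $TM$ (tangent functor applied to all structure maps) with multiplication $X_g\bullet Y_h=Tm_G(X_g,Y_h)$. $T^*G$ is a Lie groupoid over $A^*G$ with $\tilde s(\alpha_g)u=\alpha_g(Tl_g(u-Tt(u)))$ for $u\in A_{s(g)}G$,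 $\tilde t(\beta_g)v=\beta_g(Tr_g(v))$ for $v\in A_{t(g)}G$, and $(\alpha_g\circ\beta_h)(X_g\bullet Y_h)=\alpha_g(X_g)+\beta_h(Y_h)$. $\mathbb{T}G$ is the direct sum Lie groupoid over $TM\oplus A^*G$. The graphs are $\mathrm{graph}(m_{\mathbb{T}})=\{(m_{\mathbb{T}}(a,b),a,b)\}$ and $\mathrm{graph}(m_G)=\{(m_G(g,h),g,h):(g,h)\in G_{(2)}\}$. Dirac structure with support: given a Courant algebroid $(\mathbb{E},\rho,[\![\cdot,\cdot]\!])$ over $N$ and a submanifold $Q\subseteq N$, a Dirac structure supported on $Q$ is a subbundle $K\subset\mathbb{E}|_Q$ such that $K_x\subseteq\mathbb{E}_x$ is Lagrangian for all $x\in Q$ and (1) $\rho(K)\subseteq TQ$; (2) whenever $a_1,a_2\in\Gamma(\mathbb{E})$ satisfy $a_1|_Q,a_2|_Q\in\Gamma(K)$, then $[\![a_1,a_2]\!]|_Q\in\Gamma(K)$. A Courant algebroid morphism from $\mathbb{E}_1$ to $\mathbb{E}_2$ is a Dirac structure in $\mathbb{E}_2\times\overline{\mathbb{E}_1}$ supported on the graph of a smooth map $f$ from the base of $\mathbb{E}_1$ to the base of $\mathbb{E}_2$; here the map is $m_G$, which is defined only on the submanifold $G_{(2)}\subseteq G\times G$. *)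

theory Defs
  imports "HOL-Analysis.Analysis"
begin

section \<open>Model spaces\<close>

text \<open>
  \<^class>\<open>euclidean_space\<close> forces the dimension to be at least 1. To allow manifolds of dimension 0
  (for instance the unit manifold of a Lie group), charts take values in a finite-dimensional real
  inner product space of arbitrary dimension. Completeness is automatic in finite dimension; it is
  listed only to make the library's Banach space results available.
\<close>

class findim_space = real_inner + banach +
  assumes finite_spanning_set: "\<exists>B. finite B \<and> (\<forall>x. \<exists>c. x = (\<Sum>b\<in>B. c b *\<^sub>R b))"

lemma findim_spaceI:
  fixes B :: "'a::real_vector set"
  assumes "finite B" "span B = UNIV"
  shows "\<exists>B::'a set. finite B \<and> (\<forall>x. \<exists>c. x = (\<Sum>b\<in>B. c b *\<^sub>R b))"
proof (intro exI[of _ B] conjI allI)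
  fix x
  have "x \<in> range (\<lambda>c. \<Sum>b\<in>B. c b *\<^sub>R b)"
    using assms by (simp flip: span_finite)
  then show "\<exists>c. x = (\<Sum>b\<in>B. c b *\<^sub>R b)" by blast
qed (rule assms)

lemma finite_span_UNIV:
  obtains B :: "'a::findim_space set" where "finite B" "span B = UNIV"
proof -
  obtain B :: "'a set" where B: "finite B" "\<forall>x. \<exists>c. x = (\<Sum>b\<in>B. c b *\<^sub>R b)"
    using finite_spanning_set by blast
  have "x \<in> span B" for x
  proof -
    obtain c where c: "x = (\<Sum>b\<in>B. c b *\<^sub>R b)" using B(2) by blast
    have "(\<Sum>b\<in>B. c b *\<^sub>R b) \<in> span B"
      by (intro span_sum span_scale span_base)
    then show ?thesis by (simp only: c)
  qed
  then show thesis using that[of B] B(1) by blast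
qed

instance euclidean_space \<subseteq> findim_space
  by standard (rule findim_spaceI[OF finite_Basis span_Basis])

instance prod :: (findim_space, findim_space) findim_space
proof
  obtain B1 :: "'a set" where B1: "finite B1" "span B1 = UNIV"
    by (rule finite_span_UNIV)
  obtain B2 :: "'b set" where B2: "finite B2" "span B2 = UNIV"
    by (rule finite_span_UNIV)
  let ?B = "(\<lambda>x. (x, 0)) ` B1 \<union> (\<lambda>y. (0, y)) ` B2 :: ('a \<times> 'b) set"
  have l1: "linear (\<lambda>x::'a. (x, 0::'b))" and l2: "linear (\<lambda>y::'b. (0::'a, y))"
    by (auto intro!: linearI)
  have "(x, y) \<in> span ?B" for x y
  proof -
    have "(x, 0) \<in> span ((\<lambda>x. (x, 0::'b)) ` B1)"
      using B1(2) by (auto simp: linear_span_image[OF l1])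
    moreover have "(0, y) \<in> span ((\<lambda>y. (0::'a, y)) ` B2)"
      using B2(2) by (auto simp: linear_span_image[OF l2])
    ultimately have "(x, 0) + (0, y) \<in> span ?B"
      by (intro span_add) (auto intro: subsetD[OF span_mono])
    then show ?thesis by simp
  qed
  then have B: "span ?B = UNIV" by (intro set_eqI) (simp add: split_paired_all)
  then show "\<exists>B::('a \<times> 'b) set. finite B \<and> (\<forall>x. \<exists>c. x = (\<Sum>b\<in>B. c b *\<^sub>R b))"
    using B1(1) B2(1) by (intro findim_spaceI[OF _ B]) simp
qed

text \<open>The 0-dimensional model space.\<close>

instantiation unit :: real_inner
begin

definition zero_unit :: unit where "zero_unit = ()"
definition plus_unit :: "unit \<Rightarrow> unit \<Rightarrow> unit" where "plus_unit x y = ()"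
definition scaleR_unit :: "real \<Rightarrow> unit \<Rightarrow> unit" where "scaleR_unit r x = ()"
definition inner_unit :: "unit \<Rightarrow> unit \<Rightarrow> real" where "inner_unit x y = 0"
definition norm_unit :: "unit \<Rightarrow> real" where "norm_unit x = 0"
definition dist_unit :: "unit \<Rightarrow> unit \<Rightarrow> real" where "dist_unit x y = 0"
definition sgn_unit :: "unit \<Rightarrow> unit" where "sgn_unit x = ()"
definition uniformity_unit :: "(unit \<times> unit) filter" where
  "uniformity_unit = (INF e\<in>{0<..}. principal {(x, y). dist x y < e})"
definition open_unit :: "unit set \<Rightarrow> bool" where
  "open_unit U = (\<forall>x\<in>U. eventually (\<lambda>(x', y). x' = x \<longrightarrow> y \<in> U) uniformity)"

instance
proof
  show "uniformity = (INF e\<in>{0<..}. principal {(x::unit, y). dist x y < e})"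
    by (rule uniformity_unit_def)
  show "open U = (\<forall>x\<in>U. eventually (\<lambda>(x', y). x' = x \<longrightarrow> y \<in> U) uniformity)" for U :: "unit set"
    by (rule open_unit_def)
qed (auto simp: zero_unit_def plus_unit_def scaleR_unit_def inner_unit_def norm_unit_def
       dist_unit_def sgn_unit_def)

end

instance unit :: findim_space
proof
  show "convergent X" if "Cauchy X" for X :: "nat \<Rightarrow> unit"
  proof -
    have "X = (\<lambda>_. ())" by auto
    then show ?thesis by (simp add: convergent_const)
  qed
  show "\<exists>B::unit set. finite B \<and> (\<forall>x. \<exists>c. x = (\<Sum>b\<in>B. c b *\<^sub>R b))"
    by (intro exI[of _ "{}"]) simp
qed

section \<open>Smooth maps on open sets of model spaces\<close>

text \<open>The set \<^term>\<open>S\<close> is meant to be open, the domain finite-dimensional.\<close>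

primrec Ck_on :: "nat \<Rightarrow> 'a::real_normed_vector set \<Rightarrow> ('a \<Rightarrow> 'b::real_normed_vector) \<Rightarrow> bool" where
  "Ck_on 0 S f \<longleftrightarrow> continuous_on S f"
| "Ck_on (Suc n) S f \<longleftrightarrow> (\<forall>x\<in>S. f differentiable (at x)) \<and>
     (\<forall>v. Ck_on n S (\<lambda>x. frechet_derivative f (at x) v))"

definition smooth_on :: "'a::real_normed_vector set \<Rightarrow> ('a \<Rightarrow> 'b::real_normed_vector) \<Rightarrow> bool" where
  "smooth_on S f \<longleftrightarrow> (\<forall>n. Ck_on n S f)"

section \<open>Manifolds\<close>

text \<open>
  An atlas is indexed by the points of the manifold: every point \<open>p\<close> comes with a chart
  \<open>chart M p\<close> defined on a neighbourhood \<open>chart_dom M p\<close> of \<open>p\<close>. The tangent space at \<open>p\<close> is then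
  identified with the model space \<open>'e\<close> by means of the differential of this preferred chart, and the
  cotangent space with \<open>'e \<Rightarrow>\<^sub>L real\<close>. So a tangent vector is a pair \<open>(p, v) :: 'p \<times> 'e\<close>, and a vector
  field is a function \<open>'p \<Rightarrow> 'e\<close>; the coordinates with respect to another chart \<open>chart M q\<close> are
  obtained by \<open>vec_coord M q p\<close> and \<open>covec_coord M q p\<close>.
\<close>

record ('p, 'e) mfd =
  points :: "'p set"
  chart_dom :: "'p \<Rightarrow> 'p set"
  chart :: "'p \<Rightarrow> 'p \<Rightarrow> 'e"

definition chart_inv :: "('p, 'e) mfd \<Rightarrow> 'p \<Rightarrow> 'e \<Rightarrow> 'p" where
  "chart_inv M p = inv_into (chart_dom M p) (chart M p)"

definition mfd_top :: "('p, 'e::findim_space) mfd \<Rightarrow> 'p topology" where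
  "mfd_top M = topology (\<lambda>W. W \<subseteq> points M \<and>
     (\<forall>p\<in>points M. open (chart M p ` (W \<inter> chart_dom M p))))"

definition smooth_manifold :: "('p, 'e::findim_space) mfd \<Rightarrow> bool" where
  "smooth_manifold M \<longleftrightarrow>
     (\<forall>p\<in>points M. p \<in> chart_dom M p \<and> chart_dom M p \<subseteq> points M \<and>
        inj_on (chart M p) (chart_dom M p) \<and> open (chart M p ` chart_dom M p)) \<and>
     (\<forall>p\<in>points M. \<forall>q\<in>points M.
        open (chart M p ` (chart_dom M p \<inter> chart_dom M q)) \<and>
        smooth_on (chart M p ` (chart_dom M p \<inter> chart_dom M q)) (chart M q \<circ> chart_inv M p)) \<and>
     Hausdorff_space (mfd_top M) \<and> second_countable (mfd_top M)"

definition prod_mfd :: "('p, 'e) mfd \<Rightarrow> ('q, 'f) mfd \<Rightarrow> ('p \<times> 'q, 'e \<times> 'f) mfd"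
    (infixr \<open>\<times>\<^sub>M\<close> 80) where
  "M \<times>\<^sub>M N = \<lparr>points = points M \<times> points N,
     chart_dom = (\<lambda>(p, q). chart_dom M p \<times> chart_dom N q),
     chart = (\<lambda>(p, q). map_prod (chart M p) (chart N q))\<rparr>"

text \<open>The topology given by an atlas is one (the argument of \<^const>\<open>topology\<close> satisfies the axioms).\<close>

lemma openin_mfd_top:
  assumes "smooth_manifold M"
  shows "openin (mfd_top M) W \<longleftrightarrow>
    W \<subseteq> points M \<and> (\<forall>p\<in>points M. open (chart M p ` (W \<inter> chart_dom M p)))"
proof -
  let ?P = "\<lambda>W. W \<subseteq> points M \<and> (\<forall>p\<in>points M. open (chart M p ` (W \<inter> chart_dom M p)))"
  have "istopology ?P"
    unfolding istopology_def
  proof (intro conjI allI impI)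
    fix S T assume S: "?P S" and T: "?P T"
    show "S \<inter> T \<subseteq> points M" using S by blast
    show "\<forall>p\<in>points M. open (chart M p ` (S \<inter> T \<inter> chart_dom M p))"
    proof
      fix p assume p: "p \<in> points M"
      have inj: "inj_on (chart M p) (chart_dom M p)"
        using assms p by (simp add: smooth_manifold_def)
      have "chart M p ` ((S \<inter> chart_dom M p) \<inter> (T \<inter> chart_dom M p)) =
          chart M p ` (S \<inter> chart_dom M p) \<inter> chart M p ` (T \<inter> chart_dom M p)"
        by (rule inj_on_image_Int[OF inj]) auto
      moreover have "S \<inter> T \<inter> chart_dom M p = (S \<inter> chart_dom M p) \<inter> (T \<inter> chart_dom M p)"
        by blast
      ultimately show "open (chart M p ` (S \<inter> T \<inter> chart_dom M p))"
        using S T p by (metis open_Int)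
    qed
  next
    fix \<K> assume K: "\<forall>K\<in>\<K>. ?P K"
    show "\<Union>\<K> \<subseteq> points M" using K by blast
    show "\<forall>p\<in>points M. open (chart M p ` (\<Union>\<K> \<inter> chart_dom M p))"
    proof
      fix p assume p: "p \<in> points M"
      have "chart M p ` (\<Union>\<K> \<inter> chart_dom M p) = (\<Union>K\<in>\<K>. chart M p ` (K \<inter> chart_dom M p))"
        by blast
      then show "open (chart M p ` (\<Union>\<K> \<inter> chart_dom M p))"
        using K p by auto
    qed
  qed
  then show ?thesis
    by (simp add: mfd_top_def topology_inverse')
qed

subsection \<open>Smooth maps and tangent maps\<close>

definition smooth_map ::
    "('p, 'e::findim_space) mfd \<Rightarrow> ('q, 'f::findim_space) mfd \<Rightarrow> 'p set \<Rightarrow> ('p \<Rightarrow> 'q) \<Rightarrow> bool" where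
  "smooth_map M N W f \<longleftrightarrow> openin (mfd_top M) W \<and>
     continuous_map (subtopology (mfd_top M) W) (mfd_top N) f \<and>
     (\<forall>p\<in>points M. \<forall>q\<in>points N.
        smooth_on (chart M p ` {x \<in> chart_dom M p \<inter> W. f x \<in> chart_dom N q})
          (chart N q \<circ> f \<circ> chart_inv M p))"

definition local_extension :: "('p, 'e::findim_space) mfd \<Rightarrow> ('q, 'f::findim_space) mfd \<Rightarrow> 'p set \<Rightarrow>
    ('p \<Rightarrow> 'q) \<Rightarrow> 'p \<Rightarrow> ('p \<Rightarrow> 'q) \<Rightarrow> bool" where
  "local_extension M N Q f p F \<longleftrightarrow>
     (\<exists>W. p \<in> W \<and> smooth_map M N W F \<and> (\<forall>x\<in>Q \<inter> W. F x = f x))"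

text \<open>Smoothness of a map defined only on a subset \<open>Q\<close>, e.g. on an embedded submanifold.\<close>

definition smooth_map_along :: "('p, 'e::findim_space) mfd \<Rightarrow> ('q, 'f::findim_space) mfd \<Rightarrow> 'p set \<Rightarrow>
    ('p \<Rightarrow> 'q) \<Rightarrow> bool" where
  "smooth_map_along M N Q f \<longleftrightarrow> (\<forall>p\<in>Q. \<exists>F. local_extension M N Q f p F)"

definition tangent_map :: "('p, 'e::findim_space) mfd \<Rightarrow> ('q, 'f::findim_space) mfd \<Rightarrow> ('p \<Rightarrow> 'q) \<Rightarrow>
    'p \<Rightarrow> 'e \<Rightarrow> 'f" where
  "tangent_map M N f p =
     frechet_derivative (chart N (f p) \<circ> f \<circ> chart_inv M p) (at (chart M p p))"

text \<open>
  The tangent map of a map defined on a submanifold \<open>Q\<close>; only its values on vectors tangent to \<open>Q\<close>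
  are meaningful, and on these it does not depend on the chosen extension.
\<close>

definition tangent_map_along :: "('p, 'e::findim_space) mfd \<Rightarrow> ('q, 'f::findim_space) mfd \<Rightarrow> 'p set \<Rightarrow>
    ('p \<Rightarrow> 'q) \<Rightarrow> 'p \<Rightarrow> 'e \<Rightarrow> 'f" where
  "tangent_map_along M N Q f p = tangent_map M N (SOME F. local_extension M N Q f p F) p"

subsection \<open>Embedded submanifolds\<close>

text \<open>\<open>(U, \<psi>)\<close> belongs to the maximal atlas.\<close>

definition compatible_chart :: "('p, 'e::findim_space) mfd \<Rightarrow> 'p set \<Rightarrow> ('p \<Rightarrow> 'e) \<Rightarrow> bool" where
  "compatible_chart M U \<psi> \<longleftrightarrow> U \<subseteq> points M \<and> inj_on \<psi> U \<and> open (\<psi> ` U) \<and>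
     (\<forall>p\<in>points M.
        open (\<psi> ` (U \<inter> chart_dom M p)) \<and> open (chart M p ` (U \<inter> chart_dom M p)) \<and>
        smooth_on (\<psi> ` (U \<inter> chart_dom M p)) (chart M p \<circ> inv_into U \<psi>) \<and>
        smooth_on (chart M p ` (U \<inter> chart_dom M p)) (\<psi> \<circ> chart_inv M p))"

definition submanifold :: "('p, 'e::findim_space) mfd \<Rightarrow> 'p set \<Rightarrow> bool" where
  "submanifold M Q \<longleftrightarrow> Q \<subseteq> points M \<and>
     (\<exists>k. \<forall>q\<in>Q. \<exists>U \<psi> S. compatible_chart M U \<psi> \<and> q \<in> U \<and> subspace S \<and> dim S = k \<and>
        \<psi> ` (U \<inter> Q) = \<psi> ` U \<inter> S)"

text \<open>\<open>T\<^sub>q Q\<close> as the set of velocities of smooth curves in \<open>Q\<close>.\<close>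

definition tangent_space :: "('p, 'e::findim_space) mfd \<Rightarrow> 'p set \<Rightarrow> 'p \<Rightarrow> 'e set" where
  "tangent_space M Q q = {v. \<exists>\<gamma> :: real \<Rightarrow> 'p. \<exists>\<epsilon>>0. \<gamma> 0 = q \<and>
     (\<forall>t\<in>{-\<epsilon><..<\<epsilon>}. \<gamma> t \<in> Q \<inter> chart_dom M q) \<and>
     smooth_on {-\<epsilon><..<\<epsilon>} (chart M q \<circ> \<gamma>) \<and>
     ((chart M q \<circ> \<gamma>) has_vector_derivative v) (at 0)}"

section \<open>Cartan calculus\<close>

text \<open>
  \<open>vec_coord M q p\<close> and \<open>covec_coord M q p\<close> convert elements of \<open>T\<^sub>p M\<close> and \<open>T\<^sub>p\<^sup>* M\<close> from the
  coordinates given by the preferred chart at \<open>p\<close> to those given by the chart at \<open>q\<close>.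
\<close>

definition vec_coord :: "('p, 'e::findim_space) mfd \<Rightarrow> 'p \<Rightarrow> 'p \<Rightarrow> 'e \<Rightarrow> 'e" where
  "vec_coord M q p = frechet_derivative (chart M q \<circ> chart_inv M p) (at (chart M p p))"

definition covec_coord ::
    "('p, 'e::findim_space) mfd \<Rightarrow> 'p \<Rightarrow> 'p \<Rightarrow> ('e \<Rightarrow>\<^sub>L real) \<Rightarrow> ('e \<Rightarrow>\<^sub>L real)" where
  "covec_coord M q p \<alpha> = Blinfun (\<lambda>v. blinfun_apply \<alpha>
     (frechet_derivative (chart M p \<circ> chart_inv M q) (at (chart M q p)) v))"

definition vec_rep :: "('p, 'e::findim_space) mfd \<Rightarrow> 'p \<Rightarrow> ('p \<Rightarrow> 'e) \<Rightarrow> 'e \<Rightarrow> 'e" where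
  "vec_rep M q X = (\<lambda>x. vec_coord M q (chart_inv M q x) (X (chart_inv M q x)))"

definition form_rep ::
    "('p, 'e::findim_space) mfd \<Rightarrow> 'p \<Rightarrow> ('p \<Rightarrow> 'e \<Rightarrow>\<^sub>L real) \<Rightarrow> 'e \<Rightarrow> 'e \<Rightarrow>\<^sub>L real" where
  "form_rep M q \<alpha> = (\<lambda>x. covec_coord M q (chart_inv M q x) (\<alpha> (chart_inv M q x)))"

text \<open>
  All operations at \<open>p\<close> are computed in the chart at \<open>p\<close>, by the usual coordinate formulas
  \<open>[X, Y]\<^sup>i = X\<^sup>j \<partial>\<^sub>j Y\<^sup>i - Y\<^sup>j \<partial>\<^sub>j X\<^sup>i\<close>, \<open>(d\<alpha>)\<^sub>i\<^sub>j = \<partial>\<^sub>i \<alpha>\<^sub>j - \<partial>\<^sub>j \<alpha>\<^sub>i\<close> and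
  \<open>(L\<^sub>X \<beta>)\<^sub>i = X\<^sup>j \<partial>\<^sub>j \<beta>\<^sub>i + \<beta>\<^sub>j \<partial>\<^sub>i X\<^sup>j\<close>.
\<close>

definition lie_bracket ::
    "('p, 'e::findim_space) mfd \<Rightarrow> ('p \<Rightarrow> 'e) \<Rightarrow> ('p \<Rightarrow> 'e) \<Rightarrow> 'p \<Rightarrow> 'e" where
  "lie_bracket M X Y p =
     frechet_derivative (vec_rep M p Y) (at (chart M p p)) (X p) -
     frechet_derivative (vec_rep M p X) (at (chart M p p)) (Y p)"

definition ext_deriv ::
    "('p, 'e::findim_space) mfd \<Rightarrow> ('p \<Rightarrow> 'e \<Rightarrow>\<^sub>L real) \<Rightarrow> 'p \<Rightarrow> 'e \<Rightarrow> 'e \<Rightarrow> real" where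
  "ext_deriv M \<alpha> p u v =
     blinfun_apply (frechet_derivative (form_rep M p \<alpha>) (at (chart M p p)) u) v -
     blinfun_apply (frechet_derivative (form_rep M p \<alpha>) (at (chart M p p)) v) u"

definition interior_prod ::
    "('p \<Rightarrow> 'e::findim_space) \<Rightarrow> ('p \<Rightarrow> 'e \<Rightarrow> 'e \<Rightarrow> real) \<Rightarrow> 'p \<Rightarrow> 'e \<Rightarrow>\<^sub>L real" where
  "interior_prod Y \<omega> p = Blinfun (\<lambda>v. \<omega> p (Y p) v)"

definition lie_deriv ::
    "('p, 'e::findim_space) mfd \<Rightarrow> ('p \<Rightarrow> 'e) \<Rightarrow> ('p \<Rightarrow> 'e \<Rightarrow>\<^sub>L real) \<Rightarrow> 'p \<Rightarrow> 'e \<Rightarrow>\<^sub>L real" where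
  "lie_deriv M X \<beta> p = Blinfun (\<lambda>v.
     blinfun_apply (frechet_derivative (form_rep M p \<beta>) (at (chart M p p)) (X p)) v +
     blinfun_apply (\<beta> p) (frechet_derivative (vec_rep M p X) (at (chart M p p)) v))"

section \<open>Courant algebroids\<close>

text \<open>
  The data of a Courant algebroid over the manifold \<open>base E\<close>. As for tangent bundles, all fibres are
  identified with one vector space \<open>'v\<close>; \<open>bundle_coord E q p\<close> converts an element of the fibre over
  \<open>p\<close> to the local trivialisation of the bundle over the chart domain of \<open>q\<close>.
\<close>

record ('x, 'e, 'v) courant =
  base :: "('x, 'e) mfd"
  bundle_coord :: "'x \<Rightarrow> 'x \<Rightarrow> 'v \<Rightarrow> 'v"
  pairing :: "'x \<Rightarrow> 'v \<Rightarrow> 'v \<Rightarrow> real"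
  anchor :: "'x \<Rightarrow> 'v \<Rightarrow> 'e"
  bracket :: "('x \<Rightarrow> 'v) \<Rightarrow> ('x \<Rightarrow> 'v) \<Rightarrow> 'x \<Rightarrow> 'v"

definition smooth_section ::
    "('x, 'e::findim_space, 'v::real_normed_vector) courant \<Rightarrow> 'x set \<Rightarrow> ('x \<Rightarrow> 'v) \<Rightarrow> bool" where
  "smooth_section E W a \<longleftrightarrow> openin (mfd_top (base E)) W \<and>
     (\<forall>q\<in>points (base E). smooth_on (chart (base E) q ` (chart_dom (base E) q \<inter> W))
        (\<lambda>x. bundle_coord E q (chart_inv (base E) q x) (a (chart_inv (base E) q x))))"

text \<open>Smooth sections of the restriction of \<open>E\<close> to a submanifold \<open>Q\<close>.\<close>

definition smooth_section_along ::
    "('x, 'e::findim_space, 'v::real_normed_vector) courant \<Rightarrow> 'x set \<Rightarrow> ('x \<Rightarrow> 'v) \<Rightarrow> bool" where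
  "smooth_section_along E Q a \<longleftrightarrow>
     (\<forall>q\<in>Q. \<exists>W b. q \<in> W \<and> smooth_section E W b \<and> (\<forall>x\<in>Q \<inter> W. b x = a x))"

definition std_courant ::
    "('p, 'e::findim_space) mfd \<Rightarrow> ('p, 'e, 'e \<times> ('e \<Rightarrow>\<^sub>L real)) courant" where
  "std_courant M = \<lparr>base = M,
     bundle_coord = (\<lambda>q p (X, \<alpha>). (vec_coord M q p X, covec_coord M q p \<alpha>)),
     pairing = (\<lambda>p (X, \<alpha>) (Y, \<beta>). blinfun_apply \<alpha> Y + blinfun_apply \<beta> X),
     anchor = (\<lambda>p (X, \<alpha>). X),
     bracket = (\<lambda>a b p.
       let X = fst \<circ> a; \<alpha> = snd \<circ> a; Y = fst \<circ> b; \<beta> = snd \<circ> b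
       in (lie_bracket M X Y p,
           lie_deriv M X \<beta> p - interior_prod Y (ext_deriv M \<alpha>) p))\<rparr>"

definition opp_courant :: "('x, 'e, 'v) courant \<Rightarrow> ('x, 'e, 'v) courant" where
  "opp_courant E = E\<lparr>pairing := (\<lambda>x v w. - pairing E x v w)\<rparr>"

text \<open>
  The direct product. The bracket of sections pulled back from the two factors is componentwise
  (see \<open>prod_bracket_pullback\<close> below). For arbitrary sections it is then determined by
  \<open>\<lbrakk>a, f b\<rbrakk> = f \<lbrakk>a, b\<rbrakk> + \<rho>(a)(f) b\<close> and
  \<open>\<lbrakk>f a, b\<rbrakk> = f \<lbrakk>a, b\<rbrakk> - \<rho>(b)(f) a + \<langle>a, b\<rangle> \<D>f\<close>, where \<open>\<langle>\<D>f, w\<rangle> = \<rho>(w)(f)\<close>. For the first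
  component at \<open>(x, y)\<close> this gives the bracket of \<open>E\<close> with \<open>y\<close> held fixed, plus the derivatives of the
  first components (as vector valued functions of \<open>y\<close>) along the anchors of the second components,
  plus the element \<open>e\<close> with \<open>\<langle>e, w\<rangle> = \<langle>\<partial>\<^bsub>\<rho>(w)\<^esub> a\<^sub>2, b\<^sub>2\<rangle>\<close> for all \<open>w\<close> in the fibre over \<open>x\<close>.
\<close>

definition point_deriv ::
    "('x, 'e::findim_space) mfd \<Rightarrow> 'x \<Rightarrow> 'e \<Rightarrow> ('x \<Rightarrow> 'w::real_normed_vector) \<Rightarrow> 'w" where
  "point_deriv M x u f = frechet_derivative (f \<circ> chart_inv M x) (at (chart M x x)) u"

definition prod_courant ::
    "('x, 'e::findim_space, 'v::real_normed_vector) courant \<Rightarrow>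
     ('y, 'f::findim_space, 'w::real_normed_vector) courant \<Rightarrow>
     ('x \<times> 'y, 'e \<times> 'f, 'v \<times> 'w) courant" (infixr \<open>\<times>\<^sub>C\<close> 80) where
  "E \<times>\<^sub>C F = \<lparr>base = base E \<times>\<^sub>M base F,
     bundle_coord = (\<lambda>(q, q') (p, p'). map_prod (bundle_coord E q p) (bundle_coord F q' p')),
     pairing = (\<lambda>(x, y) (v, v') (w, w'). pairing E x v w + pairing F y v' w'),
     anchor = (\<lambda>(x, y). map_prod (anchor E x) (anchor F y)),
     bracket = (\<lambda>a b (x, y).
       let a1 = fst \<circ> a; a2 = snd \<circ> a; b1 = fst \<circ> b; b2 = snd \<circ> b;
           D1 = (\<lambda>u f. point_deriv (base E) x u (\<lambda>x'. f (x', y)));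
           D2 = (\<lambda>u f. point_deriv (base F) y u (\<lambda>y'. f (x, y')))
       in (bracket E (\<lambda>x'. a1 (x', y)) (\<lambda>x'. b1 (x', y)) x
             + D2 (anchor F y (a2 (x, y))) b1 - D2 (anchor F y (b2 (x, y))) a1
             + (THE e. \<forall>w. pairing E x e w = pairing F y (D1 (anchor E x w) a2) (b2 (x, y))),
           bracket F (\<lambda>y'. a2 (x, y')) (\<lambda>y'. b2 (x, y')) y
             + D1 (anchor E x (a1 (x, y))) b2 - D1 (anchor E x (b1 (x, y))) a2
             + (THE e. \<forall>w. pairing F y e w = pairing E x (D2 (anchor F y w) a1) (b1 (x, y)))))\<rparr>"

lemma prod_bracket_pullback:
  fixes E :: "('x, 'e::findim_space, 'v::real_normed_vector) courant"
    and F :: "('y, 'f::findim_space, 'w::real_normed_vector) courant"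
  assumes "\<And>w. pairing E x 0 w = 0" "\<And>e. (\<forall>w. pairing E x e w = 0) \<Longrightarrow> e = 0"
    and "\<And>w. pairing F y 0 w = 0" "\<And>e. (\<forall>w. pairing F y e w = 0) \<Longrightarrow> e = 0"
  shows "bracket (E \<times>\<^sub>C F) (\<lambda>(x', y'). (a1 x', a2 y')) (\<lambda>(x', y'). (b1 x', b2 y')) (x, y)
    = (bracket E a1 b1 x, bracket F a2 b2 y)"
proof -
  have const: "point_deriv M z u (\<lambda>_. c) = 0" for M :: "('z, 'k::findim_space) mfd" and z u
    and c :: "'l::real_normed_vector"
    by (simp add: point_deriv_def comp_def)
  have "(THE e. \<forall>w. pairing E x e w = 0) = 0" "(THE e. \<forall>w. pairing F y e w = 0) = 0"
    using assms by (auto intro!: the_equality)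
  then show ?thesis
    using assms by (simp add: prod_courant_def const comp_def)
qed

subsection \<open>Dirac structures with support\<close>

definition lagrangian :: "('x, 'e, 'v::real_vector) courant \<Rightarrow> 'x \<Rightarrow> 'v set \<Rightarrow> bool" where
  "lagrangian E x L \<longleftrightarrow> subspace L \<and> L = {v. \<forall>w\<in>L. pairing E x v w = 0}"

text \<open>
  A subset \<open>K\<close> of the total space is a smooth subbundle of the restriction of \<open>E\<close> to \<open>Q\<close>; its fibre
  over \<open>x\<close> is \<open>K `` {x}\<close>.
\<close>

definition subbundle_along :: "('x, 'e::findim_space, 'v::real_normed_vector) courant \<Rightarrow> 'x set \<Rightarrow>
    ('x \<times> 'v) set \<Rightarrow> bool" where
  "subbundle_along E Q K \<longleftrightarrow> K \<subseteq> Q \<times> UNIV \<and>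
     (\<exists>k. (\<forall>x\<in>Q. subspace (K `` {x}) \<and> dim (K `` {x}) = k) \<and>
        (\<forall>x\<in>Q. \<exists>W. \<exists>e :: nat \<Rightarrow> 'x \<Rightarrow> 'v. x \<in> W \<and> (\<forall>i<k. smooth_section E W (e i)) \<and>
           (\<forall>y\<in>Q \<inter> W. K `` {y} = span ((\<lambda>i. e i y) ` {..<k}))))"

text \<open>The restriction of \<open>a\<close> to \<open>Q\<close> is a smooth section of \<open>K\<close>.\<close>

definition section_of :: "('x, 'e::findim_space, 'v::real_normed_vector) courant \<Rightarrow> 'x set \<Rightarrow>
    ('x \<times> 'v) set \<Rightarrow> ('x \<Rightarrow> 'v) \<Rightarrow> bool" where
  "section_of E Q K a \<longleftrightarrow> smooth_section_along E Q a \<and> (\<forall>x\<in>Q. (x, a x) \<in> K)"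

definition dirac_structure :: "('x, 'e::findim_space, 'v::real_normed_vector) courant \<Rightarrow> 'x set \<Rightarrow>
    ('x \<times> 'v) set \<Rightarrow> bool" where
  "dirac_structure E Q K \<longleftrightarrow>
     submanifold (base E) Q \<and> subbundle_along E Q K \<and>
     (\<forall>x\<in>Q. lagrangian E x (K `` {x})) \<and>
     (\<forall>x\<in>Q. anchor E x ` (K `` {x}) \<subseteq> tangent_space (base E) Q x) \<and>
     (\<forall>a1 a2. smooth_section E (points (base E)) a1 \<longrightarrow> smooth_section E (points (base E)) a2 \<longrightarrow>
        section_of E Q K a1 \<longrightarrow> section_of E Q K a2 \<longrightarrow> section_of E Q K (bracket E a1 a2))"

text \<open>
  A morphism from \<open>E1\<close> to \<open>E2\<close> over a smooth map \<open>f\<close> which need only be defined on a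
  submanifold \<open>S\<close> of the base of \<open>E1\<close>.
\<close>

definition courant_morphism ::
    "('x, 'e::findim_space, 'v::real_normed_vector) courant \<Rightarrow>
     ('y, 'f::findim_space, 'w::real_normed_vector) courant \<Rightarrow>
     'x set \<Rightarrow> ('x \<Rightarrow> 'y) \<Rightarrow> (('y \<times> 'x) \<times> ('w \<times> 'v)) set \<Rightarrow> bool" where
  "courant_morphism E1 E2 S f K \<longleftrightarrow>
     submanifold (base E1) S \<and> smooth_map_along (base E1) (base E2) S f \<and>
     dirac_structure (E2 \<times>\<^sub>C opp_courant E1) {(f x, x) | x. x \<in> S} K"

section \<open>Lie groupoids\<close>

record ('g, 'e, 'm, 'f) groupoid =
  arr :: "('g, 'e) mfd"
  obj :: "('m, 'f) mfd"
  src :: "'g \<Rightarrow> 'm"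
  tgt :: "'g \<Rightarrow> 'm"
  idt :: "'m \<Rightarrow> 'g"
  inversion :: "'g \<Rightarrow> 'g"
  mult :: "'g \<Rightarrow> 'g \<Rightarrow> 'g"

definition composable :: "('g, 'e, 'm, 'f) groupoid \<Rightarrow> ('g \<times> 'g) set" where
  "composable G = {(g, h). g \<in> points (arr G) \<and> h \<in> points (arr G) \<and> src G g = tgt G h}"

definition submersion :: "('p, 'e::findim_space) mfd \<Rightarrow> ('q, 'f::findim_space) mfd \<Rightarrow> ('p \<Rightarrow> 'q) \<Rightarrow>
    bool" where
  "submersion M N f \<longleftrightarrow> smooth_map M N (points M) f \<and> (\<forall>p\<in>points M. surj (tangent_map M N f p))"

definition lie_groupoid :: "('g, 'e::findim_space, 'm, 'f::findim_space) groupoid \<Rightarrow> bool" where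
  "lie_groupoid G \<longleftrightarrow>
     smooth_manifold (arr G) \<and> smooth_manifold (obj G) \<and>
     submersion (arr G) (obj G) (src G) \<and> src G ` points (arr G) = points (obj G) \<and>
     submersion (arr G) (obj G) (tgt G) \<and> tgt G ` points (arr G) = points (obj G) \<and>
     smooth_map (obj G) (arr G) (points (obj G)) (idt G) \<and>
     smooth_map (arr G) (arr G) (points (arr G)) (inversion G) \<and>
     smooth_map_along (arr G \<times>\<^sub>M arr G) (arr G) (composable G) (\<lambda>(g, h). mult G g h) \<and>
     (\<forall>(g, h)\<in>composable G. mult G g h \<in> points (arr G) \<and>
        src G (mult G g h) = src G h \<and> tgt G (mult G g h) = tgt G g) \<and>
     (\<forall>g h k. (g, h) \<in> composable G \<longrightarrow> (h, k) \<in> composable G \<longrightarrow>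
        mult G (mult G g h) k = mult G g (mult G h k)) \<and>
     (\<forall>x\<in>points (obj G). src G (idt G x) = x \<and> tgt G (idt G x) = x) \<and>
     (\<forall>g\<in>points (arr G).
        mult G (idt G (tgt G g)) g = g \<and> mult G g (idt G (src G g)) = g \<and>
        src G (inversion G g) = tgt G g \<and> tgt G (inversion G g) = src G g \<and>
        mult G (inversion G g) g = idt G (src G g) \<and> mult G g (inversion G g) = idt G (tgt G g))"

subsection \<open>The groupoids \<open>TG\<close>, \<open>T\<^sup>*G\<close> and their direct sum\<close>

abbreviation tan_src :: "('g, 'e::findim_space, 'm, 'f::findim_space) groupoid \<Rightarrow> 'g \<times> 'e \<Rightarrow> 'm \<times> 'f"
  where "tan_src G \<equiv> (\<lambda>(g, X). (src G g, tangent_map (arr G) (obj G) (src G) g X))"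

abbreviation tan_tgt :: "('g, 'e::findim_space, 'm, 'f::findim_space) groupoid \<Rightarrow> 'g \<times> 'e \<Rightarrow> 'm \<times> 'f"
  where "tan_tgt G \<equiv> (\<lambda>(g, X). (tgt G g, tangent_map (arr G) (obj G) (tgt G) g X))"

definition tan_composable ::
    "('g, 'e::findim_space, 'm, 'f::findim_space) groupoid \<Rightarrow> (('g \<times> 'e) \<times> ('g \<times> 'e)) set" where
  "tan_composable G = {((g, X), (h, Y)).
     g \<in> points (arr G) \<and> h \<in> points (arr G) \<and> tan_src G (g, X) = tan_tgt G (h, Y)}"

definition tan_mult :: "('g, 'e::findim_space, 'm, 'f::findim_space) groupoid \<Rightarrow>
    'g \<times> 'e \<Rightarrow> 'g \<times> 'e \<Rightarrow> 'g \<times> 'e" where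
  "tan_mult G = (\<lambda>(g, X) (h, Y). (mult G g h,
     tangent_map_along (arr G \<times>\<^sub>M arr G) (arr G) (composable G) (\<lambda>(g, h). mult G g h) (g, h) (X, Y)))"

text \<open>The fibre of \<open>AG = ker Ts\<close> over \<open>x\<close>, as a subspace of the tangent space at the unit over \<open>x\<close>.\<close>

definition lie_algebroid :: "('g, 'e::findim_space, 'm, 'f::findim_space) groupoid \<Rightarrow> 'm \<Rightarrow> 'e set"
  where "lie_algebroid G x = {u. tangent_map (arr G) (obj G) (src G) (idt G x) u = 0}"

text \<open>
  Left translation by \<open>g\<close> is a map on the \<open>t\<close>-fibre over \<open>s(g)\<close>, right translation by \<open>g\<close> on the
  \<open>s\<close>-fibre over \<open>t(g)\<close>; both tangent maps are taken at units.
\<close>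

definition tan_left :: "('g, 'e::findim_space, 'm, 'f::findim_space) groupoid \<Rightarrow> 'g \<Rightarrow> 'e \<Rightarrow> 'e" where
  "tan_left G g = tangent_map_along (arr G) (arr G)
     {h \<in> points (arr G). tgt G h = src G g} (\<lambda>h. mult G g h) (idt G (src G g))"

definition tan_right :: "('g, 'e::findim_space, 'm, 'f::findim_space) groupoid \<Rightarrow> 'g \<Rightarrow> 'e \<Rightarrow> 'e" where
  "tan_right G g = tangent_map_along (arr G) (arr G)
     {h \<in> points (arr G). src G h = tgt G g} (\<lambda>h. mult G h g) (idt G (tgt G g))"

text \<open>
  Elements of \<open>A\<^sup>*G\<close> over \<open>x\<close> are functionals on \<open>lie_algebroid G x\<close>, represented as functions which
  are \<^const>\<open>undefined\<close> elsewhere. In \<open>u - Tt(u)\<close>, the vector \<open>Tt(u)\<close> tangent to \<open>M\<close> is regarded as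
  tangent to \<open>G\<close> by means of the unit map.
\<close>

definition cot_src :: "('g, 'e::findim_space, 'm, 'f::findim_space) groupoid \<Rightarrow>
    'g \<times> ('e \<Rightarrow>\<^sub>L real) \<Rightarrow> 'm \<times> ('e \<Rightarrow> real)" where
  "cot_src G = (\<lambda>(g, \<alpha>). let x = src G g in
     (x, \<lambda>u\<in>lie_algebroid G x. blinfun_apply \<alpha> (tan_left G g
        (u - tangent_map (obj G) (arr G) (idt G) x
               (tangent_map (arr G) (obj G) (tgt G) (idt G x) u)))))"

definition cot_tgt :: "('g, 'e::findim_space, 'm, 'f::findim_space) groupoid \<Rightarrow>
    'g \<times> ('e \<Rightarrow>\<^sub>L real) \<Rightarrow> 'm \<times> ('e \<Rightarrow> real)" where
  "cot_tgt G = (\<lambda>(g, \<beta>).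
     (tgt G g, \<lambda>v\<in>lie_algebroid G (tgt G g). blinfun_apply \<beta> (tan_right G g v)))"

definition cot_mult :: "('g, 'e::findim_space, 'm, 'f::findim_space) groupoid \<Rightarrow>
    'g \<times> ('e \<Rightarrow>\<^sub>L real) \<Rightarrow> 'g \<times> ('e \<Rightarrow>\<^sub>L real) \<Rightarrow> 'g \<times> ('e \<Rightarrow>\<^sub>L real)" where
  "cot_mult G = (\<lambda>(g, \<alpha>) (h, \<beta>). (mult G g h,
     THE \<gamma>. \<forall>X Y. ((g, X), (h, Y)) \<in> tan_composable G \<longrightarrow>
       blinfun_apply \<gamma> (snd (tan_mult G (g, X) (h, Y))) = blinfun_apply \<alpha> X + blinfun_apply \<beta> Y))"

definition pont_composable :: "('g, 'e::findim_space, 'm, 'f::findim_space) groupoid \<Rightarrow>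
    (('g \<times> 'e \<times> ('e \<Rightarrow>\<^sub>L real)) \<times> ('g \<times> 'e \<times> ('e \<Rightarrow>\<^sub>L real))) set" where
  "pont_composable G = {((g, X, \<alpha>), (h, Y, \<beta>)).
     ((g, X), (h, Y)) \<in> tan_composable G \<and> cot_src G (g, \<alpha>) = cot_tgt G (h, \<beta>)}"

definition pont_mult :: "('g, 'e::findim_space, 'm, 'f::findim_space) groupoid \<Rightarrow>
    'g \<times> 'e \<times> ('e \<Rightarrow>\<^sub>L real) \<Rightarrow> 'g \<times> 'e \<times> ('e \<Rightarrow>\<^sub>L real) \<Rightarrow> 'g \<times> 'e \<times> ('e \<Rightarrow>\<^sub>L real)" where
  "pont_mult G = (\<lambda>(g, X, \<alpha>) (h, Y, \<beta>).
     (mult G g h, snd (tan_mult G (g, X) (h, Y)), snd (cot_mult G (g, \<alpha>) (h, \<beta>))))"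

definition graph_mult :: "('g, 'e, 'm, 'f) groupoid \<Rightarrow> ('g \<times> 'g \<times> 'g) set" where
  "graph_mult G = {(mult G g h, g, h) | g h. (g, h) \<in> composable G}"

definition graph_pont_mult :: "('g, 'e::findim_space, 'm, 'f::findim_space) groupoid \<Rightarrow>
    (('g \<times> 'e \<times> ('e \<Rightarrow>\<^sub>L real)) \<times> ('g \<times> 'e \<times> ('e \<Rightarrow>\<^sub>L real)) \<times> ('g \<times> 'e \<times> ('e \<Rightarrow>\<^sub>L real))) set"
  where "graph_pont_mult G = {(pont_mult G a b, a, b) | a b. (a, b) \<in> pont_composable G}"

abbreviation pontryagin :: "('g, 'e::findim_space, 'm, 'f) groupoid \<Rightarrow> ('g, 'e, 'e \<times> ('e \<Rightarrow>\<^sub>L real)) courant"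
    (\<open>\<T>\<close>)
  where "\<T> G \<equiv> std_courant (arr G)"

text \<open>
  Identification of a product of three total spaces with the total space of the product bundle,
  whose elements have the form (base point, fibre element).
\<close>

definition regroup ::
    "('x \<times> 'u) \<times> ('y \<times> 'v) \<times> ('z \<times> 'w) \<Rightarrow> ('x \<times> 'y \<times> 'z) \<times> ('u \<times> 'v \<times> 'w)" where
  "regroup = (\<lambda>((x, u), (y, v), (z, w)). ((x, y, z), (u, v, w)))"

end

theory Submission
  imports Defs
begin

text \<open>
  For any submanifold \<open>Q\<close> of a manifold \<open>N\<close>, the bundle \<open>TQ \<oplus> Ann(TQ)\<close> is a Dirac structure in the
  standard Courant algebroid over \<open>N\<close> supported on \<open>Q\<close>: the Courant bracket is natural under changes
  of charts, and in a chart in which \<open>Q\<close> is a linear subspace everything is immediate. Changing the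
  sign of the covectors of the last two factors identifies the Courant algebroid of the theorem with
  the standard one over \<open>G \<times> G \<times> G\<close>, so it suffices to see that the graph of the multiplication of
  \<open>TG \<oplus> T\<^sup>*G\<close> corresponds to \<open>TQ \<oplus> Ann(TQ)\<close> for \<open>Q\<close> the graph of \<open>m\<close>. This \<open>Q\<close> is locally a level
  set of a submersion, and \<open>TQ\<close> is the graph of \<open>Tm\<close>. A triple \<open>(\<gamma>, -\<alpha>, -\<beta>)\<close> annihilates \<open>TQ\<close> iff
  \<open>\<gamma> (X \<bullet> Y) = \<alpha> X + \<beta> Y\<close> for all composable \<open>X\<close>, \<open>Y\<close>. Since \<open>Tm\<close> is onto, such a \<open>\<gamma>\<close> is unique, and
  it exists iff \<open>\<alpha> X + \<beta> Y\<close> vanishes on the kernel of \<open>Tm\<close>. That kernel consists of the pairs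
  \<open>(- Tl\<^sub>g (u - Tt u), Tr\<^sub>h u)\<close> with \<open>u\<close> in the Lie algebroid, as one sees
      by differentiating curves, so
  the condition says precisely that \<open>\<alpha>\<close> and \<open>\<beta>\<close> are composable in \<open>T\<^sup>*G\<close>.
\<close>

section \<open>Finite-dimensional inner product spaces\<close>

text \<open>The model spaces have an inner product and a finite spanning set but no distinguished
  basis, and may be zero-dimensional. The calculus is therefore built on a chosen orthonormal set,
  in which the arguments of operator-valued maps are expanded. Two features of the encoding shape
  the rest. The bracket at a point is computed in the preferred chart of that very point, so even
  its smoothness needs invariance under changes of charts; the second derivatives of the transition
  that spoil it cancel by symmetry. The tangent map of a map given only on a submanifold is that of
  an arbitrarily chosen extension, hence says something only about velocities of curves inside the
  submanifold. So the identities for \<open>Tm\<close> come from differentiating such curves, and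
  enough curves exist because submersions can be straightened by an inverse function theorem. On a
  product, the bracket contains elements given only by their pairings; nondegeneracy identifies them
  with covectors, which supply mixed derivatives missing from the brackets of the slices.\<close>

definition orthonormal :: "'a::real_inner set \<Rightarrow> bool" where
  "orthonormal B \<longleftrightarrow> (\<forall>x\<in>B. \<forall>y\<in>B. x \<bullet> y = (if x = y then 1 else 0))"

lemma orthonormal_inner_sum:
  assumes "finite B" "orthonormal B" "b \<in> B"
  shows "(\<Sum>x\<in>B. c x *\<^sub>R x) \<bullet> b = c b"
proof -
  have "(\<Sum>x\<in>B. c x *\<^sub>R x) \<bullet> b = (\<Sum>x\<in>B. if x = b then c x else 0)"
    unfolding inner_sum_left using assms by (intro sum.cong) (auto simp: orthonormal_def)
  then show ?thesis using assms by simp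
qed

lemma orthonormal_expansion:
  assumes "finite B" "orthonormal B" "v \<in> span B"
  shows "(\<Sum>b\<in>B. (v \<bullet> b) *\<^sub>R b) = v"
proof -
  obtain c where v: "v = (\<Sum>b\<in>B. c b *\<^sub>R b)"
    using assms(1,3) by (auto simp: span_finite)
  have "v \<bullet> b = c b" if "b \<in> B" for b
    using assms that by (simp add: v orthonormal_inner_sum)
  then show ?thesis by (subst (2) v) (intro sum.cong, auto)
qed

text \<open>Induction on \<open>A\<close>: the projection \<open>p\<close> of the new vector to the
  span found so far either equals the vector, and nothing is added, or leaves a remainder, which is
  normalised and adjoined.\<close>

lemma gram_schmidt:
  assumes "finite A"
  obtains B :: "'a::real_inner set" where "finite B" "orthonormal B" "span B = span A"
proof -
  have "\<exists>B. finite B \<and> orthonormal B \<and> span B = span A"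
    using assms
  proof (induction A)
    case empty
    show ?case by (rule exI[of _ "{}"]) (simp add: orthonormal_def)
  next
    case (insert a A)
    then obtain B where B: "finite B" "orthonormal B" "span B = span A" by blast
    define p where "p = (\<Sum>b\<in>B. (a \<bullet> b) *\<^sub>R b)"
    have p: "p \<in> span B" unfolding p_def by (intro span_sum span_scale span_base)
    have orth: "(a - p) \<bullet> b = 0" if "b \<in> B" for b
      using B that by (simp add: p_def inner_diff_left orthonormal_inner_sum)
    show ?case
    proof (cases "a = p")
      case True
      then have "a \<in> span A" using p B by simp
      then show ?thesis using B by (metis span_redundant)
    next
      case False
      define n where "n = (a - p) /\<^sub>R norm (a - p)"
      have n: "n \<bullet> n = 1" using False
        by (simp add: n_def power2_norm_eq_inner[symmetric] power2_eq_square)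
      have nb: "n \<bullet> b = 0" "b \<bullet> n = 0" if "b \<in> B" for b
        using orth[OF that] by (simp_all add: n_def inner_commute)
      have "orthonormal (insert n B)"
        using B(2) n nb by (auto simp: orthonormal_def)
      moreover have "span (insert n B) = span (insert a A)"
      proof -
        have "n \<in> span (insert a B)"
          using subsetD[OF span_mono[OF subset_insertI] p] unfolding n_def
          by (intro span_scale span_diff) (auto intro: span_base)
        moreover have "a \<in> span (insert n B)"
        proof -
          have "a = norm (a - p) *\<^sub>R n + p" using False by (simp add: n_def)
          moreover have "norm (a - p) *\<^sub>R n + p \<in> span (insert n B)"
            using subsetD[OF span_mono[OF subset_insertI] p] by (intro span_add span_scale)
                (auto intro: span_base)
          ultimately show ?thesis by simp
        qed
        ultimately have "span (insert n B) = span (insert a B)"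
          by (intro antisym span_minimal subspace_span) (auto intro: span_base)
        also have "\<dots> = span (insert a A)"
          using B(3) by (simp add: span_insert)
        finally show ?thesis .
      qed
      ultimately show ?thesis using B(1) by blast
    qed
  qed
  then show thesis using that by blast
qed

text \<open>Fixing one orthonormal basis per type keeps bases out of all later statements. It is
  empty when the model space is zero-dimensional, and sums over it are then 0.\<close>

definition onb :: "'a::findim_space set" where
  "onb = (SOME B. finite B \<and> orthonormal B \<and> span B = UNIV)"

lemma onb:
  shows finite_onb: "finite (onb :: 'a::findim_space set)"
    and orthonormal_onb: "orthonormal (onb :: 'a set)"
    and span_onb: "span (onb :: 'a set) = UNIV"
proof -
  obtain A :: "'a set" where A: "finite A" "span A = UNIV" by (rule finite_span_UNIV)
  obtain B :: "'a set" where "finite B" "orthonormal B" "span B = span A"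
      by (rule gram_schmidt[OF A(1)])
  then have "\<exists>B::'a set. finite B \<and> orthonormal B \<and> span B = UNIV" using A by auto
  from someI_ex[OF this] show "finite (onb :: 'a set)" "orthonormal (onb :: 'a set)"
      "span (onb :: 'a set) = UNIV"
    unfolding onb_def by auto
qed

lemma onb_expansion: "(\<Sum>b\<in>onb. (v \<bullet> b) *\<^sub>R b) = (v::'a::findim_space)"
  by (rule orthonormal_expansion) (simp_all add: onb)

lemma linear_onb:
  assumes "linear f"
  shows "f v = (\<Sum>b\<in>onb. (v \<bullet> b) *\<^sub>R f (b::'a::findim_space))"
  by (subst onb_expansion[of v, symmetric]) (simp add: linear_sum[OF assms] linear_scale[OF assms])

lemma linear_imp_bounded_linear:
  fixes f :: "'a::findim_space \<Rightarrow> 'b::real_normed_vector"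
  assumes "linear f"
  shows "bounded_linear f"
proof (rule bounded_linear_intro[where K = "\<Sum>b\<in>onb. norm (b::'a) * norm (f b)"])
  show "norm (f x) \<le> norm x * (\<Sum>b\<in>onb. norm (b::'a) * norm (f b))" for x
  proof -
    have "norm (f x) \<le> (\<Sum>b\<in>onb. norm ((x \<bullet> b) *\<^sub>R f b))"
      unfolding linear_onb[OF assms, of x] by (rule norm_sum)
    also have "\<dots> \<le> (\<Sum>b\<in>onb. norm x * (norm b * norm (f b)))"
      by (intro sum_mono) (simp add: Cauchy_Schwarz_ineq2 mult_right_mono flip: mult.assoc)
    finally show ?thesis by (simp add: sum_distrib_left)
  qed
qed (simp_all add: linear_add[OF assms] linear_scale[OF assms])

lemma blinfun_apply_Blinfun_linear:
  fixes f :: "'a::findim_space \<Rightarrow> 'b::real_normed_vector"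
  assumes "linear f"
  shows "blinfun_apply (Blinfun f) = f"
  by (rule bounded_linear_Blinfun_apply[OF linear_imp_bounded_linear[OF assms]])

text \<open>Riesz representation. It turns the annihilator of a subspace into its orthogonal
  complement when the fibres of the Dirac structure are parametrised.\<close>

lemma blinfun_onb:
  fixes \<alpha> :: "'a::findim_space \<Rightarrow>\<^sub>L real"
  shows "blinfun_apply \<alpha> v = v \<bullet> (\<Sum>b\<in>onb. blinfun_apply \<alpha> b *\<^sub>R b)"
  by (subst linear_onb[of "blinfun_apply \<alpha>"])
    (auto simp: inner_sum_right bounded_linear.linear[OF blinfun.bounded_linear_right]
        mult.commute intro!: sum.cong)

text \<open>A sum of rank one operators; smoothness of an operator-valued map thereby reduces to
  smoothness of its values on basis vectors.\<close>

lemma blinfun_to_findim_expansion: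
  fixes F :: "'a::findim_space \<Rightarrow>\<^sub>L 'b::real_normed_vector"
  shows "F = (\<Sum>b\<in>onb. blinfun_scaleR_left (blinfun_apply F b) o\<^sub>L blinfun_inner_left b)"
  by (rule blinfun_eqI, subst linear_onb[of "blinfun_apply F"])
    (simp_all add: bounded_linear.linear[OF blinfun.bounded_linear_right] blinfun.sum_left)

section \<open>Bases of subspaces and dimension counts\<close>

lemma finite_independent_findim:
  fixes B :: "'a::findim_space set"
  assumes "independent B"
  shows "finite B" 
  using independent_span_bound[OF finite_onb assms] by (simp add: span_onb)

lemma subspace_onb:
  fixes S :: "'a::findim_space set"
  assumes "subspace S"
  obtains B where "finite B" "orthonormal B" "span B = S"
proof -
  obtain B where B: "B \<subseteq> S" "independent B" "S \<subseteq> span B"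
    using basis_exists[of S] by metis
  then have "span B = S" using assms by (metis subset_antisym span_minimal)
  with gram_schmidt[OF finite_independent_findim[OF B(2)]] that show thesis by metis
qed

text \<open>Interpreting the locale is a way to reach one fact: an injective linear endomorphism is
  onto.\<close>

lemma findim_basis_locale:
  obtains B :: "'a::findim_space set" where "finite_dimensional_vector_space scaleR B"
proof -
  obtain B :: "'a set" where B: "independent B" "UNIV \<subseteq> span B"
    using basis_exists[of UNIV] by metis
  have "finite_dimensional_vector_space scaleR B"
    unfolding finite_dimensional_vector_space_def finite_dimensional_vector_space_axioms_def
    using B finite_independent_findim[OF B(1)]
    by (auto simp: real_vector.vector_space_axioms dependent_raw_def span_raw_def)
  then show thesis by (rule that)
qed

lemma dim_kernel_surj:
  fixes A :: "'a::findim_space \<Rightarrow> 'b::findim_space"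
  assumes A: "linear A" "surj A"
  shows "dim {x. A x = 0} + dim (UNIV :: 'b set) = dim (UNIV :: 'a set)"
proof -
  let ?K = "{x. A x = 0}"
  have subK: "subspace ?K"
    by (auto simp: subspace_def linear_0[OF A(1)] linear_add[OF A(1)] linear_scale[OF A(1)])
  obtain B where B: "B \<subseteq> ?K" "independent B" "?K \<subseteq> span B" "card B = dim ?K"
    using basis_exists[of ?K] by metis
  obtain C where C: "B \<subseteq> C" "independent C" "span C = UNIV"
    using maximal_independent_subset_extend[of B UNIV] B by (metis subset_UNIV top.extremum_uniqueI)
  have finC: "finite C" by (rule finite_independent_findim[OF C(2)])
  have spB: "span B = ?K" using B subK by (metis subset_antisym span_minimal)
  have disj: "span (C - B) \<inter> span B = {0}"
  proof -
    have "x = 0" if x: "x \<in> span (C - B)" "x \<in> span B" for x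
    proof -
      have BC: "C = B \<union> (C - B)" using C(1) by auto
      have "finite B" "finite (C - B)" using finC C(1) finite_subset by auto
      then obtain u v where u: "x = (\<Sum>b\<in>B. u b *\<^sub>R b)" and v: "x = (\<Sum>b\<in>C-B. v b *\<^sub>R b)"
        using x by (auto simp: span_finite)
      \<comment> \<open>The two expansions of \<open>x\<close>, glued with opposite signs, form a
        vanishing combination over all of \<open>C\<close>, so independence kills every
        coefficient.\<close>
      let ?w = "\<lambda>b. if b \<in> B then u b else - v b"
      have "(\<Sum>b\<in>C. ?w b *\<^sub>R b) = (\<Sum>b\<in>B. ?w b *\<^sub>R b) + (\<Sum>b\<in>C-B. ?w b *\<^sub>R b)"
        using sum.subset_diff[OF C(1) finC, of "\<lambda>b. ?w b *\<^sub>R b"] by (simp add: add.commute)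
      also have "\<dots> = x - x"
      proof -
        have "(\<Sum>b\<in>B. ?w b *\<^sub>R b) = x" unfolding u by (intro sum.cong) auto
        moreover have "(\<Sum>b\<in>C-B. ?w b *\<^sub>R b) = - x"
          unfolding v sum_negf[symmetric] by (intro sum.cong) auto
        ultimately show ?thesis by simp
      qed
      finally have "?w b = 0" if "b \<in> C" for b
        using independentD[OF C(2) finC subset_refl, of ?w b] that by simp
      then have "\<forall>b\<in>B. u b = 0" using C(1) by (metis subsetD)
      then show ?thesis by (simp add: u)
    qed
    then show ?thesis by (auto intro: span_zero)
  qed
  have inj: "inj_on A (span (C - B))"
    unfolding linear_inj_on_iff_eq_0[OF A(1) subspace_span]
    using disj spB by auto
  have dimC: "dim (span (C - B)) = card (C - B)"
    by (rule dim_span_eq_card_independent) (use independent_mono[OF C(2), of "C - B"] in blast)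
  have "A ` span (C - B) = UNIV"
  proof -
    have "\<exists>x\<in>span (C - B). A x = y" for y
    proof -
      obtain z where z: "A z = y" using A(2) by (metis surjD)
      have "z \<in> span (B \<union> (C - B))" using C by (simp add: Un_absorb1)
      then obtain b c where "z = b + c" "b \<in> span B" "c \<in> span (C - B)"
        unfolding span_Un by auto
      then show ?thesis using z spB linear_add[OF A(1)] by auto
    qed
    then show ?thesis unfolding set_eq_iff image_iff by (metis UNIV_I)
  qed
  moreover have "dim (A ` span (C - B)) = dim (span (C - B))"
  proof -
    have ind: "independent (A ` (C - B))"
      using independent_mono[OF C(2), of "C - B"] by (intro linear_independent_injective_image[OF
          A(1)] inj) blast
    have "dim (A ` span (C - B)) = card (A ` (C - B))"
      unfolding linear_span_image[OF A(1), symmetric] by (rule dim_span_eq_card_independent[OF ind])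
    also have "\<dots> = card (C - B)"
      using inj by (intro card_image) (meson inj_on_subset span_superset)
    finally show ?thesis
      using dimC by simp
  qed
  moreover have "dim (UNIV::'a set) = card C"
    using dim_span_eq_card_independent[OF C(2)] C(3) by simp
  moreover have "card (C - B) = card C - card B" "card B \<le> card C"
    using C(1) finC by (auto simp: card_Diff_subset finite_subset card_mono)
  ultimately show ?thesis using B(4) dimC by simp
qed

text \<open>Later targets are fibres of vectors and covectors, whose type is not a
  \<open>findim_space\<close>; hence the formulation for general real vector spaces.\<close>

lemma dim_injective_image:
  fixes T :: "'a::real_vector \<Rightarrow> 'b::real_vector"
  assumes T: "linear T" "inj T"
  shows "dim (T ` S) = dim S"
proof -
  obtain B where B: "B \<subseteq> S" "independent B" "S \<subseteq> span B"
    using basis_exists[of S] by metis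
  then have sp: "span B = span S" by (metis span_eq span_superset subset_trans)
  have inj: "inj_on T A" for A using T(2) by (rule inj_on_subset) simp
  have "independent (T ` B)"
    by (rule linear_independent_injective_image[OF T(1) B(2) inj])
  moreover have "span (T ` B) = span (T ` S)"
    by (simp add: linear_span_image[OF T(1)] sp)
  ultimately have "dim (T ` S) = card (T ` B)" by (rule dim_eq_card[rotated])
  also have "\<dots> = card B" by (rule card_image[OF inj])
  also have "\<dots> = dim S" using dim_eq_card[OF sp B(2)] by simp
  finally show ?thesis .
qed

section \<open>Calculus of smooth maps\<close>

lemma Ck_on_differentiable:
  assumes "Ck_on (Suc n) S f" "x \<in> S"
  shows "(f has_derivative frechet_derivative f (at x)) (at x)"
  using assms by (auto simp: frechet_derivative_works[symmetric])

lemma Ck_on_Suc_imp: "Ck_on (Suc n) S f \<Longrightarrow> Ck_on n S f"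
proof (induction n arbitrary: f)
  case 0
  then show ?case
    by (auto intro!: continuous_at_imp_continuous_on differentiable_imp_continuous_within)
next
  case (Suc n)
  then show ?case by (metis Ck_on.simps(2))
qed

text \<open>\<open>Ck_on\<close> differentiates at points, not within \<open>S\<close>, so without
  openness it would see values off \<open>S\<close>. For open \<open>S\<close> derivatives depend on
  the values on \<open>S\<close> alone.\<close>

lemma Ck_on_cong:
  assumes "open S" "\<And>x. x \<in> S \<Longrightarrow> f x = g x" "Ck_on n S f"
  shows "Ck_on n S g"
  using assms(2,3)
proof (induction n arbitrary: f g)
  case 0
  then show ?case by (simp add: continuous_on_eq)
next
  case (Suc n)
  have d: "(g has_derivative frechet_derivative f (at x)) (at x)" if "x \<in> S" for x
    using has_derivative_transform_within_open[OF Ck_on_differentiable[OF Suc.prems(2) that]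
        assms(1) that Suc.prems(1)] by simp
  have e: "frechet_derivative f (at x) v = frechet_derivative g (at x) v" if "x \<in> S" for x v
    by (metis frechet_derivative_at[OF d[OF that]])
  have "Ck_on n S (\<lambda>x. frechet_derivative g (at x) v)" for v
    by (rule Suc.IH[of "\<lambda>x. frechet_derivative f (at x) v"]) (use Suc.prems(2) e in auto)
  then show ?case using d unfolding Ck_on.simps differentiable_def by blast
qed

text \<open>Any family of derivatives may be supplied; uniqueness of derivatives identifies it with
  the one picked by \<open>frechet_derivative\<close>.\<close>

lemma Ck_on_SucI:
  assumes "open S" "\<And>x. x \<in> S \<Longrightarrow> (f has_derivative f' x) (at x)" "\<And>v. Ck_on n S (\<lambda>x. f' x v)"
  shows "Ck_on (Suc n) S f"
proof -
  have e: "f' x v = frechet_derivative f (at x) v" if "x \<in> S" for x v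
    by (metis frechet_derivative_at[OF assms(2)[OF that]])
  have "Ck_on n S (\<lambda>x. frechet_derivative f (at x) v)" for v
    by (rule Ck_on_cong[OF assms(1) e assms(3)])
  then show ?thesis using assms(2) unfolding Ck_on.simps differentiable_def by blast
qed

lemma Ck_on_subset: "Ck_on n S f \<Longrightarrow> T \<subseteq> S \<Longrightarrow> Ck_on n T f"
  by (induction n arbitrary: f) (auto intro: continuous_on_subset)

lemma Ck_on_const: "Ck_on n S (\<lambda>x. c)"
  by (induction n arbitrary: c) auto

lemma Ck_on_linear:
  assumes "bounded_linear L" "open S" "Ck_on n S f"
  shows "Ck_on n S (\<lambda>x. L (f x))"
  using assms(3)
proof (induction n arbitrary: f)
  case 0
  then show ?case using bounded_linear.continuous_on[OF assms(1)] by simp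
next
  case (Suc n)
  show ?case
    by (rule Ck_on_SucI[OF assms(2) bounded_linear.has_derivative[OF assms(1)
        Ck_on_differentiable[OF Suc.prems]]])
      (use Suc in auto)
qed

lemma Ck_on_id: "open S \<Longrightarrow> Ck_on n S (\<lambda>x. x)"
  by (cases n) (auto intro: Ck_on_SucI[OF _ has_derivative_ident Ck_on_const]
      simp del: Ck_on.simps(2))

lemma Ck_on_add:
  assumes "open S" "Ck_on n S f" "Ck_on n S g"
  shows "Ck_on n S (\<lambda>x. f x + g x)"
  using assms(2,3)
proof (induction n arbitrary: f g)
  case 0
  then show ?case by (simp add: continuous_on_add)
next
  case (Suc n)
  show ?case
    by (rule Ck_on_SucI[OF assms(1) has_derivative_add[OF Ck_on_differentiable[OF Suc.prems(1)]
        Ck_on_differentiable[OF Suc.prems(2)]]])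
      (use Suc in auto)
qed

lemma Ck_on_bilinear:
  assumes "bounded_bilinear p" "open S" "Ck_on n S f" "Ck_on n S g"
  shows "Ck_on n S (\<lambda>x. p (f x) (g x))"
  using assms(3,4)
proof (induction n arbitrary: f g)
  case 0
  then show ?case using bounded_bilinear.continuous_on[OF assms(1)] by simp
next
  case (Suc n)
  show ?case
    by (rule Ck_on_SucI[OF assms(2) bounded_bilinear.FDERIV[OF assms(1) Ck_on_differentiable[OF
        Suc.prems(1)] Ck_on_differentiable[OF Suc.prems(2)]]])
      (use Suc Ck_on_Suc_imp[OF Suc.prems(1)] Ck_on_Suc_imp[OF Suc.prems(2)]
          in \<open>auto intro!: Ck_on_add[OF assms(2)]\<close>)
qed

lemma Ck_on_Pair:
  assumes "open S" "Ck_on n S f" "Ck_on n S g"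
  shows "Ck_on n S (\<lambda>x. (f x, g x))"
  using assms(2,3)
proof (induction n arbitrary: f g)
  case 0
  then show ?case by (simp add: continuous_on_Pair)
next
  case (Suc n)
  show ?case
    by (rule Ck_on_SucI[OF assms(1) has_derivative_Pair[OF Ck_on_differentiable[OF Suc.prems(1)]
        Ck_on_differentiable[OF Suc.prems(2)]]])
      (use Suc in auto)
qed

lemma Ck_on_sum:
  assumes "open S" "\<And>i. i \<in> I \<Longrightarrow> Ck_on n S (f i)"
  shows "Ck_on n S (\<lambda>x. \<Sum>i\<in>I. f i x)"
  using assms(2) by (induction I rule: infinite_finite_induct) (auto intro: Ck_on_const Ck_on_add[OF
      assms(1)])

text \<open>The chain rule gives \<open>?g' (f x) (?f' x v)\<close>, where both the base point and
  the direction vary with \<open>x\<close>. Expanding the direction in \<open>onb\<close> leaves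
  scalar functions times derivatives of \<open>g\<close> in fixed directions composed with
  \<open>f\<close>, and to these the induction hypothesis applies.\<close>

lemma Ck_on_compose:
  fixes g :: "'b::findim_space \<Rightarrow> 'c::real_normed_vector"
  assumes "open S" "open T" "f ` S \<subseteq> T" "Ck_on n S f" "Ck_on n T g"
  shows "Ck_on n S (\<lambda>x. g (f x))"
  using assms(4,5)
proof (induction n arbitrary: g)
  case 0
  then show ?case using assms(3) by (simp add: continuous_on_compose2)
next
  case (Suc n)
  let ?f' = "\<lambda>x. frechet_derivative f (at x)" and ?g' = "\<lambda>y. frechet_derivative g (at y)"
  note gd = Ck_on_differentiable[OF Suc.prems(2)]
  have d: "((\<lambda>x. g (f x)) has_derivative (\<lambda>v. ?g' (f x) (?f' x v))) (at x)" if "x \<in> S" for x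
    using diff_chain_at[OF Ck_on_differentiable[OF Suc.prems(1) that] gd[of "f x"]] that assms(3)
    by (auto simp: comp_def)
  have eq: "(\<Sum>b\<in>onb. (?f' x v \<bullet> b) *\<^sub>R ?g' (f x) b) = ?g' (f x) (?f' x v)" if "x \<in> S" for x v
    by (rule linear_onb[symmetric]) (use gd[of "f x"] that assms(3)
        in \<open>auto dest!: has_derivative_linear\<close>)
  have "Ck_on n S (\<lambda>x. \<Sum>b\<in>onb. (?f' x v \<bullet> b) *\<^sub>R ?g' (f x) b)" for v
    using Suc.prems
    by (intro Ck_on_sum[OF assms(1)] Ck_on_bilinear[OF bounded_bilinear_scaleR assms(1)]
          Ck_on_linear[OF bounded_linear_inner_left assms(1)] Suc.IH Ck_on_Suc_imp[OF Suc.prems(1)])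
              auto
  from Ck_on_cong[OF assms(1) eq this] show ?case
    by (intro Ck_on_SucI[OF assms(1) d])
qed

lemma Ck_on_local:
  assumes "\<And>x. x \<in> S \<Longrightarrow> \<exists>T. x \<in> T \<and> open T \<and> Ck_on n T f"
  shows "Ck_on n S f"
  using assms
proof (induction n arbitrary: f)
  case 0
  then show ?case
    by (metis Ck_on.simps(1) continuous_at_imp_continuous_on continuous_on_eq_continuous_at)
next
  case (Suc n)
  then show ?case by (metis Ck_on.simps(2))
qed

section \<open>Closure properties of smooth functions\<close>

lemma smooth_on_derivative:
  assumes "smooth_on S f" "x \<in> S"
  shows "(f has_derivative frechet_derivative f (at x)) (at x)"
  using Ck_on_differentiable[of 0 S f x] assms by (simp only: smooth_on_def)

lemma smooth_on_frechet: "smooth_on S f \<Longrightarrow> smooth_on S (\<lambda>x. frechet_derivative f (at x) v)"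
  by (metis Ck_on.simps(2) smooth_on_def)

lemma smooth_on_continuous: "smooth_on S f \<Longrightarrow> continuous_on S f"
  by (metis Ck_on.simps(1) smooth_on_def)

lemma smooth_on_cong:
  "open S \<Longrightarrow> (\<And>x. x \<in> S \<Longrightarrow> f x = g x) \<Longrightarrow> smooth_on S f \<Longrightarrow> smooth_on S g"
  unfolding smooth_on_def by (metis Ck_on_cong)

lemma smooth_on_subset: "smooth_on S f \<Longrightarrow> T \<subseteq> S \<Longrightarrow> smooth_on T f"
  by (auto simp: smooth_on_def intro: Ck_on_subset)

lemma smooth_on_const: "smooth_on S (\<lambda>x. c)"
  by (simp add: smooth_on_def Ck_on_const)

lemma smooth_on_id: "open S \<Longrightarrow> smooth_on S (\<lambda>x. x)"
  by (simp add: smooth_on_def Ck_on_id)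

lemma smooth_on_linear:
  "bounded_linear L \<Longrightarrow> open S \<Longrightarrow> smooth_on S f \<Longrightarrow> smooth_on S (\<lambda>x. L (f x))"
  by (simp add: smooth_on_def Ck_on_linear)

lemma smooth_on_add:
  "open S \<Longrightarrow> smooth_on S f \<Longrightarrow> smooth_on S g \<Longrightarrow> smooth_on S (\<lambda>x. f x + g x)"
  by (simp add: smooth_on_def Ck_on_add)

lemma smooth_on_diff:
  "open S \<Longrightarrow> smooth_on S f \<Longrightarrow> smooth_on S g \<Longrightarrow> smooth_on S (\<lambda>x. f x - g x)"
  using smooth_on_add[of S f "\<lambda>x. - g x"] smooth_on_linear[OF bounded_linear_minus[OF
      bounded_linear_ident], of S g]
  by simp

lemma smooth_on_bilinear:
  "bounded_bilinear p \<Longrightarrow> open S \<Longrightarrow> smooth_on S f \<Longrightarrow> smooth_on S g \<Longrightarrow> smooth_on S (\<lambda>x. p (f x) (g x))"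
  by (simp add: smooth_on_def Ck_on_bilinear)

lemma smooth_on_Pair:
  "open S \<Longrightarrow> smooth_on S f \<Longrightarrow> smooth_on S g \<Longrightarrow> smooth_on S (\<lambda>x. (f x, g x))"
  by (simp add: smooth_on_def Ck_on_Pair)

lemma smooth_on_sum:
  "open S \<Longrightarrow> (\<And>i. i \<in> I \<Longrightarrow> smooth_on S (f i)) \<Longrightarrow> smooth_on S (\<lambda>x. \<Sum>i\<in>I. f i x)"
  by (simp add: smooth_on_def Ck_on_sum)

lemma smooth_on_compose:
  fixes g :: "'b::findim_space \<Rightarrow> 'c::real_normed_vector"
  shows "open S \<Longrightarrow> open T \<Longrightarrow> f ` S \<subseteq> T \<Longrightarrow> smooth_on S f \<Longrightarrow> smooth_on T g \<Longrightarrow> smooth_on S (\<lambda>x. g (f x))"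
  unfolding smooth_on_def using Ck_on_compose[of S T f _ g] by blast

lemma smooth_on_local:
  assumes "\<And>x. x \<in> S \<Longrightarrow> \<exists>T. x \<in> T \<and> open T \<and> smooth_on T f"
  shows "smooth_on S f"
  unfolding smooth_on_def
proof
  show "Ck_on n S f" for n
    by (rule Ck_on_local) (use assms in \<open>unfold smooth_on_def, blast\<close>)
qed

text \<open>A map with values in operators is evaluated on a smooth argument by expanding in a basis.\<close>

lemma smooth_on_family_apply:
  fixes F :: "'a::real_normed_vector \<Rightarrow> 'b::findim_space \<Rightarrow> 'c::real_normed_vector"
  assumes "open S" "\<And>v. smooth_on S (\<lambda>x. F x v)" "smooth_on S g" "\<And>x. x \<in> S \<Longrightarrow> linear (F x)"
  shows "smooth_on S (\<lambda>x. F x (g x))"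
proof (rule smooth_on_cong[OF assms(1)])
  show "smooth_on S (\<lambda>x. \<Sum>b\<in>onb. (g x \<bullet> b) *\<^sub>R F x b)"
    by (intro smooth_on_sum smooth_on_bilinear[OF bounded_bilinear_scaleR]
      smooth_on_linear[OF bounded_linear_inner_left] assms)
qed (simp add: linear_onb[OF assms(4), symmetric])

lemma smooth_on_frechet_apply:
  fixes f :: "'a::findim_space \<Rightarrow> 'b::real_normed_vector"
  assumes "open S" "smooth_on S f" "smooth_on S g"
  shows "smooth_on S (\<lambda>x. frechet_derivative f (at x) (g x))"
  by (rule smooth_on_family_apply[OF assms(1) smooth_on_frechet[OF assms(2)] assms(3)
        has_derivative_linear[OF smooth_on_derivative[OF assms(2)]]])

lemma smooth_on_blinfunI:
  fixes F :: "'a::real_normed_vector \<Rightarrow> 'b::findim_space \<Rightarrow>\<^sub>L 'c::real_normed_vector"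
  assumes "open S" "\<And>v. smooth_on S (\<lambda>x. blinfun_apply (F x) v)"
  shows "smooth_on S F"
proof -
  have "smooth_on S (\<lambda>x. \<Sum>b\<in>onb. blinfun_scaleR_left (blinfun_apply (F x) b) o\<^sub>L blinfun_inner_left
      b)"
    by (intro smooth_on_sum assms
        smooth_on_linear[OF bounded_linear_compose[OF bounded_bilinear.bounded_linear_left[OF
            bounded_bilinear_blinfun_compose] bounded_linear_blinfun_scaleR_left]])
  then show ?thesis by (simp flip: blinfun_to_findim_expansion)
qed

lemma smooth_on_blinfun_apply:
  assumes "open S" "smooth_on S F" "smooth_on S g"
  shows "smooth_on S (\<lambda>x. blinfun_apply (F x) (g x))"
  by (rule smooth_on_bilinear[OF bounded_bilinear_blinfun_apply assms])

text \<open>Both sides are chosen from the same set of candidate derivatives, so they agree even at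
  a point where there is none.\<close>

lemma frechet_derivative_cong:
  assumes "open S" "x \<in> S" "\<And>y. y \<in> S \<Longrightarrow> f y = g y"
  shows "frechet_derivative f (at x) = frechet_derivative g (at x)"
proof -
  have "(f has_derivative f') (at x) \<longleftrightarrow> (g has_derivative f') (at x)" for f'
    using assms has_derivative_transform_within_open[of f f' x UNIV S g]
      has_derivative_transform_within_open[of g f' x UNIV S f] by auto
  then show ?thesis by (simp add: frechet_derivative_def)
qed

lemma frechet_derivative_blinfun_apply:
  assumes "(f has_derivative f') (at x)"
  shows "((\<lambda>y. blinfun_apply (f y) v) has_derivative (\<lambda>u. blinfun_apply (f' u) v)) (at x)"
  by (rule bounded_linear.has_derivative[OF blinfun.bounded_linear_left assms])

subsection \<open>Symmetry of second derivatives\<close>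

text \<open>The second difference of \<open>f\<close> over the parallelogram with sides
  \<open>t u\<close> and \<open>t v\<close> is symmetric in \<open>u\<close> and \<open>v\<close>.
  Two applications of the mean value theorem, in either order, express it as \<open>t * t\<close>
  times a mixed derivative at a point that tends to \<open>x\<close> with \<open>t\<close>;
  continuity of the mixed derivatives then gives the claim.\<close>

lemma symmetric_second_derivative_real:
  fixes f :: "'a::real_normed_vector \<Rightarrow> real"
  assumes S: "open S" "x \<in> S" and f: "smooth_on S f"
  shows "frechet_derivative (\<lambda>y. frechet_derivative f (at y) u) (at x) v
       = frechet_derivative (\<lambda>y. frechet_derivative f (at y) v) (at x) u"
proof -
  define D where "D u v y = frechet_derivative (\<lambda>y. frechet_derivative f (at y) u) (at y) v"
      for u v y
  have cont: "continuous_on S (D u v)" for u v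
    unfolding D_def by (intro smooth_on_continuous smooth_on_frechet f)
  obtain r where r: "r > 0" "ball x r \<subseteq> S" using S openE by blast
  \<comment> \<open>Chosen so that the parallelograms with parameter below \<open>\<delta>\<close>
    stay in the ball; the summand 1 covers the case that \<open>u\<close> and \<open>v\<close> are
    both 0.\<close>
  define \<delta> where "\<delta> = r / (norm u + norm v + 1)"
  have \<delta>: "\<delta> > 0" using r by (simp add: \<delta>_def add_nonneg_pos)
  have inb: "norm (a *\<^sub>R u + b *\<^sub>R v) < r" if "0 \<le> a" "a \<le> t" "0 \<le> b" "b \<le> t" "t < \<delta>" for a b t
  proof -
    have "norm (a *\<^sub>R u + b *\<^sub>R v) \<le> a * norm u + b * norm v"
      using norm_triangle_ineq[of "a *\<^sub>R u" "b *\<^sub>R v"] that by simp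
    also have "\<dots> \<le> t * norm u + t * norm v" using that by (intro add_mono mult_right_mono) auto
    also have "\<dots> \<le> t * (norm u + norm v + 1)" using that by (simp add: algebra_simps)
    also have "\<dots> < r" using that r
      by (simp add: \<delta>_def pos_less_divide_eq add_nonneg_pos)
    finally show ?thesis .
  qed
  have inS: "x + a *\<^sub>R u + b *\<^sub>R v \<in> S" if "0 \<le> a" "a \<le> t" "0 \<le> b" "b \<le> t" "t < \<delta>" for a b t
    using inb[OF that] r(2) by (auto simp: dist_norm subset_iff add.assoc norm_minus_commute)
  let ?D = "\<lambda>u y. frechet_derivative f (at y) u"
  have key: "\<exists>a b. 0 \<le> a \<and> a \<le> t \<and> 0 \<le> b \<and> b \<le> t \<and>
      f (x + t *\<^sub>R u + t *\<^sub>R v) - f (x + t *\<^sub>R u) - f (x + t *\<^sub>R v) + f x = t * t * D u v (x + a *\<^sub>R u +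
          b *\<^sub>R v)"
    if t: "0 < t" and in_S: "\<And>a b. 0 \<le> a \<Longrightarrow> a \<le> t \<Longrightarrow> 0 \<le> b \<Longrightarrow> b \<le> t \<Longrightarrow> x + a *\<^sub>R u + b *\<^sub>R v \<in> S"
        for t u v
  proof -
    \<comment> \<open>The increment of \<open>?h\<close> over the interval from 0 to
      \<open>t\<close> is the second difference; its derivative is in turn an increment along
      \<open>v\<close>, of the derivative in direction \<open>u\<close>.\<close>
    let ?h = "\<lambda>s. f (x + s *\<^sub>R u + t *\<^sub>R v) - f (x + s *\<^sub>R u)"
    have line: "((\<lambda>s. g (y + s *\<^sub>R w)) has_real_derivative frechet_derivative g (at (y + s *\<^sub>R w)) w)
        (at s)"
      if "smooth_on S g" "y + s *\<^sub>R w \<in> S" for g y w s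
    proof -
      note gd = smooth_on_derivative[OF that]
      have "((\<lambda>s. y + s *\<^sub>R w) has_derivative (\<lambda>h. h *\<^sub>R w)) (at s)"
        by (auto intro!: derivative_eq_intros)
      from diff_chain_at[OF this gd]
      have "((\<lambda>s. g (y + s *\<^sub>R w)) has_derivative (\<lambda>h. frechet_derivative g (at (y + s *\<^sub>R w))
          (h *\<^sub>R w))) (at s)"
        by (simp only: comp_def)
      moreover have "(\<lambda>h. frechet_derivative g (at (y + s *\<^sub>R w)) (h *\<^sub>R w)) = (*)
          (frechet_derivative g (at (y + s *\<^sub>R w)) w)"
        by (rule ext) (simp add: linear_scale[OF has_derivative_linear[OF gd]])
      ultimately show ?thesis by (simp only: has_field_derivative_def)
    qed
    have d: "(?h has_real_derivative ?D u (x + s *\<^sub>R u + t *\<^sub>R v) - ?D u (x + s *\<^sub>R u)) (at s)"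
      if "0 \<le> s" "s \<le> t" for s
      using line[OF f, of "x + t *\<^sub>R v" s u] line[OF f, of "x" s u] in_S[of s t] in_S[of s 0] that t
      by (intro DERIV_diff) (simp_all add: algebra_simps)
    obtain a where a: "a > 0" "a < t" "?h t - ?h 0 = (t - 0) * (?D u (x + a *\<^sub>R u + t *\<^sub>R v)
        - ?D u (x + a *\<^sub>R u))"
      using MVT2[of 0 t ?h "\<lambda>s. ?D u (x + s *\<^sub>R u + t *\<^sub>R v) - ?D u (x + s *\<^sub>R u)", OF t d] by metis
    have d2: "((\<lambda>s. ?D u (x + a *\<^sub>R u + s *\<^sub>R v)) has_real_derivative D u v (x + a *\<^sub>R u + s *\<^sub>R v))
        (at s)"
      if "0 \<le> s" "s \<le> t" for s
      unfolding D_def by (rule line[OF smooth_on_frechet[OF f]]) (use in_S[of a s] a that in auto)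
    obtain b where b: "b > 0" "b < t" "?D u (x + a *\<^sub>R u + t *\<^sub>R v) - ?D u (x + a *\<^sub>R u + 0 *\<^sub>R v)
        = (t - 0) * D u v (x + a *\<^sub>R u + b *\<^sub>R v)"
      using MVT2[of 0 t "\<lambda>s. ?D u (x + a *\<^sub>R u + s *\<^sub>R v)" "\<lambda>s. D u v (x + a *\<^sub>R u + s *\<^sub>R v)", OF t d2]
          by metis
    show ?thesis using a b by (intro exI[of _ a] exI[of _ b]) simp
  qed
  have "\<exists>p q. norm (p - x) \<le> t * (norm u + norm v) \<and> norm (q - x) \<le> t * (norm u + norm v) \<and>
      D u v p = D v u q"
    if t: "0 < t" "t < \<delta>" for t
  proof -
    obtain a b where ab: "0 \<le> a" "a \<le> t" "0 \<le> b" "b \<le> t"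
        "f (x + t *\<^sub>R u + t *\<^sub>R v) - f (x + t *\<^sub>R u) - f (x + t *\<^sub>R v) + f x = t * t * D u v (x + a *\<^sub>R u
            + b *\<^sub>R v)"
      using key[of t u v] inS[of _ t] t by blast
    have inS': "x + a *\<^sub>R v + b *\<^sub>R u \<in> S" if "0 \<le> a" "a \<le> t" "0 \<le> b" "b \<le> t" for a b
      using inS[OF that(3,4,1,2)] t by (simp add: add_ac)
    obtain c d where cd: "0 \<le> c" "c \<le> t" "0 \<le> d" "d \<le> t"
        "f (x + t *\<^sub>R v + t *\<^sub>R u) - f (x + t *\<^sub>R v) - f (x + t *\<^sub>R u) + f x = t * t * D v u (x + c *\<^sub>R v
            + d *\<^sub>R u)"
      using key[of t v u] inS' t by blast
    \<comment> \<open>Both sides equal the same second difference, written with the roles of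
      \<open>u\<close> and \<open>v\<close> exchanged.\<close>
    have "t * t * D u v (x + a *\<^sub>R u + b *\<^sub>R v) = t * t * D v u (x + c *\<^sub>R v + d *\<^sub>R u)"
    proof -
      have "x + t *\<^sub>R v + t *\<^sub>R u = x + t *\<^sub>R u + t *\<^sub>R v" by simp
      from cd(5)[unfolded this] ab(5) show ?thesis by linarith
    qed
    then have "D u v (x + a *\<^sub>R u + b *\<^sub>R v) = D v u (x + c *\<^sub>R v + d *\<^sub>R u)" using t by simp
    moreover have "norm (a *\<^sub>R u + b *\<^sub>R v) \<le> t * (norm u + norm v)" if "0 \<le> a" "a \<le> t" "0 \<le> b"
        "b \<le> t" for a b
    proof -
      have "norm (a *\<^sub>R u + b *\<^sub>R v) \<le> a * norm u + b * norm v"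
        using norm_triangle_ineq[of "a *\<^sub>R u" "b *\<^sub>R v"] that by simp
      also have "\<dots> \<le> t * norm u + t * norm v" using that by (intro add_mono mult_right_mono) auto
      finally show ?thesis by (simp add: algebra_simps)
    qed
    ultimately show ?thesis using ab cd
      by (intro exI[of _ "x + a *\<^sub>R u + b *\<^sub>R v"] exI[of _ "x + c *\<^sub>R v + d *\<^sub>R u"])
          (simp add: add.assoc add.commute[of "c *\<^sub>R v"])
  qed
  then obtain p q where pq: "\<And>t. 0 < t \<Longrightarrow> t < \<delta> \<Longrightarrow> norm (p t - x) \<le> t * (norm u + norm v) \<and>
      norm (q t - x) \<le> t * (norm u + norm v) \<and> D u v (p t) = D v u (q t)"
    by metis
  have ev: "eventually (\<lambda>t. 0 < t \<and> t < \<delta>) (at_right 0)"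
    using \<delta> by (auto simp: eventually_at_right_field)
  have z: "((\<lambda>t. t * (norm u + norm v)) \<longlongrightarrow> 0) (at_right 0)"
    by (intro tendsto_mult_left_zero tendsto_ident_at)
  have "((\<lambda>t. p t - x) \<longlongrightarrow> 0) (at_right 0)" "((\<lambda>t. q t - x) \<longlongrightarrow> 0) (at_right 0)"
    by (rule Lim_null_comparison[OF eventually_mono[OF ev] z], use pq in blast)+
  then have "(p \<longlongrightarrow> x) (at_right 0)" "(q \<longlongrightarrow> x) (at_right 0)"
    by (simp_all only: LIM_zero_cancel)
  moreover have "isCont (D u v) x" "isCont (D v u) x"
    using cont S by (auto simp: continuous_on_eq_continuous_at)
  ultimately have "((\<lambda>t. D u v (p t)) \<longlongrightarrow> D u v x) (at_right 0)" "((\<lambda>t. D v u (q t)) \<longlongrightarrow> D v u x)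
      (at_right 0)"
    by (auto intro: isCont_tendsto_compose)
  moreover have "eventually (\<lambda>t. D u v (p t) = D v u (q t)) (at_right 0)"
    by (rule eventually_mono[OF ev]) (use pq in blast)
  ultimately have "D u v x = D v u x"
    using tendsto_cong[of "\<lambda>t. D u v (p t)" "\<lambda>t. D v u (q t)"]
      tendsto_unique[OF trivial_limit_at_right_real] by metis
  then show ?thesis by (simp add: D_def)
qed

text \<open>Pairing with a fixed vector \<open>w\<close> commutes with differentiation and reduces
  the claim to real functions.\<close>

lemma symmetric_second_derivative:
  fixes f :: "'a::real_normed_vector \<Rightarrow> 'b::real_inner"
  assumes S: "open S" "x \<in> S" and f: "smooth_on S f"
  shows "frechet_derivative (\<lambda>y. frechet_derivative f (at y) u) (at x) v
       = frechet_derivative (\<lambda>y. frechet_derivative f (at y) v) (at x) u"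
proof -
  have e1: "frechet_derivative (\<lambda>z. f z \<bullet> w) (at y) u = frechet_derivative f (at y) u \<bullet> w"
    if "y \<in> S" for y u w
    by (rule fun_cong[OF frechet_derivative_at[OF has_derivative_inner_left[OF
        smooth_on_derivative[OF f that]], symmetric]])
  have e2: "frechet_derivative (\<lambda>y. frechet_derivative f (at y) u) (at x) v \<bullet> w
     = frechet_derivative (\<lambda>y. frechet_derivative (\<lambda>z. f z \<bullet> w) (at y) u) (at x) v" for u v w
  proof -
    have "frechet_derivative (\<lambda>y. frechet_derivative (\<lambda>z. f z \<bullet> w) (at y) u) (at x)
       = frechet_derivative (\<lambda>y. frechet_derivative f (at y) u \<bullet> w) (at x)"
      by (rule frechet_derivative_cong[OF S e1])
    also have "\<dots> = (\<lambda>h. frechet_derivative (\<lambda>y. frechet_derivative f (at y) u) (at x) h \<bullet> w)"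
      by (rule frechet_derivative_at[symmetric, OF has_derivative_inner_left[OF
          smooth_on_derivative[OF smooth_on_frechet[OF f] S(2)]]])
    finally show ?thesis by (rule fun_cong[symmetric])
  qed
  have "smooth_on S (\<lambda>z. f z \<bullet> w)" for w
    by (rule smooth_on_linear[OF bounded_linear_inner_left S(1) f])
  from symmetric_second_derivative_real[OF S this]
  have "frechet_derivative (\<lambda>y. frechet_derivative f (at y) u) (at x) v \<bullet> w
       = frechet_derivative (\<lambda>y. frechet_derivative f (at y) v) (at x) u \<bullet> w" for w
    unfolding e2 .
  then show ?thesis by (metis vector_eq_rdot)
qed

subsection \<open>The inverse function theorem\<close>

text \<open>A product rule in which the second factor is merely continuous: as \<open>p\<close>
  vanishes at \<open>x\<close>, the term \<open>p y *\<^sub>R (q y - q x)\<close> is of smaller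
  order than \<open>y - x\<close>. It serves to differentiate inverse operators before they are
  known to be differentiable.\<close>

lemma has_derivative_scaleR_vanishing:
  fixes p :: "'a::real_normed_vector \<Rightarrow> real" and q :: "'a \<Rightarrow> 'b::real_normed_vector"
  assumes p: "(p has_derivative p') (at x)" "p x = 0" and q: "isCont q x"
  shows "((\<lambda>y. p y *\<^sub>R q y) has_derivative (\<lambda>h. p' h *\<^sub>R q x)) (at x)"
proof -
  obtain K where K: "\<And>h. norm (p' h) \<le> norm h * K" "K > 0"
    using bounded_linear.pos_bounded[OF has_derivative_bounded_linear[OF p(1)]] by metis
  have "((\<lambda>y. norm ((p y - p x) - p' (y - x)) / norm (y - x)) \<longlongrightarrow> 0) (at x)"
    using p(1) unfolding has_derivative_iff_norm by blast
  \<comment> \<open>The constant in the bound is \<open>K\<close> for the derivative plus 1 for the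
    remainder, which is eventually smaller than \<open>norm (y - x)\<close>.\<close>
  from order_tendstoD(2)[OF this zero_less_one]
  have ev: "eventually (\<lambda>y. norm (p y) \<le> (1 + K) * norm (y - x)) (at x)"
  proof (rule eventually_mono[OF eventually_conj[OF _ eventually_at_ball'[of 1]]])
    fix y assume y: "norm (p y - p x - p' (y - x)) / norm (y - x) < 1 \<and> y \<in> ball x 1 \<and> y \<noteq> x \<and>
        y \<in> UNIV"
    then have "y \<noteq> x" by blast
    with y have "norm (p y - p' (y - x)) < norm (y - x)"
      by (simp add: p(2) pos_divide_less_eq[of "norm (y - x)"])
    moreover have "norm (p y) \<le> norm (p y - p' (y - x)) + norm (p' (y - x))"
      by (metis diff_add_cancel norm_triangle_ineq)
    ultimately show "norm (p y) \<le> (1 + K) * norm (y - x)"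
      using K(1)[of "y - x"] by (simp add: algebra_simps)
  qed auto
  have "((\<lambda>y. p y *\<^sub>R (q y - q x)) has_derivative (\<lambda>h. 0)) (at x)"
    unfolding has_derivative_iff_norm
  proof (intro conjI bounded_linear_zero)
    have z: "((\<lambda>y. (1 + K) * norm (q y - q x)) \<longlongrightarrow> 0) (at x)"
      using q unfolding isCont_def
      by (intro tendsto_mult_right_zero tendsto_norm_zero) (simp add: LIM_zero)
    show "((\<lambda>y. norm (p y *\<^sub>R (q y - q x) - p x *\<^sub>R (q x - q x) - 0) / norm (y - x)) \<longlongrightarrow> 0) (at x)"
    proof (rule Lim_null_comparison[OF eventually_mono[OF ev] z])
      fix y assume y: "norm (p y) \<le> (1 + K) * norm (y - x)"
      have "norm (p y) * norm (q y - q x) \<le> (1 + K) * norm (y - x) * norm (q y - q x)"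
        by (rule mult_right_mono[OF y]) simp
      then show "norm (norm (p y *\<^sub>R (q y - q x) - p x *\<^sub>R (q x - q x) - 0) / norm (y - x)) \<le> (1 + K)
          * norm (q y - q x)"
        using K(2) by (cases "y = x") (simp_all add: pos_divide_le_eq mult_ac)
    qed
  qed
  from has_derivative_add[OF bounded_linear.has_derivative[OF bounded_linear_scaleR_left[of "q x"]
      p(1)] this]
  show ?thesis by (simp add: scaleR_right_diff_distrib)
qed

text \<open>For fixed \<open>x\<close> one has
  \<open>E y v = E x v - E y (M y (E x v) - M x (E x v))\<close>. The argument of \<open>E y\<close>
  vanishes at \<open>y = x\<close>, so continuity of \<open>E\<close> is enough to differentiate,
  and the derivative is an expression in \<open>E\<close> and the derivative of \<open>M\<close>.
  Smoothness follows by bootstrapping.\<close>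

lemma smooth_on_inverse_family:
  fixes M E :: "'a::real_normed_vector \<Rightarrow> 'b::findim_space \<Rightarrow> 'b"
  assumes U: "open U" and linM: "\<And>x. x \<in> U \<Longrightarrow> linear (M x)" and linE: "\<And>x. x \<in> U \<Longrightarrow> linear (E x)"
    and EM: "\<And>x v. x \<in> U \<Longrightarrow> E x (M x v) = v" and ME: "\<And>x v. x \<in> U \<Longrightarrow> M x (E x v) = v"
    and M: "\<And>v. smooth_on U (\<lambda>x. M x v)" and E: "\<And>v. continuous_on U (\<lambda>x. E x v)"
  shows "smooth_on U (\<lambda>x. E x v)"
proof -
  let ?D = "\<lambda>x u h. frechet_derivative (\<lambda>y. M y u) (at x) h"
  have d: "((\<lambda>y. E y v) has_derivative (\<lambda>h. - E x (?D x (E x v) h))) (at x)" if x: "x \<in> U" for x v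
  proof -
    let ?u = "E x v" and ?m = "\<lambda>y. M y (E x v)"
    note md = smooth_on_derivative[OF M[of ?u] x]
    have "((\<lambda>y. ((?m y - ?m x) \<bullet> b) *\<^sub>R E y b) has_derivative (\<lambda>h. (?D x ?u h \<bullet> b) *\<^sub>R E x b)) (at x)"
        for b
    proof (rule has_derivative_scaleR_vanishing)
      show "((\<lambda>y. (?m y - ?m x) \<bullet> b) has_derivative (\<lambda>h. ?D x ?u h \<bullet> b)) (at x)"
        using has_derivative_inner_left[OF has_derivative_diff[OF md has_derivative_const[of "?m
            x"]], of b] by simp
      show "isCont (\<lambda>y. E y b) x" using E U x by (auto simp: continuous_on_eq_continuous_at)
    qed simp
    then have "((\<lambda>y. ?u - (\<Sum>b\<in>onb. ((?m y - ?m x) \<bullet> b) *\<^sub>R E y b)) has_derivative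
        (\<lambda>h. 0 - (\<Sum>b\<in>onb. (?D x ?u h \<bullet> b) *\<^sub>R E x b))) (at x)"
      by (intro has_derivative_diff has_derivative_const has_derivative_sum)
    moreover have "(\<lambda>h. 0 - (\<Sum>b\<in>onb. (?D x ?u h \<bullet> b) *\<^sub>R E x b)) = (\<lambda>h. - E x (?D x ?u h))"
      by (rule ext) (simp add: linear_onb[OF linE[OF x], symmetric])
    ultimately have *: "((\<lambda>y. ?u - (\<Sum>b\<in>onb. ((?m y - ?m x) \<bullet> b) *\<^sub>R E y b)) has_derivative
        (\<lambda>h. - E x (?D x ?u h))) (at x)" by simp
    show ?thesis
    proof (rule has_derivative_transform_within_open[OF * U x])
      fix y assume y: "y \<in> U"
      have "(\<Sum>b\<in>onb. ((?m y - ?m x) \<bullet> b) *\<^sub>R E y b) = E y (?m y - ?m x)"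
        by (rule linear_onb[OF linE[OF y], symmetric])
      then show "?u - (\<Sum>b\<in>onb. ((?m y - ?m x) \<bullet> b) *\<^sub>R E y b) = E y v"
        by (simp add: linear_diff[OF linE[OF y]] EM[OF y] ME[OF x])
    qed
  qed
  have "Ck_on n U (\<lambda>x. E x v)" for n v
  proof (induction n arbitrary: v)
    case 0
    then show ?case using E by simp
  next
    case (Suc n)
    have MC: "Ck_on n U (\<lambda>x. ?D x b h)" for b h
      using smooth_on_frechet[OF M[of b], of h] by (simp add: smooth_on_def)
    \<comment> \<open>The derivative is rewritten so that \<open>E\<close> and \<open>?D\<close> are
      applied to fixed vectors only, the form in which the induction hypothesis and
      \<open>MC\<close> speak of them.\<close>
    have eq: "(\<Sum>b\<in>onb. ((\<Sum>c\<in>onb. (E x v \<bullet> c) *\<^sub>R ?D x c h) \<bullet> b) *\<^sub>R (- E x b)) = - E x (?D x (E x v)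
        h)"
      if x: "x \<in> U" for x h
    proof -
      have "(\<Sum>c\<in>onb. (E x v \<bullet> c) *\<^sub>R ?D x c h) = ?D x (E x v) h"
      proof -
        have "((\<lambda>y. \<Sum>c\<in>onb. (E x v \<bullet> c) *\<^sub>R M y c) has_derivative (\<lambda>h. \<Sum>c\<in>onb. (E x v \<bullet> c)
            *\<^sub>R ?D x c h)) (at x)"
          by (intro has_derivative_sum has_derivative_scaleR_right smooth_on_derivative[OF M x])
        then have "((\<lambda>y. M y (E x v)) has_derivative (\<lambda>h. \<Sum>c\<in>onb. (E x v \<bullet> c) *\<^sub>R ?D x c h)) (at x)"
          by (rule has_derivative_transform_within_open[OF _ U x]) (simp add: linear_onb[OF linM,
              symmetric])
        from fun_cong[OF frechet_derivative_at[OF this]] show ?thesis .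
      qed
      then show ?thesis
        by (simp add: linear_onb[OF linE[OF x], symmetric] sum_negf)
    qed
    have "Ck_on n U (\<lambda>x. \<Sum>b\<in>onb. ((\<Sum>c\<in>onb. (E x v \<bullet> c) *\<^sub>R ?D x c h) \<bullet> b) *\<^sub>R (- E x b))" for h
      by (intro Ck_on_sum Ck_on_bilinear[OF bounded_bilinear_scaleR] U MC Suc.IH
          Ck_on_linear[OF bounded_linear_inner_left] Ck_on_linear[OF bounded_linear_minus[OF
              bounded_linear_ident]])
    from Ck_on_cong[OF U eq this] show ?case
      by (intro Ck_on_SucI[OF U d])
  qed
  then show ?thesis by (simp add: smooth_on_def)
qed

text \<open>The estimate gives \<open>norm v \<le> 2 * norm (f v)\<close>, hence injectivity, hence
  surjectivity in finite dimension; the same inequality bounds the inverse by 2.\<close>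

lemma linear_near_identity_inverse:
  fixes f :: "'a::findim_space \<Rightarrow> 'a"
  assumes "linear f" "\<And>v. norm (f v - v) \<le> norm v / 2"
  obtains g where "linear g" "\<And>v. g (f v) = v" "\<And>v. f (g v) = v" "\<And>v. norm (g v) \<le> 2 * norm v"
proof -
  have low: "norm v \<le> 2 * norm (f v)" for v
    using assms(2)[of v] norm_triangle_ineq2[of v "f v"] norm_minus_commute[of v "f v"] by linarith
  have inj: "inj f"
    unfolding linear_injective_0[OF assms(1)] using low
        by (metis norm_le_zero_iff norm_zero mult_zero_right)
  obtain B :: "'a set" where "finite_dimensional_vector_space scaleR B"
    by (rule findim_basis_locale)
  then interpret fd: finite_dimensional_vector_space "scaleR :: real \<Rightarrow> 'a \<Rightarrow> 'a" B .
  have surj: "surj f"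
    by (rule fd.linear_inj_imp_surj[OF _ inj]) (use assms(1) in \<open>simp add: linear_def
        real_scaleR_def[abs_def]\<close>)
  define g where "g = inv f"
  have fg: "f (g v) = v" and gf: "g (f v) = v" for v
    using inj surj by (simp_all add: g_def surj_f_inv_f)
  have "linear g"
    by (rule linearI; rule injD[OF inj]) (simp_all add: linear_add[OF assms(1)]
        linear_scale[OF assms(1)] fg)
  then show thesis using that gf fg low[of "g _"] by simp
qed

text \<open>Near \<open>x0\<close> the map \<open>f x - x\<close> is Lipschitz with constant 1/2, so
  \<open>f\<close> is injective and, by Banach's fixed point theorem, open. The derivative of the
  inverse at \<open>y\<close> is the inverse of the derivative at the preimage, and smooth
  dependence of inverse operators raises the regularity of the inverse one order at a time. The
  normalisation of the derivative at \<open>x0\<close> is met by the map that straightens a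
  submersion.\<close>

theorem smooth_inverse_function:
  fixes f :: "'a::findim_space \<Rightarrow> 'a"
  assumes S: "open S" "x0 \<in> S" and f: "smooth_on S f"
    and id: "\<And>v. frechet_derivative f (at x0) v = v"
  obtains U where "open U" "x0 \<in> U" "U \<subseteq> S" "inj_on f U" "open (f ` U)"
      "smooth_on (f ` U) (inv_into U f)"
proof -
  let ?f' = "\<lambda>x. frechet_derivative f (at x)"
  \<comment> \<open>An upper bound for the operator norm of \<open>?f' x - id\<close> that is
    visibly continuous and vanishes at \<open>x0\<close>.\<close>
  define h where "h x = (\<Sum>b\<in>(onb::'a set). norm b * norm (?f' x b - b))" for x
  have hb: "norm (?f' x v - v) \<le> norm v * h x" if x: "x \<in> S" for x v
  proof -
    have lin: "linear (\<lambda>v. ?f' x v - v)"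
      by (intro linear_compose_sub has_derivative_linear[OF smooth_on_derivative[OF f x]]
          linear_ident)
    have "norm (?f' x v - v) \<le> (\<Sum>b\<in>onb. norm ((v \<bullet> b) *\<^sub>R (?f' x b - b)))"
      by (subst linear_onb[OF lin]) (rule norm_sum)
    also have "\<dots> \<le> (\<Sum>b\<in>onb. norm v * (norm b * norm (?f' x b - b)))"
      by (intro sum_mono) (simp add: Cauchy_Schwarz_ineq2 mult_right_mono flip: mult.assoc)
    finally show ?thesis by (simp add: h_def sum_distrib_left)
  qed
  have "continuous_on S h"
    unfolding h_def by (intro continuous_intros smooth_on_continuous[OF smooth_on_frechet[OF f]])
  moreover have "h x0 = 0" by (simp add: h_def id)
  moreover have "isCont h x0" using calculation(1) S by (simp add: continuous_on_eq_continuous_at)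
  ultimately have "eventually (\<lambda>x. h x < 1/2) (at x0)"
    by (intro order_tendstoD(2)[of h "h x0"]) (simp_all add: isCont_def)
  then obtain r1 where r1: "r1 > 0" "\<And>x. x \<noteq> x0 \<Longrightarrow> dist x x0 < r1 \<Longrightarrow> h x < 1/2"
    by (auto simp: eventually_at)
  obtain r2 where r2: "r2 > 0" "ball x0 r2 \<subseteq> S" using S openE by blast
  define U where "U = ball x0 (min r1 r2)"
  have U: "open U" "x0 \<in> U" "U \<subseteq> S" "convex U" using r1 r2 by (auto simp: U_def)
  have hU: "h x \<le> 1/2" if "x \<in> U" for x
    using r1(2)[of x] that \<open>h x0 = 0\<close> by (cases "x = x0") (auto simp: U_def dist_commute)
  have near: "norm (?f' x v - v) \<le> norm v / 2" if "x \<in> U" for x v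
    using hb[of x v] hU[OF that] that U(3) mult_left_mono[OF hU[OF that], of "norm v"] by auto
  have lip: "norm ((f x - x) - (f y - y)) \<le> 1/2 * norm (x - y)" if "x \<in> U" "y \<in> U" for x y
  proof (rule differentiable_bound[OF U(4) _ _ that, where f = "\<lambda>x. f x - x"
      and f' = "\<lambda>x v. ?f' x v - v"])
    fix z assume z: "z \<in> U"
    show "((\<lambda>x. f x - x) has_derivative (\<lambda>v. ?f' z v - v)) (at z within U)"
      using has_derivative_at_withinI[OF has_derivative_diff[OF smooth_on_derivative[OF f, of z]
          has_derivative_ident]] z U(3) by blast
    show "onorm (\<lambda>v. ?f' z v - v) \<le> 1/2"
      by (rule onorm_bound) (use near[OF z] in auto)
  qed
  have low: "norm (x - y) \<le> 2 * norm (f x - f y)" if "x \<in> U" "y \<in> U" for x y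
  proof -
    have "norm (x - y) - norm (f x - f y) \<le> norm ((x - y) - (f x - f y))"
        by (rule norm_triangle_ineq2)
    also have "(x - y) - (f x - f y) = - ((f x - x) - (f y - y))" by simp
    finally show ?thesis using lip[OF that] unfolding norm_minus_cancel by simp
  qed
  have inj: "inj_on f U"
    using low by (intro inj_onI) (metis diff_self mult_zero_right norm_le_zero_iff norm_zero
        right_minus_eq)
  have "\<exists>e>0. ball (f x) e \<subseteq> f ` U" if x: "x \<in> U" for x
  proof -
    obtain e where e: "e > 0" "cball x e \<subseteq> U" using U(1) x open_contains_cball by blast
    have "\<exists>z\<in>cball x e. f z = y" if y: "y \<in> ball (f x) (e/2)" for y
    proof -
      \<comment> \<open>A fixed point of \<open>z \<mapsto> y - (f z - z)\<close> is a solution of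
        \<open>f z = y\<close>. With \<open>y\<close> within \<open>e/2\<close> of
        \<open>f x\<close> the closed ball of radius \<open>e\<close> is preserved:
        \<open>e/2\<close> comes from \<open>y\<close> and at most \<open>e/2\<close> from the
        Lipschitz bound.\<close>
      have "\<exists>!z. z \<in> cball x e \<and> y - (f z - z) = z"
      proof (rule Banach_fix[where c = "1/2"])
        show "complete (cball x e)" by (simp add: complete_eq_closed)
        show "(\<lambda>z. y - (f z - z)) ` cball x e \<subseteq> cball x e"
        proof
          fix w assume "w \<in> (\<lambda>z. y - (f z - z)) ` cball x e"
          then obtain z where z: "z \<in> cball x e" "w = y - (f z - z)" by blast
          have "w - x = (y - f x) - ((f z - z) - (f x - x))" by (simp add: z)
          also have "norm \<dots> \<le> norm (y - f x) + norm ((f z - z) - (f x - x))"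
              by (rule norm_triangle_ineq4)
          also have "\<dots> \<le> e/2 + 1/2 * norm (z - x)"
          proof (rule add_mono)
            show "norm (y - f x) \<le> e/2" using y by (simp add: dist_norm norm_minus_commute)
            show "norm ((f z - z) - (f x - x)) \<le> 1/2 * norm (z - x)"
              using subsetD[OF e(2) z(1)] by (rule lip[OF _ x])
          qed
          also have "\<dots> \<le> e" using z by (simp add: dist_norm norm_minus_commute)
          finally show "w \<in> cball x e" by (simp add: dist_norm norm_minus_commute)
        qed
        show "dist (y - (f a - a)) (y - (f b - b)) \<le> 1/2 * dist a b" if "a \<in> cball x e"
            "b \<in> cball x e" for a b
        proof -
          have "(y - (f a - a)) - (y - (f b - b)) = - ((f a - a) - (f b - b))" by simp
          then have "dist (y - (f a - a)) (y - (f b - b)) = norm ((f a - a) - (f b - b))"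
            unfolding dist_norm by (metis norm_minus_cancel)
          then show ?thesis
            using lip[OF subsetD[OF e(2) that(1)] subsetD[OF e(2) that(2)]] by (simp add: dist_norm)
        qed
      qed (use e in auto)
      then obtain z where "z \<in> cball x e" "y - (f z - z) = z" by blast
      then show ?thesis by (intro bexI[of _ z]) (simp_all add: algebra_simps)
    qed
    then have "ball (f x) (e/2) \<subseteq> f ` U" using e(2) by blast
    then show ?thesis using e(1) by (intro exI[of _ "e/2"]) simp
  qed
  then have opn: "open (f ` U)" by (auto simp: open_contains_ball)
  define g where "g = inv_into U f"
  have gU: "g y \<in> U" and fg: "f (g y) = y" if "y \<in> f ` U" for y
    using that by (auto simp: g_def inv_into_into f_inv_into_f)
  have "\<exists>E. linear E \<and> (\<forall>v. E (?f' x v) = v) \<and> (\<forall>v. ?f' x (E v) = v) \<and> (\<forall>v. norm (E v)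
      \<le> 2 * norm v)" if "x \<in> U" for x
    by (rule linear_near_identity_inverse[of "?f' x"])
      (use near[OF that] that U(3) has_derivative_linear[OF smooth_on_derivative[OF f, of x]]
          in auto)
  then obtain E where E: "\<And>x. x \<in> U \<Longrightarrow> linear (E x)" "\<And>x v. x \<in> U \<Longrightarrow> E x (?f' x v) = v"
      "\<And>x v. x \<in> U \<Longrightarrow> ?f' x (E x v) = v" "\<And>x v. x \<in> U \<Longrightarrow> norm (E x v) \<le> 2 * norm v"
    by metis
  have fl: "linear (?f' x)" if "x \<in> U" for x
    using that U(3) by (intro has_derivative_linear[OF smooth_on_derivative[OF f]]) auto
  have Econt: "continuous_on U (\<lambda>x. E x v)" for v
    unfolding continuous_on_def
  proof
    fix x assume x: "x \<in> U"
    let ?u = "E x v"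
    have "((\<lambda>y. ?f' y ?u) \<longlongrightarrow> ?f' x ?u) (at x within U)"
      using smooth_on_continuous[OF smooth_on_subset[OF smooth_on_frechet[OF f] U(3)], of ?u] x
      by (simp add: continuous_on_def)
    then have "((\<lambda>y. 2 * norm (?f' y ?u - ?f' x ?u)) \<longlongrightarrow> 0) (at x within U)"
      by (intro tendsto_mult_right_zero tendsto_norm_zero) (simp add: LIM_zero)
    then have "((\<lambda>y. E y v - E x v) \<longlongrightarrow> 0) (at x within U)"
    proof (rule Lim_null_comparison[rotated])
      have "norm (E y v - E x v) \<le> 2 * norm (?f' y ?u - ?f' x ?u)" if y: "y \<in> U" for y
      proof -
        have "E y v - E x v = - E y (?f' y ?u - ?f' x ?u)"
          by (simp add: linear_diff[OF E(1)[OF y]] E(2)[OF y] E(3)[OF x])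
        then show ?thesis using E(4)[OF y] by simp
      qed
      then show "eventually (\<lambda>y. norm (E y v - E x v) \<le> 2 * norm (?f' y ?u - ?f' x ?u))
          (at x within U)"
        by (simp add: eventually_at_filter)
    qed
    then show "((\<lambda>x. E x v) \<longlongrightarrow> E x v) (at x within U)" by (rule LIM_zero_cancel)
  qed
  have Esm: "smooth_on U (\<lambda>x. E x v)" for v
    by (rule smooth_on_inverse_family[OF U(1) fl E(1,2,3) smooth_on_subset[OF smooth_on_frechet[OF
        f] U(3)] Econt])
  have gcont: "continuous_on (f ` U) g"
    unfolding continuous_on_iff
  proof (intro ballI allI impI)
    fix y and e :: real assume y: "y \<in> f ` U" and e: "e > 0"
    have "dist (g z) (g y) < e" if "z \<in> f ` U" "dist z y < e / 2" for z
      using low[OF gU[OF that(1)] gU[OF y]] that fg[OF that(1)] fg[OF y] by (simp add: dist_norm)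
    then show "\<exists>d>0. \<forall>z\<in>f ` U. dist z y < d \<longrightarrow> dist (g z) (g y) < e"
      using e by (intro exI[of _ "e/2"]) simp
  qed
  have gd: "(g has_derivative E (g y)) (at y)" if y: "y \<in> f ` U" for y
  proof (rule has_derivative_inverse_basic[OF _ _ _ _ opn y])
    show "(f has_derivative ?f' (g y)) (at (g y))"
      using gU[OF y] U(3) by (intro smooth_on_derivative[OF f]) auto
    show "bounded_linear (E (g y))" by (rule linear_imp_bounded_linear[OF E(1)[OF gU[OF y]]])
    show "E (g y) \<circ> ?f' (g y) = id" using E(2)[OF gU[OF y]] by auto
    show "isCont g y" using gcont opn y continuous_on_eq_continuous_at by blast
  qed (rule fg)
  have gsub: "g ` f ` U \<subseteq> U" using gU by blast
  have "Ck_on n (f ` U) g" for n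
  proof (induction n)
    case 0
    then show ?case using gcont by simp
  next
    case (Suc n)
    show ?case
    proof (rule Ck_on_SucI[OF opn gd])
      \<comment> \<open>If \<open>g\<close> has \<open>n\<close> continuous derivatives, so does its
        derivative \<open>E (g y) v\<close>, because \<open>E\<close> is smooth; this raises the
        order by one.\<close>
      show "Ck_on n (f ` U) (\<lambda>y. E (g y) v)" for v
        by (rule Ck_on_compose[OF opn U(1) gsub Suc, of "\<lambda>x. E x v"]) (use Esm in \<open>simp add:
            smooth_on_def\<close>)
    qed
  qed
  then have "smooth_on (f ` U) (inv_into U f)" by (simp add: smooth_on_def g_def)
  then show thesis by (intro that[OF U(1,2,3) inj opn])
qed

section \<open>Charts and submanifolds\<close>

lemma compatible_chartD:
  assumes "compatible_chart M U \<psi>" "p \<in> points M"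
  shows "open (\<psi> ` (U \<inter> chart_dom M p))" "open (chart M p ` (U \<inter> chart_dom M p))"
    "smooth_on (\<psi> ` (U \<inter> chart_dom M p)) (chart M p \<circ> inv_into U \<psi>)"
    "smooth_on (chart M p ` (U \<inter> chart_dom M p)) (\<psi> \<circ> chart_inv M p)"
  using assms by (simp_all add: compatible_chart_def)

text \<open>The conditions on the global topology are left out: products are only used through their
    charts.\<close>

definition atlas :: "('p, 'e::findim_space) mfd \<Rightarrow> bool" where
  "atlas M \<longleftrightarrow>
     (\<forall>p\<in>points M. p \<in> chart_dom M p \<and> chart_dom M p \<subseteq> points M \<and>
        inj_on (chart M p) (chart_dom M p) \<and> open (chart M p ` chart_dom M p)) \<and>
     (\<forall>p\<in>points M. \<forall>q\<in>points M.
        open (chart M p ` (chart_dom M p \<inter> chart_dom M q)) \<and>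
        smooth_on (chart M p ` (chart_dom M p \<inter> chart_dom M q)) (chart M q \<circ> chart_inv M p))"

lemma smooth_manifold_atlas: "smooth_manifold M \<Longrightarrow> atlas M"
  by (simp add: smooth_manifold_def atlas_def)

context
  fixes M :: "('p, 'e::findim_space) mfd"
  assumes M: "atlas M"
begin

lemma mem_chart_dom: "p \<in> points M \<Longrightarrow> p \<in> chart_dom M p"
  and chart_dom_subset: "p \<in> points M \<Longrightarrow> chart_dom M p \<subseteq> points M"
  and inj_chart: "p \<in> points M \<Longrightarrow> inj_on (chart M p) (chart_dom M p)"
  and open_chart_image: "p \<in> points M \<Longrightarrow> open (chart M p ` chart_dom M p)"
  using M by (simp_all add: atlas_def)

lemma open_transition_domain: "p \<in> points M \<Longrightarrow> q \<in> points M \<Longrightarrow> open (chart M p ` (chart_dom M p \<inter>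
    chart_dom M q))"
  and smooth_transition: "p \<in> points M \<Longrightarrow> q \<in> points M \<Longrightarrow>
    smooth_on (chart M p ` (chart_dom M p \<inter> chart_dom M q)) (chart M q \<circ> chart_inv M p)"
  using M by (simp_all add: atlas_def)

lemma chart_inv_chart: "p \<in> points M \<Longrightarrow> x \<in> chart_dom M p \<Longrightarrow> chart_inv M p (chart M p x) = x"
  by (simp add: chart_inv_def inj_chart)

lemma chart_mem_image_iff:
  "p \<in> points M \<Longrightarrow> x \<in> chart_dom M p \<Longrightarrow> W \<subseteq> chart_dom M p \<Longrightarrow> chart M p x \<in> chart M p ` W \<longleftrightarrow> x \<in> W"
  by (meson inj_chart inj_on_image_mem_iff)

text \<open>The description of open sets rests on the atlas conditions alone, so it is available for
  products, which are only shown to have an atlas.\<close>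

lemma openin_atlas:
  "openin (mfd_top M) W \<longleftrightarrow> W \<subseteq> points M \<and> (\<forall>p\<in>points M. open (chart M p ` (W \<inter> chart_dom M p)))"
proof -
  let ?P = "\<lambda>W. W \<subseteq> points M \<and> (\<forall>p\<in>points M. open (chart M p ` (W \<inter> chart_dom M p)))"
  have "chart M p ` (S \<inter> T \<inter> chart_dom M p) = chart M p ` (S \<inter> chart_dom M p)
      \<inter> chart M p ` (T \<inter> chart_dom M p)"
    if "p \<in> points M" for S T p
    using inj_on_image_Int[OF inj_chart[OF that], of "S \<inter> chart_dom M p" "T \<inter> chart_dom M p"]
    by (simp add: inf_commute inf_left_commute)
  moreover have "chart M p ` (\<Union>\<K> \<inter> chart_dom M p) = (\<Union>K\<in>\<K>. chart M p ` (K \<inter> chart_dom M p))" for p \<K>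
    by blast
  ultimately have "istopology ?P"
    unfolding istopology_def by (auto intro!: open_Int open_UN)
  then show ?thesis by (simp add: mfd_top_def topology_inverse')
qed

lemma openin_chart_dom: "p \<in> points M \<Longrightarrow> openin (mfd_top M) (chart_dom M p)"
  using open_transition_domain chart_dom_subset unfolding openin_atlas by (simp only: Int_commute)
      blast

lemma openin_points: "openin (mfd_top M) (points M)"
  using chart_dom_subset open_chart_image by (auto simp: openin_atlas Int_absorb1)

lemma topspace_mfd_top: "topspace (mfd_top M) = points M"
  using openin_points openin_atlas[of "topspace (mfd_top M)"] openin_subset by fastforce

lemma compatible_chart_chart:
  assumes "p \<in> points M"
  shows "compatible_chart M (chart_dom M p) (chart M p)"
  unfolding compatible_chart_def chart_inv_def[symmetric]
proof (intro conjI ballI chart_dom_subset inj_chart open_chart_image assms)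
  fix q assume q: "q \<in> points M"
  show "open (chart M p ` (chart_dom M p \<inter> chart_dom M q))"
      by (rule open_transition_domain[OF assms q])
  show "open (chart M q ` (chart_dom M p \<inter> chart_dom M q))"
    using open_transition_domain[OF q assms] by (simp only: Int_commute)
  show "smooth_on (chart M p ` (chart_dom M p \<inter> chart_dom M q)) (chart M q \<circ> chart_inv M p)"
    by (rule smooth_transition[OF assms q])
  show "smooth_on (chart M q ` (chart_dom M p \<inter> chart_dom M q)) (chart M p \<circ> chart_inv M q)"
    using smooth_transition[OF q assms] by (simp only: Int_commute)
qed

lemma compatible_chart_openin: "compatible_chart M U \<psi> \<Longrightarrow> openin (mfd_top M) U"
  by (simp add: openin_atlas compatible_chart_def)

lemma compatible_chart_subset: "compatible_chart M U \<psi> \<Longrightarrow> U \<subseteq> points M"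
  by (simp add: compatible_chart_def)

lemma compatible_chart_inj: "compatible_chart M U \<psi> \<Longrightarrow> inj_on \<psi> U"
  by (simp add: compatible_chart_def)

text \<open>A compatible chart is compared with preferred charts only, so the argument is local:
  near \<open>x\<close> the image is the preimage of an open set under the transition from
  \<open>\<psi>\<close> to the chart at \<open>x\<close>.\<close>

lemma open_compatible_image:
  assumes \<psi>: "compatible_chart M U \<psi>" and W: "openin (mfd_top M) W"
  shows "open (\<psi> ` (U \<inter> W))"
proof (subst open_subopen, intro ballI)
  fix z assume "z \<in> \<psi> ` (U \<inter> W)"
  then obtain x where x: "x \<in> U" "x \<in> W" "z = \<psi> x" by blast
  have xM: "x \<in> points M" using x \<psi> compatible_chart_subset by blast
  let ?A = "\<psi> ` (U \<inter> chart_dom M x)" and ?f = "chart M x \<circ> inv_into U \<psi>"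
  have A: "open ?A" "continuous_on ?A ?f"
    by (rule compatible_chartD(1)[OF \<psi> xM], rule smooth_on_continuous[OF compatible_chartD(3)[OF \<psi>
        xM]])
  have "open (chart M x ` (W \<inter> chart_dom M x))" using W xM by (simp add: openin_atlas)
  then have "open (?f -` (chart M x ` (W \<inter> chart_dom M x)) \<inter> ?A)"
    using A continuous_on_open_vimage[of ?A ?f] by blast
  moreover have "?f -` (chart M x ` (W \<inter> chart_dom M x)) \<inter> ?A = \<psi> ` (U \<inter> W \<inter> chart_dom M x)"
    using compatible_chart_inj[OF \<psi>] by (auto simp: inj_on_eq_iff[OF inj_chart[OF xM]])
  ultimately show "\<exists>T. open T \<and> z \<in> T \<and> T \<subseteq> \<psi> ` (U \<inter> W)"
    using x mem_chart_dom[OF xM] by (intro exI[of _ "\<psi> ` (U \<inter> W \<inter> chart_dom M x)"]) auto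
qed

text \<open>Near each point \<open>x\<close> the transition factors through the preferred chart at
  \<open>x\<close>, to which both \<open>\<psi>\<close> and \<open>\<kappa>\<close> are related by
  definition.\<close>

lemma smooth_compatible_transition:
  assumes \<psi>: "compatible_chart M U \<psi>" and \<kappa>: "compatible_chart M V \<kappa>"
  shows "smooth_on (\<psi> ` (U \<inter> V)) (\<kappa> \<circ> inv_into U \<psi>)"
proof (rule smooth_on_local)
  fix z assume "z \<in> \<psi> ` (U \<inter> V)"
  then obtain x where x: "x \<in> U" "x \<in> V" "z = \<psi> x" by blast
  have xM: "x \<in> points M" using x \<psi> compatible_chart_subset by blast
  let ?A = "\<psi> ` (U \<inter> (V \<inter> chart_dom M x))" and ?B = "chart M x ` (V \<inter> chart_dom M x)"
  have inj: "inv_into U \<psi> (\<psi> y) = y" if "y \<in> U" for y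
    using compatible_chart_inj[OF \<psi>] that by simp
  have A: "open ?A"
    by (intro open_compatible_image[OF \<psi>] openin_Int compatible_chart_openin[OF \<kappa>]
        openin_chart_dom xM)
  have B: "open ?B" by (rule compatible_chartD(2)[OF \<kappa> xM])
  have s1: "smooth_on ?A (chart M x \<circ> inv_into U \<psi>)"
    by (rule smooth_on_subset[OF compatible_chartD(3)[OF \<psi> xM]]) auto
  have s2: "smooth_on ?B (\<kappa> \<circ> chart_inv M x)"
    by (rule compatible_chartD(4)[OF \<kappa> xM])
  have "(chart M x \<circ> inv_into U \<psi>) ` ?A \<subseteq> ?B" using inj by auto
  from smooth_on_compose[OF A B this s1 s2]
  have "smooth_on ?A (\<kappa> \<circ> inv_into U \<psi>)"
    by (rule smooth_on_cong[OF A, rotated]) (auto simp: inj chart_inv_chart[OF xM])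
  moreover have "z \<in> ?A" using x mem_chart_dom[OF xM] by simp
  ultimately show "\<exists>T. z \<in> T \<and> open T \<and> smooth_on T (\<kappa> \<circ> inv_into U \<psi>)"
    using A by (intro exI[of _ ?A] conjI)
qed

end

text \<open>The differential at \<open>p\<close> of a vector-valued function, in the preferred chart at \<open>p\<close>. For a
  compatible chart \<open>\<psi>\<close> this converts tangent vectors to the coordinates given by \<open>\<psi>\<close>, and
  \<open>coord_deriv_inv\<close> converts them back.\<close>

definition coord_deriv :: "('p, 'e::findim_space) mfd \<Rightarrow> ('p \<Rightarrow> 'v::real_normed_vector)
    \<Rightarrow> 'p \<Rightarrow> 'e \<Rightarrow> 'v" where
  "coord_deriv M f p = frechet_derivative (f \<circ> chart_inv M p) (at (chart M p p))"

definition coord_deriv_inv :: "('p, 'e::findim_space) mfd \<Rightarrow> 'p set \<Rightarrow> ('p \<Rightarrow> 'e) \<Rightarrow> 'p \<Rightarrow> 'e \<Rightarrow> 'e" where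
  "coord_deriv_inv M U \<psi> p = frechet_derivative (chart M p \<circ> inv_into U \<psi>) (at (\<psi> p))"

lemma vec_coord_eq: "vec_coord M q p = coord_deriv M (chart M q) p"
  by (simp add: vec_coord_def coord_deriv_def)

lemma covec_coord_eq:
  "covec_coord M q p \<alpha> = Blinfun (\<lambda>v. blinfun_apply \<alpha> (coord_deriv_inv M (chart_dom M q) (chart M q)
      p v))"
  by (simp add: covec_coord_def coord_deriv_inv_def chart_inv_def)

lemma tangent_map_eq: "tangent_map M N f p = coord_deriv M (chart N (f p) \<circ> f) p"
  by (simp add: tangent_map_def coord_deriv_def)

context
  fixes M :: "('p, 'e::findim_space) mfd"
  assumes M: "atlas M"
begin

lemma vec_coord_self:
  assumes "p \<in> points M"
  shows "vec_coord M p p v = v"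
proof -
  have "((chart M p \<circ> chart_inv M p) has_derivative (\<lambda>v. v)) (at (chart M p p))"
    by (rule has_derivative_transform_within_open[OF has_derivative_ident open_chart_image[OF M
        assms]])
      (use mem_chart_dom[OF M assms] chart_inv_chart[OF M assms] in auto)
  from fun_cong[OF frechet_derivative_at[OF this]] show ?thesis by (simp add: vec_coord_def)
qed

context
  fixes U \<psi> p
  assumes \<psi>: "compatible_chart M U \<psi>" and p: "p \<in> U"
begin

private lemma pM: "p \<in> points M" using compatible_chart_subset[OF M \<psi>] p by blast

private lemma inv\<psi>: "y \<in> U \<Longrightarrow> inv_into U \<psi> (\<psi> y) = y"
  using compatible_chart_inj[OF M \<psi>] by simp

lemma coord_deriv_has_derivative:
  "((\<psi> \<circ> chart_inv M p) has_derivative coord_deriv M \<psi> p) (at (chart M p p))"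
  unfolding coord_deriv_def
  by (rule smooth_on_derivative[OF compatible_chartD(4)[OF \<psi> pM]]) (use pM p mem_chart_dom[OF M]
      in blast)

lemma coord_deriv_inv_has_derivative:
  "((chart M p \<circ> inv_into U \<psi>) has_derivative coord_deriv_inv M U \<psi> p) (at (\<psi> p))"
  unfolding coord_deriv_inv_def
  by (rule smooth_on_derivative[OF compatible_chartD(3)[OF \<psi> pM]]) (use pM p mem_chart_dom[OF M]
      in blast)

lemma linear_coord_deriv: "linear (coord_deriv M \<psi> p)"
  by (rule has_derivative_linear[OF coord_deriv_has_derivative])

lemma linear_coord_deriv_inv: "linear (coord_deriv_inv M U \<psi> p)"
  by (rule has_derivative_linear[OF coord_deriv_inv_has_derivative])

text \<open>The chain rule for \<open>f = (f \<circ> \<psi>\<inverse>) \<circ> \<psi>\<close>.\<close>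

lemma coord_deriv_via_chart:
  assumes "((f \<circ> inv_into U \<psi>) has_derivative f') (at (\<psi> p))"
  shows "((f \<circ> chart_inv M p) has_derivative (\<lambda>v. f' (coord_deriv M \<psi> p v))) (at (chart M p p))"
proof -
  have e: "\<psi> (chart_inv M p (chart M p p)) = \<psi> p"
    by (simp add: chart_inv_chart[OF M pM mem_chart_dom[OF M pM]])
  have "((\<lambda>z. (f \<circ> inv_into U \<psi>) ((\<psi> \<circ> chart_inv M p) z)) has_derivative (\<lambda>v. f' (coord_deriv M \<psi> p
      v))) (at (chart M p p))"
    using diff_chain_at[OF coord_deriv_has_derivative, of "f \<circ> inv_into U \<psi>" f'] assms
    by (simp only: comp_def e)
  then show ?thesis
    by (rule has_derivative_transform_within_open[OF _ compatible_chartD(2)[OF \<psi> pM]])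
      (use pM p mem_chart_dom[OF M] chart_inv_chart[OF M pM] inv\<psi> in auto)
qed

lemma coord_deriv_chain:
  assumes "((f \<circ> inv_into U \<psi>) has_derivative f') (at (\<psi> p))"
  shows "coord_deriv M f p v = f' (coord_deriv M \<psi> p v)"
  unfolding coord_deriv_def[of M f] by (rule fun_cong[OF frechet_derivative_at[OF
      coord_deriv_via_chart[OF assms], symmetric]])

lemma coord_deriv_inv_coord_deriv: "coord_deriv_inv M U \<psi> p (coord_deriv M \<psi> p v) = v"
proof -
  have "coord_deriv M (chart M p) p v = coord_deriv_inv M U \<psi> p (coord_deriv M \<psi> p v)"
    by (rule coord_deriv_chain[OF coord_deriv_inv_has_derivative])
  then show ?thesis using vec_coord_self[OF pM] by (simp add: vec_coord_eq)
qed

text \<open>A left inverse of an endomorphism of a finite-dimensional space is two-sided, which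
  saves a second chain rule.\<close>

lemma coord_deriv_coord_deriv_inv: "coord_deriv M \<psi> p (coord_deriv_inv M U \<psi> p v) = v"
proof -
  have "inj (coord_deriv M \<psi> p)" by (metis coord_deriv_inv_coord_deriv injI)
  moreover obtain B :: "'e set" where "finite_dimensional_vector_space scaleR B"
    by (rule findim_basis_locale)
  then interpret fd: finite_dimensional_vector_space "scaleR :: real \<Rightarrow> 'e \<Rightarrow> 'e" B .
  have "surj (coord_deriv M \<psi> p)" if "inj (coord_deriv M \<psi> p)"
    by (rule fd.linear_inj_imp_surj[OF _ that]) (use linear_coord_deriv in \<open>simp add: linear_def
        real_scaleR_def[abs_def]\<close>)
  ultimately show ?thesis by (metis coord_deriv_inv_coord_deriv surjD)
qed

end

end

definition orthogonal_projection :: "'a::real_inner set \<Rightarrow> ('a \<Rightarrow> 'a) \<Rightarrow> bool" where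
  "orthogonal_projection S \<pi> \<longleftrightarrow> bounded_linear \<pi> \<and> (\<forall>v. \<pi> v \<in> S) \<and> (\<forall>v\<in>S. \<pi> v = v) \<and>
     (\<forall>v. \<forall>w\<in>S. (v - \<pi> v) \<bullet> w = 0)"

lemma subspace_projection:
  fixes S :: "'a::findim_space set"
  assumes "subspace S"
  obtains \<pi> where "orthogonal_projection S \<pi>"
proof -
  obtain B where B: "finite B" "orthonormal B" "span B = S" by (rule subspace_onb[OF assms])
  define \<pi> where "\<pi> v = (\<Sum>b\<in>B. (v \<bullet> b) *\<^sub>R b)" for v
  have lin: "bounded_linear \<pi>"
    unfolding \<pi>_def by (intro bounded_linear_sum bounded_linear_scaleR_const
        bounded_linear_inner_left)
  have inS: "\<pi> v \<in> S" for v
    unfolding \<pi>_def B(3)[symmetric] by (intro span_sum span_scale span_base)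
  have fix_S: "\<pi> v = v" if "v \<in> S" for v
    unfolding \<pi>_def using that B by (intro orthonormal_expansion) auto
  have orth: "(v - \<pi> v) \<bullet> w = 0" if "w \<in> S" for v w
  proof -
    have "(v - \<pi> v) \<bullet> b = 0" if "b \<in> B" for b
      using B that by (simp add: \<pi>_def inner_diff_left orthonormal_inner_sum)
    moreover have "w = (\<Sum>b\<in>B. (w \<bullet> b) *\<^sub>R b)"
      using orthonormal_expansion[OF B(1,2), of w] that B(3) by simp
    ultimately show ?thesis by (metis (no_types, lifting) inner_sum_right inner_scaleR_right
        mult_zero_right sum.neutral)
  qed
  show thesis by (rule that[of \<pi>]) (auto simp: orthogonal_projection_def lin inS fix_S orth)
qed

text \<open>Near \<open>x\<close> on the line in direction \<open>h\<close> the function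
  \<open>c - \<pi> \<circ> c\<close> vanishes, so its derivative in that direction does:
  \<open>c' h = \<pi> (c' h)\<close>. Since only values on this line enter, the lemma applies to
  representatives of sections that take values in \<open>S\<close> at points of \<open>S\<close>
  alone.\<close>

lemma derivative_in_subspace:
  fixes S :: "'b::findim_space set" and c :: "'a::real_normed_vector \<Rightarrow> 'b"
  assumes "subspace S" "(c has_derivative c') (at x)" "\<exists>e>0. \<forall>t::real. \<bar>t\<bar> < e \<longrightarrow> c (x + t *\<^sub>R h) \<in> S"
  shows "c' h \<in> S"
proof -
  obtain \<pi> where p: "bounded_linear \<pi>" "\<And>v. \<pi> v \<in> S" "\<And>v. v \<in> S \<Longrightarrow> \<pi> v = v"
    using subspace_projection[OF assms(1)] unfolding orthogonal_projection_def by metis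
  obtain e where e: "e > 0" "\<And>t. \<bar>t\<bar> < e \<Longrightarrow> c (x + t *\<^sub>R h) \<in> S" using assms(3) by blast
  have l: "((\<lambda>t. x + t *\<^sub>R h) has_derivative (\<lambda>t. t *\<^sub>R h)) (at 0)"
    by (auto intro!: derivative_eq_intros)
  have "((\<lambda>t. c (x + t *\<^sub>R h)) has_derivative (\<lambda>t. c' (t *\<^sub>R h))) (at 0)"
    using diff_chain_at[OF l, of c c'] assms(2) by (simp add: comp_def)
  then have d: "((\<lambda>t. c (x + t *\<^sub>R h) - \<pi> (c (x + t *\<^sub>R h))) has_derivative (\<lambda>t. c' (t *\<^sub>R h)
      - \<pi> (c' (t *\<^sub>R h)))) (at 0)"
    by (intro has_derivative_diff bounded_linear.has_derivative[OF p(1)])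
  have "((\<lambda>t. 0) has_derivative (\<lambda>t. c' (t *\<^sub>R h) - \<pi> (c' (t *\<^sub>R h)))) (at 0)"
    by (rule has_derivative_transform_within_open[OF d, of "{-e<..<e}"]) (use e p(3) in auto)
  from has_derivative_unique[OF this has_derivative_const]
  have "c' (1 *\<^sub>R h) - \<pi> (c' (1 *\<^sub>R h)) = 0" by meson
  then show ?thesis using p(2)[of "c' h"] by simp
qed

context
  fixes M :: "('p, 'e::findim_space) mfd"
  assumes M: "atlas M"
begin

text \<open>Seen in \<open>\<psi>\<close>, a curve in \<open>Q\<close> is a curve in
  \<open>S\<close>, so its velocity lies in \<open>S\<close>. Conversely a vector in
  \<open>S\<close> is the velocity of a straight segment in \<open>S\<close>, carried back by the
  inverse of \<open>\<psi>\<close>.\<close>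

lemma tangent_space_chart:
  assumes \<psi>: "compatible_chart M U \<psi>" and p: "p \<in> U" "p \<in> Q" and S: "subspace S"
      and Q: "\<psi> ` (U \<inter> Q) = \<psi> ` U \<inter> S"
  shows "tangent_space M Q p = {v. coord_deriv M \<psi> p v \<in> S}"
proof (intro set_eqI iffI; unfold mem_Collect_eq)
  have pM: "p \<in> points M" using compatible_chart_subset[OF M \<psi>] p by blast
  note pdom = mem_chart_dom[OF M pM] and cic = chart_inv_chart[OF M pM]
  have inv\<psi>: "inv_into U \<psi> (\<psi> y) = y" if "y \<in> U" for y
    using compatible_chart_inj[OF M \<psi>] that by simp
  let ?A = "chart M p ` (U \<inter> chart_dom M p)"
  have A: "open ?A" "chart M p p \<in> ?A" using compatible_chartD(2)[OF \<psi> pM] p pdom by auto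
  let ?B = "\<psi> ` (U \<inter> chart_dom M p)"
  have B: "open ?B" "\<psi> p \<in> ?B" using compatible_chartD(1)[OF \<psi> pM] p pdom by auto
  fix v
  show "coord_deriv M \<psi> p v \<in> S" if v: "v \<in> tangent_space M Q p"
  proof -
    from v obtain \<gamma> \<epsilon> where g: "\<epsilon> > 0" "\<gamma> 0 = p" "\<And>t. t \<in> {-\<epsilon><..<\<epsilon>} \<Longrightarrow> \<gamma> t \<in> Q \<inter> chart_dom M p"
        "((chart M p \<circ> \<gamma>) has_vector_derivative v) (at 0)" and sm: "smooth_on {-\<epsilon><..<\<epsilon>} (chart M p \<circ>
            \<gamma>)"
      unfolding tangent_space_def by blast
    have "isCont (chart M p \<circ> \<gamma>) 0"
      using has_vector_derivative_continuous[OF g(4)] by simp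
    \<comment> \<open>The definition keeps \<open>\<gamma>\<close> in the chart domain of
      \<open>p\<close> only; continuity at 0 brings it into \<open>U\<close> for small
      times.\<close>
    then have "eventually (\<lambda>t. (chart M p \<circ> \<gamma>) t \<in> ?A) (at 0)"
      using A g(2) by (auto simp: isCont_def tendsto_def)
    then obtain d where d: "d > 0" "\<And>t. t \<noteq> 0 \<Longrightarrow> dist t 0 < d \<Longrightarrow> chart M p (\<gamma> t) \<in> ?A"
      by (auto simp: eventually_at)
    have inU: "\<gamma> t \<in> U" if t: "\<bar>t\<bar> < min d \<epsilon>" for t
    proof (cases "t = 0")
      case False
      then have "chart M p (\<gamma> t) \<in> ?A" using d t by simp
      moreover have "\<gamma> t \<in> chart_dom M p" using g(3)[of t] t by (simp add: abs_less_iff)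
      ultimately show ?thesis using chart_mem_image_iff[OF M pM, of "\<gamma> t" "U \<inter> chart_dom M p"]
          by blast
    qed (use g(2) p in simp)
    have cg: "(chart M p \<circ> \<gamma>) 0 = chart M p p" using g(2) by simp
    have d1: "((\<lambda>t. (\<psi> \<circ> chart_inv M p) ((chart M p \<circ> \<gamma>) t)) has_derivative (\<lambda>t. coord_deriv M \<psi> p
        (t *\<^sub>R v))) (at 0)"
      using diff_chain_at[OF g(4)[unfolded has_vector_derivative_def], of "\<psi> \<circ> chart_inv M p"
          "coord_deriv M \<psi> p"]
        coord_deriv_has_derivative[OF M \<psi> p(1)]
      unfolding cg by (simp only: comp_def)
    have "\<exists>e>0. \<forall>t::real. \<bar>t\<bar> < e \<longrightarrow> (\<psi> \<circ> chart_inv M p) ((chart M p \<circ> \<gamma>) (0 + t *\<^sub>R h)) \<in> S"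
        for h :: real
    proof (intro exI conjI allI impI)
      let ?e = "min d \<epsilon> / (\<bar>h\<bar> + 1)"
      show "?e > 0" using d g(1) by simp
      fix t assume t: "\<bar>t\<bar> < ?e"
      have "\<bar>t * h\<bar> \<le> \<bar>t\<bar> * (\<bar>h\<bar> + 1)" by (simp add: abs_mult mult_left_mono)
      also have "\<dots> < min d \<epsilon>" using t by (simp add: pos_less_divide_eq)
      finally have th: "\<bar>t * h\<bar> < min d \<epsilon>" .
      then have "\<gamma> (t * h) \<in> U" "\<gamma> (t * h) \<in> Q" "\<gamma> (t * h) \<in> chart_dom M p"
        using inU g(3)[of "t * h"] by (simp_all add: abs_less_iff)
      then have "\<psi> (\<gamma> (t * h)) \<in> S" "chart_inv M p (chart M p (\<gamma> (t * h))) = \<gamma> (t * h)"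
        using Q cic by auto
      then show "(\<psi> \<circ> chart_inv M p) ((chart M p \<circ> \<gamma>) (0 + t *\<^sub>R h)) \<in> S" by simp
    qed
    from derivative_in_subspace[OF S d1 this, of 1] show ?thesis by simp
  qed
  show "v \<in> tangent_space M Q p" if v: "coord_deriv M \<psi> p v \<in> S"
  proof -
    let ?w = "coord_deriv M \<psi> p v"
    obtain r where r: "r > 0" "ball (\<psi> p) r \<subseteq> ?B" using B openE by blast
    define \<epsilon> where "\<epsilon> = r / (norm ?w + 1)"
    have e: "\<epsilon> > 0" using r by (simp add: \<epsilon>_def add_nonneg_pos)
    have inB: "\<psi> p + t *\<^sub>R ?w \<in> ?B" if "t \<in> {-\<epsilon><..<\<epsilon>}" for t
    proof -
      have "\<bar>t\<bar> < \<epsilon>" using that by (simp add: abs_less_iff)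
      then have "\<bar>t\<bar> * (norm ?w + 1) < r" by (simp add: \<epsilon>_def pos_less_divide_eq add_nonneg_pos)
      moreover have "\<bar>t\<bar> * norm ?w \<le> \<bar>t\<bar> * (norm ?w + 1)" by (simp add: mult_left_mono)
      ultimately have "norm (t *\<^sub>R ?w) < r" by simp
      then show ?thesis using r(2) by (auto simp: dist_norm)
    qed
    define \<gamma> where "\<gamma> t = inv_into U \<psi> (\<psi> p + t *\<^sub>R ?w)" for t
    have "\<psi> p \<in> S" using Q p by auto
    have g: "\<gamma> t \<in> Q \<inter> chart_dom M p" if t: "t \<in> {-\<epsilon><..<\<epsilon>}" for t
    proof -
      obtain y where y: "y \<in> U" "y \<in> chart_dom M p" "\<psi> p + t *\<^sub>R ?w = \<psi> y" using inB[OF t] by blast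
      have "\<psi> p + t *\<^sub>R ?w \<in> S"
        by (intro subspace_add[OF S] subspace_scale[OF S] v \<open>\<psi> p \<in> S\<close>)
      then have "\<psi> y \<in> \<psi> ` (U \<inter> Q)" using Q y by auto
      then have "y \<in> Q" using y compatible_chart_inj[OF M \<psi>] by (auto dest: inj_onD)
      then show ?thesis using y by (simp add: \<gamma>_def inv\<psi>)
    qed
    have line: "((\<lambda>t. \<psi> p + t *\<^sub>R ?w) has_derivative (\<lambda>t. t *\<^sub>R ?w)) (at 0)"
      by (auto intro!: derivative_eq_intros)
    have "((chart M p \<circ> inv_into U \<psi>) has_derivative coord_deriv_inv M U \<psi> p) (at (\<psi> p + 0 *\<^sub>R ?w))"
      using coord_deriv_inv_has_derivative[OF M \<psi> p(1)] by simp
    from diff_chain_at[OF line this]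
    have "((chart M p \<circ> \<gamma>) has_derivative (\<lambda>t. coord_deriv_inv M U \<psi> p (t *\<^sub>R ?w))) (at 0)"
      by (simp only: comp_def \<gamma>_def)
    then have "((chart M p \<circ> \<gamma>) has_vector_derivative v) (at 0)"
      by (simp add: has_vector_derivative_def linear_scale[OF linear_coord_deriv_inv[OF M \<psi> p(1)]]
          coord_deriv_inv_coord_deriv[OF M \<psi> p(1)])
    moreover have "smooth_on {-\<epsilon><..<\<epsilon>} (chart M p \<circ> \<gamma>)"
    proof -
      have "smooth_on {-\<epsilon><..<\<epsilon>} (\<lambda>t. \<psi> p + t *\<^sub>R ?w)"
        by (intro smooth_on_add smooth_on_const smooth_on_linear[OF bounded_linear_scaleR_left]
            smooth_on_id) auto
      from smooth_on_compose[OF open_greaterThanLessThan B(1) image_subsetI[OF inB]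
          this compatible_chartD(3)[OF \<psi> pM]]
      have "smooth_on {-\<epsilon><..<\<epsilon>} (\<lambda>t. (chart M p \<circ> inv_into U \<psi>) (\<psi> p + t *\<^sub>R ?w))" .
      then show ?thesis by (simp add: comp_def \<gamma>_def)
    qed
    moreover have "\<gamma> 0 = p" using p by (simp add: \<gamma>_def inv\<psi>)
    ultimately show ?thesis
      unfolding tangent_space_def using e g by blast
  qed
qed

section \<open>Straightening of submersions and level sets\<close>

lemma compatible_chart_compose:
  assumes q: "q \<in> points M" and O: "open O'" "O' \<subseteq> chart M q ` chart_dom M q" and f: "inj_on f O'"
      "open (f ` O')"
    "smooth_on O' f" "smooth_on (f ` O') (inv_into O' f)"
  shows "compatible_chart M (chart_inv M q ` O') (f \<circ> chart M q)"
proof -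
  let ?U = "chart_inv M q ` O'" and ?\<psi> = "f \<circ> chart M q"
  have Osub: "z \<in> O' \<Longrightarrow> chart_inv M q z \<in> chart_dom M q \<and> chart M q (chart_inv M q z) = z" for z
    using O(2) chart_inv_chart[OF M q] by auto
  have Udom: "?U \<subseteq> chart_dom M q" using Osub by auto
  then have UM: "?U \<subseteq> points M" using chart_dom_subset[OF M q] by blast
  have inj: "inj_on ?\<psi> ?U"
    using f(1) Osub by (auto simp: inj_on_def)
  have im: "?\<psi> ` ?U = f ` O'" using Osub by (force simp: image_iff)
  have invU: "inv_into ?U ?\<psi> y = chart_inv M q (inv_into O' f y)" if y: "y \<in> f ` O'" for y
  proof -
    obtain z where z: "z \<in> O'" "y = f z" using y by blast
    have "inv_into ?U ?\<psi> (?\<psi> (chart_inv M q z)) = chart_inv M q z" by (rule inv_into_f_f[OF inj])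
        (use z in blast)
    then show ?thesis using z Osub f(1) by simp
  qed
  show ?thesis
    unfolding compatible_chart_def
  proof (intro conjI ballI UM inj)
    show "open (?\<psi> ` ?U)" using im f(2) by simp
    fix p assume p: "p \<in> points M"
    let ?T = "chart M q ` (chart_dom M q \<inter> chart_dom M p)"
    have T: "open ?T" by (rule open_transition_domain[OF M q p])
    have eq: "?\<psi> ` (?U \<inter> chart_dom M p) = f ` (O' \<inter> ?T)"
      using Osub chart_inv_chart[OF M q] by (force simp: image_iff)
    have eq2: "f ` (O' \<inter> ?T) = inv_into O' f -` (O' \<inter> ?T) \<inter> f ` O'"
      using f(1) by auto
    show o1: "open (?\<psi> ` (?U \<inter> chart_dom M p))"
      unfolding eq eq2
      using continuous_on_open_vimage[OF f(2)] smooth_on_continuous[OF f(4)] O(1) T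
          by (meson open_Int)
    have e3: "chart M p ` (?U \<inter> chart_dom M p)
        = (chart M q \<circ> chart_inv M p) -` O' \<inter> chart M p ` (chart_dom M p \<inter> chart_dom M q)"
    proof (intro set_eqI iffI)
      fix z assume "z \<in> chart M p ` (?U \<inter> chart_dom M p)"
      then obtain w where "w \<in> O'" "chart_inv M q w \<in> chart_dom M p"
          "z = chart M p (chart_inv M q w)" by blast
      then show "z \<in> (chart M q \<circ> chart_inv M p) -` O' \<inter> chart M p ` (chart_dom M p \<inter> chart_dom M
          q)"
        using Osub chart_inv_chart[OF M p] by auto
    next
      fix z assume "z \<in> (chart M q \<circ> chart_inv M p) -` O' \<inter> chart M p ` (chart_dom M p \<inter> chart_dom M
          q)"
      then obtain x where x: "x \<in> chart_dom M p" "x \<in> chart_dom M q" "z = chart M p x"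
          "chart M q x \<in> O'"
        using chart_inv_chart[OF M p] by auto
      then have "x = chart_inv M q (chart M q x)" using chart_inv_chart[OF M q] by simp
      then show "z \<in> chart M p ` (?U \<inter> chart_dom M p)" using x by blast
    qed
    show o2: "open (chart M p ` (?U \<inter> chart_dom M p))"
      unfolding e3
      using iffD1[OF continuous_on_open_vimage[OF open_transition_domain[OF M p q]]
          smooth_on_continuous[OF smooth_transition[OF M p q]]] O(1) by blast
    have s1: "smooth_on (f ` (O' \<inter> ?T)) (inv_into O' f)" by (rule smooth_on_subset[OF f(4)]) auto
    have sub1: "inv_into O' f ` f ` (O' \<inter> ?T) \<subseteq> ?T" using f(1) by auto
    have o3: "open (f ` (O' \<inter> ?T))" using o1 eq by simp
    have "smooth_on (f ` (O' \<inter> ?T)) (chart M p \<circ> inv_into ?U ?\<psi>)"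
      by (rule smooth_on_cong[OF o3 _ smooth_on_compose[OF o3 T sub1 s1 smooth_transition[OF M q
          p]]])
        (use invU in auto)
    then show "smooth_on (?\<psi> ` (?U \<inter> chart_dom M p)) (chart M p \<circ> inv_into ?U ?\<psi>)"
      using eq by simp
    have s2: "smooth_on (chart M p ` (?U \<inter> chart_dom M p)) (chart M q \<circ> chart_inv M p)"
      by (rule smooth_on_subset[OF smooth_transition[OF M p q]]) (use Udom in auto)
    have sub2: "(chart M q \<circ> chart_inv M p) ` chart M p ` (?U \<inter> chart_dom M p) \<subseteq> O'"
      using chart_inv_chart[OF M p] Osub by auto
    have "smooth_on (chart M p ` (?U \<inter> chart_dom M p)) (\<lambda>z. f ((chart M q \<circ> chart_inv M p) z))"
      by (rule smooth_on_compose[OF o2 O(1) sub2 s2 f(3)])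
    then show "smooth_on (chart M p ` (?U \<inter> chart_dom M p)) (?\<psi> \<circ> chart_inv M p)"
      by (simp add: comp_def)
  qed
qed

text \<open>Near a point \<open>q\<close> where the differential \<open>A\<close> of \<open>\<Phi>\<close> is onto, with right inverse \<open>R\<close>, the map
  \<open>z + R (\<Phi> z - A z)\<close> is a chart in which \<open>\<Phi>\<close> becomes the linear map \<open>A\<close>.\<close>

lemma submersion_straightening:
  fixes \<Phi> :: "'p \<Rightarrow> 'v::findim_space"
  assumes W: "openin (mfd_top M) W" "q \<in> W" "W \<subseteq> chart_dom M q"
    and \<Phi>: "smooth_on (chart M q ` W) (\<Phi> \<circ> chart_inv M q)" and surj: "surj (coord_deriv M \<Phi> q)"
        and 0: "\<Phi> q = 0"
  obtains U \<psi> where "compatible_chart M U \<psi>" "q \<in> U" "U \<subseteq> W" "\<And>x. x \<in> U \<Longrightarrow> coord_deriv M \<Phi> q (\<psi> x)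
      = \<Phi> x"
    "coord_deriv M \<psi> q = (\<lambda>v. v)"
proof -
  define A where "A = coord_deriv M \<Phi> q"
  have qM: "q \<in> points M" using W openin_atlas[OF M] by blast
  define z0 where "z0 = chart M q q"
  have z0: "z0 \<in> chart M q ` W" "chart_inv M q z0 = q"
    using W(2) chart_inv_chart[OF M qM mem_chart_dom[OF M qM]] by (auto simp: z0_def)
  have oW: "open (chart M q ` W)" using W qM openin_atlas[OF M] by (metis inf.absorb1)
  let ?\<phi> = "\<Phi> \<circ> chart_inv M q"
  have dA: "(?\<phi> has_derivative A) (at z0)"
    using smooth_on_derivative[OF \<Phi> z0(1)] by (simp add: A_def coord_deriv_def z0_def)
  have linA: "linear A" by (rule has_derivative_linear[OF dA])
  note blA = linear_imp_bounded_linear[OF linA]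
  obtain R where R: "linear R" "\<And>v. A (R v) = v"
    using linear_surjective_right_inverse[OF linA] surj unfolding A_def[symmetric]
        by (auto simp: fun_eq_iff)
  note blR = linear_imp_bounded_linear[OF R(1)]
  \<comment> \<open>Both properties of the chart are built in: \<open>A (f z) = ?\<phi> z\<close>
    because \<open>A \<circ> R\<close> is the identity, and the derivative at \<open>z0\<close>
    sends \<open>v\<close> to \<open>v + R (A v - A v) = v\<close>.\<close>
  define f where "f z = (z - z0) + R (?\<phi> z - A (z - z0))" for z
  have fs: "smooth_on (chart M q ` W) f"
    unfolding f_def
    by (intro smooth_on_add smooth_on_diff smooth_on_const smooth_on_id oW \<Phi> smooth_on_linear[OF
        blR] smooth_on_linear[OF blA])
  have df: "(f has_derivative (\<lambda>v. v)) (at z0)"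
  proof -
    have "(f has_derivative (\<lambda>v. (v - 0) + R (A v - A (v - 0)))) (at z0)"
      unfolding f_def
      by (intro has_derivative_add has_derivative_diff has_derivative_ident has_derivative_const
          bounded_linear.has_derivative[OF blR] bounded_linear.has_derivative[OF blA] dA)
    then show ?thesis by (simp add: linear_0[OF R(1)])
  qed
  have "frechet_derivative f (at z0) v = v" for v
    using fun_cong[OF frechet_derivative_at[OF df], of v] by simp
  then obtain O' where O: "open O'" "z0 \<in> O'" "O' \<subseteq> chart M q ` W" "inj_on f O'" "open (f ` O')"
      "smooth_on (f ` O') (inv_into O' f)"
    by (rule smooth_inverse_function[OF oW z0(1) fs])
  let ?U = "chart_inv M q ` O'" and ?\<psi> = "f \<circ> chart M q"
  have O_dom: "O' \<subseteq> chart M q ` chart_dom M q" using O(3) W(3) by auto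
  have cU: "chart M q (chart_inv M q z) = z" if "z \<in> O'" for z
    using that O_dom chart_inv_chart[OF M qM] by auto
  show thesis
  proof (rule that)
    show "compatible_chart M ?U ?\<psi>"
      by (rule compatible_chart_compose[OF qM O(1) O_dom O(4,5) smooth_on_subset[OF fs O(3)] O(6)])
    show "q \<in> ?U" using O(2) z0(2) by force
    show "?U \<subseteq> W" using O(3) W(3) chart_inv_chart[OF M qM] by fastforce
    show "coord_deriv M \<Phi> q (?\<psi> x) = \<Phi> x" if "x \<in> ?U" for x
    proof -
      obtain z where z: "z \<in> O'" "x = chart_inv M q z" using \<open>x \<in> ?U\<close> by blast
      have "A (f z) = ?\<phi> z"
        by (simp add: f_def linear_add[OF linA] R(2))
      then show ?thesis using z cU by (simp add: A_def)
    qed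
    have "((?\<psi> \<circ> chart_inv M q) has_derivative (\<lambda>v. v)) (at (chart M q q))"
      using O(2) cU by (intro has_derivative_transform_within_open[OF df[unfolded z0_def] O(1)])
          (auto simp: z0_def)
    from frechet_derivative_at[OF this]
    show "coord_deriv M ?\<psi> q = (\<lambda>v. v)" by (simp only: coord_deriv_def)
  qed
qed

text \<open>Surjectivity is asked at \<open>q\<close> alone; the straightening takes care of a
  neighbourhood. Since \<open>\<Phi>\<close> may be chosen anew for each \<open>q\<close>, the
  notion also covers sets that are not globally a zero set.\<close>

definition level_set_at :: "'p set \<Rightarrow> 'p \<Rightarrow> ('p \<Rightarrow> 'v::findim_space) \<Rightarrow> bool" where
  "level_set_at Q q \<Phi> \<longleftrightarrow> (\<exists>W. openin (mfd_top M) W \<and> q \<in> W \<and> W \<subseteq> chart_dom M q \<and>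
     smooth_on (chart M q ` W) (\<Phi> \<circ> chart_inv M q) \<and> surj (coord_deriv M \<Phi> q) \<and> (\<forall>x\<in>W. x \<in> Q \<longleftrightarrow>
         \<Phi> x = 0))"

text \<open>The straightening chart has the same differential at \<open>q\<close> as the preferred
  chart, so the tangent space can be read off as the kernel of the differential of
  \<open>\<Phi>\<close> without a change of coordinates.\<close>

lemma level_set_chart:
  fixes \<Phi> :: "'p \<Rightarrow> 'v::findim_space"
  assumes L: "level_set_at Q q \<Phi>" and q: "q \<in> Q"
  obtains U \<psi> where "compatible_chart M U \<psi>" "q \<in> U"
    "\<psi> ` (U \<inter> Q) = \<psi> ` U \<inter> {v. coord_deriv M \<Phi> q v = 0}"
    "subspace {v. coord_deriv M \<Phi> q v = 0}" "dim {v. coord_deriv M \<Phi> q v = 0} + dim (UNIV :: 'v set)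
        = dim (UNIV :: 'e set)"
    "coord_deriv M \<psi> q = (\<lambda>v. v)"
proof -
  obtain W where W: "openin (mfd_top M) W" "q \<in> W" "W \<subseteq> chart_dom M q"
     "smooth_on (chart M q ` W) (\<Phi> \<circ> chart_inv M q)" "surj (coord_deriv M \<Phi> q)"
         and Q: "\<And>x. x \<in> W \<Longrightarrow> x \<in> Q \<longleftrightarrow> \<Phi> x = 0"
    using L unfolding level_set_at_def by blast
  have "\<Phi> q = 0" using Q W q by blast
  from submersion_straightening[OF W this]
  obtain U \<psi> where U: "compatible_chart M U \<psi>" "q \<in> U" "U \<subseteq> W" "\<And>x. x \<in> U \<Longrightarrow> coord_deriv M \<Phi> q (\<psi> x)
      = \<Phi> x"
    "coord_deriv M \<psi> q = (\<lambda>v. v)" by metis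
  have lin: "linear (coord_deriv M \<Phi> q)"
    unfolding coord_deriv_def by (rule has_derivative_linear[OF smooth_on_derivative[OF W(4)]])
        (use W(2) in blast)
  show thesis
  proof (rule that[OF U(1,2) _ _ _ U(5)])
    show "\<psi> ` (U \<inter> Q) = \<psi> ` U \<inter> {v. coord_deriv M \<Phi> q v = 0}"
      using U(3,4) Q by (auto intro!: imageI)
    show "subspace {v. coord_deriv M \<Phi> q v = 0}"
      by (auto simp: subspace_def linear_0[OF lin] linear_add[OF lin] linear_scale[OF lin])
  qed (rule dim_kernel_surj[OF lin W(5)])
qed

lemma level_set_submanifold:
  fixes \<Phi> :: "'p \<Rightarrow> 'p \<Rightarrow> 'v::findim_space"
  assumes "Q \<subseteq> points M" "\<And>q. q \<in> Q \<Longrightarrow> level_set_at Q q (\<Phi> q)"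
  shows "submanifold M Q"
  unfolding submanifold_def
proof (intro conjI assms(1) exI[of _ "dim (UNIV::'e set) - dim (UNIV :: 'v set)"] ballI)
  fix q assume q: "q \<in> Q"
  obtain U \<psi> where U: "compatible_chart M U \<psi>" "q \<in> U"
    "\<psi> ` (U \<inter> Q) = \<psi> ` U \<inter> {v. coord_deriv M (\<Phi> q) q v = 0}"
    "subspace {v. coord_deriv M (\<Phi> q) q v = 0}" "dim {v. coord_deriv M (\<Phi> q) q v = 0} + dim (UNIV ::
        'v set) = dim (UNIV :: 'e set)"
    by (rule level_set_chart[OF assms(2)[OF q] q])
  then have "dim {v. coord_deriv M (\<Phi> q) q v = 0} = dim (UNIV::'e set) - dim (UNIV :: 'v set)"
      by simp
  with U show "\<exists>U \<psi> S. compatible_chart M U \<psi> \<and> q \<in> U \<and> subspace S \<and>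
      dim S = dim (UNIV::'e set) - dim (UNIV :: 'v set) \<and> \<psi> ` (U \<inter> Q) = \<psi> ` U \<inter> S"
    by blast
qed

lemma level_set_tangent_space:
  fixes \<Phi> :: "'p \<Rightarrow> 'v::findim_space"
  assumes L: "level_set_at Q q \<Phi>" and q: "q \<in> Q"
  shows "tangent_space M Q q = {v. coord_deriv M \<Phi> q v = 0}"
proof -
  obtain U \<psi> where U: "compatible_chart M U \<psi>" "q \<in> U"
    "\<psi> ` (U \<inter> Q) = \<psi> ` U \<inter> {v. coord_deriv M \<Phi> q v = 0}"
    "subspace {v. coord_deriv M \<Phi> q v = 0}" "coord_deriv M \<psi> q = (\<lambda>v. v)"
    by (rule level_set_chart[OF L q])
  show ?thesis using tangent_space_chart[OF U(1,2) q U(4,3)] U(5) by simp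
qed

end

section \<open>The Courant bracket in coordinates\<close>

text \<open>Differentiating the expansion of the first derivative in \<open>onb\<close> shows that
  the second derivative is linear in its inner direction, which is hidden in the iterated
  form.\<close>

lemma linear_second_derivative:
  fixes \<phi> :: "'a::findim_space \<Rightarrow> 'b::real_normed_vector"
  assumes O: "open O'" "z \<in> O'" and \<phi>: "smooth_on O' \<phi>"
  shows "(\<Sum>b\<in>onb. (v \<bullet> b) *\<^sub>R frechet_derivative (\<lambda>z. frechet_derivative \<phi> (at z) b) (at z) w)
    = frechet_derivative (\<lambda>z. frechet_derivative \<phi> (at z) v) (at z) w"
proof -
  have "((\<lambda>z. \<Sum>b\<in>onb. (v \<bullet> b) *\<^sub>R frechet_derivative \<phi> (at z) b) has_derivative
      (\<lambda>w. \<Sum>b\<in>onb. (v \<bullet> b) *\<^sub>R frechet_derivative (\<lambda>z. frechet_derivative \<phi> (at z) b) (at z) w))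
          (at z)"
    by (intro has_derivative_sum has_derivative_scaleR_right smooth_on_derivative[OF
        smooth_on_frechet[OF \<phi>] O(2)])
  then have "((\<lambda>z. frechet_derivative \<phi> (at z) v) has_derivative
      (\<lambda>w. \<Sum>b\<in>onb. (v \<bullet> b) *\<^sub>R frechet_derivative (\<lambda>z. frechet_derivative \<phi> (at z) b) (at z) w))
          (at z)"
    by (rule has_derivative_transform_within_open[OF _ O])
      (rule linear_onb[symmetric], rule has_derivative_linear[OF smooth_on_derivative[OF \<phi>]])
  from fun_cong[OF frechet_derivative_at[OF this]] show ?thesis .
qed

text \<open>A product rule for an operator that varies with the point: one term from the argument
  \<open>g\<close>, one from the operator. The expansion in \<open>onb\<close> reduces it to
  products with scalars.\<close>

lemma has_derivative_frechet_apply: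
  fixes \<phi> :: "'a::findim_space \<Rightarrow> 'b::real_normed_vector"
  assumes O: "open O'" "z \<in> O'" and \<phi>: "smooth_on O' \<phi>" and g: "(g has_derivative g') (at z)"
  shows "((\<lambda>z. frechet_derivative \<phi> (at z) (g z)) has_derivative
    (\<lambda>w. frechet_derivative \<phi> (at z) (g' w) + frechet_derivative (\<lambda>y. frechet_derivative \<phi> (at y)
        (g z)) (at z) w)) (at z)"
proof -
  let ?D = "\<lambda>b z. frechet_derivative \<phi> (at z) b"
  have lin: "linear (frechet_derivative \<phi> (at z))" if "z \<in> O'" for z
    by (rule has_derivative_linear[OF smooth_on_derivative[OF \<phi> that]])
  have "((\<lambda>z. \<Sum>b\<in>onb. (g z \<bullet> b) *\<^sub>R ?D b z) has_derivative
      (\<lambda>w. \<Sum>b\<in>onb. (g z \<bullet> b) *\<^sub>R frechet_derivative (?D b) (at z) w + (g' w \<bullet> b) *\<^sub>R ?D b z)) (at z)"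
    by (intro has_derivative_sum has_derivative_scaleR has_derivative_inner_left g
        smooth_on_derivative[OF smooth_on_frechet[OF \<phi>] O(2)])
  moreover have "(\<Sum>b\<in>onb. (g z \<bullet> b) *\<^sub>R frechet_derivative (?D b) (at z) w + (g' w \<bullet> b) *\<^sub>R ?D b z)
      = frechet_derivative \<phi> (at z) (g' w) + frechet_derivative (\<lambda>y. frechet_derivative \<phi> (at y)
          (g z)) (at z) w" for w
    unfolding sum.distrib linear_second_derivative[OF O \<phi>] linear_onb[OF lin[OF O(2)], symmetric]
    by (rule add.commute)
  ultimately have "((\<lambda>z. \<Sum>b\<in>onb. (g z \<bullet> b) *\<^sub>R ?D b z) has_derivative
      (\<lambda>w. frechet_derivative \<phi> (at z) (g' w) + frechet_derivative (\<lambda>y. frechet_derivative \<phi> (at y)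
          (g z)) (at z) w)) (at z)"
    by simp
  then show ?thesis
    by (rule has_derivative_transform_within_open[OF _ O]) (rule linear_onb[OF lin, symmetric])
qed

definition cour_vec :: "('a::real_normed_vector \<Rightarrow> 'a) \<Rightarrow> ('a \<Rightarrow> 'a) \<Rightarrow> 'a \<Rightarrow> 'a" where
  "cour_vec X Y z = frechet_derivative Y (at z) (X z) - frechet_derivative X (at z) (Y z)"

text \<open>The two summands with \<open>\<beta>\<close> form the Lie derivative of
  \<open>\<beta>\<close> along \<open>X\<close>, evaluated at \<open>v\<close>; the parenthesis
  subtracted from them is the exterior derivative of \<open>\<alpha>\<close> on \<open>Y\<close> and
  \<open>v\<close>.\<close>

definition cour_form :: "('a::real_normed_vector \<Rightarrow> 'a) \<Rightarrow> ('a \<Rightarrow> 'a \<Rightarrow>\<^sub>L real) \<Rightarrow> ('a \<Rightarrow> 'a)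
    \<Rightarrow> ('a \<Rightarrow> 'a \<Rightarrow>\<^sub>L real) \<Rightarrow> 'a \<Rightarrow> 'a \<Rightarrow> real" where
  "cour_form X \<alpha> Y \<beta> z v =
     blinfun_apply (frechet_derivative \<beta> (at z) (X z)) v + blinfun_apply (\<beta> z) (frechet_derivative X
         (at z) v)
     - (blinfun_apply (frechet_derivative \<alpha> (at z) (Y z)) v - blinfun_apply (frechet_derivative \<alpha>
         (at z) v) (Y z))"

lemma smooth_on_cour_vec:
  fixes X :: "'a::findim_space \<Rightarrow> 'a"
  assumes "open S" "smooth_on S X" "smooth_on S Y"
  shows "smooth_on S (cour_vec X Y)"
  unfolding cour_vec_def[abs_def]
  by (intro smooth_on_diff smooth_on_frechet_apply assms)

lemma smooth_on_cour_form:
  fixes X :: "'a::findim_space \<Rightarrow> 'a"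
  assumes S: "open S" and sm: "smooth_on S X" "smooth_on S \<alpha>" "smooth_on S Y" "smooth_on S \<beta>"
  shows "smooth_on S (\<lambda>z. cour_form X \<alpha> Y \<beta> z v)"
  unfolding cour_form_def
  by (intro smooth_on_diff smooth_on_add smooth_on_blinfun_apply smooth_on_frechet_apply
      smooth_on_frechet S sm smooth_on_const)

text \<open>Differentiating the transformation laws of vector fields and forms produces extra terms
  with the second derivative \<open>?H\<close> of \<open>\<phi>\<close>. In the vector part they are
  \<open>?H (X z) (Y z)\<close> and \<open>?H (Y z) (X z)\<close> with opposite signs. In the form
  part those coming from \<open>\<alpha>\<close> cancel each other, and the one from the derivative
  of \<open>\<beta>\<close> matches the one from the derivative of \<open>X'\<close>. In each case
  the reason is the symmetry of \<open>?H\<close>.\<close>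

lemma cour_natural:
  fixes \<phi> :: "'a::findim_space \<Rightarrow> 'a"
  assumes O: "open O'" "z \<in> O'" and \<phi>: "smooth_on O' \<phi>"
    and X: "X differentiable (at z)" "X' differentiable (at (\<phi> z))" "\<And>y. y \<in> O' \<Longrightarrow> X' (\<phi> y)
        = frechet_derivative \<phi> (at y) (X y)"
    and Y: "Y differentiable (at z)" "Y' differentiable (at (\<phi> z))" "\<And>y. y \<in> O' \<Longrightarrow> Y' (\<phi> y)
        = frechet_derivative \<phi> (at y) (Y y)"
    and \<alpha>: "\<alpha> differentiable (at z)" "\<alpha>' differentiable (at (\<phi> z))"
        "\<And>y v. y \<in> O' \<Longrightarrow> blinfun_apply (\<alpha> y) v = blinfun_apply (\<alpha>' (\<phi> y)) (frechet_derivative \<phi> (at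
        y) v)"
    and \<beta>: "\<beta> differentiable (at z)" "\<beta>' differentiable (at (\<phi> z))"
        "\<And>y v. y \<in> O' \<Longrightarrow> blinfun_apply (\<beta> y) v = blinfun_apply (\<beta>' (\<phi> y)) (frechet_derivative \<phi> (at
        y) v)"
  shows "cour_vec X' Y' (\<phi> z) = frechet_derivative \<phi> (at z) (cour_vec X Y z)"
    and "cour_form X' \<alpha>' Y' \<beta>' (\<phi> z) (frechet_derivative \<phi> (at z) v) = cour_form X \<alpha> Y \<beta> z v"
proof -
  let ?D = "frechet_derivative \<phi> (at z)"
  let ?H = "\<lambda>u w. frechet_derivative (\<lambda>y. frechet_derivative \<phi> (at y) u) (at z) w"
  have d\<phi>: "(\<phi> has_derivative ?D) (at z)" by (rule smooth_on_derivative[OF \<phi> O(2)])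
  note fd = frechet_derivative_works[THEN iffD1]
  have sym: "?H u w = ?H w u" for u w by (rule symmetric_second_derivative[OF O \<phi>])
  have lin: "linear ?D" by (rule has_derivative_linear[OF d\<phi>])
  have vec: "frechet_derivative V' (at (\<phi> z)) (?D w) = ?D (frechet_derivative V (at z) w) + ?H (V z)
      w"
    if V: "V differentiable (at z)" "V' differentiable (at (\<phi> z))" "\<And>y. y \<in> O' \<Longrightarrow> V' (\<phi> y)
        = frechet_derivative \<phi> (at y) (V y)" for V V' w
  proof -
    have 1: "((\<lambda>y. V' (\<phi> y)) has_derivative (\<lambda>w. frechet_derivative V' (at (\<phi> z)) (?D w))) (at z)"
      using diff_chain_at[OF d\<phi> fd[OF V(2)]] by (simp only: comp_def)
    have 2: "((\<lambda>y. V' (\<phi> y)) has_derivative (\<lambda>w. ?D (frechet_derivative V (at z) w) + ?H (V z) w))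
        (at z)"
      by (rule has_derivative_transform_within_open[OF has_derivative_frechet_apply[OF O \<phi> fd[OF
          V(1)]] O]) (rule V(3)[symmetric])
    show ?thesis by (rule fun_cong[OF has_derivative_unique[OF 1 2]])
  qed
  have form: "blinfun_apply (frechet_derivative \<gamma> (at z) w) u
      = blinfun_apply (\<gamma>' (\<phi> z)) (?H u w) + blinfun_apply (frechet_derivative \<gamma>' (at (\<phi> z)) (?D w))
          (?D u)"
    if g: "\<gamma> differentiable (at z)" "\<gamma>' differentiable (at (\<phi> z))"
      "\<And>y v. y \<in> O' \<Longrightarrow> blinfun_apply (\<gamma> y) v = blinfun_apply (\<gamma>' (\<phi> y)) (frechet_derivative \<phi> (at y)
          v)" for \<gamma> \<gamma>' :: "'a \<Rightarrow> 'a \<Rightarrow>\<^sub>L real" and u w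
  proof -
    have 1: "((\<lambda>y. blinfun_apply (\<gamma> y) u) has_derivative (\<lambda>w. blinfun_apply (frechet_derivative \<gamma>
        (at z) w) u)) (at z)"
      by (rule frechet_derivative_blinfun_apply[OF fd[OF g(1)]])
    have c: "((\<lambda>y. \<gamma>' (\<phi> y)) has_derivative (\<lambda>w. frechet_derivative \<gamma>' (at (\<phi> z)) (?D w))) (at z)"
      using diff_chain_at[OF d\<phi> fd[OF g(2)]] by (simp only: comp_def)
    have 2: "((\<lambda>y. blinfun_apply (\<gamma> y) u) has_derivative (\<lambda>w. blinfun_apply (\<gamma>' (\<phi> z)) (?H u w)
        + blinfun_apply (frechet_derivative \<gamma>' (at (\<phi> z)) (?D w)) (?D u))) (at z)"
      by (rule has_derivative_transform_within_open[OF bounded_bilinear.FDERIV[OF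
          bounded_bilinear_blinfun_apply c smooth_on_derivative[OF smooth_on_frechet[OF \<phi>] O(2)]]
          O]) (rule g(3)[symmetric])
    show ?thesis by (rule fun_cong[OF has_derivative_unique[OF 1 2]])
  qed
  note eqs = X(3)[OF O(2)] Y(3)[OF O(2)]
  have vX: "frechet_derivative X' (at (\<phi> z)) (?D w) = ?D (frechet_derivative X (at z) w) + ?H (X z)
      w" for w
    by (rule vec[OF X])
  have vY: "frechet_derivative Y' (at (\<phi> z)) (?D w) = ?D (frechet_derivative Y (at z) w) + ?H (Y z)
      w" for w
    by (rule vec[OF Y])
  show "cour_vec X' Y' (\<phi> z) = ?D (cour_vec X Y z)"
    unfolding cour_vec_def eqs vX vY linear_diff[OF lin] by (simp add: sym[of "X z" "Y z"])
  have f\<alpha>: "blinfun_apply (frechet_derivative \<alpha> (at z) w) u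
      = blinfun_apply (\<alpha>' (\<phi> z)) (?H u w) + blinfun_apply (frechet_derivative \<alpha>' (at (\<phi> z)) (?D w))
          (?D u)" for u w
    by (rule form[OF \<alpha>])
  have f\<beta>: "blinfun_apply (frechet_derivative \<beta> (at z) w) u
      = blinfun_apply (\<beta>' (\<phi> z)) (?H u w) + blinfun_apply (frechet_derivative \<beta>' (at (\<phi> z)) (?D w))
          (?D u)" for u w
    by (rule form[OF \<beta>])
  show "cour_form X' \<alpha>' Y' \<beta>' (\<phi> z) (?D v) = cour_form X \<alpha> Y \<beta> z v"
    unfolding cour_form_def eqs vX f\<alpha> f\<beta> \<beta>(3)[OF O(2)] blinfun.add_right
    by (simp add: sym[of v "X z"] sym[of v "Y z"])
qed

section \<open>Vector fields and forms in a compatible chart\<close>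

text \<open>\<open>vrep\<close> and \<open>frep\<close> extend \<open>vec_rep\<close> and
  \<open>form_rep\<close> from the preferred charts to all compatible charts, in particular to those
  adapted to a submanifold.\<close>

definition vrep :: "('p, 'e::findim_space) mfd \<Rightarrow> 'p set \<Rightarrow> ('p \<Rightarrow> 'e) \<Rightarrow> ('p \<Rightarrow> 'e) \<Rightarrow> 'e \<Rightarrow> 'e" where
  "vrep M U \<psi> X z = coord_deriv M \<psi> (inv_into U \<psi> z) (X (inv_into U \<psi> z))"

definition frep :: "('p, 'e::findim_space) mfd \<Rightarrow> 'p set \<Rightarrow> ('p \<Rightarrow> 'e) \<Rightarrow> ('p \<Rightarrow> 'e \<Rightarrow>\<^sub>L real)
    \<Rightarrow> 'e \<Rightarrow> 'e \<Rightarrow>\<^sub>L real" where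
  "frep M U \<psi> \<alpha> z = Blinfun (\<lambda>v. blinfun_apply (\<alpha> (inv_into U \<psi> z)) (coord_deriv_inv M U \<psi> (inv_into
      U \<psi> z) v))"

lemma vec_rep_eq: "vec_rep M q = vrep M (chart_dom M q) (chart M q)"
  by (rule ext)+ (simp add: vec_rep_def vrep_def vec_coord_eq chart_inv_def)

lemma form_rep_eq: "form_rep M q = frep M (chart_dom M q) (chart M q)"
  by (rule ext)+ (simp add: form_rep_def frep_def covec_coord_eq chart_inv_def)

lemma base_std_courant [simp]: "base (std_courant M) = M"
  by (simp add: std_courant_def)

lemma std_bracket_eq:
  "bracket (std_courant M) a b p = (lie_bracket M (fst \<circ> a) (fst \<circ> b) p,
     lie_deriv M (fst \<circ> a) (snd \<circ> b) p - interior_prod (fst \<circ> b) (ext_deriv M (snd \<circ> a)) p)"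
  by (simp add: std_courant_def Let_def)

context
  fixes M :: "('p, 'e::findim_space) mfd"
  assumes M: "atlas M"
begin

lemma frep_apply:
  assumes \<psi>: "compatible_chart M U \<psi>" and p: "p \<in> U"
  shows "blinfun_apply (frep M U \<psi> \<alpha> (\<psi> p)) v = blinfun_apply (\<alpha> p) (coord_deriv_inv M U \<psi> p v)"
proof -
  have "linear (\<lambda>v. blinfun_apply (\<alpha> p) (coord_deriv_inv M U \<psi> p v))"
    using linear_compose[OF linear_coord_deriv_inv[OF M \<psi> p] bounded_linear.linear[OF
        blinfun.bounded_linear_right[of "\<alpha> p"]]]
    by (simp add: comp_def)
  then show ?thesis
    using p compatible_chart_inj[OF M \<psi>] by (simp add: frep_def blinfun_apply_Blinfun_linear)
qed

lemma vrep_at: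
  assumes "compatible_chart M U \<psi>" "p \<in> U"
  shows "vrep M U \<psi> X (\<psi> p) = coord_deriv M \<psi> p (X p)"
  using assms compatible_chart_inj[OF M assms(1)] by (simp add: vrep_def)

lemma rep_change:
  assumes \<psi>: "compatible_chart M U \<psi>" and \<kappa>: "compatible_chart M V \<kappa>" and z: "z \<in> \<psi> ` (U \<inter> V)"
  defines "\<phi> \<equiv> \<kappa> \<circ> inv_into U \<psi>"
  shows vrep_change: "vrep M V \<kappa> X (\<phi> z) = frechet_derivative \<phi> (at z) (vrep M U \<psi> X z)"
    and frep_change: "blinfun_apply (frep M U \<psi> \<alpha> z) v = blinfun_apply (frep M V \<kappa> \<alpha> (\<phi> z))
        (frechet_derivative \<phi> (at z) v)"
proof -
  obtain p where p: "p \<in> U" "p \<in> V" "z = \<psi> p" using z by blast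
  have \<phi>z: "\<phi> z = \<kappa> p" using p compatible_chart_inj[OF M \<psi>] by (simp add: \<phi>_def)
  have d: "(\<phi> has_derivative frechet_derivative \<phi> (at z)) (at (\<psi> p))"
    using smooth_on_derivative[OF smooth_compatible_transition[OF M \<psi> \<kappa>] z]
        by (simp add: \<phi>_def p(3))
  have ch: "coord_deriv M \<kappa> p v = frechet_derivative \<phi> (at z) (coord_deriv M \<psi> p v)" for v
    unfolding \<phi>_def by (rule coord_deriv_chain[OF M \<psi> p(1) d[unfolded \<phi>_def]])
  show "vrep M V \<kappa> X (\<phi> z) = frechet_derivative \<phi> (at z) (vrep M U \<psi> X z)"
    unfolding \<phi>z unfolding p(3) vrep_at[OF \<psi> p(1)] vrep_at[OF \<kappa> p(2)] by (rule ch[unfolded p(3)])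
  have "coord_deriv_inv M V \<kappa> p (frechet_derivative \<phi> (at (\<psi> p)) v) = coord_deriv_inv M U \<psi> p v"
    using ch[of "coord_deriv_inv M U \<psi> p v", unfolded p(3)] coord_deriv_coord_deriv_inv[OF M \<psi> p(1)]
      coord_deriv_inv_coord_deriv[OF M \<kappa> p(2)] by metis
  then show "blinfun_apply (frep M U \<psi> \<alpha> z) v = blinfun_apply (frep M V \<kappa> \<alpha> (\<phi> z))
      (frechet_derivative \<phi> (at z) v)"
    unfolding \<phi>z unfolding p(3) frep_apply[OF \<psi> p(1)] frep_apply[OF \<kappa> p(2)] by simp
qed

lemma smooth_section_std_iff:
  "smooth_section (std_courant M) W a \<longleftrightarrow> openin (mfd_top M) W \<and>
    (\<forall>q\<in>points M. smooth_on (chart M q ` (chart_dom M q \<inter> W)) (vrep M (chart_dom M q) (chart M q)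
        (fst \<circ> a)) \<and>
       smooth_on (chart M q ` (chart_dom M q \<inter> W)) (frep M (chart_dom M q) (chart M q) (snd \<circ> a)))"
proof -
  have "smooth_on (chart M q ` (chart_dom M q \<inter> W)) (\<lambda>x. bundle_coord (std_courant M)
      q (chart_inv M q x) (a (chart_inv M q x)))
    \<longleftrightarrow> smooth_on (chart M q ` (chart_dom M q \<inter> W)) (vrep M (chart_dom M q) (chart M q) (fst \<circ> a)) \<and>
       smooth_on (chart M q ` (chart_dom M q \<inter> W)) (frep M (chart_dom M q) (chart M q)
           (snd \<circ> a))" (is "smooth_on ?S ?f \<longleftrightarrow> smooth_on ?S ?v \<and> smooth_on ?S ?w")
    if q: "q \<in> points M" and W: "openin (mfd_top M) W" for q
  proof -
    have S: "open ?S" by (rule open_compatible_image[OF M compatible_chart_chart[OF M q] W])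
    have f: "?f = (\<lambda>x. (?v x, ?w x))"
      by (rule ext) (simp add: std_courant_def vrep_def frep_def vec_coord_eq covec_coord_eq
          chart_inv_def split_beta)
    show ?thesis
    proof
      assume h: "smooth_on ?S ?f"
      from smooth_on_linear[OF bounded_linear_fst S h[unfolded f]]
          smooth_on_linear[OF bounded_linear_snd S h[unfolded f]]
      show "smooth_on ?S ?v \<and> smooth_on ?S ?w" by (simp only: fst_conv snd_conv simp_thms)
    next
      assume "smooth_on ?S ?v \<and> smooth_on ?S ?w"
      then show "smooth_on ?S ?f" unfolding f using smooth_on_Pair[OF S] by blast
    qed
  qed
  then show ?thesis unfolding smooth_section_def by auto
qed

text \<open>By definition smoothness is tested in preferred charts only. Near a point
  \<open>x\<close> the representative in \<open>\<psi>\<close> is obtained from the one in the chart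
  at \<open>x\<close>: for vectors with the derivative of the transition \<open>?\<sigma>\<close> to
  \<open>\<psi>\<close>, for covectors with that of the transition \<open>?\<tau>\<close> from
  \<open>\<psi>\<close>.\<close>

lemma smooth_section_rep:
  assumes a: "smooth_section (std_courant M) W a" and \<psi>: "compatible_chart M U \<psi>"
  shows "smooth_on (\<psi> ` (U \<inter> W)) (vrep M U \<psi> (fst \<circ> a))" and "smooth_on (\<psi> ` (U \<inter> W))
      (frep M U \<psi> (snd \<circ> a))"
proof -
  have W: "openin (mfd_top M) W" using a by (simp add: smooth_section_std_iff)
  have "\<exists>T. z \<in> T \<and> open T \<and> smooth_on T (vrep M U \<psi> (fst \<circ> a)) \<and> smooth_on T (frep M U \<psi> (snd \<circ>
      a))"
    if z: "z \<in> \<psi> ` (U \<inter> W)" for z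
  proof -
    obtain x where x: "x \<in> U" "x \<in> W" "z = \<psi> x" using z by blast
    have xM: "x \<in> points M" using x \<psi> compatible_chart_subset[OF M] by blast
    let ?V = "chart_dom M x" and ?\<kappa> = "chart M x"
    note \<kappa> = compatible_chart_chart[OF M xM]
    let ?T = "\<psi> ` (U \<inter> (W \<inter> ?V))" and ?R = "?\<kappa> ` (?V \<inter> (W \<inter> U))"
    let ?\<tau> = "?\<kappa> \<circ> inv_into U \<psi>" and ?\<sigma> = "\<psi> \<circ> inv_into ?V ?\<kappa>"
    have T: "open ?T" by (intro open_compatible_image[OF M \<psi>] openin_Int W openin_chart_dom[OF M
        xM])
    have R: "open ?R" by (intro open_compatible_image[OF M \<kappa>]
        openin_Int W compatible_chart_openin[OF M \<psi>])
    have \<tau>: "smooth_on ?T ?\<tau>" by (rule smooth_on_subset[OF smooth_compatible_transition[OF M \<psi> \<kappa>]])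
        auto
    have \<sigma>: "smooth_on ?R ?\<sigma>" by (rule smooth_on_subset[OF smooth_compatible_transition[OF M \<kappa> \<psi>]])
        auto
    have TR: "?\<tau> ` ?T \<subseteq> ?R" using compatible_chart_inj[OF M \<psi>] by auto
    have sR: "smooth_on ?R (vrep M ?V ?\<kappa> (fst \<circ> a))" "smooth_on ?R (frep M ?V ?\<kappa> (snd \<circ> a))"
      using a xM unfolding smooth_section_std_iff by (blast intro: smooth_on_subset)+
    have inv\<sigma>: "?\<sigma> (?\<tau> y) = y" "?\<tau> y \<in> ?\<kappa> ` (?V \<inter> U)" if "y \<in> ?T" for y
      using that compatible_chart_inj[OF M \<psi>] compatible_chart_inj[OF M \<kappa>] by auto
    have "smooth_on ?R (\<lambda>y. frechet_derivative ?\<sigma> (at y) (vrep M ?V ?\<kappa> (fst \<circ> a) y))"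
      by (rule smooth_on_frechet_apply[OF R \<sigma> sR(1)])
    from smooth_on_compose[OF T R TR \<tau> this]
    have 1: "smooth_on ?T (vrep M U \<psi> (fst \<circ> a))"
    proof (rule smooth_on_cong[OF T, rotated])
      fix y assume y: "y \<in> ?T"
      show "frechet_derivative ?\<sigma> (at (?\<tau> y)) (vrep M ?V ?\<kappa> (fst \<circ> a) (?\<tau> y)) = vrep M U \<psi> (fst \<circ> a)
          y"
        using vrep_change[OF \<kappa> \<psi> inv\<sigma>(2)[OF y], of "fst \<circ> a"] unfolding inv\<sigma>(1)[OF y] by (rule sym)
    qed
    have 2: "smooth_on ?T (frep M U \<psi> (snd \<circ> a))"
    proof (rule smooth_on_blinfunI[OF T])
      fix v
      have "smooth_on ?T (\<lambda>y. blinfun_apply (frep M ?V ?\<kappa> (snd \<circ> a) (?\<tau> y)) (frechet_derivative ?\<tau>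
          (at y) v))"
        by (rule smooth_on_blinfun_apply[OF T smooth_on_compose[OF T R TR \<tau> sR(2)]
            smooth_on_frechet[OF \<tau>]])
      then show "smooth_on ?T (\<lambda>y. blinfun_apply (frep M U \<psi> (snd \<circ> a) y) v)"
        by (rule smooth_on_cong[OF T, rotated]) (rule frep_change[OF \<psi> \<kappa>, symmetric], auto)
    qed
    have "z \<in> ?T" using x mem_chart_dom[OF M xM] by simp
    then show ?thesis using T 1 2 by (intro exI[of _ ?T] conjI)
  qed
  note loc = this
  show "smooth_on (\<psi> ` (U \<inter> W)) (vrep M U \<psi> (fst \<circ> a))"
    by (rule smooth_on_local) (use loc in metis)
  show "smooth_on (\<psi> ` (U \<inter> W)) (frep M U \<psi> (snd \<circ> a))"
    by (rule smooth_on_local) (use loc in metis)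
qed

text \<open>At the centre of the preferred chart a section and its representative have the same
  value, so the defining formulas become \<open>cour_vec\<close> and \<open>cour_form\<close>.
  Smoothness of \<open>a\<close> makes the functions under \<open>Blinfun\<close> linear, as these
  contain the derivatives of \<open>X\<close> and \<open>\<alpha>\<close> in the free direction
  \<open>v\<close>.\<close>

lemma std_bracket:
  fixes b :: "'p \<Rightarrow> 'e \<times> ('e \<Rightarrow>\<^sub>L real)"
  assumes a: "smooth_section (std_courant M) W a" and p: "p \<in> W"
  defines "X \<equiv> vec_rep M p (fst \<circ> a)" and "\<alpha> \<equiv> form_rep M p (snd \<circ> a)"
    and "Y \<equiv> vec_rep M p (fst \<circ> b)" and "\<beta> \<equiv> form_rep M p (snd \<circ> b)"
  shows "fst (bracket (std_courant M) a b p) = cour_vec X Y (chart M p p)"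
    and "blinfun_apply (snd (bracket (std_courant M) a b p)) v = cour_form X \<alpha> Y \<beta> (chart M p p) v"
proof -
  have W: "openin (mfd_top M) W" using a by (simp add: smooth_section_std_iff)
  have pM: "p \<in> points M" using p W openin_atlas[OF M] by blast
  note \<psi> = compatible_chart_chart[OF M pM]
  note pd = mem_chart_dom[OF M pM]
  have at: "vec_rep M p V (chart M p p) = V p" for V
    by (simp add: vec_rep_def chart_inv_chart[OF M pM pd] vec_coord_self[OF M pM])
  have atf: "blinfun_apply (form_rep M p \<gamma> (chart M p p)) u = blinfun_apply (\<gamma> p) u" for \<gamma> u
    using coord_deriv_inv_coord_deriv[OF M \<psi> pd, of u] vec_coord_self[OF M pM, of u]
    by (simp add: form_rep_eq frep_apply[OF \<psi> pd] vec_coord_eq)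
  show "fst (bracket (std_courant M) a b p) = cour_vec X Y (chart M p p)"
    unfolding cour_vec_def X_def Y_def at by (simp add: std_bracket_eq lie_bracket_def)
  have in_img: "chart M p p \<in> chart M p ` (chart_dom M p \<inter> W)" using pd p by blast
  have dX: "X differentiable (at (chart M p p))" and d\<alpha>: "\<alpha> differentiable (at (chart M p p))"
    using smooth_on_derivative[OF smooth_section_rep(1)[OF a \<psi>] in_img] smooth_on_derivative[OF
        smooth_section_rep(2)[OF a \<psi>] in_img]
    unfolding X_def \<alpha>_def vec_rep_eq form_rep_eq differentiable_def by blast+
  have lX: "linear (frechet_derivative X (at (chart M p p)))"
      and l\<alpha>: "linear (frechet_derivative \<alpha> (at (chart M p p)))"
    using dX d\<alpha> by (simp_all add: linear_frechet_derivative)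
  have l1: "linear (\<lambda>v. blinfun_apply (frechet_derivative \<beta> (at (chart M p p)) (fst (a p)))
      v + blinfun_apply (snd (b p)) (frechet_derivative X (at (chart M p p)) v))"
    by (rule linearI) (simp_all add: linear_add[OF lX] linear_scale[OF lX]
        blinfun.add_right blinfun.scaleR_right algebra_simps)
  have l2: "linear (\<lambda>v. blinfun_apply (frechet_derivative \<alpha> (at (chart M p p)) (fst (b p)))
      v - blinfun_apply (frechet_derivative \<alpha> (at (chart M p p)) v) (fst (b p)))"
    by (rule linearI) (simp_all add: linear_add[OF l\<alpha>] linear_scale[OF l\<alpha>]
        blinfun.add_right blinfun.add_left blinfun.scaleR_left blinfun.scaleR_right algebra_simps)
  show "blinfun_apply (snd (bracket (std_courant M) a b p)) v = cour_form X \<alpha> Y \<beta> (chart M p p) v"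
    unfolding cour_form_def std_bracket_eq snd_conv lie_deriv_def interior_prod_def ext_deriv_def
        blinfun.diff_left
    unfolding X_def[symmetric] \<alpha>_def[symmetric] \<beta>_def[symmetric]
    unfolding o_apply
      blinfun_apply_Blinfun_linear[OF l1] blinfun_apply_Blinfun_linear[OF l2]
    by (simp add: X_def Y_def \<beta>_def at atf)
qed

text \<open>The bracket at \<open>p\<close> is defined in the chart at \<open>p\<close>, which
  changes with \<open>p\<close>. Naturality expresses it in one chart \<open>\<psi>\<close> for all
  points at once; smoothness of the bracket and its behaviour along a submanifold are read off
  there.\<close>

lemma std_bracket_chart:
  assumes a: "smooth_section (std_courant M) W a" and b: "smooth_section (std_courant M) W b"
    and \<psi>: "compatible_chart M U \<psi>" and p: "p \<in> U" "p \<in> W"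
  shows "coord_deriv M \<psi> p (fst (bracket (std_courant M) a b p))
      = cour_vec (vrep M U \<psi> (fst \<circ> a)) (vrep M U \<psi> (fst \<circ> b)) (\<psi> p)"
    and "blinfun_apply (snd (bracket (std_courant M) a b p)) (coord_deriv_inv M U \<psi> p v)
      = cour_form (vrep M U \<psi> (fst \<circ> a)) (frep M U \<psi> (snd \<circ> a)) (vrep M U \<psi> (fst \<circ> b))
          (frep M U \<psi> (snd \<circ> b)) (\<psi> p) v"
proof -
  have W: "openin (mfd_top M) W" using a by (simp add: smooth_section_std_iff)
  have pM: "p \<in> points M" using p W openin_atlas[OF M] by blast
  let ?V = "chart_dom M p" and ?\<kappa> = "chart M p"
  note \<kappa> = compatible_chart_chart[OF M pM]
  note pd = mem_chart_dom[OF M pM]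
  let ?O = "?\<kappa> ` (?V \<inter> U)" and ?\<phi> = "\<psi> \<circ> inv_into ?V ?\<kappa>"
  have O: "open ?O" "?\<kappa> p \<in> ?O"
    using open_compatible_image[OF M \<kappa> compatible_chart_openin[OF M \<psi>]] p pd by auto
  have \<phi>: "smooth_on ?O ?\<phi>" by (rule smooth_compatible_transition[OF M \<kappa> \<psi>])
  have \<phi>p: "?\<phi> (?\<kappa> p) = \<psi> p" using compatible_chart_inj[OF M \<kappa>] pd by simp
  have d: "frechet_derivative ?\<phi> (at (?\<kappa> p)) = coord_deriv M \<psi> p"
    by (simp add: coord_deriv_def chart_inv_def)
  have diff: "F differentiable (at z)" if "smooth_on T F" "z \<in> T"
      for F :: "'e \<Rightarrow> 'x::real_normed_vector" and T z
    using smooth_on_derivative[OF that] unfolding differentiable_def by blast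
  have i1: "?\<kappa> p \<in> ?\<kappa> ` (?V \<inter> W)" and i2: "?\<phi> (?\<kappa> p) \<in> \<psi> ` (U \<inter> W)" using pd p unfolding \<phi>p by auto
  note nat = cour_natural[OF O \<phi>
      diff[OF smooth_section_rep(1)[OF a \<kappa>] i1] diff[OF smooth_section_rep(1)[OF a \<psi>] i2]
          vrep_change[OF \<kappa> \<psi>]
      diff[OF smooth_section_rep(1)[OF b \<kappa>] i1] diff[OF smooth_section_rep(1)[OF b \<psi>] i2]
          vrep_change[OF \<kappa> \<psi>]
      diff[OF smooth_section_rep(2)[OF a \<kappa>] i1] diff[OF smooth_section_rep(2)[OF a \<psi>] i2]
          frep_change[OF \<kappa> \<psi>]
      diff[OF smooth_section_rep(2)[OF b \<kappa>] i1] diff[OF smooth_section_rep(2)[OF b \<psi>] i2]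
          frep_change[OF \<kappa> \<psi>],
      unfolded \<phi>p d]
  show "coord_deriv M \<psi> p (fst (bracket (std_courant M) a b p))
      = cour_vec (vrep M U \<psi> (fst \<circ> a)) (vrep M U \<psi> (fst \<circ> b)) (\<psi> p)"
    unfolding std_bracket(1)[OF a p(2)] vec_rep_eq by (rule nat(1)[symmetric])
  show "blinfun_apply (snd (bracket (std_courant M) a b p)) (coord_deriv_inv M U \<psi> p v)
      = cour_form (vrep M U \<psi> (fst \<circ> a)) (frep M U \<psi> (snd \<circ> a)) (vrep M U \<psi> (fst \<circ> b))
          (frep M U \<psi> (snd \<circ> b)) (\<psi> p) v"
    using nat(2)[of "coord_deriv_inv M U \<psi> p v"]
    unfolding std_bracket(2)[OF a p(2)] vec_rep_eq form_rep_eq coord_deriv_coord_deriv_inv[OF M \<psi>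
        p(1)] by (rule sym)
qed

lemma smooth_section_std_bracket:
  assumes a: "smooth_section (std_courant M) W a" and b: "smooth_section (std_courant M) W b"
  shows "smooth_section (std_courant M) W (bracket (std_courant M) a b)"
  unfolding smooth_section_std_iff
proof (intro conjI ballI)
  show W: "openin (mfd_top M) W" using a by (simp add: smooth_section_std_iff)
  fix q assume q: "q \<in> points M"
  let ?U = "chart_dom M q" and ?\<psi> = "chart M q"
  let ?S = "?\<psi> ` (?U \<inter> W)"
  note \<psi> = compatible_chart_chart[OF M q]
  have S: "open ?S" by (rule open_compatible_image[OF M \<psi> W])
  note sm = smooth_section_rep[OF a \<psi>] smooth_section_rep[OF b \<psi>]
  show "smooth_on ?S (vrep M ?U ?\<psi> (fst \<circ> bracket (std_courant M) a b))"
  proof (rule smooth_on_cong[OF S _ smooth_on_cour_vec[OF S sm(1,3)]])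
    fix z assume "z \<in> ?S"
    then obtain x where x: "x \<in> ?U" "x \<in> W" "z = ?\<psi> x" by blast
    show "cour_vec (vrep M ?U ?\<psi> (fst \<circ> a)) (vrep M ?U ?\<psi> (fst \<circ> b)) z = vrep M ?U ?\<psi> (fst \<circ> bracket
        (std_courant M) a b) z"
      unfolding x(3) vrep_at[OF \<psi> x(1)] by (simp add: std_bracket_chart(1)[OF a b \<psi> x(1,2)])
  qed
  show "smooth_on ?S (frep M ?U ?\<psi> (snd \<circ> bracket (std_courant M) a b))"
  proof (rule smooth_on_blinfunI[OF S], rule smooth_on_cong[OF S _ smooth_on_cour_form[OF S sm]])
    fix z v assume "z \<in> ?S"
    then obtain x where x: "x \<in> ?U" "x \<in> W" "z = ?\<psi> x" by blast
    show "cour_form (vrep M ?U ?\<psi> (fst \<circ> a)) (frep M ?U ?\<psi> (snd \<circ> a)) (vrep M ?U ?\<psi> (fst \<circ> b))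
        (frep M ?U ?\<psi> (snd \<circ> b)) z v
        = blinfun_apply (frep M ?U ?\<psi> (snd \<circ> bracket (std_courant M) a b) z) v"
      unfolding x(3) frep_apply[OF \<psi> x(1)] by (simp add: std_bracket_chart(2)[OF a b \<psi> x(1,2)])
  qed
qed

end

section \<open>The Dirac structure of a submanifold\<close>

definition conormal_dirac :: "('p, 'e::findim_space) mfd \<Rightarrow> 'p set \<Rightarrow> ('p \<times> 'e \<times> ('e \<Rightarrow>\<^sub>L real))
    set" where
  "conormal_dirac M Q = {(x, v, \<alpha>). x \<in> Q \<and> v \<in> tangent_space M Q x \<and>
     (\<forall>w\<in>tangent_space M Q x. blinfun_apply \<alpha> w = 0)}"

context
  fixes M :: "('p, 'e::findim_space) mfd" and U \<psi> S Q
  assumes M: "atlas M" and \<psi>: "compatible_chart M U \<psi>" and S: "subspace S"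
      and Q: "\<psi> ` (U \<inter> Q) = \<psi> ` U \<inter> S"
begin

private lemma tangent: "p \<in> U \<Longrightarrow> p \<in> Q \<Longrightarrow> tangent_space M Q p = {v. coord_deriv M \<psi> p v \<in> S}"
  by (rule tangent_space_chart[OF M \<psi> _ _ S Q])

text \<open>In the chart \<open>\<psi>\<close> the fibre is the sum of \<open>S\<close> and its annihilator, which is identified with the
  orthogonal complement of \<open>S\<close>. So it is parametrised by the whole model space.\<close>

definition conormal_param :: "('e \<Rightarrow> 'e) \<Rightarrow> 'p \<Rightarrow> 'e \<Rightarrow> 'e \<times> ('e \<Rightarrow>\<^sub>L real)" where
  "conormal_param \<pi> y v = (coord_deriv_inv M U \<psi> y (\<pi> v), Blinfun (\<lambda>u. (v - \<pi> v)
      \<bullet> coord_deriv M \<psi> y u))"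

context
  fixes \<pi>
  assumes P: "orthogonal_projection S \<pi>"
begin

private lemma \<pi>: "bounded_linear \<pi>" "\<And>v. \<pi> v \<in> S" "\<And>v. v \<in> S \<Longrightarrow> \<pi> v = v" "\<And>v w. w \<in> S \<Longrightarrow> (v - \<pi> v)
    \<bullet> w = 0"
  using P by (auto simp: orthogonal_projection_def)

private lemma lin\<pi>: "linear \<pi>" by (rule bounded_linear.linear[OF \<pi>(1)])

lemma conormal_param_form: "y \<in> U \<Longrightarrow> blinfun_apply (snd (conormal_param \<pi> y v)) u = (v - \<pi> v)
    \<bullet> coord_deriv M \<psi> y u"
proof -
  assume y: "y \<in> U"
  have l: "linear (coord_deriv M \<psi> y)" by (rule linear_coord_deriv[OF M \<psi> y])
  have "linear (\<lambda>u. (v - \<pi> v) \<bullet> coord_deriv M \<psi> y u)"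
    by (rule linearI) (simp_all add: linear_add[OF l] linear_scale[OF l] inner_add_right)
  then show ?thesis by (simp add: conormal_param_def blinfun_apply_Blinfun_linear)
qed

lemma linear_conormal_param:
  assumes y: "y \<in> U"
  shows "linear (conormal_param \<pi> y)"
proof (rule linearI)
  note l = linear_coord_deriv_inv[OF M \<psi> y]
  show "conormal_param \<pi> y (v + w) = conormal_param \<pi> y v + conormal_param \<pi> y w" for v w
  proof (rule prod_eqI)
    show "snd (conormal_param \<pi> y (v + w)) = snd (conormal_param \<pi> y v + conormal_param \<pi> y w)"
      unfolding snd_add by (rule blinfun_eqI) (simp add: conormal_param_form[OF y]
          blinfun.add_left linear_add[OF lin\<pi>] inner_add_left inner_diff_left)
  qed (simp add: conormal_param_def linear_add[OF l] linear_add[OF lin\<pi>])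
  show "conormal_param \<pi> y (r *\<^sub>R v) = r *\<^sub>R conormal_param \<pi> y v" for r v
  proof (rule prod_eqI)
    show "snd (conormal_param \<pi> y (r *\<^sub>R v)) = snd (r *\<^sub>R conormal_param \<pi> y v)"
      unfolding snd_scaleR by (rule blinfun_eqI) (simp add: conormal_param_form[OF y]
          blinfun.scaleR_left linear_scale[OF lin\<pi>] inner_diff_left right_diff_distrib)
  qed (simp add: conormal_param_def linear_scale[OF l] linear_scale[OF lin\<pi>])
qed

lemma inj_conormal_param:
  assumes y: "y \<in> U"
  shows "inj (conormal_param \<pi> y)"
  unfolding linear_injective_0[OF linear_conormal_param[OF y]]
proof (intro allI impI)
  fix v assume v: "conormal_param \<pi> y v = 0"
  have "coord_deriv_inv M U \<psi> y (\<pi> v) = 0" using v by (simp add: conormal_param_def prod_eq_iff)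
  then have "\<pi> v = 0"
    by (metis coord_deriv_coord_deriv_inv[OF M \<psi> y] linear_0[OF linear_coord_deriv[OF M \<psi> y]])
  \<comment> \<open>The covector is tested on the tangent vector whose coordinates in
    \<open>\<psi>\<close> are \<open>v\<close>; with \<open>\<pi> v = 0\<close> the value is
    \<open>v \<bullet> v\<close>.\<close>
  moreover have "(v - \<pi> v) \<bullet> coord_deriv M \<psi> y (coord_deriv_inv M U \<psi> y v) = 0"
    using v by (simp flip: conormal_param_form[OF y])
  ultimately show "v = 0" by (simp add: coord_deriv_coord_deriv_inv[OF M \<psi> y])
qed

lemma range_conormal_param:
  assumes y: "y \<in> U" "y \<in> Q"
  shows "conormal_dirac M Q `` {y} = range (conormal_param \<pi> y)"
proof (intro set_eqI iffI)
  fix a assume "a \<in> range (conormal_param \<pi> y)"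
  then obtain v where a: "a = conormal_param \<pi> y v" by blast
  have "coord_deriv M \<psi> y (fst a) \<in> S"
    by (simp add: a conormal_param_def coord_deriv_coord_deriv_inv[OF M \<psi> y(1)] \<pi>(2))
  moreover have "blinfun_apply (snd a) w = 0" if "coord_deriv M \<psi> y w \<in> S" for w
    using that by (simp add: a conormal_param_form[OF y(1)] \<pi>(4))
  ultimately show "a \<in> conormal_dirac M Q `` {y}"
    using y by (auto simp: conormal_dirac_def tangent split_beta)
next
  fix a assume "a \<in> conormal_dirac M Q `` {y}"
  then have a: "coord_deriv M \<psi> y (fst a) \<in> S" "\<And>w. coord_deriv M \<psi> y w \<in> S \<Longrightarrow> blinfun_apply (snd a)
      w = 0"
    using y by (auto simp: conormal_dirac_def tangent split_beta)
  let ?f = "\<lambda>w. blinfun_apply (snd a) (coord_deriv_inv M U \<psi> y w)"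
  \<comment> \<open>The parameter is found as a sum: \<open>w1\<close> is the vector part in the
    chart and lies in \<open>S\<close>, \<open>w2\<close> represents the covector part and is
    orthogonal to \<open>S\<close>.\<close>
  define w1 where "w1 = coord_deriv M \<psi> y (fst a)"
  define w2 where "w2 = (\<Sum>b\<in>onb. ?f b *\<^sub>R b)"
  have lf: "linear ?f"
    using linear_compose[OF linear_coord_deriv_inv[OF M \<psi> y(1)] bounded_linear.linear[OF
        blinfun.bounded_linear_right[of "snd a"]]]
    by (simp add: comp_def)
  have f: "?f w = w \<bullet> w2" for w
    using blinfun_onb[of "Blinfun ?f" w] by (simp add: blinfun_apply_Blinfun_linear[OF lf] w2_def)
  have w2S: "w \<bullet> w2 = 0" if "w \<in> S" for w
    unfolding f[symmetric] by (rule a(2)) (simp add: coord_deriv_coord_deriv_inv[OF M \<psi> y(1)] that)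
  have "\<pi> w2 \<bullet> \<pi> w2 = w2 \<bullet> \<pi> w2"
    using \<pi>(4)[OF \<pi>(2), of w2 w2] by (simp add: inner_diff_left)
  also have "\<dots> = 0" using w2S[OF \<pi>(2)] by (simp add: inner_commute)
  finally have p2: "\<pi> w2 = 0" by simp
  have p1: "\<pi> w1 = w1" using a(1) \<pi>(3) by (simp add: w1_def)
  have "conormal_param \<pi> y (w1 + w2) = a"
  proof (rule prod_eqI)
    show "fst (conormal_param \<pi> y (w1 + w2)) = fst a"
      by (simp add: conormal_param_def linear_add[OF lin\<pi>] p1 p2)
          (simp add: w1_def coord_deriv_inv_coord_deriv[OF M \<psi> y(1)])
    show "snd (conormal_param \<pi> y (w1 + w2)) = snd a"
    proof (rule blinfun_eqI)
      fix u
      have "blinfun_apply (snd a) u = coord_deriv M \<psi> y u \<bullet> w2"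
        using f[of "coord_deriv M \<psi> y u"] by (simp add: coord_deriv_inv_coord_deriv[OF M \<psi> y(1)])
      then show "blinfun_apply (snd (conormal_param \<pi> y (w1 + w2))) u = blinfun_apply (snd a) u"
        by (simp add: conormal_param_form[OF y(1)] linear_add[OF lin\<pi>] p1 p2 inner_commute)
    qed
  qed
  then show "a \<in> range (conormal_param \<pi> y)" by blast
qed

text \<open>In a preferred chart the vector part is the derivative of the transition from
  \<open>\<psi>\<close> in the fixed direction \<open>\<pi> v\<close>, and the form part pairs the
  fixed vector \<open>v - \<pi> v\<close> with the derivative of the transition to
  \<open>\<psi>\<close>.\<close>

lemma smooth_section_conormal_param: "smooth_section (std_courant M) U (\<lambda>y. conormal_param \<pi> y v)"
  unfolding smooth_section_std_iff[OF M]
proof (intro conjI ballI)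
  show "openin (mfd_top M) U" by (rule compatible_chart_openin[OF M \<psi>])
  fix q assume q: "q \<in> points M"
  note \<kappa> = compatible_chart_chart[OF M q]
  let ?V = "chart_dom M q" and ?\<kappa> = "chart M q"
  let ?\<tau> = "\<psi> \<circ> inv_into ?V ?\<kappa>" and ?\<sigma> = "?\<kappa> \<circ> inv_into U \<psi>"
  let ?A = "?\<kappa> ` (?V \<inter> U)" and ?B = "\<psi> ` (U \<inter> ?V)"
  have A: "open ?A" by (rule open_compatible_image[OF M \<kappa> compatible_chart_openin[OF M \<psi>]])
  have B: "open ?B" by (rule open_compatible_image[OF M \<psi> openin_chart_dom[OF M q]])
  have \<tau>: "smooth_on ?A ?\<tau>" by (rule smooth_compatible_transition[OF M \<kappa> \<psi>])
  have \<sigma>: "smooth_on ?B ?\<sigma>" by (rule smooth_compatible_transition[OF M \<psi> \<kappa>])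
  have AB: "?\<tau> ` ?A \<subseteq> ?B" using compatible_chart_inj[OF M \<kappa>] by auto
  show "smooth_on ?A (vrep M ?V ?\<kappa> (fst \<circ> (\<lambda>y. conormal_param \<pi> y v)))"
  proof (rule smooth_on_cong[OF A _ smooth_on_compose[OF A B AB \<tau> smooth_on_frechet[OF \<sigma>,
      of "\<pi> v"]]])
    fix z assume "z \<in> ?A"
    then obtain y where y: "y \<in> ?V" "y \<in> U" "z = ?\<kappa> y" by blast
    have \<tau>z: "?\<tau> z = \<psi> y" using y compatible_chart_inj[OF M \<kappa>] by simp
    have "coord_deriv M ?\<kappa> y (coord_deriv_inv M U \<psi> y (\<pi> v)) = frechet_derivative ?\<sigma> (at (\<psi> y))
        (coord_deriv M \<psi> y (coord_deriv_inv M U \<psi> y (\<pi> v)))"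
      by (rule coord_deriv_chain[OF M \<psi> y(2) smooth_on_derivative[OF \<sigma>]]) (use y in blast)
    then show "frechet_derivative ?\<sigma> (at (?\<tau> z)) (\<pi> v) = vrep M ?V ?\<kappa> (fst \<circ> (\<lambda>y. conormal_param \<pi> y
        v)) z"
      unfolding \<tau>z unfolding y(3) vrep_at[OF M \<kappa> y(1)]
      by (simp add: conormal_param_def coord_deriv_coord_deriv_inv[OF M \<psi> y(2)])
  qed
  show "smooth_on ?A (frep M ?V ?\<kappa> (snd \<circ> (\<lambda>y. conormal_param \<pi> y v)))"
  proof (rule smooth_on_blinfunI[OF A])
    fix u
    show "smooth_on ?A (\<lambda>z. blinfun_apply (frep M ?V ?\<kappa> (snd \<circ> (\<lambda>y. conormal_param \<pi> y v)) z) u)"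
    proof (rule smooth_on_cong[OF A _ smooth_on_linear[OF bounded_linear_inner_right[of "v - \<pi> v"]
        A smooth_on_frechet[OF \<tau>, of u]]])
      fix z assume z: "z \<in> ?A"
      then obtain y where y: "y \<in> ?V" "y \<in> U" "z = ?\<kappa> y" by blast
      have "coord_deriv M \<psi> y (coord_deriv_inv M ?V ?\<kappa> y u) = frechet_derivative ?\<tau> (at (?\<kappa> y))
          (coord_deriv M ?\<kappa> y (coord_deriv_inv M ?V ?\<kappa> y u))"
        by (rule coord_deriv_chain[OF M \<kappa> y(1) smooth_on_derivative[OF \<tau>]]) (use y in blast)
      then show "(v - \<pi> v) \<bullet> frechet_derivative ?\<tau> (at z) u = blinfun_apply (frep M ?V ?\<kappa> (snd \<circ>
          (\<lambda>y. conormal_param \<pi> y v)) z) u"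
        unfolding y(3) frep_apply[OF M \<kappa> y(1)] o_apply conormal_param_form[OF y(2)]
            coord_deriv_coord_deriv_inv[OF M \<kappa> y(1)] by simp
    qed
  qed
qed

end

text \<open>Evaluating the parametrisation on the orthonormal basis gives the frame;
  \<open>h\<close> numbers this basis because frames of a subbundle are indexed by natural numbers.
  The rank is the dimension of the model space, whatever the dimension of \<open>S\<close>.\<close>

lemma conormal_dirac_frame:
  assumes h: "bij_betw h {..<k} (onb :: 'e set)" and p: "p \<in> Q" "p \<in> U"
  shows "subspace (conormal_dirac M Q `` {p})" "dim (conormal_dirac M Q `` {p})
      = dim (UNIV :: 'e set)"
    "\<exists>W e. p \<in> W \<and> (\<forall>i<k. smooth_section (std_courant M) W (e (i::nat))) \<and>
      (\<forall>y\<in>Q \<inter> W. conormal_dirac M Q `` {y} = span ((\<lambda>i. e i y) ` {..<k}))"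
proof -
  obtain \<pi> where P: "orthogonal_projection S \<pi>" by (rule subspace_projection[OF S])
  then have \<pi>: "bounded_linear \<pi>" "\<And>v. \<pi> v \<in> S" "\<And>v. v \<in> S \<Longrightarrow> \<pi> v = v" "\<And>v w. w \<in> S \<Longrightarrow> (v - \<pi> v)
      \<bullet> w = 0"
    by (auto simp: orthogonal_projection_def)
  note lin = linear_conormal_param[OF P] and rng = range_conormal_param[OF P]
  show "subspace (conormal_dirac M Q `` {p})"
    unfolding rng[OF p(2,1)] by (rule linear_subspace_image[OF lin[OF p(2)] subspace_UNIV])
  show "dim (conormal_dirac M Q `` {p}) = dim (UNIV :: 'e set)"
    unfolding rng[OF p(2,1)] by (rule dim_injective_image[OF lin[OF p(2)] inj_conormal_param[OF P
        p(2)]])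
  have "conormal_dirac M Q `` {y} = span ((\<lambda>i. conormal_param \<pi> y (h i)) ` {..<k})"
      if y: "y \<in> Q \<inter> U" for y
  proof -
    have "(\<lambda>i. conormal_param \<pi> y (h i)) ` {..<k} = conormal_param \<pi> y ` onb"
      using bij_betw_imp_surj_on[OF h] by (auto simp: image_image[symmetric])
    also have "span \<dots> = range (conormal_param \<pi> y)"
      using linear_span_image[OF lin, of y onb] y by (simp add: span_onb)
    finally show ?thesis using rng y by simp
  qed
  then show "\<exists>W e. p \<in> W \<and> (\<forall>i<k. smooth_section (std_courant M) W (e (i::nat))) \<and>
      (\<forall>y\<in>Q \<inter> W. conormal_dirac M Q `` {y} = span ((\<lambda>i. e i y) ` {..<k}))"
    using smooth_section_conormal_param[OF P] p(2)
    by (intro exI[of _ U] exI[of _ "\<lambda>i y. conormal_param \<pi> y (h i)"] conjI) auto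
qed

lemma conormal_dirac_lagrangian:
  assumes p: "p \<in> Q" "p \<in> U"
  shows "lagrangian (std_courant M) p (conormal_dirac M Q `` {p})"
proof -
  obtain \<pi> where P: "orthogonal_projection S \<pi>" by (rule subspace_projection[OF S])
  then have \<pi>: "bounded_linear \<pi>" "\<And>v. \<pi> v \<in> S" "\<And>v. v \<in> S \<Longrightarrow> \<pi> v = v" "\<And>v w. w \<in> S \<Longrightarrow> (v - \<pi> v)
      \<bullet> w = 0"
    by (auto simp: orthogonal_projection_def)
  let ?K = "conormal_dirac M Q `` {p}"
  have mem: "(v, \<alpha>) \<in> ?K \<longleftrightarrow> coord_deriv M \<psi> p v \<in> S \<and> (\<forall>w. coord_deriv M \<psi> p w \<in> S \<longrightarrow>
      blinfun_apply \<alpha> w = 0)" for v \<alpha>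
    using p by (auto simp: conormal_dirac_def tangent)
  have pair: "pairing (std_courant M) p (v, \<alpha>) (w, \<beta>) = blinfun_apply \<alpha> w + blinfun_apply \<beta> v"
      for v w \<alpha> \<beta>
    by (simp add: std_courant_def)
  have sub: "subspace ?K"
    unfolding range_conormal_param[OF P p(2,1)]
    by (rule linear_subspace_image[OF linear_conormal_param[OF P p(2)] subspace_UNIV])
  have "(v, \<alpha>) \<in> ?K" if orth: "\<forall>w\<in>?K. pairing (std_courant M) p (v, \<alpha>) w = 0" for v \<alpha>
  proof -
    have "blinfun_apply \<alpha> w = 0" if "coord_deriv M \<psi> p w \<in> S" for w
    proof -
      have "(w, 0) \<in> ?K" unfolding mem using that by simp
      from bspec[OF orth this] show ?thesis by (simp add: pair)
    qed
    moreover have "coord_deriv M \<psi> p v \<in> S"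
    proof -
      let ?c = "coord_deriv M \<psi> p v"
      \<comment> \<open>An element with zero vector part whose covector is the inner product with
        the component of \<open>?c\<close> orthogonal to \<open>S\<close>; pairing with it to 0
        forces this component to vanish.\<close>
      let ?a = "conormal_param \<pi> p (?c - \<pi> ?c)"
      have "?a \<in> ?K" unfolding range_conormal_param[OF P p(2,1)] by blast
      from bspec[OF orth this] have "blinfun_apply \<alpha> (fst ?a) + blinfun_apply (snd ?a) v = 0"
        by (metis pair prod.collapse)
      moreover have z: "\<pi> (?c - \<pi> ?c) = 0"
        by (simp add: linear_diff[OF bounded_linear.linear[OF \<pi>(1)]] \<pi>(2,3))
      moreover have "fst ?a = 0"
        by (simp add: conormal_param_def z linear_0[OF linear_coord_deriv_inv[OF M \<psi> p(2)]])
      moreover have "blinfun_apply (snd ?a) v = (?c - \<pi> ?c) \<bullet> ?c"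
        using conormal_param_form[OF P p(2), of "?c - \<pi> ?c" v] z by simp
      moreover have "(?c - \<pi> ?c) \<bullet> ?c = (?c - \<pi> ?c) \<bullet> (?c - \<pi> ?c)"
        using \<pi>(4)[OF \<pi>(2), of ?c ?c] by (simp add: inner_diff_right)
      ultimately have "?c = \<pi> ?c" by simp
      then show ?thesis using \<pi>(2)[of ?c] by simp
    qed
    ultimately show ?thesis unfolding mem by blast
  qed
  moreover have "pairing (std_courant M) p (v, \<alpha>) (w, \<beta>) = 0" if "(v, \<alpha>) \<in> ?K" "(w, \<beta>) \<in> ?K"
      for v \<alpha> w \<beta>
    using that unfolding mem pair by simp
  ultimately have "?K = {v. \<forall>w\<in>?K. pairing (std_courant M) p v w = 0}"
    by (intro set_eqI iffI; clarify) blast+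
  with sub show ?thesis by (simp add: lagrangian_def)
qed

text \<open>At points of \<open>S\<close> near \<open>\<psi> p\<close>, the vector parts of
  \<open>a\<close> and \<open>b\<close> in the chart lie in \<open>S\<close> and the form parts
  annihilate \<open>S\<close>. Both properties pass to derivatives in directions of
  \<open>S\<close>, so \<open>cour_vec\<close> stays in \<open>S\<close> and each of the four terms
  of \<open>cour_form\<close> vanishes on \<open>S\<close>.\<close>

lemma conormal_dirac_bracket:
  assumes p: "p \<in> Q" "p \<in> U" and W: "Q \<subseteq> W"
    and a: "smooth_section (std_courant M) W a" "\<And>x. x \<in> Q \<Longrightarrow> (x, a x) \<in> conormal_dirac M Q"
    and b: "smooth_section (std_courant M) W b" "\<And>x. x \<in> Q \<Longrightarrow> (x, b x) \<in> conormal_dirac M Q"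
  shows "(p, bracket (std_courant M) a b p) \<in> conormal_dirac M Q"
proof -
  let ?O = "\<psi> ` (U \<inter> W)"
  have pW: "p \<in> W" using W p by blast
  have O: "open ?O" "\<psi> p \<in> ?O"
    using open_compatible_image[OF M \<psi>] a(1) p pW by (auto simp: smooth_section_std_iff[OF M])
  have \<psi>S: "\<psi> p \<in> S" using Q p by blast
  let ?rep = "\<lambda>a. vrep M U \<psi> (fst \<circ> a)" and ?frep = "\<lambda>a. frep M U \<psi> (snd \<circ> a)"
  have near: "\<exists>e>0. \<forall>t::real. \<bar>t\<bar> < e \<longrightarrow> \<psi> p + t *\<^sub>R h \<in> ?O \<inter> S" if h: "h \<in> S" for h
  proof -
    obtain r where r: "r > 0" "ball (\<psi> p) r \<subseteq> ?O" using O openE by blast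
    have "\<psi> p + t *\<^sub>R h \<in> ?O \<inter> S" if t: "\<bar>t\<bar> < r / (norm h + 1)" for t
    proof
      have "\<bar>t\<bar> * (norm h + 1) < r" using t by (simp add: pos_less_divide_eq add_nonneg_pos)
      moreover have "\<bar>t\<bar> * norm h \<le> \<bar>t\<bar> * (norm h + 1)" by (simp add: mult_left_mono)
      ultimately have "norm (t *\<^sub>R h) < r" by simp
      then show "\<psi> p + t *\<^sub>R h \<in> ?O" using r(2) by (auto simp: dist_norm)
      show "\<psi> p + t *\<^sub>R h \<in> S" by (intro subspace_add[OF S] subspace_scale[OF S] \<psi>S h)
    qed
    then show ?thesis using r(1) by (intro exI[of _ "r / (norm h + 1)"]) (simp add: add_nonneg_pos)
  qed
  have on_S: "?rep c z \<in> S" "u \<in> S \<Longrightarrow> blinfun_apply (?frep c z) u = 0"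
    if c: "\<And>x. x \<in> Q \<Longrightarrow> (x, c x) \<in> conormal_dirac M Q" and z: "z \<in> ?O \<inter> S" for c z u
  proof -
    have "z \<in> \<psi> ` (U \<inter> Q)" using z Q by blast
    then obtain x where x: "x \<in> U" "x \<in> Q" "z = \<psi> x" by blast
    have cx: "coord_deriv M \<psi> x (fst (c x)) \<in> S" "\<And>w. coord_deriv M \<psi> x w \<in> S \<Longrightarrow>
        blinfun_apply (snd (c x)) w = 0"
      using c[OF x(2)] x tangent by (auto simp: conormal_dirac_def split_beta)
    show "?rep c z \<in> S" using cx(1) by (simp add: x(3) vrep_at[OF M \<psi> x(1)])
    show "blinfun_apply (?frep c z) u = 0" if "u \<in> S"
      using cx(2)[of "coord_deriv_inv M U \<psi> x u"] that
      by (simp add: x(3) frep_apply[OF M \<psi> x(1)] coord_deriv_coord_deriv_inv[OF M \<psi> x(1)])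
  qed
  have pS: "\<psi> p \<in> ?O \<inter> S" using O \<psi>S by blast
  have vecS: "frechet_derivative (?rep c) (at (\<psi> p)) h \<in> S"
    if c: "smooth_section (std_courant M) W c" "\<And>x. x \<in> Q \<Longrightarrow> (x, c x) \<in> conormal_dirac M Q"
        and h: "h \<in> S" for c h
  proof (rule derivative_in_subspace[OF S smooth_on_derivative[OF smooth_section_rep(1)[OF M c(1) \<psi>]
      O(2)]])
    show "\<exists>e>0. \<forall>t::real. \<bar>t\<bar> < e \<longrightarrow> ?rep c (\<psi> p + t *\<^sub>R h) \<in> S"
      using near[OF h] on_S(1)[OF c(2)] by blast
  qed
  have formS: "blinfun_apply (frechet_derivative (?frep c) (at (\<psi> p)) h) u = 0"
    if c: "smooth_section (std_courant M) W c" "\<And>x. x \<in> Q \<Longrightarrow> (x, c x) \<in> conormal_dirac M Q"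
        and h: "h \<in> S" and u: "u \<in> S" for c h u
  proof -
    have "\<exists>e>0. \<forall>t::real. \<bar>t\<bar> < e \<longrightarrow> blinfun_apply (?frep c (\<psi> p + t *\<^sub>R h)) u \<in> {0}"
      using near[OF h] on_S(2)[OF c(2) _ u] by blast
    from derivative_in_subspace[OF subspace_single_0 frechet_derivative_blinfun_apply[OF
        smooth_on_derivative[OF smooth_section_rep(2)[OF M c(1) \<psi>] O(2)]] this]
    show ?thesis by simp
  qed
  have 1: "coord_deriv M \<psi> p (fst (bracket (std_courant M) a b p)) \<in> S"
    unfolding std_bracket_chart(1)[OF M a(1) b(1) \<psi> p(2) pW] cour_vec_def
    by (intro subspace_diff[OF S] vecS a b on_S(1)[OF _ pS])
  have 2: "blinfun_apply (snd (bracket (std_courant M) a b p)) w = 0"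
      if w: "coord_deriv M \<psi> p w \<in> S" for w
  proof -
    let ?v = "coord_deriv M \<psi> p w"
    have "blinfun_apply (snd (bracket (std_courant M) a b p)) (coord_deriv_inv M U \<psi> p ?v) = 0"
      unfolding std_bracket_chart(2)[OF M a(1) b(1) \<psi> p(2) pW] cour_form_def
      by (simp add: formS[OF b on_S(1)[OF a(2) pS] w] formS[OF a on_S(1)[OF b(2) pS] w]
          formS[OF a w on_S(1)[OF b(2) pS]] on_S(2)[OF b(2) pS vecS[OF a w]])
    then show ?thesis by (simp add: coord_deriv_inv_coord_deriv[OF M \<psi> p(2)])
  qed
  show ?thesis
    using 1 2 p by (cases "bracket (std_courant M) a b p") (auto simp: conormal_dirac_def tangent)
qed

end

theorem dirac_structure_conormal:
  fixes M :: "('p, 'e::findim_space) mfd"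
  assumes M: "atlas M" and Q: "submanifold M Q"
  shows "dirac_structure (std_courant M) Q (conormal_dirac M Q)"
proof -
  have QM: "Q \<subseteq> points M" using Q by (simp add: submanifold_def)
  have chart: "\<exists>U \<psi> S. compatible_chart M U \<psi> \<and> q \<in> U \<and> subspace S \<and> \<psi> ` (U \<inter> Q) = \<psi> ` U \<inter> S"
      if "q \<in> Q" for q
    using Q that unfolding submanifold_def by blast
  define k where "k = dim (UNIV :: 'e set)"
  have "card (onb :: 'e set) = k"
  proof -
    have ind: "independent (onb :: 'e set)"
    proof (rule independent_if_scalars_zero[OF finite_onb])
      fix f :: "'e \<Rightarrow> real" and x :: 'e assume "(\<Sum>x\<in>onb. f x *\<^sub>R x) = 0" "x \<in> onb"
      then show "f x = 0" using orthonormal_inner_sum[OF finite_onb orthonormal_onb, of x f] by simp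
    qed
    show ?thesis using dim_span_eq_card_independent[OF ind] by (simp add: span_onb k_def)
  qed
  then obtain h where h: "bij_betw h {..<k} (onb :: 'e set)"
    using ex_bij_betw_nat_finite[OF finite_onb] by (auto simp: atLeast0LessThan)
  show ?thesis
    unfolding dirac_structure_def base_std_courant
  proof (intro conjI ballI allI impI Q)
    show "subbundle_along (std_courant M) Q (conormal_dirac M Q)"
      unfolding subbundle_along_def
    proof (intro conjI exI[of _ k] ballI)
      show "conormal_dirac M Q \<subseteq> Q \<times> UNIV" by (auto simp: conormal_dirac_def)
      fix x assume x: "x \<in> Q"
      obtain U \<psi> S where c: "compatible_chart M U \<psi>" "x \<in> U" "subspace S" "\<psi> ` (U \<inter> Q) = \<psi> ` U \<inter> S"
        using chart[OF x] by blast
      note fr = conormal_dirac_frame[OF M c(1,3,4) h x c(2)]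
      show "subspace (conormal_dirac M Q `` {x})" by (rule fr(1))
      show "dim (conormal_dirac M Q `` {x}) = k" unfolding k_def by (rule fr(2))
      show "\<exists>W e. x \<in> W \<and> (\<forall>i<k. smooth_section (std_courant M) W (e i)) \<and>
          (\<forall>y\<in>Q \<inter> W. conormal_dirac M Q `` {y} = span ((\<lambda>i. e i y) ` {..<k}))" by (rule fr(3))
    qed
  next
    fix x assume x: "x \<in> Q"
    obtain U \<psi> S where c: "compatible_chart M U \<psi>" "x \<in> U" "subspace S" "\<psi> ` (U \<inter> Q) = \<psi> ` U \<inter> S"
      using chart[OF x] by blast
    show "lagrangian (std_courant M) x (conormal_dirac M Q `` {x})"
      by (rule conormal_dirac_lagrangian[OF M c(1,3,4) x c(2)])
    show "anchor (std_courant M) x ` (conormal_dirac M Q `` {x}) \<subseteq> tangent_space M Q x"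
      by (auto simp: std_courant_def conormal_dirac_def)
  next
    fix a b
    assume a: "smooth_section (std_courant M) (points M) a" and b: "smooth_section (std_courant M)
        (points M) b"
      and aK: "section_of (std_courant M) Q (conormal_dirac M Q) a"
          and bK: "section_of (std_courant M) Q (conormal_dirac M Q) b"
    show "section_of (std_courant M) Q (conormal_dirac M Q) (bracket (std_courant M) a b)"
      unfolding section_of_def smooth_section_along_def
    proof (intro conjI ballI)
      fix x assume x: "x \<in> Q"
      \<comment> \<open>The bracket is smooth on the whole manifold, hence is its own local
        extension.\<close>
      show "\<exists>W c. x \<in> W \<and> smooth_section (std_courant M) W c \<and> (\<forall>y\<in>Q \<inter> W. c y = bracket (std_courant
          M) a b y)"
        using smooth_section_std_bracket[OF M a b] x QM by blast
      obtain U \<psi> S where c: "compatible_chart M U \<psi>" "x \<in> U" "subspace S" "\<psi> ` (U \<inter> Q) = \<psi> ` U \<inter> S"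
        using chart[OF x] by blast
      show "(x, bracket (std_courant M) a b x) \<in> conormal_dirac M Q"
        by (rule conormal_dirac_bracket[OF M c(1,3,4) x c(2) QM a _ b])
          (use aK bK in \<open>auto simp: section_of_def\<close>)
    qed
  qed
qed

section \<open>Product manifolds\<close>

lemma prod_mfd_simps [simp]:
  "points (M \<times>\<^sub>M N) = points M \<times> points N"
  "chart_dom (M \<times>\<^sub>M N) (p, q) = chart_dom M p \<times> chart_dom N q"
  "chart (M \<times>\<^sub>M N) (p, q) = map_prod (chart M p) (chart N q)"
  by (simp_all add: prod_mfd_def)

lemma map_prod_image_Int:
  "map_prod f g ` (A \<times> B \<inter> C \<times> D) = f ` (A \<inter> C) \<times> g ` (B \<inter> D)"
  by (simp add: Times_Int_Times map_prod_image)

lemma has_derivative_slice: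
  assumes "(f has_derivative f') (at (a, b))"
  shows "((\<lambda>u. f (u, b)) has_derivative (\<lambda>u. f' (u, 0))) (at a)"
    and "((\<lambda>v. f (a, v)) has_derivative (\<lambda>v. f' (0, v))) (at b)"
proof -
  have 1: "((\<lambda>u. (u, b)) has_derivative (\<lambda>u. (u, 0))) (at a)"
    and 2: "((\<lambda>v. (a, v)) has_derivative (\<lambda>v. (0, v))) (at b)"
    by (auto intro!: derivative_eq_intros)
  show "((\<lambda>u. f (u, b)) has_derivative (\<lambda>u. f' (u, 0))) (at a)"
    using diff_chain_at[OF 1 assms] by (simp only: comp_def)
  show "((\<lambda>v. f (a, v)) has_derivative (\<lambda>v. f' (0, v))) (at b)"
    using diff_chain_at[OF 2 assms] by (simp only: comp_def)
qed

lemma has_derivative_map_prod: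
  assumes "(f has_derivative f') (at a)" "(g has_derivative g') (at b)"
  shows "(map_prod f g has_derivative map_prod f' g') (at (a, b))"
proof -
  have f: "((f \<circ> fst) has_derivative f' \<circ> fst) (at (a, b))"
    by (rule diff_chain_at[OF bounded_linear_imp_has_derivative[OF bounded_linear_fst]])
        (use assms(1) in simp)
  have g: "((g \<circ> snd) has_derivative g' \<circ> snd) (at (a, b))"
    by (rule diff_chain_at[OF bounded_linear_imp_has_derivative[OF bounded_linear_snd]])
        (use assms(2) in simp)
  have "((\<lambda>z. ((f \<circ> fst) z, (g \<circ> snd) z)) has_derivative (\<lambda>z. ((f' \<circ> fst) z, (g' \<circ> snd) z))) (at (a,
      b))"
    by (rule has_derivative_Pair[OF f g])
  moreover have "(\<lambda>z. ((f \<circ> fst) z, (g \<circ> snd) z)) = map_prod f g" "(\<lambda>z. ((f' \<circ> fst) z, (g' \<circ> snd)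
      z)) = map_prod f' g'"
    by auto
  ultimately show ?thesis by simp
qed

lemma smooth_on_map_prod:
  fixes f :: "'a::findim_space \<Rightarrow> 'c::real_normed_vector"
      and g :: "'b::findim_space \<Rightarrow> 'd::real_normed_vector"
  assumes "open S" "open T" "smooth_on S f" "smooth_on T g"
  shows "smooth_on (S \<times> T) (map_prod f g)"
proof -
  have ST: "open (S \<times> T)" by (intro open_Times assms)
  have s1: "smooth_on (S \<times> T) (\<lambda>z. f (fst z))"
    by (rule smooth_on_compose[OF ST assms(1) _ smooth_on_linear[OF bounded_linear_fst ST
        smooth_on_id[OF ST]] assms(3)]) auto
  have s2: "smooth_on (S \<times> T) (\<lambda>z. g (snd z))"
    by (rule smooth_on_compose[OF ST assms(2) _ smooth_on_linear[OF bounded_linear_snd ST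
        smooth_on_id[OF ST]] assms(4)]) auto
  show ?thesis
    by (rule smooth_on_cong[OF ST _ smooth_on_Pair[OF ST s1 s2]]) auto
qed

text \<open>Off the image of a chart \<open>inv_into\<close> has no controlled value, so the inverse
  is split only at points of both images.\<close>

lemma chart_inv_prod:
  assumes "inj_on (chart M p) (chart_dom M p)" "inj_on (chart N q) (chart_dom N q)"
    and "z1 \<in> chart M p ` chart_dom M p" "z2 \<in> chart N q ` chart_dom N q"
  shows "chart_inv (M \<times>\<^sub>M N) (p, q) (z1, z2) = (chart_inv M p z1, chart_inv N q z2)"
proof -
  obtain x y where xy: "x \<in> chart_dom M p" "z1 = chart M p x" "y \<in> chart_dom N q" "z2 = chart N q y"
    using assms(3,4) by blast
  have "inj_on (map_prod (chart M p) (chart N q)) (chart_dom M p \<times> chart_dom N q)"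
    by (rule map_prod_inj_on[OF assms(1,2)])
  then have "inv_into (chart_dom M p \<times> chart_dom N q) (map_prod (chart M p) (chart N q))
      (map_prod (chart M p) (chart N q) (x, y)) = (x, y)"
    using xy by (intro inv_into_f_f) auto
  then show ?thesis using xy assms(1,2) by (simp add: chart_inv_def)
qed

context
  fixes M :: "('p, 'e::findim_space) mfd" and N :: "('q, 'f::findim_space) mfd"
  assumes M: "atlas M" and N: "atlas N"
begin

private lemmas injM = inj_chart[OF M] and injN = inj_chart[OF N]

lemma atlas_prod: "atlas (M \<times>\<^sub>M N)"
  unfolding atlas_def
proof (intro conjI ballI)
  fix p assume p: "p \<in> points (M \<times>\<^sub>M N)"
  obtain p1 p2 where p12: "p = (p1, p2)" "p1 \<in> points M" "p2 \<in> points N" using p by auto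
  note pM = p12(2) and pN = p12(3)
  show "p \<in> chart_dom (M \<times>\<^sub>M N) p" using mem_chart_dom[OF M pM] mem_chart_dom[OF N pN]
      by (simp add: p12(1))
  show "chart_dom (M \<times>\<^sub>M N) p \<subseteq> points (M \<times>\<^sub>M N)"
    using chart_dom_subset[OF M pM] chart_dom_subset[OF N pN] by (auto simp: p12(1))
  show "inj_on (chart (M \<times>\<^sub>M N) p) (chart_dom (M \<times>\<^sub>M N) p)"
    using map_prod_inj_on[OF injM[OF pM] injN[OF pN]] by (simp add: p12(1))
  show "open (chart (M \<times>\<^sub>M N) p ` chart_dom (M \<times>\<^sub>M N) p)"
    using open_chart_image[OF M pM] open_chart_image[OF N pN] by (simp add: p12(1)
        map_prod_image open_Times)
  fix q assume q: "q \<in> points (M \<times>\<^sub>M N)"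
  obtain q1 q2 where q12: "q = (q1, q2)" "q1 \<in> points M" "q2 \<in> points N" using q by auto
  note qM = q12(2) and qN = q12(3)
  let ?A = "chart M p1 ` (chart_dom M p1 \<inter> chart_dom M q1)"
      and ?B = "chart N p2 ` (chart_dom N p2 \<inter> chart_dom N q2)"
  have im: "chart (M \<times>\<^sub>M N) p ` (chart_dom (M \<times>\<^sub>M N) p \<inter> chart_dom (M \<times>\<^sub>M N) q) = ?A \<times> ?B"
    by (simp add: p12(1) q12(1) map_prod_image_Int)
  have A: "open ?A" and B: "open ?B"
    by (rule open_transition_domain[OF M pM qM], rule open_transition_domain[OF N pN qN])
  show "open (chart (M \<times>\<^sub>M N) p ` (chart_dom (M \<times>\<^sub>M N) p \<inter> chart_dom (M \<times>\<^sub>M N) q))"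
    unfolding im by (rule open_Times[OF A B])
  have "smooth_on (?A \<times> ?B) (map_prod (chart M q1 \<circ> chart_inv M p1) (chart N q2 \<circ> chart_inv N p2))"
    by (rule smooth_on_map_prod[OF A B smooth_transition[OF M pM qM] smooth_transition[OF N pN qN]])
  then show "smooth_on (chart (M \<times>\<^sub>M N) p ` (chart_dom (M \<times>\<^sub>M N) p \<inter> chart_dom (M \<times>\<^sub>M N) q))
      (chart (M \<times>\<^sub>M N) q \<circ> chart_inv (M \<times>\<^sub>M N) p)"
    unfolding im
  proof (rule smooth_on_cong[OF open_Times[OF A B], rotated])
    fix z assume "z \<in> ?A \<times> ?B"
    then have z: "fst z \<in> chart M p1 ` chart_dom M p1" "snd z \<in> chart N p2 ` chart_dom N p2" by auto
    show "map_prod (chart M q1 \<circ> chart_inv M p1) (chart N q2 \<circ> chart_inv N p2) z = (chart (M \<times>\<^sub>M N)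
        q \<circ> chart_inv (M \<times>\<^sub>M N) p) z"
      using chart_inv_prod[OF injM[OF pM] injN[OF pN] z] by (simp add: p12(1) q12(1)
          map_prod_def split_beta)
  qed
qed

lemma transition_derivative_prod:
  assumes p: "p \<in> points M" "p' \<in> points N" and q: "q \<in> points M" "q' \<in> points N"
    and x: "x \<in> chart_dom M p" "x \<in> chart_dom M q" and y: "y \<in> chart_dom N p'" "y \<in> chart_dom N q'"
  shows "frechet_derivative (chart (M \<times>\<^sub>M N) (q, q') \<circ> chart_inv (M \<times>\<^sub>M N) (p, p')) (at (chart M p x,
      chart N p' y))
    = map_prod (frechet_derivative (chart M q \<circ> chart_inv M p) (at (chart M p x)))
        (frechet_derivative (chart N q' \<circ> chart_inv N p') (at (chart N p' y)))"
proof (rule frechet_derivative_at[symmetric])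
  have d1: "((chart M q \<circ> chart_inv M p) has_derivative frechet_derivative (chart M q \<circ> chart_inv M
      p) (at (chart M p x))) (at (chart M p x))"
    by (rule smooth_on_derivative[OF smooth_transition[OF M p(1) q(1)]]) (use x in blast)
  have d2: "((chart N q' \<circ> chart_inv N p') has_derivative frechet_derivative (chart N q' \<circ> chart_inv
      N p') (at (chart N p' y))) (at (chart N p' y))"
    by (rule smooth_on_derivative[OF smooth_transition[OF N p(2) q(2)]]) (use y in blast)
  let ?S = "chart M p ` chart_dom M p \<times> chart N p' ` chart_dom N p'"
  have S: "open ?S" by (intro open_Times open_chart_image[OF M p(1)] open_chart_image[OF N p(2)])
  show "(chart (M \<times>\<^sub>M N) (q, q') \<circ> chart_inv (M \<times>\<^sub>M N) (p, p') has_derivative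
     map_prod (frechet_derivative (chart M q \<circ> chart_inv M p) (at (chart M p x)))
        (frechet_derivative (chart N q' \<circ> chart_inv N p') (at (chart N p' y)))) (at (chart M p x,
            chart N p' y))"
  proof (rule has_derivative_transform_within_open[OF has_derivative_map_prod[OF d1 d2] S])
    show "(chart M p x, chart N p' y) \<in> ?S" using x y by blast
    fix z assume "z \<in> ?S"
    then have z: "fst z \<in> chart M p ` chart_dom M p" "snd z \<in> chart N p' ` chart_dom N p'" by auto
    show "map_prod (chart M q \<circ> chart_inv M p) (chart N q' \<circ> chart_inv N p') z = (chart (M \<times>\<^sub>M N)
        (q, q') \<circ> chart_inv (M \<times>\<^sub>M N) (p, p')) z"
      using chart_inv_prod[OF injM[OF p(1)] injN[OF p(2)] z] by (simp add: map_prod_def split_beta)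
  qed
qed

end

section \<open>Isomorphisms with standard Courant algebroids\<close>

lemma bundle_coord_std [simp]:
  "bundle_coord (std_courant M) q p a = (vec_coord M q p (fst a), covec_coord M q p (snd a))"
  by (simp add: std_courant_def split_beta)

lemma pairing_std [simp]:
  "pairing (std_courant M) p a b = blinfun_apply (snd a) (fst b) + blinfun_apply (snd b) (fst a)"
  by (simp add: std_courant_def split_beta)

lemma anchor_std [simp]: "anchor (std_courant M) p a = fst a"
  by (simp add: std_courant_def split_beta)

lemma covec_coord_apply:
  assumes "atlas M" "q \<in> points M" "p \<in> chart_dom M q"
  shows "blinfun_apply (covec_coord M q p \<alpha>) v = blinfun_apply \<alpha> (coord_deriv_inv M (chart_dom M q)
      (chart M q) p v)"
  using frep_apply[OF assms(1) compatible_chart_chart[OF assms(1,2)] assms(3), of "\<lambda>_. \<alpha>" v]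
    inj_chart[OF assms(1,2)] assms(3) by (simp add: frep_def covec_coord_eq)

lemma covec_coord_self:
  assumes "atlas M" "p \<in> points M"
  shows "covec_coord M p p \<alpha> = \<alpha>"
proof (rule blinfun_eqI)
  fix v
  show "blinfun_apply (covec_coord M p p \<alpha>) v = blinfun_apply \<alpha> v"
    using coord_deriv_inv_coord_deriv[OF assms(1) compatible_chart_chart[OF assms]
        mem_chart_dom[OF assms], of v]
      vec_coord_self[OF assms, of v]
    by (simp add: covec_coord_apply[OF assms mem_chart_dom[OF assms]] vec_coord_eq)
qed

text \<open>One linear map serves for all fibres, since these share a type; compatibility with
  \<open>bundle_coord\<close> says that it is the same map \<open>J\<close> in local trivialisations
  too, hence smooth. The bracket condition speaks of smooth sections and points of the base, where
  the bracket has its geometric meaning.\<close>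

definition courant_iso :: "('x, 'e::findim_space, 'v::real_normed_vector) courant \<Rightarrow> ('v \<Rightarrow> 'e \<times> ('e
    \<Rightarrow>\<^sub>L real)) \<Rightarrow> bool" where
  "courant_iso E J \<longleftrightarrow> atlas (base E) \<and> bounded_linear J \<and> bij J \<and> bounded_linear (inv J) \<and>
     (\<forall>q\<in>points (base E). \<forall>p\<in>chart_dom (base E) q. \<forall>v.
        J (bundle_coord E q p v) = bundle_coord (std_courant (base E)) q p (J v)) \<and>
     (\<forall>p v w. pairing E p v w = pairing (std_courant (base E)) p (J v) (J w)) \<and>
     (\<forall>p v. anchor E p v = fst (J v)) \<and>
     (\<forall>a b. smooth_section E (points (base E)) a \<longrightarrow> smooth_section E (points (base E)) b \<longrightarrow>
        (\<forall>p\<in>points (base E). J (bracket E a b p) = bracket (std_courant (base E)) (J \<circ> a) (J \<circ> b)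
            p))"

text \<open>In every chart the representative of \<open>J \<circ> a\<close> is the fixed linear map
  \<open>J\<close> applied to that of \<open>a\<close>.\<close>

lemma smooth_section_linear_map:
  assumes M: "atlas (base E)" and E': "base E' = base E" and J: "bounded_linear J"
    and bc: "\<And>q p v. q \<in> points (base E) \<Longrightarrow> p \<in> chart_dom (base E) q \<Longrightarrow> J (bundle_coord E q p v)
        = bundle_coord E' q p (J v)"
    and a: "smooth_section E W a"
  shows "smooth_section E' W (J \<circ> a)"
  unfolding smooth_section_def E'
proof (intro conjI ballI)
  show W: "openin (mfd_top (base E)) W" using a by (simp add: smooth_section_def)
  fix q assume q: "q \<in> points (base E)"
  let ?S = "chart (base E) q ` (chart_dom (base E) q \<inter> W)"
  have S: "open ?S" by (rule open_compatible_image[OF M compatible_chart_chart[OF M q] W])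
  have s: "smooth_on ?S (\<lambda>x. bundle_coord E q (chart_inv (base E) q x) (a (chart_inv (base E)
      q x)))"
    using a q unfolding smooth_section_def by blast
  show "smooth_on ?S (\<lambda>x. bundle_coord E' q (chart_inv (base E) q x) ((J \<circ> a) (chart_inv (base E)
      q x)))"
  proof (rule smooth_on_cong[OF S _ smooth_on_linear[OF J S s]])
    fix x assume "x \<in> ?S"
    then have "chart_inv (base E) q x \<in> chart_dom (base E) q" using chart_inv_chart[OF M q] by auto
    from bc[OF q this]
    show "J (bundle_coord E q (chart_inv (base E) q x) (a (chart_inv (base E) q x))) =
        bundle_coord E' q (chart_inv (base E) q x) ((J \<circ> a) (chart_inv (base E) q x))" by simp
  qed
qed

lemma courant_iso_std:
  fixes M :: "('p, 'e::findim_space) mfd"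
  assumes "atlas M"
  shows "courant_iso (std_courant M) (\<lambda>v. v)"
proof -
  have "inv (\<lambda>v::'e \<times> ('e \<Rightarrow>\<^sub>L real). v) = (\<lambda>v. v)" by (rule inv_equality) simp_all
  moreover have "bij (\<lambda>v::'e \<times> ('e \<Rightarrow>\<^sub>L real). v)" by (rule bijI') auto
  ultimately show ?thesis
    using assms by (simp add: courant_iso_def bounded_linear_ident comp_def)
qed

context
  fixes E :: "('x, 'e::findim_space, 'v::real_normed_vector) courant" and J
  assumes iso: "courant_iso E J"
begin

lemma iso_atlas: "atlas (base E)"
  and iso_linear: "bounded_linear J"
  and iso_bij: "bij J"
  and iso_inv_linear: "bounded_linear (inv J)"
  and iso_bundle_coord: "q \<in> points (base E) \<Longrightarrow> p \<in> chart_dom (base E) q \<Longrightarrow>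
        J (bundle_coord E q p v) = bundle_coord (std_courant (base E)) q p (J v)"
  and iso_pairing: "pairing E p v w = pairing (std_courant (base E)) p (J v) (J w)"
  and iso_anchor: "anchor E p v = fst (J v)"
  and iso_bracket: "smooth_section E (points (base E)) a \<Longrightarrow> smooth_section E (points (base E)) b \<Longrightarrow>
        p \<in> points (base E) \<Longrightarrow> J (bracket E a b p) = bracket (std_courant (base E)) (J \<circ> a) (J \<circ> b)
            p"
  using iso unfolding courant_iso_def by blast+

lemma iso_inv1: "inv J (J v) = v"
  by (rule inv_f_f[OF bij_is_inj[OF iso_bij]])

lemma iso_inv2: "J (inv J w) = w"
  by (rule surj_f_inv_f[OF bij_is_surj[OF iso_bij]])

lemma iso_smooth_section: "smooth_section E W a \<longleftrightarrow> smooth_section (std_courant (base E)) W (J \<circ> a)"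
proof
  assume a: "smooth_section E W a"
  show "smooth_section (std_courant (base E)) W (J \<circ> a)"
    by (rule smooth_section_linear_map[OF iso_atlas base_std_courant iso_linear _ a])
        (rule iso_bundle_coord)
next
  have bc: "inv J (bundle_coord (std_courant (base E)) q p w) = bundle_coord E q p (inv J w)"
    if "q \<in> points (base E)" "p \<in> chart_dom (base E) q" for q p w
    using iso_bundle_coord[OF that, of "inv J w"] unfolding iso_inv2 by (metis iso_inv1)
  assume a: "smooth_section (std_courant (base E)) W (J \<circ> a)"
  have "smooth_section E W (inv J \<circ> (J \<circ> a))"
    by (rule smooth_section_linear_map[OF _ _ iso_inv_linear _ a]) (simp_all add: iso_atlas bc del:
        bundle_coord_std)
  moreover have "inv J \<circ> (J \<circ> a) = a" by (rule ext) (simp add: iso_inv1)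
  ultimately show "smooth_section E W a" by simp
qed

lemma iso_section_along: "smooth_section_along (std_courant (base E)) Q (J \<circ> a) \<Longrightarrow>
    smooth_section_along E Q a"
  unfolding smooth_section_along_def
proof
  fix q assume "\<forall>q\<in>Q. \<exists>W b. q \<in> W \<and> smooth_section (std_courant (base E)) W b \<and> (\<forall>x\<in>Q \<inter> W. b x =
      (J \<circ> a) x)" "q \<in> Q"
  then obtain W b where b: "q \<in> W" "smooth_section (std_courant (base E)) W b"
      "\<forall>x\<in>Q \<inter> W. b x = (J \<circ> a) x" by blast
  have "J \<circ> (inv J \<circ> b) = b" by (rule ext) (simp add: iso_inv2)
  then have "smooth_section E W (inv J \<circ> b)" using b(2) by (simp add: iso_smooth_section)
  moreover have "\<forall>x\<in>Q \<inter> W. (inv J \<circ> b) x = a x" using b(3) by (simp add: iso_inv1)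
  ultimately show "\<exists>W b. q \<in> W \<and> smooth_section E W b \<and> (\<forall>x\<in>Q \<inter> W. b x = a x)" using b(1) by blast
qed

lemma iso_section_along': "smooth_section_along E Q a \<Longrightarrow> smooth_section_along (std_courant (base E))
    Q (J \<circ> a)"
  unfolding smooth_section_along_def iso_smooth_section by fastforce

text \<open>Each clause of the definition is transported along \<open>J\<close> fibre by fibre; the
  base, and with it \<open>Q\<close> and its tangent spaces, stays the same.\<close>

lemma dirac_structure_iso:
  assumes D: "dirac_structure (std_courant (base E)) Q K'" and K: "K = {(x, v). (x, J v) \<in> K'}"
  shows "dirac_structure E Q K"
proof -
  let ?B = "base E"
  have fib: "K `` {x} = inv J ` (K' `` {x})" for x
  proof (intro set_eqI iffI)
    fix v assume "v \<in> K `` {x}"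
    then have "J v \<in> K' `` {x}" by (simp add: K)
    then show "v \<in> inv J ` (K' `` {x})" by (metis imageI iso_inv1)
  next
    fix v assume "v \<in> inv J ` (K' `` {x})"
    then show "v \<in> K `` {x}" using iso_inv2 by (auto simp: K)
  qed
  note lJ = bounded_linear.linear[OF iso_linear] and lI = bounded_linear.linear[OF iso_inv_linear]
  have injI: "inj (inv J)" by (rule bij_is_inj[OF bij_imp_bij_inv[OF iso_bij]])
  have sub: "submanifold ?B Q" and bun: "subbundle_along (std_courant ?B) Q K'"
    and lag: "\<And>x. x \<in> Q \<Longrightarrow> lagrangian (std_courant ?B) x (K' `` {x})"
    and anc: "\<And>x. x \<in> Q \<Longrightarrow> anchor (std_courant ?B) x ` (K' `` {x}) \<subseteq> tangent_space ?B Q x"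
    and inv: "\<And>a b. smooth_section (std_courant ?B) (points ?B) a \<Longrightarrow> smooth_section (std_courant ?B)
        (points ?B) b \<Longrightarrow>
        section_of (std_courant ?B) Q K' a \<Longrightarrow> section_of (std_courant ?B) Q K' b \<Longrightarrow>
            section_of (std_courant ?B) Q K' (bracket (std_courant ?B) a b)"
    using D unfolding dirac_structure_def base_std_courant by blast+
  have QM: "Q \<subseteq> points ?B" using sub by (simp add: submanifold_def)
  show ?thesis
    unfolding dirac_structure_def
  proof (intro conjI sub ballI allI impI)
    obtain k where k: "K' \<subseteq> Q \<times> UNIV" "\<And>x. x \<in> Q \<Longrightarrow> subspace (K' `` {x}) \<and> dim (K' `` {x}) = k"
      and fr: "\<And>x. x \<in> Q \<Longrightarrow> \<exists>W. \<exists>e :: nat \<Rightarrow> _. x \<in> W \<and> (\<forall>i<k. smooth_section (std_courant ?B)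
          W (e i)) \<and>
           (\<forall>y\<in>Q \<inter> W. K' `` {y} = span ((\<lambda>i. e i y) ` {..<k}))"
      using bun unfolding subbundle_along_def by blast
    show "subbundle_along E Q K"
      unfolding subbundle_along_def
    proof (intro conjI exI[of _ k] ballI)
      show "K \<subseteq> Q \<times> UNIV" using k(1) by (auto simp: K)
      fix x assume x: "x \<in> Q"
      show "subspace (K `` {x})" unfolding fib using k(2)[OF x] linear_subspace_image[OF lI]
          by blast
      show "dim (K `` {x}) = k" unfolding fib dim_injective_image[OF lI injI] using k(2)[OF x]
          by blast
      obtain W e where e: "x \<in> W" "\<forall>i<k. smooth_section (std_courant ?B) W (e i)"
          "\<forall>y\<in>Q \<inter> W. K' `` {y} = span ((\<lambda>i. e (i::nat) y) ` {..<k})"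
        using fr[OF x] by blast
      have "J \<circ> (\<lambda>y. inv J (e i y)) = e i" for i by (rule ext) (simp add: iso_inv2)
      then have "\<forall>i<k. smooth_section E W (\<lambda>y. inv J (e i y))" using e(2)
          by (simp add: iso_smooth_section)
      moreover have "K `` {y} = span ((\<lambda>i. inv J (e i y)) ` {..<k})" if "y \<in> Q \<inter> W" for y
        unfolding fib using e(3) that linear_span_image[OF lI, of "(\<lambda>i. e i y) ` {..<k}"]
            by (simp add: image_image)
      ultimately show "\<exists>W e. x \<in> W \<and> (\<forall>i<k. smooth_section E W (e i)) \<and> (\<forall>y\<in>Q \<inter> W. K `` {y} =
          span ((\<lambda>i. e i y) ` {..<k}))"
        using e(1) by (intro exI[of _ W] exI[of _ "\<lambda>i y. inv J (e i y)"]) blast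
    qed
  next
    fix x assume x: "x \<in> Q"
    have s: "subspace (K' `` {x})" and l: "K' `` {x} = {v. \<forall>w\<in>K' `` {x}. pairing (std_courant ?B)
        x v w = 0}"
      using lag[OF x] unfolding lagrangian_def by blast+
    have mem: "v \<in> K `` {x} \<longleftrightarrow> J v \<in> K' `` {x}" for v by (simp add: K)
    have "v \<in> K `` {x} \<longleftrightarrow> (\<forall>w\<in>K `` {x}. pairing E x v w = 0)" for v
    proof -
      have "v \<in> K `` {x} \<longleftrightarrow> (\<forall>w\<in>K' `` {x}. pairing (std_courant ?B) x (J v) w = 0)"
        unfolding mem by (subst l) blast
      also have "\<dots> \<longleftrightarrow> (\<forall>w\<in>K `` {x}. pairing E x v w = 0)"
        unfolding fib iso_pairing by (simp add: iso_inv2)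
      finally show ?thesis .
    qed
    moreover have "subspace (K `` {x})" unfolding fib using s linear_subspace_image[OF lI] by blast
    ultimately show "lagrangian E x (K `` {x})" unfolding lagrangian_def by blast
    show "anchor E x ` (K `` {x}) \<subseteq> tangent_space ?B Q x"
      using anc[OF x] by (auto simp: iso_anchor K)
  next
    fix a b assume a: "smooth_section E (points ?B) a" and b: "smooth_section E (points ?B) b"
      and aK: "section_of E Q K a" and bK: "section_of E Q K b"
    have tr: "section_of (std_courant ?B) Q K' (J \<circ> c)" if "section_of E Q K c" for c
      using that iso_section_along' by (auto simp: section_of_def K)
    have S: "section_of (std_courant ?B) Q K' (bracket (std_courant ?B) (J \<circ> a) (J \<circ> b))"
      by (rule inv[OF _ _ tr[OF aK] tr[OF bK]]) (use a b iso_smooth_section in blast)+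
    have br: "J (bracket E a b x) = bracket (std_courant ?B) (J \<circ> a) (J \<circ> b) x" if "x \<in> Q" for x
      using iso_bracket[OF a b] that QM by blast
    have "smooth_section_along (std_courant ?B) Q (J \<circ> bracket E a b)"
      using S br unfolding section_of_def smooth_section_along_def by auto
    from iso_section_along[OF this] show "section_of E Q K (bracket E a b)"
      using S br by (auto simp: section_of_def K)
  qed
qed

text \<open>Evaluates the elements defined by \<open>THE\<close> in the product bracket. In the
  standard Courant algebroid, an element whose pairing with \<open>w\<close> depends linearly on the
  anchor of \<open>w\<close> is a pure covector, namely that linear functional.\<close>

lemma iso_the_pairing:
  assumes "linear \<rho>"
  shows "J (THE e. \<forall>w. pairing E x e w = \<rho> (anchor E x w)) = (0, Blinfun \<rho>)"
proof -
  have "(THE e. \<forall>w. pairing E x e w = \<rho> (anchor E x w)) = inv J (0, Blinfun \<rho>)"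
  proof (rule the_equality)
    show "\<forall>w. pairing E x (inv J (0, Blinfun \<rho>)) w = \<rho> (anchor E x w)"
      by (simp add: iso_pairing iso_inv2 iso_anchor blinfun_apply_Blinfun_linear[OF assms])
    fix e assume e: "\<forall>w. pairing E x e w = \<rho> (anchor E x w)"
    have *: "blinfun_apply (snd (J e)) v + blinfun_apply \<beta> (fst (J e)) = \<rho> v" for v \<beta>
      using e[rule_format, of "inv J (v, \<beta>)"] by (simp add: iso_pairing iso_inv2 iso_anchor)
    have 1: "snd (J e) = Blinfun \<rho>"
      by (rule blinfun_eqI) (use *[of _ 0] in \<open>simp add: blinfun_apply_Blinfun_linear[OF assms]\<close>)
    \<comment> \<open>The inner product with the vector part itself is the covector that detects
      it.\<close>
    have "blinfun_apply (blinfun_inner_left (fst (J e))) (fst (J e)) = 0"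
      using *[of 0 "blinfun_inner_left (fst (J e))"] linear_0[OF assms] by simp
    then have "fst (J e) = 0" by simp
    with 1 have "J e = (0, Blinfun \<rho>)" by (simp add: prod_eq_iff)
    then show "e = inv J (0, Blinfun \<rho>)" by (metis iso_inv1)
  qed
  then show ?thesis by (simp add: iso_inv2)
qed

end

subsection \<open>Reversing the pairing\<close>

definition flip_form :: "'e \<times> ('e::real_normed_vector \<Rightarrow>\<^sub>L real) \<Rightarrow> 'e \<times> ('e \<Rightarrow>\<^sub>L real)" where
  "flip_form a = (fst a, - snd a)"

lemma flip_form_simps [simp]: "fst (flip_form a) = fst a" "snd (flip_form a) = - snd a"
    "flip_form (flip_form a) = a"
  by (simp_all add: flip_form_def)

lemma bounded_linear_flip_form: "bounded_linear flip_form"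
  unfolding flip_form_def[abs_def]
  by (intro bounded_linear_Pair bounded_linear_fst bounded_linear_minus bounded_linear_snd)

lemma covec_coord_minus:
  assumes "atlas M" "q \<in> points M" "p \<in> chart_dom M q"
  shows "covec_coord M q p (- \<alpha>) = - covec_coord M q p \<alpha>"
  by (rule blinfun_eqI) (simp add: covec_coord_apply[OF assms] blinfun.minus_left)

lemma smooth_section_flip:
  assumes M: "atlas M" and a: "smooth_section (std_courant M) W a"
  shows "smooth_section (std_courant M) W (flip_form \<circ> a)"
  by (rule smooth_section_linear_map[OF _ refl bounded_linear_flip_form _ a])
    (simp_all add: M flip_form_def covec_coord_minus[OF M])

text \<open>The vector part of the bracket does not involve the forms and the form part is linear in
  the pair of forms, so a common sign comes out. This is why reversing the pairing leaves the
  algebroid isomorphic to the standard one.\<close>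

lemma std_bracket_flip:
  assumes M: "atlas M" and a: "smooth_section (std_courant M) W a"
      and b: "smooth_section (std_courant M) W b" and p: "p \<in> W"
  shows "bracket (std_courant M) (flip_form \<circ> a) (flip_form \<circ> b) p = flip_form (bracket (std_courant
      M) a b p)"
proof -
  have W: "openin (mfd_top M) W" using a by (simp add: smooth_section_def)
  have pM: "p \<in> points M" using p W openin_atlas[OF M] by blast
  note \<psi> = compatible_chart_chart[OF M pM]
  let ?z = "chart M p p"
  have z: "?z \<in> chart M p ` (chart_dom M p \<inter> W)" using mem_chart_dom[OF M pM] p by blast
  have vec: "fst \<circ> (flip_form \<circ> c) = fst \<circ> c" for c :: "'a \<Rightarrow> 'b \<times> ('b \<Rightarrow>\<^sub>L real)" by auto
  have form: "form_rep M p (snd \<circ> (flip_form \<circ> c)) y = - form_rep M p (snd \<circ> c) y"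
      if "y \<in> chart M p ` chart_dom M p" for c y
    using that chart_inv_chart[OF M pM] by (auto simp: form_rep_def covec_coord_minus[OF M pM])
  have dform: "frechet_derivative (form_rep M p (snd \<circ> (flip_form \<circ> c))) (at ?z)
      u = - frechet_derivative (form_rep M p (snd \<circ> c)) (at ?z) u"
    if c: "smooth_section (std_courant M) W c" for c u
  proof -
    have "frechet_derivative (form_rep M p (snd \<circ> (flip_form \<circ> c))) (at ?z) = frechet_derivative
        (\<lambda>y. - form_rep M p (snd \<circ> c) y) (at ?z)"
      by (rule frechet_derivative_cong[OF open_chart_image[OF M pM] _ form]) (use z in auto)
    also have "\<dots> = (\<lambda>u. - frechet_derivative (form_rep M p (snd \<circ> c)) (at ?z) u)"
      unfolding form_rep_eq
      by (rule frechet_derivative_at[symmetric, OF has_derivative_minus[OF smooth_on_derivative[OF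
          smooth_section_rep(2)[OF M c \<psi>] z]]])
    finally show ?thesis by (rule fun_cong)
  qed
  note fa = smooth_section_flip[OF M a]
  show ?thesis
  proof (rule prod_eqI)
    show "fst (bracket (std_courant M) (flip_form \<circ> a) (flip_form \<circ> b) p) = fst (flip_form (bracket
        (std_courant M) a b p))"
      by (simp only: std_bracket(1)[OF M fa p] std_bracket(1)[OF M a p] vec flip_form_simps)
    show "snd (bracket (std_courant M) (flip_form \<circ> a) (flip_form \<circ> b) p) = snd (flip_form (bracket
        (std_courant M) a b p))"
    proof (rule blinfun_eqI)
      fix v
      have zz: "?z \<in> chart M p ` chart_dom M p" using z by blast
      show "blinfun_apply (snd (bracket (std_courant M) (flip_form \<circ> a) (flip_form \<circ> b) p))
          v = blinfun_apply (snd (flip_form (bracket (std_courant M) a b p))) v"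
        unfolding flip_form_simps blinfun.minus_left std_bracket(2)[OF M fa p] std_bracket(2)[OF M a
            p] vec cour_form_def
          dform[OF a] dform[OF b] form[OF zz] by simp
    qed
  qed
qed

lemma opp_courant_simps [simp]:
  "base (opp_courant E) = base E" "bundle_coord (opp_courant E) = bundle_coord E"
  "pairing (opp_courant E) x v w = - pairing E x v w" "anchor (opp_courant E) = anchor E"
      "bracket (opp_courant E) = bracket E"
  by (simp_all add: opp_courant_def)

lemma courant_iso_opp:
  fixes E :: "('x, 'e::findim_space, 'v::real_normed_vector) courant"
  assumes iso: "courant_iso E J"
  shows "courant_iso (opp_courant E) (flip_form \<circ> J)"
proof -
  note M = iso_atlas[OF iso]
  have bf: "bij (flip_form :: 'e \<times> ('e \<Rightarrow>\<^sub>L real) \<Rightarrow> _)" by (rule bijI') (metis flip_form_simps(3))+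
  have "inv (flip_form :: 'e \<times> ('e \<Rightarrow>\<^sub>L real) \<Rightarrow> _) = flip_form" by (rule inv_equality) simp_all
  then have inv: "inv (flip_form \<circ> J) = inv J \<circ> flip_form"
    by (simp add: o_inv_distrib[OF bf iso_bij[OF iso]])
  have sec: "smooth_section (opp_courant E) W a \<longleftrightarrow> smooth_section E W a" for W a
    by (simp add: smooth_section_def)
  show ?thesis
    unfolding courant_iso_def opp_courant_simps sec inv
  proof (intro conjI M ballI allI impI)
    show "bounded_linear (flip_form \<circ> J)"
      unfolding comp_def by (rule bounded_linear_compose[OF bounded_linear_flip_form iso_linear[OF
          iso]])
    show "bij (flip_form \<circ> J)" by (rule bij_comp[OF iso_bij[OF iso] bf])
    show "bounded_linear (inv J \<circ> flip_form)"
      unfolding comp_def by (rule bounded_linear_compose[OF iso_inv_linear[OF iso]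
          bounded_linear_flip_form])
    show "(flip_form \<circ> J) (bundle_coord E q p v) = bundle_coord (std_courant (base E))
        q p ((flip_form \<circ> J) v)"
      if "q \<in> points (base E)" "p \<in> chart_dom (base E) q" for q p v
      using that by (simp add: iso_bundle_coord[OF iso] flip_form_def covec_coord_minus[OF M])
    show "- pairing E p v w = pairing (std_courant (base E)) p ((flip_form \<circ> J) v) ((flip_form \<circ> J)
        w)" for p v w
      by (simp add: iso_pairing[OF iso] blinfun.minus_left)
    show "anchor E p v = fst ((flip_form \<circ> J) v)" for p v by (simp add: iso_anchor[OF iso])
    fix a b p assume a: "smooth_section E (points (base E)) a"
        and b: "smooth_section E (points (base E)) b" and p: "p \<in> points (base E)"
    show "(flip_form \<circ> J) (bracket E a b p) = bracket (std_courant (base E)) (flip_form \<circ> J \<circ> a)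
        (flip_form \<circ> J \<circ> b) p"
      using std_bracket_flip[OF M _ _ p, of "J \<circ> a" "J \<circ> b"] a b iso_bracket[OF iso a b p]
      by (simp add: iso_smooth_section[OF iso] comp_assoc)
  qed
qed

subsection \<open>Direct products\<close>

definition inl_blinfun :: "'a::real_normed_vector \<Rightarrow>\<^sub>L ('a \<times> 'b::real_normed_vector)" where
  "inl_blinfun = Blinfun (\<lambda>u. (u, 0))"

definition inr_blinfun :: "'b::real_normed_vector \<Rightarrow>\<^sub>L ('a::real_normed_vector \<times> 'b)" where
  "inr_blinfun = Blinfun (\<lambda>v. (0, v))"

lemma inl_inr_apply [simp]:
  "blinfun_apply inl_blinfun u = (u, 0)" "blinfun_apply inr_blinfun v = (0, v)"
  unfolding inl_blinfun_def inr_blinfun_def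
  by (subst bounded_linear_Blinfun_apply; intro bounded_linear_Pair bounded_linear_ident
      bounded_linear_zero refl)+

text \<open>The canonical identification of the product of two bundles of vectors and covectors with
  the bundle over the product manifold: a pair of covectors becomes the sum of their pullbacks under
  the projections.\<close>

definition std_join :: "('e::real_normed_vector \<times> ('e \<Rightarrow>\<^sub>L real)) \<times> ('f::real_normed_vector \<times> ('f \<Rightarrow>\<^sub>L
    real)) \<Rightarrow>
    ('e \<times> 'f) \<times> (('e \<times> 'f) \<Rightarrow>\<^sub>L real)" where
  "std_join a = ((fst (fst a), fst (snd a)), (snd (fst a) o\<^sub>L fst_blinfun) + (snd (snd a)
      o\<^sub>L snd_blinfun))"

definition std_split :: "('e::real_normed_vector \<times> 'f::real_normed_vector) \<times> (('e \<times> 'f) \<Rightarrow>\<^sub>L real) \<Rightarrow>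
    ('e \<times> ('e \<Rightarrow>\<^sub>L real)) \<times> ('f \<times> ('f \<Rightarrow>\<^sub>L real))" where
  "std_split c = ((fst (fst c), snd c o\<^sub>L inl_blinfun), (snd (fst c), snd c o\<^sub>L inr_blinfun))"

lemma std_join_simps [simp]:
  "fst (std_join a) = (fst (fst a), fst (snd a))"
  "blinfun_apply (snd (std_join a)) v = blinfun_apply (snd (fst a)) (fst v) + blinfun_apply (snd
      (snd a)) (snd v)"
  by (simp_all add: std_join_def blinfun.add_left)

lemma std_split_join [simp]: "std_split (std_join a) = a"
  by (auto simp: std_split_def std_join_def prod_eq_iff blinfun.add_left intro!: blinfun_eqI)

lemma std_join_split [simp]: "std_join (std_split c) = c"
proof (rule prod_eqI)
  have "blinfun_apply (snd c) (u, 0) + blinfun_apply (snd c) (0, v) = blinfun_apply (snd c) (u, v)"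
      for u v
    by (simp flip: blinfun.add_right)
  then show "snd (std_join (std_split c)) = snd c"
    by (intro blinfun_eqI) (simp add: std_split_def)
qed (simp add: std_split_def)

lemma bounded_linear_std_join: "bounded_linear std_join"
  unfolding std_join_def[abs_def]
  by (intro bounded_linear_Pair bounded_linear_add
      bounded_linear_compose[OF bounded_bilinear.bounded_linear_left[OF
          bounded_bilinear_blinfun_compose]]
      bounded_linear_compose[OF bounded_linear_fst] bounded_linear_compose[OF bounded_linear_snd]
      bounded_linear_fst bounded_linear_snd)

lemma bounded_linear_std_split: "bounded_linear std_split"
  unfolding std_split_def[abs_def]
  by (intro bounded_linear_Pair
      bounded_linear_compose[OF bounded_bilinear.bounded_linear_left[OF
          bounded_bilinear_blinfun_compose]]
      bounded_linear_compose[OF bounded_linear_fst] bounded_linear_compose[OF bounded_linear_snd]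
      bounded_linear_fst bounded_linear_snd)

lemma vec_rep_at_center:
  assumes "atlas M" "p \<in> points M"
  shows "vec_rep M p X (chart M p p) = X p"
  by (simp add: vec_rep_def chart_inv_chart[OF assms mem_chart_dom[OF assms]]
      vec_coord_self[OF assms])

lemma form_rep_at_center:
  assumes "atlas M" "p \<in> points M"
  shows "form_rep M p \<alpha> (chart M p p) = \<alpha> p"
  by (simp add: form_rep_def chart_inv_chart[OF assms mem_chart_dom[OF assms]]
      covec_coord_self[OF assms])

text \<open>\<open>D\<close> is the derivative at \<open>(x, y)\<close> of the pair \<open>(A, A')\<close> of sections in the coordinates given
    by the
  preferred charts; the derivatives of the slices are its restrictions.\<close>

definition pair_derivative where
  "pair_derivative M N A A' x y D \<longleftrightarrow> linear D \<and>
    (\<forall>h. frechet_derivative (vec_rep (M \<times>\<^sub>M N) (x, y) (fst \<circ> (\<lambda>p. std_join (A p, A' p))))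
        (at (chart (M \<times>\<^sub>M N) (x, y) (x, y))) h = fst (std_join (D h))) \<and>
    (\<forall>h. frechet_derivative (form_rep (M \<times>\<^sub>M N) (x, y) (snd \<circ> (\<lambda>p. std_join (A p, A' p))))
        (at (chart (M \<times>\<^sub>M N) (x, y) (x, y))) h = snd (std_join (D h))) \<and>
    (\<forall>u. frechet_derivative (vec_rep M x (fst \<circ> (\<lambda>x'. A (x', y)))) (at (chart M x x))
        u = fst (fst (D (u, 0)))) \<and>
    (\<forall>u. frechet_derivative (form_rep M x (snd \<circ> (\<lambda>x'. A (x', y)))) (at (chart M x x))
        u = snd (fst (D (u, 0)))) \<and>
    (\<forall>v. frechet_derivative (vec_rep N y (fst \<circ> (\<lambda>y'. A' (x, y')))) (at (chart N y y))
        v = fst (snd (D (0, v)))) \<and>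
    (\<forall>v. frechet_derivative (form_rep N y (snd \<circ> (\<lambda>y'. A' (x, y')))) (at (chart N y y))
        v = snd (snd (D (0, v)))) \<and>
    ((\<lambda>y'. A (x, y')) \<circ> chart_inv N y has_derivative (\<lambda>v. fst (D (0, v)))) (at (chart N y y)) \<and>
    ((\<lambda>x'. A' (x', y)) \<circ> chart_inv M x has_derivative (\<lambda>u. snd (D (u, 0)))) (at (chart M x x))"

lemma pair_derivativeD:
  assumes "pair_derivative M N A A' x y D"
  shows "linear D"
    and "frechet_derivative (vec_rep (M \<times>\<^sub>M N) (x, y) (fst \<circ> (\<lambda>p. std_join (A p, A' p))))
        (at (chart (M \<times>\<^sub>M N) (x, y) (x, y))) h = fst (std_join (D h))"
    and "frechet_derivative (form_rep (M \<times>\<^sub>M N) (x, y) (snd \<circ> (\<lambda>p. std_join (A p, A' p))))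
        (at (chart (M \<times>\<^sub>M N) (x, y) (x, y))) h = snd (std_join (D h))"
    and "frechet_derivative (vec_rep M x (fst \<circ> (\<lambda>x'. A (x', y)))) (at (chart M x x))
        u = fst (fst (D (u, 0)))"
    and "frechet_derivative (form_rep M x (snd \<circ> (\<lambda>x'. A (x', y)))) (at (chart M x x))
        u = snd (fst (D (u, 0)))"
    and "frechet_derivative (vec_rep N y (fst \<circ> (\<lambda>y'. A' (x, y')))) (at (chart N y y))
        v = fst (snd (D (0, v)))"
    and "frechet_derivative (form_rep N y (snd \<circ> (\<lambda>y'. A' (x, y')))) (at (chart N y y))
        v = snd (snd (D (0, v)))"
    and "((\<lambda>y'. A (x, y')) \<circ> chart_inv N y has_derivative (\<lambda>v. fst (D (0, v)))) (at (chart N y y))"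
    and "((\<lambda>x'. A' (x', y)) \<circ> chart_inv M x has_derivative (\<lambda>u. snd (D (u, 0)))) (at (chart M x x))"
  using assms unfolding pair_derivative_def by blast+

context
  fixes M :: "('p, 'e::findim_space) mfd" and N :: "('q, 'f::findim_space) mfd"
  assumes M: "atlas M" and N: "atlas N"
begin

private lemmas P = atlas_prod[OF M N]

text \<open>The derivative of a product transition is block diagonal, so vectors and covectors of
  the two factors transform independently.\<close>

lemma bundle_coord_join:
  assumes q: "q \<in> points M" "q' \<in> points N" and p: "p \<in> chart_dom M q" "p' \<in> chart_dom N q'"
  shows "bundle_coord (std_courant (M \<times>\<^sub>M N)) (q, q') (p, p') (std_join (a, b))
    = std_join (bundle_coord (std_courant M) q p a, bundle_coord (std_courant N) q' p' b)"
proof -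
  have pM: "p \<in> points M" "p' \<in> points N" using p chart_dom_subset[OF M q(1)] chart_dom_subset[OF N
      q(2)] by auto
  have pd: "p \<in> chart_dom M p" "p' \<in> chart_dom N p'" using mem_chart_dom[OF M pM(1)]
      mem_chart_dom[OF N pM(2)] .
  have v: "vec_coord (M \<times>\<^sub>M N) (q, q') (p, p') = map_prod (vec_coord M q p) (vec_coord N q' p')"
    using transition_derivative_prod[OF M N pM q pd(1) p(1) pd(2) p(2)] by (simp add: vec_coord_def)
  have c: "coord_deriv_inv (M \<times>\<^sub>M N) (chart_dom (M \<times>\<^sub>M N) (q, q')) (chart (M \<times>\<^sub>M N) (q, q')) (p, p')
     = map_prod (coord_deriv_inv M (chart_dom M q) (chart M q) p) (coord_deriv_inv N (chart_dom N
         q') (chart N q') p')"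
    using transition_derivative_prod[OF M N q pM p(1) pd(1) p(2) pd(2)]
    unfolding coord_deriv_inv_def chart_inv_def[symmetric] by simp
  have qP: "(q, q') \<in> points (M \<times>\<^sub>M N)" and pP: "(p, p') \<in> chart_dom (M \<times>\<^sub>M N) (q, q')" using q p
      by auto
  show ?thesis
  proof (rule prod_eqI)
    show "snd (bundle_coord (std_courant (M \<times>\<^sub>M N)) (q, q') (p, p') (std_join (a, b)))
        = snd (std_join (bundle_coord (std_courant M) q p a, bundle_coord (std_courant N) q' p' b))"
      by (rule blinfun_eqI)
        (simp only: bundle_coord_std snd_conv covec_coord_apply[OF P qP pP]
            c std_join_simps fst_conv
          covec_coord_apply[OF M q(1) p(1)] covec_coord_apply[OF N q(2) p(2)]
              fst_map_prod snd_map_prod)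
  qed (simp add: v)
qed

context
  fixes A :: "'p \<times> 'q \<Rightarrow> 'e \<times> ('e \<Rightarrow>\<^sub>L real)" and A' :: "'p \<times> 'q \<Rightarrow> 'f \<times> ('f \<Rightarrow>\<^sub>L real)"
  assumes s: "smooth_section (std_courant (M \<times>\<^sub>M N)) (points (M \<times>\<^sub>M N)) (\<lambda>p. std_join (A p, A' p))"
begin

text \<open>The pair \<open>(A, A')\<close> in the product chart, trivialised factor by factor. Kept
  split, it restricts directly to the slices; its smoothness is carried over from the joined section
  by \<open>std_split\<close>.\<close>

definition pair_rep :: "'p \<Rightarrow> 'q \<Rightarrow> 'e \<times> 'f \<Rightarrow> ('e \<times> ('e \<Rightarrow>\<^sub>L real)) \<times> ('f \<times> ('f \<Rightarrow>\<^sub>L real))" where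
  "pair_rep q q' z = (let p = chart_inv M q (fst z); p' = chart_inv N q' (snd z) in
     (bundle_coord (std_courant M) q p (A (p, p')), bundle_coord (std_courant N) q' p' (A' (p,
         p'))))"

private abbreviation (input) "pair_dom q q' \<equiv> chart M q ` chart_dom M q \<times> chart N q' ` chart_dom N
    q'"

lemma join_pair_rep:
  assumes q: "q \<in> points M" "q' \<in> points N" and z: "z \<in> pair_dom q q'"
  shows "std_join (pair_rep q q' z) = bundle_coord (std_courant (M \<times>\<^sub>M N)) (q, q')
      (chart_inv (M \<times>\<^sub>M N) (q, q') z)
      (std_join (A (chart_inv (M \<times>\<^sub>M N) (q, q') z), A' (chart_inv (M \<times>\<^sub>M N) (q, q') z)))"
proof -
  obtain x y where xy: "x \<in> chart_dom M q" "y \<in> chart_dom N q'" "z = (chart M q x, chart N q' y)"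
      using z by auto
  have e: "chart_inv (M \<times>\<^sub>M N) (q, q') z = (x, y)"
    using chart_inv_prod[OF inj_chart[OF M q(1)] inj_chart[OF N q(2)], of "fst z"
        "snd z"] xy chart_inv_chart[OF M q(1) xy(1)] chart_inv_chart[OF N q(2) xy(2)] by simp
  show ?thesis
    unfolding e bundle_coord_join[OF q xy(1,2)] pair_rep_def Let_def
    by (simp only: xy(3) fst_conv snd_conv chart_inv_chart[OF M q(1) xy(1)] chart_inv_chart[OF N
        q(2) xy(2)])
qed

lemma open_pair_dom: "q \<in> points M \<Longrightarrow> q' \<in> points N \<Longrightarrow> open (pair_dom q q')"
  by (intro open_Times open_chart_image[OF M] open_chart_image[OF N])

lemma smooth_join_pair_rep:
  assumes q: "q \<in> points M" "q' \<in> points N"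
  shows "smooth_on (pair_dom q q') (\<lambda>z. std_join (pair_rep q q' z))"
proof -
  have im: "chart (M \<times>\<^sub>M N) (q, q') ` (chart_dom (M \<times>\<^sub>M N) (q, q') \<inter> points (M \<times>\<^sub>M N)) = pair_dom q q'"
    using chart_dom_subset[OF M q(1)] chart_dom_subset[OF N q(2)]
        by (simp add: map_prod_image_Int Int_absorb2)
  have qP: "(q, q') \<in> points (M \<times>\<^sub>M N)" using q by simp
  have "smooth_on (pair_dom q q') (\<lambda>z. bundle_coord (std_courant (M \<times>\<^sub>M N)) (q, q')
      (chart_inv (M \<times>\<^sub>M N) (q, q') z)
      (std_join (A (chart_inv (M \<times>\<^sub>M N) (q, q') z), A' (chart_inv (M \<times>\<^sub>M N) (q, q') z))))"
    using s qP unfolding smooth_section_def base_std_courant im[symmetric] by blast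
  then show ?thesis
    by (rule smooth_on_cong[OF open_pair_dom[OF q] join_pair_rep[OF q, symmetric], rotated])
qed

lemma smooth_pair_rep:
  assumes q: "q \<in> points M" "q' \<in> points N"
  shows "smooth_on (pair_dom q q') (pair_rep q q')"
  using smooth_on_linear[OF bounded_linear_std_split open_pair_dom[OF q] smooth_join_pair_rep[OF q]]
      by simp

lemma smooth_section_slice1:
  assumes y: "y \<in> points N"
  shows "smooth_section (std_courant M) (points M) (\<lambda>x. A (x, y))"
  unfolding smooth_section_def base_std_courant
proof (intro conjI ballI openin_points[OF M])
  fix q assume q: "q \<in> points M"
  have im: "chart M q ` (chart_dom M q \<inter> points M) = chart M q ` chart_dom M q"
    using chart_dom_subset[OF M q] by (simp add: Int_absorb2)
  note S = open_chart_image[OF M q]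
  have sub: "(\<lambda>u. (u, chart N y y)) ` (chart M q ` chart_dom M q) \<subseteq> pair_dom q y"
      using mem_chart_dom[OF N y] by auto
  have sm: "smooth_on (chart M q ` chart_dom M q) (\<lambda>u. (u, chart N y y))"
    by (intro smooth_on_Pair S smooth_on_id smooth_on_const)
  show "smooth_on (chart M q ` (chart_dom M q \<inter> points M)) (\<lambda>x. bundle_coord (std_courant M)
      q (chart_inv M q x) (A (chart_inv M q x, y)))"
    unfolding im
    by (rule smooth_on_cong[OF S _ smooth_on_linear[OF bounded_linear_fst S smooth_on_compose[OF S
        open_pair_dom[OF q y] sub sm smooth_pair_rep[OF q y]]]])
      (simp add: pair_rep_def Let_def chart_inv_chart[OF N y mem_chart_dom[OF N y]]
          del: bundle_coord_std)
qed

lemma smooth_section_slice2: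
  assumes x: "x \<in> points M"
  shows "smooth_section (std_courant N) (points N) (\<lambda>y. A' (x, y))"
  unfolding smooth_section_def base_std_courant
proof (intro conjI ballI openin_points[OF N])
  fix q assume q: "q \<in> points N"
  have im: "chart N q ` (chart_dom N q \<inter> points N) = chart N q ` chart_dom N q"
    using chart_dom_subset[OF N q] by (simp add: Int_absorb2)
  note S = open_chart_image[OF N q]
  have sub: "(\<lambda>v. (chart M x x, v)) ` (chart N q ` chart_dom N q) \<subseteq> pair_dom x q"
      using mem_chart_dom[OF M x] by auto
  have sm: "smooth_on (chart N q ` chart_dom N q) (\<lambda>v. (chart M x x, v))"
    by (intro smooth_on_Pair S smooth_on_id smooth_on_const)
  show "smooth_on (chart N q ` (chart_dom N q \<inter> points N)) (\<lambda>z. bundle_coord (std_courant N)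
      q (chart_inv N q z) (A' (x, chart_inv N q z)))"
    unfolding im
    by (rule smooth_on_cong[OF S _ smooth_on_linear[OF bounded_linear_snd S smooth_on_compose[OF S
        open_pair_dom[OF x q] sub sm smooth_pair_rep[OF x q]]]])
      (simp add: pair_rep_def Let_def chart_inv_chart[OF M x mem_chart_dom[OF M x]]
          del: bundle_coord_std)
qed

text \<open>All clauses are read off from the single derivative \<open>D\<close> of
  \<open>pair_rep\<close> at the centre. In the last two, one factor is held at the centre of its
  chart, where the coordinate change on the fibre is the identity; this is why the derivatives
  across the factors in the product bracket can be written without trivialisation.\<close>

lemma pair_rep_derivatives:
  assumes x: "x \<in> points M" and y: "y \<in> points N"
  shows "\<exists>D. pair_derivative M N A A' x y D"
proof -
  let ?z1 = "chart M x x" and ?z2 = "chart N y y" and ?R = "pair_rep x y"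
  define D where "D = frechet_derivative ?R (at (?z1, ?z2))"
  have z: "(?z1, ?z2) \<in> pair_dom x y" using mem_chart_dom[OF M x] mem_chart_dom[OF N y] by blast
  have d: "(?R has_derivative D) (at (?z1, ?z2))"
    unfolding D_def by (rule smooth_on_derivative[OF smooth_pair_rep[OF x y] z])
  note dj = bounded_linear.has_derivative[OF bounded_linear_std_join d]
  note d1 = has_derivative_slice(1)[OF d] and d2 = has_derivative_slice(2)[OF d]
  note o1 = open_chart_image[OF M x] and o2 = open_chart_image[OF N y] and o = open_pair_dom[OF x y]
  have z1: "?z1 \<in> chart M x ` chart_dom M x" and z2: "?z2 \<in> chart N y ` chart_dom N y" using z
      by auto
  have c: "chart (M \<times>\<^sub>M N) (x, y) (x, y) = (?z1, ?z2)" by simp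
  have i1: "chart_inv M x ?z1 = x" and i2: "chart_inv N y ?z2 = y"
    by (rule chart_inv_chart[OF M x mem_chart_dom[OF M x]], rule chart_inv_chart[OF N y
        mem_chart_dom[OF N y]])
  show ?thesis
    unfolding pair_derivative_def
  proof (intro exI[of _ D] conjI allI)
    show "linear D" by (rule has_derivative_linear[OF d])
    show "frechet_derivative (vec_rep (M \<times>\<^sub>M N) (x, y) (fst \<circ> (\<lambda>p. std_join (A p, A' p))))
        (at (chart (M \<times>\<^sub>M N) (x, y) (x, y))) h = fst (std_join (D h))" for h
      unfolding c
      by (rule fun_cong[OF frechet_derivative_at[symmetric,
          OF has_derivative_transform_within_open[OF has_derivative_fst[OF dj] o z]]])
        (simp only: join_pair_rep[OF x y] bundle_coord_std vec_rep_def fst_conv o_apply)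
    show "frechet_derivative (form_rep (M \<times>\<^sub>M N) (x, y) (snd \<circ> (\<lambda>p. std_join (A p, A' p))))
        (at (chart (M \<times>\<^sub>M N) (x, y) (x, y))) h = snd (std_join (D h))" for h
      unfolding c
      by (rule fun_cong[OF frechet_derivative_at[symmetric,
          OF has_derivative_transform_within_open[OF has_derivative_snd[OF dj] o z]]])
        (simp only: join_pair_rep[OF x y] bundle_coord_std form_rep_def snd_conv o_apply)
    show "frechet_derivative (vec_rep M x (fst \<circ> (\<lambda>x'. A (x', y)))) (at ?z1) u = fst (fst (D (u,
        0)))" for u
      by (rule fun_cong[OF frechet_derivative_at[symmetric,
          OF has_derivative_transform_within_open[OF has_derivative_fst[OF has_derivative_fst[OF
          d1]] o1 z1]]])
        (simp add: pair_rep_def Let_def i2 vec_rep_def)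
    show "frechet_derivative (form_rep M x (snd \<circ> (\<lambda>x'. A (x', y)))) (at ?z1) u = snd (fst (D (u,
        0)))" for u
      by (rule fun_cong[OF frechet_derivative_at[symmetric,
          OF has_derivative_transform_within_open[OF has_derivative_snd[OF has_derivative_fst[OF
          d1]] o1 z1]]])
        (simp add: pair_rep_def Let_def i2 form_rep_def)
    show "frechet_derivative (vec_rep N y (fst \<circ> (\<lambda>y'. A' (x, y')))) (at ?z2) v = fst (snd (D (0,
        v)))" for v
      by (rule fun_cong[OF frechet_derivative_at[symmetric,
          OF has_derivative_transform_within_open[OF has_derivative_fst[OF has_derivative_snd[OF
          d2]] o2 z2]]])
        (simp add: pair_rep_def Let_def i1 vec_rep_def)
    show "frechet_derivative (form_rep N y (snd \<circ> (\<lambda>y'. A' (x, y')))) (at ?z2) v = snd (snd (D (0,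
        v)))" for v
      by (rule fun_cong[OF frechet_derivative_at[symmetric,
          OF has_derivative_transform_within_open[OF has_derivative_snd[OF has_derivative_snd[OF
          d2]] o2 z2]]])
        (simp add: pair_rep_def Let_def i1 form_rep_def)
    show "((\<lambda>y'. A (x, y')) \<circ> chart_inv N y has_derivative (\<lambda>v. fst (D (0, v)))) (at ?z2)"
      by (rule has_derivative_transform_within_open[OF has_derivative_fst[OF d2] o2 z2])
        (simp add: pair_rep_def Let_def i1 vec_coord_self[OF M x] covec_coord_self[OF M x])
    show "((\<lambda>x'. A' (x', y)) \<circ> chart_inv M x has_derivative (\<lambda>u. snd (D (u, 0)))) (at ?z1)"
      by (rule has_derivative_transform_within_open[OF has_derivative_snd[OF d1] o1 z1])
        (simp add: pair_rep_def Let_def i2 vec_coord_self[OF N y] covec_coord_self[OF N y])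
  qed
qed

end

end

lemma prod_courant_simps [simp]:
  "base (E \<times>\<^sub>C F) = base E \<times>\<^sub>M base F"
  "bundle_coord (E \<times>\<^sub>C F) (q, q') (p, p') v = (bundle_coord E q p (fst v), bundle_coord F q' p' (snd
      v))"
  "pairing (E \<times>\<^sub>C F) (x, y) v w = pairing E x (fst v) (fst w) + pairing F y (snd v) (snd w)"
  "anchor (E \<times>\<^sub>C F) (x, y) v = (anchor E x (fst v), anchor F y (snd v))"
  by (simp_all add: prod_courant_def map_prod_def split_beta)

lemma prod_bracket_eq:
  "bracket (E \<times>\<^sub>C F) a b (x, y) =
     (bracket E (\<lambda>x'. fst (a (x', y))) (\<lambda>x'. fst (b (x', y))) x
        + point_deriv (base F) y (anchor F y (snd (a (x, y)))) (\<lambda>y'. fst (b (x, y')))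
        - point_deriv (base F) y (anchor F y (snd (b (x, y)))) (\<lambda>y'. fst (a (x, y')))
        + (THE e. \<forall>w. pairing E x e w = pairing F y (point_deriv (base E) x (anchor E x w)
            (\<lambda>x'. snd (a (x', y)))) (snd (b (x, y)))),
      bracket F (\<lambda>y'. snd (a (x, y'))) (\<lambda>y'. snd (b (x, y'))) y
        + point_deriv (base E) x (anchor E x (fst (a (x, y)))) (\<lambda>x'. snd (b (x', y)))
        - point_deriv (base E) x (anchor E x (fst (b (x, y)))) (\<lambda>x'. snd (a (x', y)))
        + (THE e. \<forall>w. pairing F y e w = pairing E x (point_deriv (base F) y (anchor F y w)
            (\<lambda>y'. fst (a (x, y')))) (fst (b (x, y)))))"
  by (simp add: prod_courant_def Let_def)

text \<open>\<open>J\<close> does not depend on the point, so it passes through the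
  derivative.\<close>

lemma iso_point_deriv:
  assumes iso: "courant_iso E J" and d: "((\<lambda>x. J (f x)) \<circ> chart_inv M y has_derivative f')
      (at (chart M y y))"
  shows "point_deriv M y u f = inv J (f' u)"
proof -
  have "((\<lambda>z. inv J (((\<lambda>x. J (f x)) \<circ> chart_inv M y) z)) has_derivative (\<lambda>u. inv J (f' u)))
      (at (chart M y y))"
    by (rule bounded_linear.has_derivative[OF iso_inv_linear[OF iso] d])
  then have "((f \<circ> chart_inv M y) has_derivative (\<lambda>u. inv J (f' u))) (at (chart M y y))"
    by (simp add: iso_inv1[OF iso] comp_def)
  from fun_cong[OF frechet_derivative_at[OF this], of u] show ?thesis by (simp add: point_deriv_def)
qed

definition join_iso :: "('v \<Rightarrow> 'e::real_normed_vector \<times> ('e \<Rightarrow>\<^sub>L real)) \<Rightarrow> ('w \<Rightarrow> 'f::real_normed_vector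
    \<times> ('f \<Rightarrow>\<^sub>L real)) \<Rightarrow>
    'v \<times> 'w \<Rightarrow> ('e \<times> 'f) \<times> (('e \<times> 'f) \<Rightarrow>\<^sub>L real)" where
  "join_iso J J' v = std_join (J (fst v), J' (snd v))"

context
  fixes E :: "('x, 'e::findim_space, 'v::real_normed_vector) courant" and J
    and F :: "('y, 'f::findim_space, 'w::real_normed_vector) courant" and J'
  assumes E: "courant_iso E J" and F: "courant_iso F J'"
begin

private lemmas M = iso_atlas[OF E] and N = iso_atlas[OF F]

text \<open>Everything is expressed by the values of the sections at \<open>(x, y)\<close> and their
  derivatives \<open>DA\<close> and \<open>DB\<close>. The brackets of the slices contribute the
  derivatives within one factor; the terms with \<open>point_deriv\<close> and the covectors
  \<open>Blinfun \<rho>\<close> and \<open>Blinfun \<rho>'\<close> contribute exactly the mixed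
  derivatives in the coordinate formula on the product.\<close>

lemma join_iso_bracket:
  assumes a: "smooth_section (std_courant (base E \<times>\<^sub>M base F)) (points (base E \<times>\<^sub>M base F))
      (join_iso J J' \<circ> a)"
    and b: "smooth_section (std_courant (base E \<times>\<^sub>M base F)) (points (base E \<times>\<^sub>M base F))
        (join_iso J J' \<circ> b)"
    and x: "x \<in> points (base E)" and y: "y \<in> points (base F)"
  shows "join_iso J J' (bracket (E \<times>\<^sub>C F) a b (x, y)) = bracket (std_courant (base E \<times>\<^sub>M base F))
      (join_iso J J' \<circ> a) (join_iso J J' \<circ> b) (x, y)"
proof -
  let ?M = "base E" and ?N = "base F"
  let ?P = "?M \<times>\<^sub>M ?N"
  define A A' B B' where AB: "A p = J (fst (a p))" "A' p = J' (snd (a p))" "B p = J (fst (b p))"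
      "B' p = J' (snd (b p))" for p
  have ja: "join_iso J J' \<circ> a = (\<lambda>p. std_join (A p, A' p))" and jb: "join_iso J J' \<circ> b =
      (\<lambda>p. std_join (B p, B' p))"
    by (auto simp: join_iso_def AB)
  note sa = a[unfolded ja] and sb = b[unfolded jb]
  obtain DA where pA: "pair_derivative ?M ?N A A' x y DA"
    using pair_rep_derivatives[OF M N sa x y] by blast
  note lA = pair_derivativeD(1)[OF pA] and DA = pair_derivativeD(2-)[OF pA]
  obtain DB where pB: "pair_derivative ?M ?N B B' x y DB"
    using pair_rep_derivatives[OF M N sb x y] by blast
  note lB = pair_derivativeD(1)[OF pB] and DB = pair_derivativeD(2-)[OF pB]
  have pd: "point_deriv ?N y v (\<lambda>y'. fst (a (x, y'))) = inv J (fst (DA (0, v)))"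
    "point_deriv ?N y v (\<lambda>y'. fst (b (x, y'))) = inv J (fst (DB (0, v)))"
    "point_deriv ?M x u (\<lambda>x'. snd (a (x', y))) = inv J' (snd (DA (u, 0)))"
    "point_deriv ?M x u (\<lambda>x'. snd (b (x', y))) = inv J' (snd (DB (u, 0)))" for u v
    using iso_point_deriv[OF E DA(7)[unfolded AB]] iso_point_deriv[OF E DB(7)[unfolded AB]]
      iso_point_deriv[OF F DA(8)[unfolded AB]] iso_point_deriv[OF F DB(8)[unfolded AB]] by blast+
  \<comment> \<open>\<open>\<rho> u\<close> pairs the derivative of \<open>A'\<close> in direction
    \<open>u\<close> with \<open>B'\<close>, and \<open>\<rho>'\<close> does the same with the
    factors exchanged; these are the functionals in the two \<open>THE\<close> terms.\<close>
  define \<rho> where "\<rho> u = blinfun_apply (snd (snd (DA (u, 0)))) (fst (B' (x, y))) + blinfun_apply (snd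
      (B' (x, y))) (fst (snd (DA (u, 0))))" for u
  define \<rho>' where "\<rho>' v = blinfun_apply (snd (fst (DA (0, v)))) (fst (B (x, y)))
      + blinfun_apply (snd (B (x, y))) (fst (fst (DA (0, v))))" for v
  have DA1: "DA (u + u', 0) = DA (u, 0) + DA (u', 0)" "DA (r *\<^sub>R u, 0) = r *\<^sub>R DA (u, 0)" for u u' r
    using linear_add[OF lA, of "(u, 0)" "(u', 0)"] linear_scale[OF lA, of r "(u, 0)"] by simp_all
  have DA2: "DA (0, v + v') = DA (0, v) + DA (0, v')" "DA (0, r *\<^sub>R v) = r *\<^sub>R DA (0, v)" for v v' r
    using linear_add[OF lA, of "(0, v)" "(0, v')"] linear_scale[OF lA, of r "(0, v)"] by simp_all
  have l\<rho>: "linear \<rho>" unfolding \<rho>_def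
    by (rule linearI) (simp_all add: DA1 blinfun.add_left blinfun.add_right blinfun.scaleR_left
        blinfun.scaleR_right algebra_simps)
  have l\<rho>': "linear \<rho>'" unfolding \<rho>'_def
    by (rule linearI) (simp_all add: DA2 blinfun.add_left blinfun.add_right blinfun.scaleR_left
        blinfun.scaleR_right algebra_simps)
  have the1: "J (THE e. \<forall>w. pairing E x e w = pairing F y (inv J' (snd (DA (anchor E x w, 0))))
      (snd (b (x, y)))) = (0, Blinfun \<rho>)"
    using iso_the_pairing[OF E l\<rho>, of x] by (simp add: \<rho>_def iso_pairing[OF F] iso_inv2[OF F] AB)
  have the2: "J' (THE e. \<forall>w. pairing F y e w = pairing E x (inv J (fst (DA (0, anchor F y w))))
      (fst (b (x, y)))) = (0, Blinfun \<rho>')"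
    using iso_the_pairing[OF F l\<rho>', of y] by (simp add: \<rho>'_def iso_pairing[OF E] iso_inv2[OF E] AB)
  have sl: "J \<circ> (\<lambda>x'. fst (a (x', y))) = (\<lambda>x'. A (x', y))" "J \<circ> (\<lambda>x'. fst (b (x', y)))
      = (\<lambda>x'. B (x', y))"
    "J' \<circ> (\<lambda>y'. snd (a (x, y'))) = (\<lambda>y'. A' (x, y'))" "J' \<circ> (\<lambda>y'. snd (b (x, y'))) = (\<lambda>y'. B' (x,
        y'))"
    by (auto simp: AB)
  note sA = smooth_section_slice1[OF M N sa y] and sB = smooth_section_slice1[OF M N sb y]
    and sA' = smooth_section_slice2[OF M N sa x] and sB' = smooth_section_slice2[OF M N sb x]
  have br1: "J (bracket E (\<lambda>x'. fst (a (x', y))) (\<lambda>x'. fst (b (x', y))) x) = bracket (std_courant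
      ?M) (\<lambda>x'. A (x', y)) (\<lambda>x'. B (x', y)) x"
    using iso_bracket[OF E _ _ x, of "\<lambda>x'. fst (a (x', y))" "\<lambda>x'. fst (b (x', y))"] sA sB
    unfolding iso_smooth_section[OF E] sl by blast
  have br2: "J' (bracket F (\<lambda>y'. snd (a (x, y'))) (\<lambda>y'. snd (b (x, y'))) y) = bracket (std_courant
      ?N) (\<lambda>y'. A' (x, y')) (\<lambda>y'. B' (x, y')) y"
    using iso_bracket[OF F _ _ y, of "\<lambda>y'. snd (a (x, y'))" "\<lambda>y'. snd (b (x, y'))"] sA' sB'
    unfolding iso_smooth_section[OF F] sl by blast
  note lJ = bounded_linear.linear[OF iso_linear[OF E]]
      and lJ' = bounded_linear.linear[OF iso_linear[OF F]]
  have anc: "anchor E x (fst (a (x, y))) = fst (A (x, y))" "anchor E x (fst (b (x, y))) = fst (B (x,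
      y))"
    "anchor F y (snd (a (x, y))) = fst (A' (x, y))" "anchor F y (snd (b (x, y))) = fst (B' (x, y))"
    by (simp_all add: iso_anchor[OF E] iso_anchor[OF F] AB)
  have L: "join_iso J J' (bracket (E \<times>\<^sub>C F) a b (x, y)) = std_join
     (bracket (std_courant ?M) (\<lambda>x'. A (x', y)) (\<lambda>x'. B (x', y)) x + fst (DB (0, fst (A' (x, y))))
         - fst (DA (0, fst (B' (x, y)))) + (0, Blinfun \<rho>),
      bracket (std_courant ?N) (\<lambda>y'. A' (x, y')) (\<lambda>y'. B' (x, y')) y + snd (DB (fst (A (x, y)), 0))
          - snd (DA (fst (B (x, y)), 0)) + (0, Blinfun \<rho>'))"
    (is "_ = std_join (?L1, ?L2)")
    unfolding join_iso_def prod_bracket_eq pd anc fst_conv snd_conv linear_add[OF lJ]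
        linear_diff[OF lJ] linear_add[OF lJ'] linear_diff[OF lJ']
      the1 the2 br1 br2 iso_inv2[OF E] iso_inv2[OF F] ..
  have DAs: "DA (u, v) = DA (u, 0) + DA (0, v)" and DBs: "DB (u, v) = DB (u, 0) + DB (0, v)" for u v
    using linear_add[OF lA, of "(u, 0)" "(0, v)"] linear_add[OF lB, of "(u, 0)" "(0, v)"]
        by simp_all
  have PP: "atlas ?P" by (rule atlas_prod[OF M N])
  have xyP: "(x, y) \<in> points ?P" using x y by simp
  note cen = vec_rep_at_center[OF PP xyP] form_rep_at_center[OF PP xyP] vec_rep_at_center[OF M x]
      form_rep_at_center[OF M x]
    vec_rep_at_center[OF N y] form_rep_at_center[OF N y]
  show ?thesis
    unfolding L ja jb
  proof (rule prod_eqI)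
    show "fst (std_join (?L1, ?L2))
      = fst (bracket (std_courant ?P) (\<lambda>p. std_join (A p, A' p)) (\<lambda>p. std_join (B p, B' p)) (x, y))"
      unfolding std_join_simps fst_conv snd_conv fst_add fst_diff std_bracket(1)[OF M sA x]
          std_bracket(1)[OF N sA' y] std_bracket(1)[OF PP sa xyP]
        cour_vec_def DA DB cen o_apply DAs[of "fst (B (x, y))" "fst (B' (x, y))"] DBs[of "fst (A (x,
            y))" "fst (A' (x, y))"]
      by simp
    show "snd (std_join (?L1, ?L2))
      = snd (bracket (std_courant ?P) (\<lambda>p. std_join (A p, A' p)) (\<lambda>p. std_join (B p, B' p)) (x, y))"
    proof (rule blinfun_eqI)
      fix w :: "'e \<times> 'f"
      have w: "w = (fst w, snd w)" by simp
      have DAw: "DA w = DA (fst w, 0) + DA (0, snd w)" using DAs[of "fst w" "snd w"] by simp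
      show "blinfun_apply (snd (std_join (?L1, ?L2))) w
      = blinfun_apply (snd (bracket (std_courant ?P) (\<lambda>p. std_join (A p, A' p)) (\<lambda>p. std_join (B p,
          B' p)) (x, y))) w"
        unfolding std_join_simps fst_conv snd_conv snd_add snd_diff blinfun.add_left
            blinfun.diff_left
          std_bracket(2)[OF M sA x] std_bracket(2)[OF N sA' y] std_bracket(2)[OF PP sa xyP]
          blinfun_apply_Blinfun_linear[OF l\<rho>] blinfun_apply_Blinfun_linear[OF l\<rho>']
          cour_form_def DA DB cen o_apply \<rho>_def \<rho>'_def DAw
          DAs[of "fst (B (x, y))" "fst (B' (x, y))"] DBs[of "fst (A (x, y))" "fst (A' (x, y))"]
        by (simp add: blinfun.add_left blinfun.add_right algebra_simps)
    qed
  qed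
qed

lemma courant_iso_prod: "courant_iso (E \<times>\<^sub>C F) (join_iso J J')"
proof -
  let ?P = "base E \<times>\<^sub>M base F"
  have PP: "atlas ?P" by (rule atlas_prod[OF M N])
  have bl: "bounded_linear (join_iso J J')"
    unfolding join_iso_def[abs_def]
    by (intro bounded_linear_compose[OF bounded_linear_std_join] bounded_linear_Pair
        bounded_linear_compose[OF iso_linear[OF E]] bounded_linear_compose[OF iso_linear[OF F]]
            bounded_linear_fst bounded_linear_snd)
  define G where "G c = (inv J (fst (std_split c)), inv J' (snd (std_split c)))" for c
  have G1: "G (join_iso J J' v) = v" for v
    by (simp add: G_def join_iso_def iso_inv1[OF E] iso_inv1[OF F])
  have G2: "join_iso J J' (G c) = c" for c
    by (simp add: G_def join_iso_def iso_inv2[OF E] iso_inv2[OF F])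
  have inv: "inv (join_iso J J') = G" by (rule inv_equality) (simp_all add: G1 G2)
  have bij: "bij (join_iso J J')" by (rule bijI') (metis G1, metis G2)
  have blG: "bounded_linear G"
    unfolding G_def[abs_def]
    by (intro bounded_linear_Pair bounded_linear_compose[OF iso_inv_linear[OF E]]
        bounded_linear_compose[OF iso_inv_linear[OF F]]
        bounded_linear_compose[OF bounded_linear_fst] bounded_linear_compose[OF bounded_linear_snd]
            bounded_linear_std_split)
  have bc: "join_iso J J' (bundle_coord (E \<times>\<^sub>C F) q p v) = bundle_coord (std_courant ?P)
      q p (join_iso J J' v)"
    if "q \<in> points ?P" "p \<in> chart_dom ?P q" for q p v
  proof -
    obtain q1 q2 where q12: "q = (q1, q2)" by (cases q)
    obtain p1 p2 where p12: "p = (p1, p2)" by (cases p)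
    have qp: "q1 \<in> points (base E)" "q2 \<in> points (base F)" "p1 \<in> chart_dom (base E) q1"
        "p2 \<in> chart_dom (base F) q2"
      using that by (simp_all add: q12 p12)
    show ?thesis
      unfolding q12 p12 join_iso_def prod_courant_simps fst_conv snd_conv bundle_coord_join[OF M N
          qp]
        iso_bundle_coord[OF E qp(1,3)] iso_bundle_coord[OF F qp(2,4)] ..
  qed
  have sec: "smooth_section (std_courant ?P) W (join_iso J J' \<circ> a)" if "smooth_section (E \<times>\<^sub>C F) W a"
      for W a
    by (rule smooth_section_linear_map[OF _ _ bl _ that]) (use PP bc in auto)
  show ?thesis
    unfolding courant_iso_def prod_courant_simps(1) inv
  proof (intro conjI PP bl bij blG ballI allI impI)
    show "join_iso J J' (bundle_coord (E \<times>\<^sub>C F) q p v) = bundle_coord (std_courant ?P)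
        q p (join_iso J J' v)"
      if "q \<in> points ?P" "p \<in> chart_dom ?P q" for q p v by (rule bc[OF that])
    show "pairing (E \<times>\<^sub>C F) p v w = pairing (std_courant ?P) p (join_iso J J' v) (join_iso J J' w)"
        for p v w
      by (cases p) (simp add: join_iso_def iso_pairing[OF E] iso_pairing[OF F])
    show "anchor (E \<times>\<^sub>C F) p v = fst (join_iso J J' v)" for p v
      by (cases p) (simp add: join_iso_def iso_anchor[OF E] iso_anchor[OF F])
    fix a b p
    assume a: "smooth_section (E \<times>\<^sub>C F) (points ?P) a" and b: "smooth_section (E \<times>\<^sub>C F) (points ?P) b"
        and p: "p \<in> points ?P"
    show "join_iso J J' (bracket (E \<times>\<^sub>C F) a b p) = bracket (std_courant ?P) (join_iso J J' \<circ> a)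
        (join_iso J J' \<circ> b) p"
      using join_iso_bracket[OF sec[OF a] sec[OF b]] p by auto
  qed
qed

end

section \<open>Smooth functions near a point\<close>

text \<open>Smoothness is recorded in the chart at \<open>p\<close> alone, which is what
  \<open>level_set_at\<close> asks for and what derivatives at \<open>p\<close> see.\<close>

definition smooth_fn :: "('p, 'e::findim_space) mfd \<Rightarrow> 'p set \<Rightarrow> 'p \<Rightarrow> ('p \<Rightarrow> 'v::real_normed_vector)
    \<Rightarrow> bool" where
  "smooth_fn M W p f \<longleftrightarrow> openin (mfd_top M) W \<and> p \<in> W \<and> W \<subseteq> chart_dom M p \<and>
     smooth_on (chart M p ` W) (f \<circ> chart_inv M p)"

lemma smooth_fn_has_derivative:
  "smooth_fn M W p f \<Longrightarrow> ((f \<circ> chart_inv M p) has_derivative coord_deriv M f p) (at (chart M p p))"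
  unfolding coord_deriv_def by (rule smooth_on_derivative[of "chart M p ` W"])
      (auto simp: smooth_fn_def)

lemma linear_coord_deriv_fn: "smooth_fn M W p f \<Longrightarrow> linear (coord_deriv M f p)"
  by (rule has_derivative_linear[OF smooth_fn_has_derivative])

lemma coord_deriv_eqI:
  "((f \<circ> chart_inv M p) has_derivative f') (at (chart M p p)) \<Longrightarrow> coord_deriv M f p = f'"
  unfolding coord_deriv_def by (rule frechet_derivative_at[symmetric])

context
  fixes M :: "('p, 'e::findim_space) mfd"
  assumes M: "atlas M"
begin

lemma smooth_fn_open: "smooth_fn M W p f \<Longrightarrow> p \<in> points M \<and> open (chart M p ` W)"
  unfolding smooth_fn_def openin_atlas[OF M] by (metis inf.absorb1 subsetD)

lemma smooth_fn_mono:
  assumes "smooth_fn M W p f" "openin (mfd_top M) V" "p \<in> V"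
  shows "smooth_fn M (W \<inter> V) p f"
  using assms unfolding smooth_fn_def by (auto intro: openin_Int smooth_on_subset)

lemma smooth_fn_diff:
  assumes f: "smooth_fn M W p f" and g: "smooth_fn M V p g"
  shows "smooth_fn M (W \<inter> V) p (\<lambda>x. f x - g x)"
    and "coord_deriv M (\<lambda>x. f x - g x) p v = coord_deriv M f p v - coord_deriv M g p v"
proof -
  have 1: "smooth_fn M (W \<inter> V) p f"
    by (rule smooth_fn_mono[OF f]) (use g in \<open>simp_all add: smooth_fn_def\<close>)
  have 2: "smooth_fn M (V \<inter> W) p g"
    by (rule smooth_fn_mono[OF g]) (use f in \<open>simp_all add: smooth_fn_def\<close>)
  have o: "open (chart M p ` (W \<inter> V))" using smooth_fn_open[OF 1] by blast
  show "smooth_fn M (W \<inter> V) p (\<lambda>x. f x - g x)"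
    using 1 2 smooth_on_diff[OF o, of "f \<circ> chart_inv M p" "g \<circ> chart_inv M p"]
    by (auto simp: smooth_fn_def comp_def Int_commute)
  have "(((\<lambda>x. f x - g x) \<circ> chart_inv M p) has_derivative (\<lambda>v. coord_deriv M f p v - coord_deriv M g
      p v)) (at (chart M p p))"
    using has_derivative_diff[OF smooth_fn_has_derivative[OF f] smooth_fn_has_derivative[OF g]]
        by (simp only: comp_def)
  from coord_deriv_eqI[OF this] show "coord_deriv M (\<lambda>x. f x - g x) p v = coord_deriv M f p v -
      coord_deriv M g p v" by simp
qed

lemma smooth_fn_Pair:
  assumes f: "smooth_fn M W p f" and g: "smooth_fn M V p g"
  shows "smooth_fn M (W \<inter> V) p (\<lambda>x. (f x, g x))"
    and "coord_deriv M (\<lambda>x. (f x, g x)) p v = (coord_deriv M f p v, coord_deriv M g p v)"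
proof -
  have 1: "smooth_fn M (W \<inter> V) p f"
    by (rule smooth_fn_mono[OF f]) (use g in \<open>simp_all add: smooth_fn_def\<close>)
  have 2: "smooth_fn M (V \<inter> W) p g"
    by (rule smooth_fn_mono[OF g]) (use f in \<open>simp_all add: smooth_fn_def\<close>)
  have o: "open (chart M p ` (W \<inter> V))" using smooth_fn_open[OF 1] by blast
  show "smooth_fn M (W \<inter> V) p (\<lambda>x. (f x, g x))"
    using 1 2 smooth_on_Pair[OF o, of "f \<circ> chart_inv M p" "g \<circ> chart_inv M p"]
    by (auto simp: smooth_fn_def comp_def Int_commute)
  have "(((\<lambda>x. (f x, g x)) \<circ> chart_inv M p) has_derivative (\<lambda>v. (coord_deriv M f p v, coord_deriv M
      g p v))) (at (chart M p p))"
    using has_derivative_Pair[OF smooth_fn_has_derivative[OF f] smooth_fn_has_derivative[OF g]]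
        by (simp only: comp_def)
  from coord_deriv_eqI[OF this] show "coord_deriv M (\<lambda>x. (f x, g x)) p v = (coord_deriv M f p v,
      coord_deriv M g p v)" by simp
qed

lemma smooth_fn_const:
  assumes "p \<in> points M"
  shows "smooth_fn M (chart_dom M p) p (\<lambda>x. c)" and "coord_deriv M (\<lambda>x. c) p v = 0"
proof -
  show "smooth_fn M (chart_dom M p) p (\<lambda>x. c)"
    by (simp add: smooth_fn_def openin_chart_dom[OF M assms] mem_chart_dom[OF M assms]
        comp_def smooth_on_const)
  have "((\<lambda>x. c) \<circ> chart_inv M p has_derivative (\<lambda>v. 0)) (at (chart M p p))" by (simp add: comp_def)
  from coord_deriv_eqI[OF this] show "coord_deriv M (\<lambda>x. c) p v = 0" by simp
qed

lemma smooth_fn_chart: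
  assumes "p \<in> points M"
  shows "smooth_fn M (chart_dom M p) p (chart M p)" and "coord_deriv M (chart M p) p v = v"
proof -
  show "coord_deriv M (chart M p) p v = v" using vec_coord_self[OF M assms, of v]
      by (simp add: vec_coord_eq)
  have "smooth_on (chart M p ` chart_dom M p) (chart M p \<circ> chart_inv M p)"
    using smooth_transition[OF M assms assms] by simp
  then show "smooth_fn M (chart_dom M p) p (chart M p)"
    by (simp add: smooth_fn_def openin_chart_dom[OF M assms] mem_chart_dom[OF M assms])
qed

context
  fixes N :: "('q, 'f::findim_space) mfd"
  assumes N: "atlas N"
begin

lemma smooth_map_image: "smooth_map M N W f \<Longrightarrow> x \<in> W \<Longrightarrow> f x \<in> points N"
  unfolding smooth_map_def using continuous_map_image_subset_topspace[of "subtopology (mfd_top M) W"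
      "mfd_top N" f]
  by (auto simp: topspace_mfd_top[OF M] topspace_mfd_top[OF N] openin_atlas[OF M])

lemma smooth_map_preimage:
  assumes f: "smooth_map M N W f" and V: "openin (mfd_top N) V"
  shows "openin (mfd_top M) {x \<in> W. f x \<in> V}"
proof -
  have W: "openin (mfd_top M) W" and c: "continuous_map (subtopology (mfd_top M) W) (mfd_top N) f"
    using f by (auto simp: smooth_map_def)
  have "topspace (subtopology (mfd_top M) W) = W"
    using openin_subset[OF W] by (simp add: Int_absorb1)
  then have "openin (subtopology (mfd_top M) W) {x \<in> W. f x \<in> V}"
    using openin_continuous_map_preimage[OF c V] by simp
  then show ?thesis using W by (rule openin_trans_full)
qed

lemma smooth_fn_map:
  assumes f: "smooth_map M N W f" and p: "p \<in> W"
  defines "V \<equiv> {x \<in> W. f x \<in> chart_dom N (f p)} \<inter> chart_dom M p"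
  shows "smooth_fn M V p (\<lambda>x. chart N (f p) (f x))"
    and "coord_deriv M (\<lambda>x. chart N (f p) (f x)) p = tangent_map M N f p"
proof -
  have W: "openin (mfd_top M) W" using f by (simp add: smooth_map_def)
  have pM: "p \<in> points M" using W p openin_atlas[OF M] by blast
  have fp: "f p \<in> points N" by (rule smooth_map_image[OF f p])
  have "openin (mfd_top M) V"
    unfolding V_def by (intro openin_Int smooth_map_preimage[OF f] openin_chart_dom[OF N fp]
        openin_chart_dom[OF M pM])
  moreover have "V = {x \<in> chart_dom M p \<inter> W. f x \<in> chart_dom N (f p)}" by (auto simp: V_def)
  ultimately show "smooth_fn M V p (\<lambda>x. chart N (f p) (f x))"
    using f pM fp p mem_chart_dom[OF M pM] mem_chart_dom[OF N fp]
    by (auto simp: smooth_fn_def smooth_map_def comp_def)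
  show "coord_deriv M (\<lambda>x. chart N (f p) (f x)) p = tangent_map M N f p"
    by (simp add: tangent_map_eq comp_def)
qed

lemma linear_tangent_map:
  "smooth_map M N W f \<Longrightarrow> p \<in> W \<Longrightarrow> linear (tangent_map M N f p)"
  using linear_coord_deriv_fn[OF smooth_fn_map(1)] smooth_fn_map(2) by metis

text \<open>The tangent map along \<open>Q\<close> is taken from an extension picked by
  \<open>SOME\<close>; that it is the tangent map of some extension is all that is ever used about
  it.\<close>

lemma tangent_map_along_extension:
  assumes "smooth_map_along M N Q f" "p \<in> Q"
  obtains F W where "p \<in> W" "smooth_map M N W F" "\<And>x. x \<in> Q \<Longrightarrow> x \<in> W \<Longrightarrow> F x = f x"
    "tangent_map_along M N Q f p = tangent_map M N F p"
proof -
  have "\<exists>F. local_extension M N Q f p F" using assms by (auto simp: smooth_map_along_def)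
  from someI_ex[OF this] show thesis
    using that unfolding local_extension_def tangent_map_along_def by blast
qed

lemma linear_tangent_map_along:
  assumes "smooth_map_along M N Q f" "p \<in> Q"
  shows "linear (tangent_map_along M N Q f p)"
proof -
  obtain F W where "p \<in> W" "smooth_map M N W F" "tangent_map_along M N Q f p = tangent_map M N F p"
    by (rule tangent_map_along_extension[OF assms])
  then show ?thesis using linear_tangent_map by simp
qed

lemma smooth_fn_fst:
  assumes f: "smooth_fn M W p f" and q: "q \<in> points N"
  shows "smooth_fn (M \<times>\<^sub>M N) (W \<times> chart_dom N q) (p, q) (\<lambda>z. f (fst z))"
    and "coord_deriv (M \<times>\<^sub>M N) (\<lambda>z. f (fst z)) (p, q) v = coord_deriv M f p (fst v)"
proof -
  have pM: "p \<in> points M" and o1: "open (chart M p ` W)" using smooth_fn_open[OF f] by auto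
  have o2: "open (chart N q ` chart_dom N q)" by (rule open_chart_image[OF N q])
  have W: "W \<subseteq> chart_dom M p" "p \<in> W" "openin (mfd_top M) W" using f by (auto simp: smooth_fn_def)
  have ci: "fst (chart_inv (M \<times>\<^sub>M N) (p, q) z) = chart_inv M p (fst z)"
    if "z \<in> chart M p ` W \<times> chart N q ` chart_dom N q" for z
    using that W(1) chart_inv_prod[OF inj_chart[OF M pM] inj_chart[OF N q], of "fst z" "snd z"]
        by (cases z) auto
  have im: "chart (M \<times>\<^sub>M N) (p, q) ` (W \<times> chart_dom N q) = chart M p ` W \<times> chart N q ` chart_dom N q"
    by (simp add: map_prod_image)
  have o: "open (chart M p ` W \<times> chart N q ` chart_dom N q)" by (rule open_Times[OF o1 o2])
  have "openin (mfd_top (M \<times>\<^sub>M N)) (W \<times> chart_dom N q)"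
    unfolding openin_atlas[OF atlas_prod[OF M N]]
  proof (intro conjI ballI)
    show "W \<times> chart_dom N q \<subseteq> points (M \<times>\<^sub>M N)"
      using W(3) openin_atlas[OF M] chart_dom_subset[OF N q] by auto
    fix r assume r: "r \<in> points (M \<times>\<^sub>M N)"
    obtain r1 r2 where r12: "r = (r1, r2)" by (cases r)
    have "open (chart M r1 ` (W \<inter> chart_dom M r1))" "open (chart N r2 ` (chart_dom N q \<inter> chart_dom N
        r2))"
      using r W(3) openin_chart_dom[OF N q] by (auto simp: r12 openin_atlas[OF M]
          openin_atlas[OF N])
    then show "open (chart (M \<times>\<^sub>M N) r ` (W \<times> chart_dom N q \<inter> chart_dom (M \<times>\<^sub>M N) r))"
      by (simp add: r12 map_prod_image_Int open_Times)
  qed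
  moreover have "smooth_on (chart M p ` W \<times> chart N q ` chart_dom N q) ((\<lambda>z. f (fst z))
      \<circ> chart_inv (M \<times>\<^sub>M N) (p, q))"
  proof (rule smooth_on_cong[OF o])
    have sf: "smooth_on (chart M p ` W) (f \<circ> chart_inv M p)" using f by (simp add: smooth_fn_def)
    show "smooth_on (chart M p ` W \<times> chart N q ` chart_dom N q) (\<lambda>z. (f \<circ> chart_inv M p) (fst z))"
      by (rule smooth_on_compose[OF o o1 _ smooth_on_linear[OF bounded_linear_fst o smooth_on_id[OF
          o]] sf]) auto
  qed (simp add: ci)
  ultimately show "smooth_fn (M \<times>\<^sub>M N) (W \<times> chart_dom N q) (p, q) (\<lambda>z. f (fst z))"
    using W mem_chart_dom[OF N q] by (auto simp: smooth_fn_def map_prod_image)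
  have d0: "((f \<circ> chart_inv M p) has_derivative coord_deriv M f p) (at (fst (chart M p p,
      chart N q q)))"
    using smooth_fn_has_derivative[OF f] by simp
  have "((\<lambda>z. (f \<circ> chart_inv M p) (fst z)) has_derivative (\<lambda>v. coord_deriv M f p (fst v)))
      (at (chart M p p, chart N q q))"
    using diff_chain_at[OF bounded_linear_imp_has_derivative[OF bounded_linear_fst] d0]
        by (simp only: comp_def)
  then have "(((\<lambda>z. f (fst z)) \<circ> chart_inv (M \<times>\<^sub>M N) (p, q)) has_derivative (\<lambda>v. coord_deriv M f p
      (fst v))) (at (chart (M \<times>\<^sub>M N) (p, q) (p, q)))"
    unfolding prod_mfd_simps map_prod_simp
    by (rule has_derivative_transform_within_open[OF _ o]) (use W mem_chart_dom[OF N q] ci in auto)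
  from coord_deriv_eqI[OF this] show "coord_deriv (M \<times>\<^sub>M N) (\<lambda>z. f (fst z)) (p, q)
      v = coord_deriv M f p (fst v)" by simp
qed

lemma smooth_fn_snd:
  assumes p: "p \<in> points M" and f: "smooth_fn N W q f"
  shows "smooth_fn (M \<times>\<^sub>M N) (chart_dom M p \<times> W) (p, q) (\<lambda>z. f (snd z))"
    and "coord_deriv (M \<times>\<^sub>M N) (\<lambda>z. f (snd z)) (p, q) v = coord_deriv N f q (snd v)"
proof -
  have W: "W \<subseteq> chart_dom N q" "q \<in> W" "openin (mfd_top N) W" using f by (auto simp: smooth_fn_def)
  have qN: "q \<in> points N" using W openin_atlas[OF N] by blast
  have o2: "open (chart N q ` W)" using W qN unfolding openin_atlas[OF N] by (metis inf.absorb1)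
  have o1: "open (chart M p ` chart_dom M p)" by (rule open_chart_image[OF M p])
  have ci: "snd (chart_inv (M \<times>\<^sub>M N) (p, q) z) = chart_inv N q (snd z)"
    if "z \<in> chart M p ` chart_dom M p \<times> chart N q ` W" for z
    using that W(1) chart_inv_prod[OF inj_chart[OF M p] inj_chart[OF N qN], of "fst z" "snd z"]
        by (cases z) auto
  have o: "open (chart M p ` chart_dom M p \<times> chart N q ` W)" by (rule open_Times[OF o1 o2])
  have "openin (mfd_top (M \<times>\<^sub>M N)) (chart_dom M p \<times> W)"
    unfolding openin_atlas[OF atlas_prod[OF M N]]
  proof (intro conjI ballI)
    show "chart_dom M p \<times> W \<subseteq> points (M \<times>\<^sub>M N)"
      using W(3) openin_atlas[OF N] chart_dom_subset[OF M p] by auto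
    fix r assume r: "r \<in> points (M \<times>\<^sub>M N)"
    obtain r1 r2 where r12: "r = (r1, r2)" by (cases r)
    have "open (chart M r1 ` (chart_dom M p \<inter> chart_dom M r1))"
        "open (chart N r2 ` (W \<inter> chart_dom N r2))"
      using r W(3) openin_chart_dom[OF M p] by (auto simp: r12 openin_atlas[OF M]
          openin_atlas[OF N])
    then show "open (chart (M \<times>\<^sub>M N) r ` (chart_dom M p \<times> W \<inter> chart_dom (M \<times>\<^sub>M N) r))"
      by (simp add: r12 map_prod_image_Int open_Times)
  qed
  moreover have "smooth_on (chart M p ` chart_dom M p \<times> chart N q ` W) ((\<lambda>z. f (snd z))
      \<circ> chart_inv (M \<times>\<^sub>M N) (p, q))"
  proof (rule smooth_on_cong[OF o])
    have sf: "smooth_on (chart N q ` W) (f \<circ> chart_inv N q)" using f by (simp add: smooth_fn_def)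
    show "smooth_on (chart M p ` chart_dom M p \<times> chart N q ` W) (\<lambda>z. (f \<circ> chart_inv N q) (snd z))"
      by (rule smooth_on_compose[OF o o2 _ smooth_on_linear[OF bounded_linear_snd o smooth_on_id[OF
          o]] sf]) auto
  qed (simp add: ci)
  ultimately show "smooth_fn (M \<times>\<^sub>M N) (chart_dom M p \<times> W) (p, q) (\<lambda>z. f (snd z))"
    using W mem_chart_dom[OF M p] by (auto simp: smooth_fn_def map_prod_image)
  have d0: "((f \<circ> chart_inv N q) has_derivative coord_deriv N f q) (at (snd (chart M p p,
      chart N q q)))"
    using smooth_fn_has_derivative[OF f] by simp
  have "((\<lambda>z. (f \<circ> chart_inv N q) (snd z)) has_derivative (\<lambda>v. coord_deriv N f q (snd v)))
      (at (chart M p p, chart N q q))"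
    using diff_chain_at[OF bounded_linear_imp_has_derivative[OF bounded_linear_snd] d0]
        by (simp only: comp_def)
  then have "(((\<lambda>z. f (snd z)) \<circ> chart_inv (M \<times>\<^sub>M N) (p, q)) has_derivative (\<lambda>v. coord_deriv N f q
      (snd v))) (at (chart (M \<times>\<^sub>M N) (p, q) (p, q)))"
    unfolding prod_mfd_simps map_prod_simp
    by (rule has_derivative_transform_within_open[OF _ o]) (use W mem_chart_dom[OF M p] ci in auto)
  from coord_deriv_eqI[OF this] show "coord_deriv (M \<times>\<^sub>M N) (\<lambda>z. f (snd z)) (p, q)
      v = coord_deriv N f q (snd v)" by simp
qed

end

lemma level_set_atI:
  assumes "smooth_fn M W q \<Phi>" "surj (coord_deriv M \<Phi> q)" "\<And>x. x \<in> W \<Longrightarrow> x \<in> Q \<longleftrightarrow> \<Phi> x = 0"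
  shows "level_set_at M Q q \<Phi>"
  using assms unfolding level_set_at_def[OF M] smooth_fn_def by blast

section \<open>Velocities of curves\<close>

text \<open>A relation instead of a derivative operator, so that uniqueness turns two computations
  of the velocity of one curve into an equation. Differentiability is required at time 0 only, which
  keeps compositions of curves with maps cheap.\<close>

definition velocity :: "(real \<Rightarrow> 'p) \<Rightarrow> 'p \<Rightarrow> 'e \<Rightarrow> bool" where
  "velocity c p v \<longleftrightarrow> c 0 = p \<and> p \<in> points M \<and> eventually (\<lambda>t. c t \<in> chart_dom M p) (nhds 0) \<and>
     ((chart M p \<circ> c) has_vector_derivative v) (at 0)"

lemma velocity_unique: "velocity c p v \<Longrightarrow> velocity c p w \<Longrightarrow> v = w"
  unfolding velocity_def by (blast intro: vector_derivative_unique_at)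

lemma velocity_const: "p \<in> points M \<Longrightarrow> velocity (\<lambda>_. p) p 0"
  by (simp add: velocity_def mem_chart_dom[OF M] comp_def)

text \<open>Differentiability gives continuity in the chart only; that the curve stays in the chart
  domain near time 0 turns this into a statement about the curve itself.\<close>

lemma velocity_in_open:
  assumes c: "velocity c p v" and W: "openin (mfd_top M) W" "p \<in> W"
  shows "eventually (\<lambda>t. c t \<in> W) (nhds 0)"
proof -
  have pM: "p \<in> points M" and c0: "c 0 = p" using c by (auto simp: velocity_def)
  let ?A = "chart M p ` (W \<inter> chart_dom M p)"
  have A: "open ?A" "chart M p p \<in> ?A" using W pM openin_atlas[OF M] mem_chart_dom[OF M pM] by auto
  have "isCont (chart M p \<circ> c) 0"
    using c has_vector_derivative_continuous unfolding velocity_def by blast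
  then have "eventually (\<lambda>t. (chart M p \<circ> c) t \<in> ?A) (nhds 0)"
    using A c0 by (auto simp: continuous_at tendsto_def eventually_nhds_conv_at)
  moreover have "eventually (\<lambda>t. c t \<in> chart_dom M p) (nhds 0)" using c by (simp add: velocity_def)
  ultimately show ?thesis
  proof eventually_elim
    case (elim t)
    then show ?case using chart_mem_image_iff[OF M pM, of "c t" "W \<inter> chart_dom M p"] by simp
  qed
qed

lemma velocity_tangent:
  assumes v: "v \<in> tangent_space M Q p" and Q: "Q \<subseteq> points M" "p \<in> Q"
  obtains c where "velocity c p v" "\<And>t. c t \<in> Q"
proof -
  from v obtain \<gamma> \<epsilon> where g: "\<epsilon> > 0" "\<gamma> 0 = p" "\<And>t. t \<in> {-\<epsilon><..<\<epsilon>} \<Longrightarrow> \<gamma> t \<in> Q \<inter> chart_dom M p"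
      "((chart M p \<circ> \<gamma>) has_vector_derivative v) (at 0)"
    unfolding tangent_space_def by blast
  \<comment> \<open>Extended by the constant \<open>p\<close>, the curve lies in \<open>Q\<close> at
    all times, so that later statements need no bound on the time.\<close>
  define c where "c t = (if t \<in> {-\<epsilon><..<\<epsilon>} then \<gamma> t else p)" for t
  have cd: "c t \<in> chart_dom M p" for t using g(3) mem_chart_dom[OF M, of p] Q by (auto simp: c_def)
  have "((chart M p \<circ> c) has_vector_derivative v) (at 0)"
    unfolding has_vector_derivative_def
    by (rule has_derivative_transform_within_open[OF g(4)[unfolded has_vector_derivative_def],
        of "{-\<epsilon><..<\<epsilon>}"])
      (use g(1) in \<open>auto simp: c_def\<close>)
  then have "velocity c p v" using g(1,2) cd Q by (auto simp: velocity_def c_def)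
  moreover have "c t \<in> Q" for t using g(3) Q by (auto simp: c_def)
  ultimately show thesis by (rule that)
qed

end

context
  fixes M :: "('p, 'e::findim_space) mfd" and N :: "('q, 'f::findim_space) mfd"
  assumes M: "atlas M" and N: "atlas N"
begin

lemma velocity_map:
  assumes f: "smooth_map M N W f" and p: "p \<in> W" and c: "velocity M c p v"
  shows "velocity N (\<lambda>t. f (c t)) (f p) (tangent_map M N f p v)"
proof -
  let ?V = "{x \<in> W. f x \<in> chart_dom N (f p)} \<inter> chart_dom M p"
  note sf = smooth_fn_map(1)[OF M N f p]
  have c0: "c 0 = p" and cd: "((chart M p \<circ> c) has_vector_derivative v) (at 0)" using c
      by (auto simp: velocity_def[OF M])
  have pM: "p \<in> points M" using c by (simp add: velocity_def[OF M])
  have "openin (mfd_top M) ?V" "p \<in> ?V" using sf by (auto simp: smooth_fn_def)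
  from velocity_in_open[OF M c this] have ev: "eventually (\<lambda>t. c t \<in> ?V) (nhds 0)" .
  have d: "((\<lambda>x. chart N (f p) (f x)) \<circ> chart_inv M p has_derivative tangent_map M N f p)
      (at ((chart M p \<circ> c) 0))"
    using smooth_fn_has_derivative[OF sf] by (simp add: smooth_fn_map(2)[OF M N f p] c0)
  have "((\<lambda>t. ((\<lambda>x. chart N (f p) (f x)) \<circ> chart_inv M p) ((chart M p \<circ> c) t))
      has_derivative (\<lambda>t. tangent_map M N f p (t *\<^sub>R v))) (at 0)"
    using diff_chain_at[OF cd[unfolded has_vector_derivative_def] d] by (simp only: comp_def)
  then have "((chart N (f p) \<circ> (\<lambda>t. f (c t))) has_derivative (\<lambda>t. tangent_map M N f p (t *\<^sub>R v)))
      (at 0)"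
  proof (rule has_derivative_transform_eventually)
    show "eventually (\<lambda>t. ((\<lambda>x. chart N (f p) (f x)) \<circ> chart_inv M p) ((chart M p \<circ> c) t)
        = (chart N (f p) \<circ> (\<lambda>t. f (c t))) t) (at 0)"
      using eventually_nhds_conv_at[THEN iffD1, OF ev]
          by (auto elim!: eventually_mono simp: chart_inv_chart[OF M pM])
  qed (simp_all add: c0 chart_inv_chart[OF M pM mem_chart_dom[OF M pM]])
  then have "((chart N (f p) \<circ> (\<lambda>t. f (c t))) has_vector_derivative tangent_map M N f p v) (at 0)"
    by (simp add: has_vector_derivative_def linear_scale[OF linear_tangent_map[OF M N f p]])
  then show ?thesis
    using ev smooth_map_image[OF M N f p] by (auto simp: velocity_def[OF N]
        c0 elim: eventually_mono)
qed

text \<open>On a curve inside \<open>Q\<close> the chosen extension agrees with \<open>f\<close>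
  near time 0. So on velocities of such curves the tangent map along \<open>Q\<close> does not
  depend on the choice.\<close>

lemma velocity_along:
  assumes f: "smooth_map_along M N Q f" and p: "p \<in> Q" and c: "velocity M c p v"
      and cQ: "\<And>t. c t \<in> Q"
  shows "velocity N (\<lambda>t. f (c t)) (f p) (tangent_map_along M N Q f p v)"
proof -
  obtain F W where F: "p \<in> W" "smooth_map M N W F" "\<And>x. x \<in> Q \<Longrightarrow> x \<in> W \<Longrightarrow> F x = f x"
    "tangent_map_along M N Q f p = tangent_map M N F p"
    using tangent_map_along_extension[OF M N f p] by metis
  have W: "openin (mfd_top M) W" using F(2) by (simp add: smooth_map_def)
  have fp: "F p = f p" using F(3) p F(1) by blast
  have v: "velocity N (\<lambda>t. F (c t)) (f p) (tangent_map M N F p v)"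
    using velocity_map[OF F(2,1) c] by (simp add: fp)
  have ev: "eventually (\<lambda>t. F (c t) = f (c t)) (nhds 0)"
    using velocity_in_open[OF M c W F(1)] by eventually_elim (use F(3) cQ in auto)
  have c0: "c 0 = p" using c by (simp add: velocity_def[OF M])
  have "((chart N (f p) \<circ> (\<lambda>t. f (c t))) has_vector_derivative tangent_map M N F p v) (at 0)"
    unfolding has_vector_derivative_def
  proof (rule has_derivative_transform_eventually)
    show "((chart N (f p) \<circ> (\<lambda>t. F (c t))) has_derivative (\<lambda>t. t *\<^sub>R tangent_map M N F p v)) (at 0)"
      using v by (simp add: velocity_def[OF N] has_vector_derivative_def)
    show "eventually (\<lambda>t. (chart N (f p) \<circ> (\<lambda>t. F (c t))) t = (chart N (f p) \<circ> (\<lambda>t. f (c t))) t)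
        (at 0)"
      using eventually_nhds_conv_at[THEN iffD1, OF ev] by (auto elim: eventually_mono)
  qed (simp_all add: c0 fp)
  moreover have "eventually (\<lambda>t. f (c t) \<in> chart_dom N (f p)) (nhds 0)"
  proof -
    have "eventually (\<lambda>t. F (c t) \<in> chart_dom N (f p)) (nhds 0)" using v
        by (simp add: velocity_def[OF N])
    with ev show ?thesis by eventually_elim simp
  qed
  ultimately show ?thesis using v by (simp add: velocity_def[OF N] c0 F(4))
qed

lemma velocity_Pair:
  assumes c: "velocity M c p v" and d: "velocity N d q w"
  shows "velocity (M \<times>\<^sub>M N) (\<lambda>t. (c t, d t)) (p, q) (v, w)"
proof -
  have cd: "((chart M p \<circ> c) has_vector_derivative v) (at 0)"
      "((chart N q \<circ> d) has_vector_derivative w) (at 0)"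
    using c d unfolding velocity_def[OF M] velocity_def[OF N] by blast+
  have "((\<lambda>t. ((chart M p \<circ> c) t, (chart N q \<circ> d) t)) has_vector_derivative (v, w)) (at 0)"
    by (rule has_vector_derivative_Pair[OF cd])
  moreover have "eventually (\<lambda>t. c t \<in> chart_dom M p \<and> d t \<in> chart_dom N q) (nhds 0)"
    using c d by (intro eventually_conj) (simp_all add: velocity_def[OF M] velocity_def[OF N])
  ultimately show ?thesis
    using c d by (auto simp: velocity_def[OF M] velocity_def[OF N] velocity_def[OF atlas_prod[OF M
        N]] comp_def)
qed

lemma velocity_fst_snd:
  assumes c: "velocity (M \<times>\<^sub>M N) c (p, q) (v, w)"
  shows "velocity M (\<lambda>t. fst (c t)) p v" "velocity N (\<lambda>t. snd (c t)) q w"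
proof -
  have d: "((chart (M \<times>\<^sub>M N) (p, q) \<circ> c) has_derivative (\<lambda>t. t *\<^sub>R (v, w))) (at 0)"
    using c by (simp add: velocity_def[OF atlas_prod[OF M N]] has_vector_derivative_def)
  have e: "eventually (\<lambda>t. c t \<in> chart_dom M p \<times> chart_dom N q) (nhds 0)"
    using c by (simp add: velocity_def[OF atlas_prod[OF M N]])
  have "((chart M p \<circ> (\<lambda>t. fst (c t))) has_vector_derivative v) (at 0)"
      "((chart N q \<circ> (\<lambda>t. snd (c t))) has_vector_derivative w) (at 0)"
    using has_derivative_fst[OF d] has_derivative_snd[OF d]
        by (simp_all add: has_vector_derivative_def comp_def)
  moreover have "eventually (\<lambda>t. fst (c t) \<in> chart_dom M p) (nhds 0)" "eventually (\<lambda>t. snd (c t)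
      \<in> chart_dom N q) (nhds 0)"
    by (rule eventually_mono[OF e], auto)+
  ultimately show "velocity M (\<lambda>t. fst (c t)) p v" "velocity N (\<lambda>t. snd (c t)) q w"
    using c by (auto simp: velocity_def[OF M] velocity_def[OF N] velocity_def[OF atlas_prod[OF M
        N]])
qed

end

section \<open>Slices of smooth maps\<close>

context
  fixes M :: "('p, 'e::findim_space) mfd" and N :: "('q, 'f::findim_space) mfd"
  assumes M: "atlas M" and N: "atlas N"
begin

lemma openin_slice1:
  assumes W: "openin (mfd_top (M \<times>\<^sub>M N)) W" and b: "b \<in> points N"
  shows "openin (mfd_top M) {x. (x, b) \<in> W}"
  unfolding openin_atlas[OF M]
proof (intro conjI ballI)
  show "{x. (x, b) \<in> W} \<subseteq> points M" using W by (auto simp: openin_atlas[OF atlas_prod[OF M N]])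
  fix p assume p: "p \<in> points M"
  let ?A = "chart (M \<times>\<^sub>M N) (p, b) ` (W \<inter> chart_dom (M \<times>\<^sub>M N) (p, b))"
  have "(p, b) \<in> points (M \<times>\<^sub>M N)" using p b by simp
  then have "open ?A" using W unfolding openin_atlas[OF atlas_prod[OF M N]] by blast
  then have "open ((\<lambda>u. (u, chart N b b)) -` ?A)"
    by (rule open_vimage) (intro continuous_intros)
  moreover have "(\<lambda>u. (u, chart N b b)) -` ?A = chart M p ` ({x. (x, b) \<in> W} \<inter> chart_dom M p)"
    using mem_chart_dom[OF N b] inj_onD[OF inj_chart[OF N b]] by (force simp: image_iff)
  ultimately show "open (chart M p ` ({x. (x, b) \<in> W} \<inter> chart_dom M p))" by simp
qed

lemma openin_slice2:
  assumes W: "openin (mfd_top (M \<times>\<^sub>M N)) W" and a: "a \<in> points M"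
  shows "openin (mfd_top N) {y. (a, y) \<in> W}"
  unfolding openin_atlas[OF N]
proof (intro conjI ballI)
  show "{y. (a, y) \<in> W} \<subseteq> points N" using W by (auto simp: openin_atlas[OF atlas_prod[OF M N]])
  fix q assume q: "q \<in> points N"
  let ?A = "chart (M \<times>\<^sub>M N) (a, q) ` (W \<inter> chart_dom (M \<times>\<^sub>M N) (a, q))"
  have "(a, q) \<in> points (M \<times>\<^sub>M N)" using q a by simp
  then have "open ?A" using W unfolding openin_atlas[OF atlas_prod[OF M N]] by blast
  then have "open ((\<lambda>u. (chart M a a, u)) -` ?A)"
    by (rule open_vimage) (intro continuous_intros)
  moreover have "(\<lambda>u. (chart M a a, u)) -` ?A = chart N q ` ({y. (a, y) \<in> W} \<inter> chart_dom N q)"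
    using mem_chart_dom[OF M a] inj_onD[OF inj_chart[OF M a]] by (force simp: image_iff)
  ultimately show "open (chart N q ` ({y. (a, y) \<in> W} \<inter> chart_dom N q))" by simp
qed

context
  fixes K :: "('r, 'k::findim_space) mfd" and W F
  assumes K: "atlas K" and F: "smooth_map (M \<times>\<^sub>M N) K W F"
begin

private lemmas MN = atlas_prod[OF M N]

private lemma W: "openin (mfd_top (M \<times>\<^sub>M N)) W" using F by (simp add: smooth_map_def)

text \<open>Translations in a groupoid are obtained from a local extension of the multiplication by
  freezing one argument; the two slice lemmas make them smooth along the fibres on which they are
  defined.\<close>

lemma smooth_map_slice1:
  assumes b: "b \<in> points N"
  shows "smooth_map M K {x. (x, b) \<in> W} (\<lambda>x. F (x, b))"
proof -
  let ?V = "{x. (x, b) \<in> W}"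
  have V: "openin (mfd_top M) ?V" by (rule openin_slice1[OF W b])
  have pre: "openin (mfd_top M) {x \<in> ?V. F (x, b) \<in> S}" if "openin (mfd_top K) S" for S
    using openin_slice1[OF smooth_map_preimage[OF MN K F that] b] by simp
  have ts: "topspace (subtopology (mfd_top M) ?V) = ?V"
    using openin_subset[OF V] by (simp add: Int_absorb1)
  show ?thesis
    unfolding smooth_map_def
  proof (intro conjI V ballI)
    show "continuous_map (subtopology (mfd_top M) ?V) (mfd_top K) (\<lambda>x. F (x, b))"
      unfolding continuous_map_def
    proof (intro conjI allI impI funcsetI)
      fix x assume "x \<in> topspace (subtopology (mfd_top M) ?V)"
      then show "F (x, b) \<in> topspace (mfd_top K)"
        using smooth_map_image[OF MN K F] by (simp add: topspace_mfd_top[OF K])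
    next
      fix S assume "openin (mfd_top K) S"
      from pre[OF this] show "openin (subtopology (mfd_top M) ?V) {x \<in> topspace (subtopology
          (mfd_top M) ?V). F (x, b) \<in> S}"
        unfolding ts openin_open_subtopology[OF V] by auto
    qed
    fix p q assume p: "p \<in> points M" and q: "q \<in> points K"
    let ?S = "{x \<in> chart_dom M p \<inter> ?V. F (x, b) \<in> chart_dom K q}"
    let ?T = "{z \<in> chart_dom (M \<times>\<^sub>M N) (p, b) \<inter> W. F z \<in> chart_dom K q}"
    have Seq: "?S = {x \<in> ?V. F (x, b) \<in> chart_dom K q} \<inter> chart_dom M p" by blast
    have oS: "open (chart M p ` ?S)"
      unfolding Seq using pre[OF openin_chart_dom[OF K q]] p openin_atlas[OF M] by blast
    have Teq: "?T = {z \<in> W. F z \<in> chart_dom K q} \<inter> chart_dom (M \<times>\<^sub>M N) (p, b)" by blast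
    have pb: "(p, b) \<in> points (M \<times>\<^sub>M N)" using p b by simp
    have oT: "open (chart (M \<times>\<^sub>M N) (p, b) ` ?T)"
      unfolding Teq using smooth_map_preimage[OF MN K F openin_chart_dom[OF K q]]
          pb openin_atlas[OF MN] by blast
    have sT: "smooth_on (chart (M \<times>\<^sub>M N) (p, b) ` ?T) (chart K q \<circ> F \<circ> chart_inv (M \<times>\<^sub>M N) (p, b))"
      using F pb q unfolding smooth_map_def by blast
    have sub: "(\<lambda>u. (u, chart N b b)) ` (chart M p ` ?S) \<subseteq> chart (M \<times>\<^sub>M N) (p, b) ` ?T"
      using mem_chart_dom[OF N b] by (force simp: image_iff)
    have sl: "smooth_on (chart M p ` ?S) (\<lambda>u. (u, chart N b b))"
      by (intro smooth_on_Pair oS smooth_on_id smooth_on_const)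
    show "smooth_on (chart M p ` ?S) (chart K q \<circ> (\<lambda>x. F (x, b)) \<circ> chart_inv M p)"
    proof (rule smooth_on_cong[OF oS _ smooth_on_compose[OF oS oT sub sl sT]])
      fix z assume "z \<in> chart M p ` ?S"
      then have "z \<in> chart M p ` chart_dom M p" by blast
      from chart_inv_prod[OF inj_chart[OF M p] inj_chart[OF N b] this, of "chart N b b"]
      show "(chart K q \<circ> F \<circ> chart_inv (M \<times>\<^sub>M N) (p, b)) (z, chart N b b) = (chart K q \<circ> (\<lambda>x. F (x,
          b)) \<circ> chart_inv M p) z"
        by (simp add: mem_chart_dom[OF N b] chart_inv_chart[OF N b mem_chart_dom[OF N b]])
    qed
  qed
qed

lemma smooth_map_slice2:
  assumes a: "a \<in> points M"
  shows "smooth_map N K {y. (a, y) \<in> W} (\<lambda>y. F (a, y))"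
proof -
  let ?V = "{y. (a, y) \<in> W}"
  have V: "openin (mfd_top N) ?V" by (rule openin_slice2[OF W a])
  have pre: "openin (mfd_top N) {y \<in> ?V. F (a, y) \<in> S}" if "openin (mfd_top K) S" for S
    using openin_slice2[OF smooth_map_preimage[OF MN K F that] a] by simp
  have ts: "topspace (subtopology (mfd_top N) ?V) = ?V"
    using openin_subset[OF V] by (simp add: Int_absorb1)
  show ?thesis
    unfolding smooth_map_def
  proof (intro conjI V ballI)
    show "continuous_map (subtopology (mfd_top N) ?V) (mfd_top K) (\<lambda>y. F (a, y))"
      unfolding continuous_map_def
    proof (intro conjI allI impI funcsetI)
      fix x assume "x \<in> topspace (subtopology (mfd_top N) ?V)"
      then show "F (a, x) \<in> topspace (mfd_top K)"
        using smooth_map_image[OF MN K F] by (simp add: topspace_mfd_top[OF K])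
    next
      fix S assume "openin (mfd_top K) S"
      from pre[OF this] show "openin (subtopology (mfd_top N) ?V) {y \<in> topspace (subtopology
          (mfd_top N) ?V). F (a, y) \<in> S}"
        unfolding ts openin_open_subtopology[OF V] by auto
    qed
    fix p q assume p: "p \<in> points N" and q: "q \<in> points K"
    let ?S = "{y \<in> chart_dom N p \<inter> ?V. F (a, y) \<in> chart_dom K q}"
    let ?T = "{z \<in> chart_dom (M \<times>\<^sub>M N) (a, p) \<inter> W. F z \<in> chart_dom K q}"
    have Seq: "?S = {y \<in> ?V. F (a, y) \<in> chart_dom K q} \<inter> chart_dom N p" by blast
    have oS: "open (chart N p ` ?S)"
      unfolding Seq using pre[OF openin_chart_dom[OF K q]] p openin_atlas[OF N] by blast
    have Teq: "?T = {z \<in> W. F z \<in> chart_dom K q} \<inter> chart_dom (M \<times>\<^sub>M N) (a, p)" by blast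
    have pb: "(a, p) \<in> points (M \<times>\<^sub>M N)" using p a by simp
    have oT: "open (chart (M \<times>\<^sub>M N) (a, p) ` ?T)"
      unfolding Teq using smooth_map_preimage[OF MN K F openin_chart_dom[OF K q]]
          pb openin_atlas[OF MN] by blast
    have sT: "smooth_on (chart (M \<times>\<^sub>M N) (a, p) ` ?T) (chart K q \<circ> F \<circ> chart_inv (M \<times>\<^sub>M N) (a, p))"
      using F pb q unfolding smooth_map_def by blast
    have sub: "(\<lambda>u. (chart M a a, u)) ` (chart N p ` ?S) \<subseteq> chart (M \<times>\<^sub>M N) (a, p) ` ?T"
      using mem_chart_dom[OF M a] by (force simp: image_iff)
    have sl: "smooth_on (chart N p ` ?S) (\<lambda>u. (chart M a a, u))"
      by (intro smooth_on_Pair oS smooth_on_id smooth_on_const)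
    show "smooth_on (chart N p ` ?S) (chart K q \<circ> (\<lambda>y. F (a, y)) \<circ> chart_inv N p)"
    proof (rule smooth_on_cong[OF oS _ smooth_on_compose[OF oS oT sub sl sT]])
      fix z assume "z \<in> chart N p ` ?S"
      then have "z \<in> chart N p ` chart_dom N p" by blast
      from chart_inv_prod[OF inj_chart[OF M a] inj_chart[OF N p] _ this, of "chart M a a"]
      show "(chart K q \<circ> F \<circ> chart_inv (M \<times>\<^sub>M N) (a, p)) (chart M a a, z) = (chart K q \<circ> (\<lambda>y. F (a,
          y)) \<circ> chart_inv N p) z"
        by (simp add: mem_chart_dom[OF M a] chart_inv_chart[OF M a mem_chart_dom[OF M a]])
    qed
  qed
qed

end

end

section \<open>Fibre products as level sets\<close>

text \<open>The chart at \<open>f p\<close> is injective, so where both maps land in its domain the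
  difference of chart values vanishes exactly at the pairs on which the maps agree.\<close>

lemma level_set_equalizer:
  assumes M: "atlas M" and N: "atlas N" and K: "atlas K"
    and f: "smooth_map M K (points M) f" and f': "smooth_map N K (points N) f'"
    and p: "p \<in> points M" and q: "q \<in> points N" and eq: "f p = f' q"
    and surj: "surj (tangent_map M K f p)"
  defines "\<Phi> \<equiv> \<lambda>z. chart K (f p) (f (fst z)) - chart K (f p) (f' (snd z))"
  obtains W where "smooth_fn (M \<times>\<^sub>M N) W (p, q) \<Phi>"
    "\<And>v w. coord_deriv (M \<times>\<^sub>M N) \<Phi> (p, q) (v, w) = tangent_map M K f p v - tangent_map N K f' q w"
    "\<And>x y. (x, y) \<in> W \<Longrightarrow> x \<in> points M \<and> y \<in> points N"
    "\<And>x y. (x, y) \<in> W \<Longrightarrow> f x = f' y \<longleftrightarrow> \<Phi> (x, y) = 0"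
proof -
  define V1 where "V1 = {x \<in> points M. f x \<in> chart_dom K (f p)} \<inter> chart_dom M p"
  define V2 where "V2 = {y \<in> points N. f' y \<in> chart_dom K (f p)} \<inter> chart_dom N q"
  note P = atlas_prod[OF M N]
  have s1: "smooth_fn M V1 p (\<lambda>x. chart K (f p) (f x))" "coord_deriv M (\<lambda>x. chart K (f p) (f x))
      p = tangent_map M K f p"
    unfolding V1_def by (rule smooth_fn_map[OF M K f p])+
  have s2: "smooth_fn N V2 q (\<lambda>y. chart K (f p) (f' y))" "coord_deriv N (\<lambda>y. chart K (f p) (f' y))
      q = tangent_map N K f' q"
    unfolding V2_def eq by (rule smooth_fn_map[OF N K f' q])+
  note a = smooth_fn_fst[OF M N s1(1) q] and b = smooth_fn_snd[OF M N p s2(1)]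
  have fp: "f p \<in> points K" by (rule smooth_map_image[OF M K f p])
  show thesis
  proof (rule that[of "(V1 \<times> chart_dom N q) \<inter> (chart_dom M p \<times> V2)"])
    show "smooth_fn (M \<times>\<^sub>M N) ((V1 \<times> chart_dom N q) \<inter> (chart_dom M p \<times> V2)) (p, q) \<Phi>"
      unfolding \<Phi>_def by (rule smooth_fn_diff(1)[OF P a(1) b(1)])
    show "coord_deriv (M \<times>\<^sub>M N) \<Phi> (p, q) (v, w) = tangent_map M K f p v - tangent_map N K f' q w"
        for v w
      unfolding \<Phi>_def by (simp add: smooth_fn_diff(2)[OF P a(1) b(1)] a(2) b(2) s1(2) s2(2))
    fix x y assume xy: "(x, y) \<in> (V1 \<times> chart_dom N q) \<inter> (chart_dom M p \<times> V2)"
    then show "x \<in> points M \<and> y \<in> points N" by (auto simp: V1_def V2_def)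
    have "f x \<in> chart_dom K (f p)" "f' y \<in> chart_dom K (f p)" using xy by (auto simp: V1_def V2_def)
    then show "f x = f' y \<longleftrightarrow> \<Phi> (x, y) = 0"
      using inj_onD[OF inj_chart[OF K fp]] by (auto simp: \<Phi>_def)
  qed
qed

lemma surj_fst_diff:
  fixes f :: "'a::real_vector \<Rightarrow> 'c::real_vector" and g :: "'b::real_vector \<Rightarrow> 'c"
  assumes "surj f" "linear g"
  shows "surj (\<lambda>z. f (fst z) - g (snd z))"
  unfolding surj_def
proof
  fix c
  obtain v where "f v = c" using assms(1) by (metis surjD)
  then have "c = f (fst (v, 0)) - g (snd (v, 0))" using linear_0[OF assms(2)] by simp
  then show "\<exists>z. c = f (fst z) - g (snd z)" by blast
qed

text \<open>The differential of \<open>\<Phi>\<close> is onto because that of \<open>f\<close>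
  already is. Applied to source and target for composable pairs, and to the source twice for pairs
  of arrows with the same source.\<close>

lemma equalizer_submanifold:
  fixes f :: "'p \<Rightarrow> 'r" and f' :: "'q \<Rightarrow> 'r" and K :: "('r, 'k::findim_space) mfd"
  assumes M: "atlas M" and N: "atlas N" and K: "atlas K"
    and f: "submersion M K f" and f': "smooth_map N K (points N) f'"
  defines "Q \<equiv> {(x, y). x \<in> points M \<and> y \<in> points N \<and> f x = f' y}"
  shows "submanifold (M \<times>\<^sub>M N) Q"
    and "(p, q) \<in> Q \<Longrightarrow> tangent_space (M \<times>\<^sub>M N) Q (p, q) = {(v, w). tangent_map M K f p v =
        tangent_map N K f' q w}"
proof -
  note P = atlas_prod[OF M N]
  define \<Phi> where "\<Phi> r z = chart K (f (fst r)) (f (fst z)) - chart K (f (fst r)) (f' (snd z))"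
    for r :: "'p \<times> 'q" and z
  have sf: "smooth_map M K (points M) f" and surj: "\<And>p. p \<in> points M \<Longrightarrow> surj (tangent_map M K f p)"
    using f by (auto simp: submersion_def)
  have main: "level_set_at (M \<times>\<^sub>M N) Q (p, q) (\<Phi> (p, q)) \<and>
      (\<forall>v w. coord_deriv (M \<times>\<^sub>M N) (\<Phi> (p, q)) (p, q) (v, w) = tangent_map M K f p v - tangent_map N K
          f' q w)"
    if "(p, q) \<in> Q" for p q
  proof -
    have pq: "p \<in> points M" "q \<in> points N" "f p = f' q" using that by (auto simp: Q_def)
    have \<Phi>: "\<Phi> (p, q) = (\<lambda>z. chart K (f p) (f (fst z)) - chart K (f p) (f' (snd z)))"
        by (rule ext) (simp add: \<Phi>_def)
    obtain W where W: "smooth_fn (M \<times>\<^sub>M N) W (p, q) (\<Phi> (p, q))"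
      "\<And>v w. coord_deriv (M \<times>\<^sub>M N) (\<Phi> (p, q)) (p, q) (v, w) = tangent_map M K f p v - tangent_map N K
          f' q w"
      "\<And>x y. (x, y) \<in> W \<Longrightarrow> x \<in> points M \<and> y \<in> points N"
      "\<And>x y. (x, y) \<in> W \<Longrightarrow> f x = f' y \<longleftrightarrow> \<Phi> (p, q) (x, y) = 0"
      unfolding \<Phi> using level_set_equalizer[OF M N K sf f' pq surj[OF pq(1)]] by blast
    have "coord_deriv (M \<times>\<^sub>M N) (\<Phi> (p, q)) (p, q) = (\<lambda>z. tangent_map M K f p (fst z)
        - tangent_map N K f' q (snd z))"
      using W(2) by auto
    then have "surj (coord_deriv (M \<times>\<^sub>M N) (\<Phi> (p, q)) (p, q))"
      using surj_fst_diff[OF surj[OF pq(1)] linear_tangent_map[OF N K f' pq(2)]] by simp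
    moreover have "z \<in> Q \<longleftrightarrow> \<Phi> (p, q) z = 0" if "z \<in> W" for z
      using W(3,4)[of "fst z" "snd z"] that by (auto simp: Q_def split_beta)
    ultimately show ?thesis using level_set_atI[OF P W(1)] W(2) by blast
  qed
  show "submanifold (M \<times>\<^sub>M N) Q"
  proof (rule level_set_submanifold[OF P, where \<Phi> = \<Phi>])
    show "Q \<subseteq> points (M \<times>\<^sub>M N)" by (auto simp: Q_def)
    show "level_set_at (M \<times>\<^sub>M N) Q r (\<Phi> r)" if "r \<in> Q" for r using main[of "fst r" "snd r"] that
        by simp
  qed
  show "tangent_space (M \<times>\<^sub>M N) Q (p, q) = {(v, w). tangent_map M K f p v = tangent_map N K f' q w}"
      if "(p, q) \<in> Q"
    using level_set_tangent_space[OF P _ that, of "\<Phi> (p, q)"] main[OF that]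
        by (auto split: prod.splits)
qed

text \<open>The same argument with a constant in place of the second map; it describes the vectors
  tangent to source fibres.\<close>

lemma fibre_tangent_space:
  fixes f :: "'p \<Rightarrow> 'r" and K :: "('r, 'k::findim_space) mfd"
  assumes M: "atlas M" and K: "atlas K" and f: "submersion M K f" and p: "p \<in> points M"
  shows "tangent_space M {x \<in> points M. f x = f p} p = {v. tangent_map M K f p v = 0}"
proof -
  have sf: "smooth_map M K (points M) f" and surj: "surj (tangent_map M K f p)"
    using f p by (auto simp: submersion_def)
  let ?V = "{x \<in> points M. f x \<in> chart_dom K (f p)} \<inter> chart_dom M p"
  let ?\<Phi> = "\<lambda>x. chart K (f p) (f x) - chart K (f p) (f p)"
  have fp: "f p \<in> points K" by (rule smooth_map_image[OF M K sf p])
  note s1 = smooth_fn_map[OF M K sf p] and s2 = smooth_fn_const[OF M p, where c = "chart K (f p)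
      (f p)"]
  have s: "smooth_fn M (?V \<inter> chart_dom M p) p ?\<Phi>" by (rule smooth_fn_diff(1)[OF M s1(1) s2(1)])
  have d: "coord_deriv M ?\<Phi> p = tangent_map M K f p"
    by (rule ext) (simp add: smooth_fn_diff(2)[OF M s1(1) s2(1)] s1(2) s2(2))
  have "level_set_at M {x \<in> points M. f x = f p} p ?\<Phi>"
  proof (rule level_set_atI[OF M s])
    show "surj (coord_deriv M ?\<Phi> p)" unfolding d by (rule surj)
    show "x \<in> {x \<in> points M. f x = f p} \<longleftrightarrow> ?\<Phi> x = 0" if "x \<in> ?V \<inter> chart_dom M p" for x
      using that inj_onD[OF inj_chart[OF K fp]] mem_chart_dom[OF K fp] by auto
  qed
  from level_set_tangent_space[OF M this] p show ?thesis unfolding d by simp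
qed

section \<open>The tangent groupoid\<close>

context
  fixes G :: "('g, 'e::findim_space, 'm, 'f::findim_space) groupoid"
  assumes LG: "lie_groupoid G"
begin

private abbreviation (input) "M \<equiv> arr G"
private abbreviation (input) "B \<equiv> obj G"
private abbreviation (input) "s \<equiv> src G"
private abbreviation (input) "t \<equiv> tgt G"
private abbreviation (input) "u1 \<equiv> idt G"
private abbreviation (input) "i \<equiv> inversion G"
private abbreviation (input) "m \<equiv> mult G"
private abbreviation (input) "C \<equiv> composable G"
private abbreviation (input) "Ts \<equiv> tangent_map M B s"
private abbreviation (input) "Tt \<equiv> tangent_map M B t"
private abbreviation (input) "Tm g h \<equiv> tangent_map_along (M \<times>\<^sub>M M) M C (\<lambda>(g, h). m g h) (g, h)"

private lemma AM: "atlas M" and AB: "atlas B"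
  using LG by (auto simp: lie_groupoid_def intro: smooth_manifold_atlas)

private lemmas P2 = atlas_prod[OF AM AM]
private lemmas P3 = atlas_prod[OF AM P2]

private lemma sub_s: "submersion M B s" and sub_t: "submersion M B t"
  and sm_e: "smooth_map B M (points B) u1" and sm_i: "smooth_map M M (points M) i"
  and sm_m: "smooth_map_along (M \<times>\<^sub>M M) M C (\<lambda>(g, h). m g h)"
  using LG by (simp_all add: lie_groupoid_def)

private lemma sm_s: "smooth_map M B (points M) s" and sm_t: "smooth_map M B (points M) t"
  using sub_s sub_t by (auto simp: submersion_def)

private lemma s_in: "g \<in> points M \<Longrightarrow> s g \<in> points B" and t_in: "g \<in> points M \<Longrightarrow> t g \<in> points B"
  and e_in: "x \<in> points B \<Longrightarrow> u1 x \<in> points M" and i_in: "g \<in> points M \<Longrightarrow> i g \<in> points M"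
  using smooth_map_image[OF AM AB sm_s] smooth_map_image[OF AM AB sm_t] smooth_map_image[OF AB AM
      sm_e] smooth_map_image[OF AM AM sm_i] by blast+

private lemma comp_iff: "(g, h) \<in> C \<longleftrightarrow> g \<in> points M \<and> h \<in> points M \<and> s g = t h"
  by (simp add: composable_def)

private lemma m_in: "(g, h) \<in> C \<Longrightarrow> m g h \<in> points M" and s_m: "(g, h) \<in> C \<Longrightarrow> s (m g h) = s h"
  and t_m: "(g, h) \<in> C \<Longrightarrow> t (m g h) = t g"
  using LG by (auto simp: lie_groupoid_def)

private lemma assoc: "(g, h) \<in> C \<Longrightarrow> (h, k) \<in> C \<Longrightarrow> m (m g h) k = m g (m h k)"
  using LG unfolding lie_groupoid_def by blast

private lemma s_e: "x \<in> points B \<Longrightarrow> s (u1 x) = x" and t_e: "x \<in> points B \<Longrightarrow> t (u1 x) = x"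
  using LG unfolding lie_groupoid_def by blast+

private lemma unitl: "g \<in> points M \<Longrightarrow> m (u1 (t g)) g = g" and unitr: "g \<in> points M \<Longrightarrow> m g (u1 (s g))
    = g"
  and s_i: "g \<in> points M \<Longrightarrow> s (i g) = t g" and t_i: "g \<in> points M \<Longrightarrow> t (i g) = s g"
  and invl: "g \<in> points M \<Longrightarrow> m (i g) g = u1 (s g)" and invr: "g \<in> points M \<Longrightarrow> m g (i g) = u1 (t g)"
  using LG unfolding lie_groupoid_def by blast+

private lemma i_e: "x \<in> points B \<Longrightarrow> i (u1 x) = u1 x"
  using unitr[OF i_in[OF e_in]] invl[OF e_in] by (simp add: s_i e_in s_e t_e)

private lemma mult_inv_cancel: "(g, h) \<in> C \<Longrightarrow> m (m g h) (i h) = g"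
  using assoc[of g h "i h"] invr[of h] unitr[of g] by (simp add: comp_iff i_in t_i)

private lemma mult_cancel_inv: "g \<in> points M \<Longrightarrow> h \<in> points M \<Longrightarrow> s g = s h \<Longrightarrow> m (m g (i h)) h = g"
  using assoc[of g "i h" h] invl[of h] unitr[of g] by (simp add: comp_iff i_in t_i s_i)

text \<open>Near \<open>(m g h, g, h)\<close> the graph is the zero set of a map with two
  components: the difference between the first entry and a local extension \<open>F\<close> of the
  multiplication, in the chart at \<open>m g h\<close>, and the difference between source and
  target. The second component is there because \<open>F\<close> is tied to the product only on
  composable pairs.\<close>

lemma graph_mult_submanifold: "submanifold (M \<times>\<^sub>M M \<times>\<^sub>M M) (graph_mult G)"
  and tangent_space_graph_mult: "(g, h) \<in> C \<Longrightarrow>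
    tangent_space (M \<times>\<^sub>M M \<times>\<^sub>M M) (graph_mult G) (m g h, g, h) = {(Z, X, Y). Z = Tm g h (X, Y) \<and>
        Ts g X = Tt h Y}"
proof -
  have main: "\<exists>\<Phi> :: 'g \<times> 'g \<times> 'g \<Rightarrow> 'e \<times> 'f. level_set_at (M \<times>\<^sub>M M \<times>\<^sub>M M) (graph_mult G) (m g h, g, h)
      \<Phi> \<and>
      (\<forall>Z X Y. coord_deriv (M \<times>\<^sub>M M \<times>\<^sub>M M) \<Phi> (m g h, g, h) (Z, X, Y) = (Z - Tm g h (X, Y),
          Ts g X - Tt h Y))"
    if gh: "(g, h) \<in> C" for g h
  proof -
    have g: "g \<in> points M" and h: "h \<in> points M" and st: "s g = t h" using gh
        by (auto simp: comp_iff)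
    obtain F W where F: "(g, h) \<in> W" "smooth_map (M \<times>\<^sub>M M) M W F" "\<And>x. x \<in> C \<Longrightarrow> x \<in> W \<Longrightarrow> F x = (\<lambda>(g,
        h). m g h) x"
      "Tm g h = tangent_map (M \<times>\<^sub>M M) M F (g, h)"
      using tangent_map_along_extension[OF P2 AM sm_m gh] by metis
    have Fgh: "F (g, h) = m g h" using F(1) F(3)[OF gh] by simp
    have k: "m g h \<in> points M" by (rule m_in[OF gh])
    have gh2: "(g, h) \<in> points (M \<times>\<^sub>M M)" using g h by simp
    define \<Psi> where "\<Psi> = (\<lambda>z. chart B (s g) (s (fst z)) - chart B (s g) (t (snd z)))"
    have surj: "surj (Ts g)" using sub_s g by (simp add: submersion_def)
    obtain V where V: "smooth_fn (M \<times>\<^sub>M M) V (g, h) \<Psi>"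
      "\<And>v w. coord_deriv (M \<times>\<^sub>M M) \<Psi> (g, h) (v, w) = Ts g v - Tt h w"
      "\<And>x y. (x, y) \<in> V \<Longrightarrow> x \<in> points M \<and> y \<in> points M"
      "\<And>x y. (x, y) \<in> V \<Longrightarrow> s x = t y \<longleftrightarrow> \<Psi> (x, y) = 0"
      unfolding \<Psi>_def using level_set_equalizer[OF AM AM AB sm_s sm_t g h st surj] by blast
    define W' where "W' = {x \<in> W. F x \<in> chart_dom M (m g h)} \<inter> chart_dom (M \<times>\<^sub>M M) (g, h)"
    have f2: "smooth_fn (M \<times>\<^sub>M M) W' (g, h) (\<lambda>x. chart M (m g h) (F x))"
      "coord_deriv (M \<times>\<^sub>M M) (\<lambda>x. chart M (m g h) (F x)) (g, h) = Tm g h"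
      using smooth_fn_map[OF P2 AM F(2,1)] by (simp_all only: Fgh W'_def F(4))
    note a1 = smooth_fn_fst[OF AM P2 smooth_fn_chart(1)[OF AM k] gh2]
    note a2 = smooth_fn_snd[OF AM P2 k f2(1)]
    note a3 = smooth_fn_snd[OF AM P2 k V(1)]
    note a12 = smooth_fn_diff[OF P3 a1(1) a2(1)]
    note a = smooth_fn_Pair[OF P3 a12(1) a3(1)]
    let ?\<Phi> = "\<lambda>z. (chart M (m g h) (fst z) - chart M (m g h) (F (snd z)), \<Psi> (snd z))"
    have cd: "coord_deriv (M \<times>\<^sub>M M \<times>\<^sub>M M) ?\<Phi> (m g h, g, h) (Z, X, Y) = (Z - Tm g h (X, Y),
        Ts g X - Tt h Y)" for Z X Y
      by (simp add: a(2) a12(2) a1(2) a2(2) a3(2) f2(2) V(2) smooth_fn_chart(2)[OF AM k])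
    have "level_set_at (M \<times>\<^sub>M M \<times>\<^sub>M M) (graph_mult G) (m g h, g, h) ?\<Phi>"
    proof (rule level_set_atI[OF P3 a(1)])
      show "surj (coord_deriv (M \<times>\<^sub>M M \<times>\<^sub>M M) ?\<Phi> (m g h, g, h))"
        unfolding surj_def
      proof
        fix c :: "'e \<times> 'f"
        obtain X where X: "Ts g X = snd c" using surj by (metis surjD)
        \<comment> \<open>\<open>X\<close> lifts the second component through the submersion
          \<open>s\<close>, with \<open>Y = 0\<close>; the first entry is free and corrects for
          \<open>Tm\<close>.\<close>
        have "c = coord_deriv (M \<times>\<^sub>M M \<times>\<^sub>M M) ?\<Phi> (m g h, g, h) (fst c + Tm g h (X, 0), X, 0)"
          unfolding cd by (simp add: X linear_0[OF linear_tangent_map[OF AM AB sm_t h]])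
        then show "\<exists>z. c = coord_deriv (M \<times>\<^sub>M M \<times>\<^sub>M M) ?\<Phi> (m g h, g, h) z" by blast
      qed
      fix z assume z: "z \<in> chart_dom M (m g h) \<times> chart_dom (M \<times>\<^sub>M M) (g, h) \<inter> chart_dom M (m g h)
          \<times> W' \<inter> chart_dom M (m g h) \<times> V"
      obtain k' g' h' where z': "z = (k', g', h')" by (cases z)
      have zz: "k' \<in> chart_dom M (m g h)" "(g', h') \<in> W" "F (g', h') \<in> chart_dom M (m g h)"
          "(g', h') \<in> V"
        using z by (auto simp: z' W'_def)
      have "z \<in> graph_mult G \<longleftrightarrow> (g', h') \<in> C \<and> k' = m g' h'" by (auto simp: z' graph_mult_def)
      also have "\<dots> \<longleftrightarrow> s g' = t h' \<and> k' = F (g', h')" using F(3)[OF _ zz(2)] V(3)[OF zz(4)]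
          by (auto simp: comp_iff)
      also have "\<dots> \<longleftrightarrow> \<Psi> (g', h') = 0 \<and> chart M (m g h) k' = chart M (m g h) (F (g', h'))"
        using V(4)[OF zz(4)] inj_onD[OF inj_chart[OF AM k] _ zz(1,3)] by auto
      also have "\<dots> \<longleftrightarrow> ?\<Phi> z = 0" by (auto simp: z' zero_prod_def)
      finally show "z \<in> graph_mult G \<longleftrightarrow> ?\<Phi> z = 0" .
    qed
    with cd show ?thesis by blast
  qed
  then obtain \<Phi> :: "'g \<Rightarrow> 'g \<Rightarrow> 'g \<times> 'g \<times> 'g \<Rightarrow> 'e \<times> 'f" where
    \<Phi>: "\<And>g h. (g, h) \<in> C \<Longrightarrow> level_set_at (M \<times>\<^sub>M M \<times>\<^sub>M M) (graph_mult G) (m g h, g, h) (\<Phi> g h)"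
      "\<And>g h Z X Y. (g, h) \<in> C \<Longrightarrow> coord_deriv (M \<times>\<^sub>M M \<times>\<^sub>M M) (\<Phi> g h) (m g h, g, h) (Z, X, Y)
          = (Z - Tm g h (X, Y), Ts g X - Tt h Y)"
    by metis
  show "submanifold (M \<times>\<^sub>M M \<times>\<^sub>M M) (graph_mult G)"
  proof (rule level_set_submanifold[OF P3, where \<Phi> = "\<lambda>r. \<Phi> (fst (snd r)) (snd (snd r))"])
    show "graph_mult G \<subseteq> points (M \<times>\<^sub>M M \<times>\<^sub>M M)" using m_in by (auto simp: graph_mult_def comp_iff)
    show "level_set_at (M \<times>\<^sub>M M \<times>\<^sub>M M) (graph_mult G) r (\<Phi> (fst (snd r)) (snd (snd r)))"
        if "r \<in> graph_mult G" for r
      using that \<Phi>(1) by (auto simp: graph_mult_def)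
  qed
  show "tangent_space (M \<times>\<^sub>M M \<times>\<^sub>M M) (graph_mult G) (m g h, g, h) = {(Z, X, Y). Z = Tm g h (X, Y) \<and>
      Ts g X = Tt h Y}"
    if gh: "(g, h) \<in> C"
  proof -
    have "(m g h, g, h) \<in> graph_mult G" using gh by (auto simp: graph_mult_def)
    from level_set_tangent_space[OF P3 \<Phi>(1)[OF gh] this] show ?thesis
      using \<Phi>(2)[OF gh] by (auto simp: zero_prod_def)
  qed
qed

section \<open>Curves realising tangent vectors of pairs of arrows\<close>

lemma composable_submanifold: "submanifold (M \<times>\<^sub>M M) C"
  using equalizer_submanifold(1)[OF AM AM AB sub_s sm_t] by (simp add: composable_def)

text \<open>The condition on \<open>X\<close> and \<open>Y\<close> describes the tangent space of
  the set of composable pairs, so the pair is the velocity of a curve of composable arrows, along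
  which products can be differentiated.\<close>

lemma composable_curve:
  assumes "(g, h) \<in> C" "Ts g X = Tt h Y"
  obtains c d where "velocity M c g X" "velocity M d h Y" "\<And>r. (c r, d r) \<in> C"
proof -
  have C: "C = {(x, y). x \<in> points M \<and> y \<in> points M \<and> s x = t y}" by (simp add: composable_def)
  have "(X, Y) \<in> tangent_space (M \<times>\<^sub>M M) C (g, h)"
    using equalizer_submanifold(2)[OF AM AM AB sub_s sm_t, of g h] assms unfolding C by auto
  then obtain c where c: "velocity (M \<times>\<^sub>M M) c (g, h) (X, Y)" "\<And>r. c r \<in> C"
    using velocity_tangent[OF P2 _ _ assms(1)] by (auto simp: comp_iff subset_iff)
  show thesis by (rule that[OF velocity_fst_snd[OF AM AM c(1)]]) (use c(2) in simp)
qed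

text \<open>Pairs with equal source are those that can be divided on the right; their curves serve
  to show that \<open>Tm\<close> is onto.\<close>

lemma same_source_curve:
  assumes "g \<in> points M" "h \<in> points M" "s g = s h" "Ts g X = Ts h Y"
  obtains c d where "velocity M c g X" "velocity M d h Y" "\<And>r. c r \<in> points M \<and> d r \<in> points M \<and>
      s (c r) = s (d r)"
proof -
  let ?Q = "{(x, y). x \<in> points M \<and> y \<in> points M \<and> s x = s y}"
  have Q: "?Q \<subseteq> points (M \<times>\<^sub>M M)" "(g, h) \<in> ?Q" using assms by auto
  have "(X, Y) \<in> tangent_space (M \<times>\<^sub>M M) ?Q (g, h)"
    unfolding equalizer_submanifold(2)[OF AM AM AB sub_s sm_s Q(2)] using assms(4) by simp
  then obtain c where c: "velocity (M \<times>\<^sub>M M) c (g, h) (X, Y)" "\<And>r. c r \<in> ?Q"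
    by (rule velocity_tangent[OF P2 _ Q]) blast
  show thesis
  proof (rule that[OF velocity_fst_snd[OF AM AM c(1)]])
    show "fst (c r) \<in> points M \<and> snd (c r) \<in> points M \<and> s (fst (c r)) = s (snd (c r))" for r
      using c(2)[of r] by (simp add: split_beta)
  qed
qed

lemma source_fibre_curve:
  assumes "g \<in> points M" "Ts g X = 0"
  obtains c where "velocity M c g X" "\<And>r. c r \<in> points M \<and> s (c r) = s g"
proof -
  have "X \<in> tangent_space M {x \<in> points M. s x = s g} g"
    using fibre_tangent_space[OF AM AB sub_s assms(1)] assms(2) by simp
  then obtain c where "velocity M c g X" "\<And>r. c r \<in> {x \<in> points M. s x = s g}"
    by (rule velocity_tangent[OF AM]) (use assms(1) in blast)+
  then show thesis by (intro that) auto
qed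

section \<open>Velocities under the structure maps and translations\<close>

private lemma vel_in: "velocity M c g v \<Longrightarrow> g \<in> points M"
  by (simp add: velocity_def[OF AM])

private lemma vel_s: "velocity M c g v \<Longrightarrow> velocity B (\<lambda>r. s (c r)) (s g) (Ts g v)"
  and vel_t: "velocity M c g v \<Longrightarrow> velocity B (\<lambda>r. t (c r)) (t g) (Tt g v)"
  and vel_i: "velocity M c g v \<Longrightarrow> velocity M (\<lambda>r. i (c r)) (i g) (tangent_map M M i g v)"
  using velocity_map[OF AM AB sm_s] velocity_map[OF AM AB sm_t] velocity_map[OF AM AM sm_i] vel_in
      by blast+

private lemma vel_m:
  assumes c: "velocity M c g v" and d: "velocity M d h w" and cd: "\<And>r. (c r, d r) \<in> C"
  shows "velocity M (\<lambda>r. m (c r) (d r)) (m g h) (Tm g h (v, w))"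
proof -
  have "c 0 = g" "d 0 = h" using c d by (auto simp: velocity_def[OF AM])
  then have gh: "(g, h) \<in> C" using cd[of 0] by simp
  show ?thesis using velocity_along[OF P2 AM sm_m gh velocity_Pair[OF AM AM c d] cd] by simp
qed

private lemma linear_Tm: "(g, h) \<in> C \<Longrightarrow> linear (Tm g h)"
  by (rule linear_tangent_map_along[OF P2 AM sm_m])

text \<open>Freezing \<open>g\<close> in a local extension of the multiplication extends the
  translation from the target fibre to an open set of arrows.\<close>

private lemma sm_left: "g \<in> points M \<Longrightarrow> smooth_map_along M M {h \<in> points M. t h = s g} (\<lambda>h. m g h)"
  unfolding smooth_map_along_def
proof
  fix h assume g: "g \<in> points M" and h: "h \<in> {h \<in> points M. t h = s g}"
  then have gh: "(g, h) \<in> C" by (simp add: comp_iff)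
  obtain F W where F: "(g, h) \<in> W" "smooth_map (M \<times>\<^sub>M M) M W F" "\<And>x. x \<in> C \<Longrightarrow> x \<in> W \<Longrightarrow> F x = (\<lambda>(g,
      h). m g h) x"
    using tangent_map_along_extension[OF P2 AM sm_m gh] by metis
  have "local_extension M M {h \<in> points M. t h = s g} (m g) h (\<lambda>h. F (g, h))"
    unfolding local_extension_def
    using F smooth_map_slice2[OF AM AM AM F(2) g] g by (intro exI[of _ "{y. (g, y) \<in> W}"])
        (auto simp: comp_iff)
  then show "\<exists>F. local_extension M M {h \<in> points M. t h = s g} (m g) h F" by blast
qed

private lemma sm_right: "g \<in> points M \<Longrightarrow> smooth_map_along M M {h \<in> points M. s h = t g} (\<lambda>h. m h g)"
  unfolding smooth_map_along_def
proof
  fix h assume g: "g \<in> points M" and h: "h \<in> {h \<in> points M. s h = t g}"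
  then have hg: "(h, g) \<in> C" by (simp add: comp_iff)
  obtain F W where F: "(h, g) \<in> W" "smooth_map (M \<times>\<^sub>M M) M W F" "\<And>x. x \<in> C \<Longrightarrow> x \<in> W \<Longrightarrow> F x = (\<lambda>(g,
      h). m g h) x"
    using tangent_map_along_extension[OF P2 AM sm_m hg] by metis
  have "local_extension M M {h \<in> points M. s h = t g} (\<lambda>h. m h g) h (\<lambda>h. F (h, g))"
    unfolding local_extension_def
    using F smooth_map_slice1[OF AM AM AM F(2) g] g by (intro exI[of _ "{x. (x, g) \<in> W}"])
        (auto simp: comp_iff)
  then show "\<exists>F. local_extension M M {h \<in> points M. s h = t g} (\<lambda>h. m h g) h F" by blast
qed

private lemma vel_left:
  assumes g: "g \<in> points M" and c: "velocity M c (u1 (s g)) v" "\<And>r. c r \<in> points M \<and> t (c r) = s g"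
  shows "velocity M (\<lambda>r. m g (c r)) g (tan_left G g v)"
  using velocity_along[OF AM AM sm_left[OF g] _ c(1)] c(2) g unitr[OF g]
  by (simp add: tan_left_def e_in s_in t_e)

private lemma vel_right:
  assumes g: "g \<in> points M" and c: "velocity M c (u1 (t g)) v" "\<And>r. c r \<in> points M \<and> s (c r) = t g"
  shows "velocity M (\<lambda>r. m (c r) g) g (tan_right G g v)"
  using velocity_along[OF AM AM sm_right[OF g] _ c(1)] c(2) g unitl[OF g]
  by (simp add: tan_right_def e_in t_in s_e)

private lemma linear_left: "g \<in> points M \<Longrightarrow> linear (tan_left G g)"
  unfolding tan_left_def
  by (rule linear_tangent_map_along[OF AM AM sm_left]) (simp_all add: e_in s_in t_e)

text \<open>The vector \<open>u - Tt u\<close> from the source map of the cotangent groupoid; on the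
  Lie algebroid it is minus the differential of the inversion, by
  \<open>tangent_inversion\<close>.\<close>

private abbreviation (input) "anchored x u \<equiv> u - tangent_map B M u1 x (Tt (u1 x) u)"

text \<open>The differential of the inversion on \<open>ker Ts\<close> at a unit, from \<open>a \<cdot> a\<inverse> = 1\<close>.\<close>

private lemma tangent_inversion:
  assumes x: "x \<in> points B" and u: "u \<in> lie_algebroid G x"
  shows "tangent_map M M i (u1 x) u = - anchored x u"
proof -
  let ?w = "tangent_map M M i (u1 x) u"
  have e: "u1 x \<in> points M" by (rule e_in[OF x])
  have ee: "(u1 x, u1 x) \<in> C" by (simp add: comp_iff e s_e t_e x)
  have m1: "m (u1 x) (u1 x) = u1 x" using unitl[OF e] by (simp add: t_e x)
  obtain a where a: "velocity M a (u1 x) u" "\<And>r. a r \<in> points M \<and> s (a r) = s (u1 x)"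
    using source_fibre_curve[OF e] u by (auto simp: lie_algebroid_def)
  have a': "a r \<in> points M" "s (a r) = x" for r using a(2) by (simp_all add: s_e x)
  have w: "velocity M (\<lambda>r. i (a r)) (u1 x) ?w" using vel_i[OF a(1)] by (simp add: i_e x)
  note c = velocity_const[OF AM e]
  have 1: "velocity M (\<lambda>r. u1 (t (a r))) (u1 x) (tangent_map B M u1 x (Tt (u1 x) u))"
    using velocity_map[OF AB AM sm_e _ vel_t[OF a(1)]] by (simp add: t_e x)
  have "velocity M (\<lambda>r. m (a r) (i (a r))) (u1 x) (Tm (u1 x) (u1 x) (u, ?w))"
    using vel_m[OF a(1) w] a' by (simp add: m1 comp_iff i_in t_i)
  then have 11: "Tm (u1 x) (u1 x) (u, ?w) = tangent_map B M u1 x (Tt (u1 x) u)"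
    unfolding invr[OF a'(1)] by (rule velocity_unique[OF AM _ 1])
  have au: "m (a r) (u1 x) = a r" for r using unitr[OF a'(1), of r] by (simp add: a'(2))
  have "velocity M (\<lambda>r. m (a r) (u1 x)) (u1 x) (Tm (u1 x) (u1 x) (u, 0))"
    using vel_m[OF a(1) c] a' by (simp add: m1 comp_iff e t_e x)
  then have 2: "Tm (u1 x) (u1 x) (u, 0) = u" unfolding au by (rule velocity_unique[OF AM _ a(1)])
  have ua: "m (u1 x) (i (a r)) = i (a r)" for r using unitl[OF i_in[OF a'(1)], of r]
      by (simp add: t_i a')
  have "velocity M (\<lambda>r. m (u1 x) (i (a r))) (u1 x) (Tm (u1 x) (u1 x) (0, ?w))"
    using vel_m[OF c w] a' by (simp add: m1 comp_iff e s_e x i_in t_i)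
  then have 3: "Tm (u1 x) (u1 x) (0, ?w) = ?w" unfolding ua by (rule velocity_unique[OF AM _ w])
  \<comment> \<open>Splitting the pair separates the arrow from its inverse, and a product with a
    unit contributes its other factor unchanged. So \<open>u + ?w\<close> is the velocity of the
    product, which runs through the units at the targets.\<close>
  have "Tm (u1 x) (u1 x) ((u, 0) + (0, ?w)) = u + ?w"
    unfolding linear_add[OF linear_Tm[OF ee]] 2 3 ..
  then show ?thesis using 11 by (simp add: algebra_simps)
qed

text \<open>For a curve \<open>a\<close> in the source fibre through a unit, \<open>(g \<cdot> a\<inverse>) \<cdot> (a \<cdot> h) = g \<cdot> h\<close> is constant.\<close>

private lemma kernel_vectors:
  assumes gh: "(g, h) \<in> C" and u: "u \<in> lie_algebroid G (s g)"
  shows "Ts g (- tan_left G g (anchored (s g) u)) = Tt h (tan_right G h u)"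
    and "Tm g h (- tan_left G g (anchored (s g) u), tan_right G h u) = 0"
proof -
  let ?x = "s g" and ?w = "- anchored (s g) u"
  have g: "g \<in> points M" and h: "h \<in> points M" and st: "s g = t h" using gh by (auto simp: comp_iff)
  have x: "?x \<in> points B" by (rule s_in[OF g])
  have e: "u1 ?x \<in> points M" by (rule e_in[OF x])
  obtain a where a: "velocity M a (u1 ?x) u" "\<And>r. a r \<in> points M \<and> s (a r) = s (u1 ?x)"
    using source_fibre_curve[OF e] u by (auto simp: lie_algebroid_def)
  have a': "a r \<in> points M" "s (a r) = ?x" for r using a(2) by (simp_all add: s_e x)
  have w: "velocity M (\<lambda>r. i (a r)) (u1 ?x) ?w"
    using vel_i[OF a(1)] tangent_inversion[OF x u] by (simp add: i_e x)
  have l: "velocity M (\<lambda>r. m g (i (a r))) g (- tan_left G g (anchored (s g) u))"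
    using vel_left[OF g w] a' by (simp add: linear_neg[OF linear_left[OF g], symmetric] i_in t_i)
  have r: "velocity M (\<lambda>r. m (a r) h) h (tan_right G h u)"
    using vel_right[OF h, of a u] a(1) a' by (simp add: st)
  have c1: "(g, i (a r)) \<in> C" "(a r, h) \<in> C" "(i (a r), a r) \<in> C" for r
    using a' g h st by (simp_all add: comp_iff i_in t_i s_i)
  have c2: "(m g (i (a r)), m (a r) h) \<in> C" "(i (a r), m (a r) h) \<in> C" for r
    using a' c1[of r] by (simp_all add: comp_iff[of "m g (i (a r))"] comp_iff[of "i (a r)"]
        m_in s_m t_m s_i i_in)
  have prod: "m (m g (i (a r))) (m (a r) h) = m g h" for r
  proof -
    have "m (m g (i (a r))) (m (a r) h) = m g (m (i (a r)) (m (a r) h))" by (rule assoc[OF c1(1)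
        c2(2)])
    also have "m (i (a r)) (m (a r) h) = m (m (i (a r)) (a r)) h"
        by (rule assoc[OF c1(3,2), symmetric])
    also have "\<dots> = h" using unitl[OF h] by (simp add: invl[OF a'(1)] a'(2) st)
    finally show ?thesis .
  qed
  \<comment> \<open>The two factors stay composable along the curve: the source of the first and the
    target of the second are both \<open>t (a r)\<close>.\<close>
  have "velocity B (\<lambda>r. s (m g (i (a r)))) (s g) (Tt h (tan_right G h u))"
    using vel_t[OF r] c1 by (simp add: s_m t_m s_i a' st)
  then show "Ts g (- tan_left G g (anchored (s g) u)) = Tt h (tan_right G h u)"
    by (rule velocity_unique[OF AB vel_s[OF l]])
  have "velocity M (\<lambda>r. m g h) (m g h) (Tm g h (- tan_left G g (anchored (s g)
      u), tan_right G h u))"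
    using vel_m[OF l r c2(1)] by (simp only: prod)
  then show "Tm g h (- tan_left G g (anchored (s g) u), tan_right G h u) = 0"
    by (rule velocity_unique[OF AM _ velocity_const[OF AM m_in[OF gh]]])
qed

text \<open>Multiplication by \<open>i h\<close> on the right recovers \<open>c r\<close> from
  \<open>m (c r) h\<close>. The latter curve has velocity 0, so \<open>c\<close> has too.\<close>

private lemma Tm_right_cancel:
  assumes gh: "(g, h) \<in> C" and X: "Ts g X = 0" "Tm g h (X, 0) = 0"
  shows "X = 0"
proof -
  have g: "g \<in> points M" and h: "h \<in> points M" and st: "s g = t h" using gh by (auto simp: comp_iff)
  obtain c where c: "velocity M c g X" "\<And>r. c r \<in> points M \<and> s (c r) = s g"
    by (rule source_fibre_curve[OF g X(1)]) blast
  have ch: "(c r, h) \<in> C" for r using c(2) h st by (simp add: comp_iff)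
  have 1: "velocity M (\<lambda>r. m (c r) h) (m g h) 0"
    using vel_m[OF c(1) velocity_const[OF AM h] ch] X(2) by simp
  have ci: "(m (c r) h, i h) \<in> C" "(m g h, i h) \<in> C" for r
    using ch gh h by (simp_all add: comp_iff[of _ "i h"] m_in s_m i_in t_i)
  have "velocity M (\<lambda>r. m (m (c r) h) (i h)) (m (m g h) (i h)) (Tm (m g h) (i h) (0, 0))"
    by (rule vel_m[OF 1 velocity_const[OF AM i_in[OF h]] ci(1)])
  then have "velocity M c g (Tm (m g h) (i h) (0, 0))"
    by (simp add: mult_inv_cancel[OF ch] mult_inv_cancel[OF gh])
  from velocity_unique[OF AM c(1) this] have "X = Tm (m g h) (i h) 0" by (simp only: zero_prod_def)
  then show ?thesis using linear_0[OF linear_Tm[OF ci(2)]] by simp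
qed

text \<open>Since \<open>s (m g h) = s h\<close>, the vector \<open>Y\<close> is tangent to the
  source fibre; multiplying a curve for it by \<open>i h\<close> moves it to the unit and gives
  \<open>u\<close>. The kernel vector that \<open>kernel_vectors\<close> attaches to this
  \<open>u\<close> has the same second entry, and cancellation on the right makes the first entries
  agree.\<close>

private lemma kernel_Tm:
  assumes gh: "(g, h) \<in> C" and XY: "Ts g X = Tt h Y" "Tm g h (X, Y) = 0"
  obtains u where "u \<in> lie_algebroid G (s g)" "X = - tan_left G g (anchored (s g) u)"
      "Y = tan_right G h u"
proof -
  have g: "g \<in> points M" and h: "h \<in> points M" and st: "s g = t h" using gh by (auto simp: comp_iff)
  have x: "t h \<in> points B" by (rule t_in[OF h])
  obtain c d where cd: "velocity M c g X" "velocity M d h Y" "\<And>r. (c r, d r) \<in> C"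
    by (rule composable_curve[OF gh XY(1)]) blast
  have "velocity B (\<lambda>r. s (m (c r) (d r))) (s (m g h)) (Ts (m g h) (Tm g h (X, Y)))"
    by (rule vel_s[OF vel_m[OF cd]])
  then have "velocity B (\<lambda>r. s (d r)) (s h) (Ts (m g h) 0)"
    by (simp add: s_m[OF cd(3)] s_m[OF gh] XY(2))
  from velocity_unique[OF AB vel_s[OF cd(2)] this] have "Ts h Y = 0"
    by (simp only: linear_0[OF linear_tangent_map[OF AM AB sm_s m_in[OF gh]]])
  \<comment> \<open>A new curve is needed: \<open>d\<close> has velocity \<open>Y\<close> but need
    not stay in the source fibre of \<open>h\<close>.\<close>
  then obtain b where b: "velocity M b h Y" "\<And>r. b r \<in> points M \<and> s (b r) = s h"
    using source_fibre_curve[OF h] by blast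
  have bi: "(b r, i h) \<in> C" for r using b(2) h by (simp add: comp_iff i_in t_i)
  have hi: "(h, i h) \<in> C" using h by (simp add: comp_iff i_in t_i)
  define u where "u = Tm h (i h) (Y, 0)"
  have a: "velocity M (\<lambda>r. m (b r) (i h)) (u1 (t h)) u"
    using vel_m[OF b(1) velocity_const[OF AM i_in[OF h]] bi] by (simp add: u_def invr[OF h])
  have sa: "s (m (b r) (i h)) = t h" "m (b r) (i h) \<in> points M" for r
    by (simp_all add: s_m[OF bi] s_i[OF h] m_in[OF bi])
  have "velocity B (\<lambda>r. t h) (t h) (Ts (u1 (t h)) u)"
    using vel_s[OF a] by (simp only: sa s_e[OF x])
  from velocity_unique[OF AB this velocity_const[OF AB x]] have "Ts (u1 (t h)) u = 0" .
  then have u: "u \<in> lie_algebroid G (s g)" by (simp add: lie_algebroid_def st)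
  have "m (m (b r) (i h)) h = b r" for r using mult_cancel_inv[of "b r" h] b(2) h by simp
  then have "velocity M b h (tan_right G h u)"
    using vel_right[OF h a] sa by simp
  then have Y: "Y = tan_right G h u" by (rule velocity_unique[OF AM b(1)])
  let ?Z = "- tan_left G g (anchored (s g) u)"
  note k = kernel_vectors[OF gh u]
  have "Ts g (X - ?Z) = Ts g X - Ts g ?Z" by (rule linear_diff[OF linear_tangent_map[OF AM AB sm_s
      g]])
  then have 1: "Ts g (X - ?Z) = 0" using k(1) XY(1) by (simp only: Y diff_self)
  have "Tm g h ((X, Y) - (?Z, Y)) = Tm g h (X, Y) - Tm g h (?Z, Y)"
      by (rule linear_diff[OF linear_Tm[OF gh]])
  then have "Tm g h (X - ?Z, 0) = 0" using XY(2) k(2) by (simp add: Y)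
  from Tm_right_cancel[OF gh 1 this] have "X = ?Z" by (simp only: right_minus_eq)
  from that[OF u this Y] show thesis .
qed

text \<open>A curve \<open>c\<close> through \<open>m g h\<close> with velocity \<open>Z\<close> and
  a curve \<open>d\<close> through \<open>h\<close> with equal sources are divided:
  \<open>m (c r) (i (d r))\<close> passes through \<open>g\<close>, and its product with
  \<open>d r\<close> is \<open>c r\<close> again.\<close>

private lemma Tm_surj:
  assumes gh: "(g, h) \<in> C"
  obtains X Y where "Ts g X = Tt h Y" "Tm g h (X, Y) = Z"
proof -
  have g: "g \<in> points M" and h: "h \<in> points M" and st: "s g = t h" using gh by (auto simp: comp_iff)
  note k = m_in[OF gh]
  \<comment> \<open>The source is a submersion at \<open>h\<close>, which provides a direction for
    \<open>d\<close> matching the change of source along \<open>c\<close>.\<close>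
  obtain Y where Y: "Ts h Y = Ts (m g h) Z" using sub_s h by (metis submersion_def surjD)
  obtain c d where cd: "velocity M c (m g h) Z" "velocity M d h Y" "\<And>r. c r \<in> points M \<and>
      d r \<in> points M \<and> s (c r) = s (d r)"
    using same_source_curve[OF k h s_m[OF gh] Y[symmetric]] by metis
  have ci: "(c r, i (d r)) \<in> C" for r using cd(3) by (simp add: comp_iff i_in t_i)
  define X where "X = Tm (m g h) (i h) (Z, tangent_map M M i h Y)"
  have a: "velocity M (\<lambda>r. m (c r) (i (d r))) g X"
    using vel_m[OF cd(1) vel_i[OF cd(2)] ci] by (simp add: X_def mult_inv_cancel[OF gh])
  have ad: "(m (c r) (i (d r)), d r) \<in> C" for r
    using cd(3) by (simp add: comp_iff[of _ "d r"] m_in[OF ci] s_m[OF ci] s_i)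
  have "m (m (c r) (i (d r))) (d r) = c r" for r using cd(3) mult_cancel_inv by blast
  then have "velocity M c (m g h) (Tm g h (X, Y))" using vel_m[OF a cd(2) ad] by simp
  then have Z: "Tm g h (X, Y) = Z" by (rule velocity_unique[OF AM _ cd(1)])
  have "s (m (c r) (i (d r))) = t (d r)" for r using ad by (simp add: comp_iff)
  then have "velocity B (\<lambda>r. t (d r)) (t h) (Ts g X)" using vel_s[OF a] by (simp add: st)
  then have "Ts g X = Tt h Y" by (rule velocity_unique[OF AB _ vel_t[OF cd(2)]])
  from that[OF this Z] show thesis .
qed

section \<open>The cotangent groupoid\<close>

text \<open>As \<open>s g = t h\<close>, both sides of the left-hand equation are functions
  restricted to the same fibre of the Lie algebroid. The minus sign in the kernel vectors turns the
  equality of their values at \<open>u\<close> into the vanishing of a sum.\<close>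

lemma cot_composable_iff:
  assumes gh: "(g, h) \<in> C"
  shows "cot_src G (g, \<alpha>) = cot_tgt G (h, \<beta>) \<longleftrightarrow>
    (\<forall>X Y. Ts g X = Tt h Y \<longrightarrow> Tm g h (X, Y) = 0 \<longrightarrow> blinfun_apply \<alpha> X + blinfun_apply \<beta> Y = 0)"
proof -
  have st: "s g = t h" using gh by (simp add: comp_iff)
  have "cot_src G (g, \<alpha>) = cot_tgt G (h, \<beta>) \<longleftrightarrow>
      (\<forall>u\<in>lie_algebroid G (s g). blinfun_apply \<alpha> (tan_left G g (anchored (s g) u))
          = blinfun_apply \<beta> (tan_right G h u))"
    by (auto simp: cot_src_def cot_tgt_def Let_def st restrict_def fun_eq_iff)
  also have "\<dots> \<longleftrightarrow> (\<forall>u\<in>lie_algebroid G (s g). blinfun_apply \<alpha> (- tan_left G g (anchored (s g) u))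
      + blinfun_apply \<beta> (tan_right G h u) = 0)"
  proof -
    have "- a + b = 0 \<longleftrightarrow> a = b" for a b :: real by linarith
    then show ?thesis by (simp only: blinfun.minus_right)
  qed
  also have "\<dots> \<longleftrightarrow> (\<forall>X Y. Ts g X = Tt h Y \<longrightarrow> Tm g h (X, Y) = 0 \<longrightarrow> blinfun_apply \<alpha> X + blinfun_apply \<beta> Y
      = 0)"
  proof (intro iffI allI impI ballI)
    fix X Y assume H: "\<forall>u\<in>lie_algebroid G (s g). blinfun_apply \<alpha> (- tan_left G g (anchored (s g) u))
        + blinfun_apply \<beta> (tan_right G h u) = 0"
      and XY: "Ts g X = Tt h Y" "Tm g h (X, Y) = 0"
    obtain u where "u \<in> lie_algebroid G (s g)" "X = - tan_left G g (anchored (s g) u)"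
        "Y = tan_right G h u"
      by (rule kernel_Tm[OF gh XY])
    then show "blinfun_apply \<alpha> X + blinfun_apply \<beta> Y = 0" using H by simp
  next
    fix u assume H: "\<forall>X Y. Ts g X = Tt h Y \<longrightarrow> Tm g h (X, Y) = 0 \<longrightarrow> blinfun_apply \<alpha> X + blinfun_apply \<beta>
        Y = 0"
      and u: "u \<in> lie_algebroid G (s g)"
    show "blinfun_apply \<alpha> (- tan_left G g (anchored (s g) u)) + blinfun_apply \<beta> (tan_right G h u)
        = 0"
      by (rule H[rule_format, OF kernel_vectors[OF gh u]])
  qed
  finally show ?thesis .
qed

text \<open>\<open>cot_mult\<close> is a definite description and meaningful only once existence and
  uniqueness hold. Uniqueness comes from \<open>Tm_surj\<close>; existence follows from
  composability of \<open>\<alpha>\<close> and \<open>\<beta>\<close>, and conversely a covector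
  with the property forces composability. Hence the conjunction on the left.\<close>

lemma cot_mult_iff:
  assumes gh: "(g, h) \<in> C"
  shows "cot_src G (g, \<alpha>) = cot_tgt G (h, \<beta>) \<and> \<gamma> = snd (cot_mult G (g, \<alpha>) (h, \<beta>)) \<longleftrightarrow>
    (\<forall>X Y. Ts g X = Tt h Y \<longrightarrow> blinfun_apply \<gamma> (Tm g h (X, Y)) = blinfun_apply \<alpha> X + blinfun_apply \<beta>
        Y)"
    (is "?comp \<and> \<gamma> = ?cm \<longleftrightarrow> ?P \<gamma>")
proof -
  have g: "g \<in> points M" and h: "h \<in> points M" and st: "s g = t h" using gh by (auto simp: comp_iff)
  have uniq: "\<gamma> = \<gamma>'" if "?P \<gamma>" "?P \<gamma>'" for \<gamma> \<gamma>'
  proof (rule blinfun_eqI)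
    fix Z
    obtain X Y where "Ts g X = Tt h Y" "Tm g h (X, Y) = Z" by (rule Tm_surj[OF gh])
    then show "blinfun_apply \<gamma> Z = blinfun_apply \<gamma>' Z" using that by metis
  qed
  have cm: "?cm = (THE \<gamma>. ?P \<gamma>)"
    using g h st by (simp add: cot_mult_def tan_composable_def tan_mult_def)
  have ex: "\<exists>\<gamma>. ?P \<gamma>" if ?comp
  proof -
    let ?\<phi> = "\<lambda>v. blinfun_apply \<alpha> (fst v) + blinfun_apply \<beta> (snd v)"
    let ?T = "\<lambda>v. Ts g (fst v) = Tt h (snd v)"
    have ls: "linear (Ts g)" and lt: "linear (Tt h)" and lm: "linear (Tm g h)"
      by (rule linear_tangent_map[OF AM AB sm_s g], rule linear_tangent_map[OF AM AB sm_t h],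
          rule linear_Tm[OF gh])
    \<comment> \<open>Two lifts of the same vector differ by a kernel vector of \<open>Tm\<close>,
      on which \<open>?\<phi>\<close> vanishes.\<close>
    have ker: "?\<phi> v = ?\<phi> w" if vw: "?T v" "?T w" "Tm g h v = Tm g h w" for v w
    proof -
      have "Ts g (fst v - fst w) = Tt h (snd v - snd w)" using vw by (simp add: linear_diff[OF ls]
          linear_diff[OF lt])
      moreover have "Tm g h (fst v - fst w, snd v - snd w) = 0"
        using linear_diff[OF lm, of v w] vw(3) by (simp add: minus_prod_def)
      ultimately have "blinfun_apply \<alpha> (fst v - fst w) + blinfun_apply \<beta> (snd v - snd w) = 0"
        using \<open>?comp\<close> cot_composable_iff[OF gh] by blast
      then show ?thesis by (simp add: blinfun.diff_right)
    qed
    have "\<exists>v. ?T v \<and> Tm g h v = Z" for Z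
    proof -
      obtain X Y where "Ts g X = Tt h Y" "Tm g h (X, Y) = Z" by (rule Tm_surj[OF gh])
      then show ?thesis by (intro exI[of _ "(X, Y)"]) simp
    qed
    \<comment> \<open>An arbitrary choice of composable lifts, which need not be linear; by
      \<open>ker\<close> its composite with \<open>?\<phi>\<close> is linear nevertheless.\<close>
    then obtain r where r: "\<And>Z. ?T (r Z)" "\<And>Z. Tm g h (r Z) = Z" by metis
    have lin: "linear (\<lambda>Z. ?\<phi> (r Z))"
    proof (rule linearI)
      fix Z Z' c
      have "?\<phi> (r (Z + Z')) = ?\<phi> (r Z + r Z')"
        by (rule ker) (simp_all add: r linear_add[OF ls] linear_add[OF lt] linear_add[OF lm])
      then show "?\<phi> (r (Z + Z')) = ?\<phi> (r Z) + ?\<phi> (r Z')" by (simp add: blinfun.add_right)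
      have "?\<phi> (r (c *\<^sub>R Z)) = ?\<phi> (c *\<^sub>R r Z)"
        by (rule ker) (simp_all add: r linear_scale[OF ls] linear_scale[OF lt] linear_scale[OF lm])
      then show "?\<phi> (r (c *\<^sub>R Z)) = c *\<^sub>R ?\<phi> (r Z)" by (simp add: blinfun.scaleR_right algebra_simps)
    qed
    have "?P (Blinfun (\<lambda>Z. ?\<phi> (r Z)))"
    proof (intro allI impI)
      fix X Y assume XY: "Ts g X = Tt h Y"
      have "?\<phi> (r (Tm g h (X, Y))) = ?\<phi> (X, Y)" by (rule ker) (simp_all add: r XY)
      then show "blinfun_apply (Blinfun (\<lambda>Z. ?\<phi> (r Z))) (Tm g h (X, Y)) = blinfun_apply \<alpha> X +
          blinfun_apply \<beta> Y"
        by (simp add: blinfun_apply_Blinfun_linear[OF lin])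
    qed
    then show ?thesis by blast
  qed
  show ?thesis
  proof
    assume c: "?comp \<and> \<gamma> = ?cm"
    then obtain \<gamma>' where P': "?P \<gamma>'" using ex by blast
    have "?P (THE \<gamma>. ?P \<gamma>)" by (rule theI[of ?P, OF P']) (rule uniq[OF _ P'])
    then show "?P \<gamma>" using c cm by simp
  next
    assume P: "?P \<gamma>"
    have "(THE \<gamma>. ?P \<gamma>) = \<gamma>" using P by (rule the_equality) (rule uniq[OF _ P])
    moreover have ?comp
      unfolding cot_composable_iff[OF gh]
    proof (intro allI impI)
      fix X Y assume XY: "Ts g X = Tt h Y" "Tm g h (X, Y) = 0"
      have "blinfun_apply \<alpha> X + blinfun_apply \<beta> Y = blinfun_apply \<gamma> (Tm g h (X, Y))" using P XY(1)
          by simp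
      then show "blinfun_apply \<alpha> X + blinfun_apply \<beta> Y = 0" by (simp add: XY(2))
    qed
    ultimately show "?comp \<and> \<gamma> = ?cm" by (simp add: cm)
  qed
qed

section \<open>The graph of the multiplication\<close>

text \<open>The sign change sits outside the inner \<open>join_iso\<close>, matching
  \<open>opp_courant\<close> applied to the product of the last two factors as a whole.\<close>

definition graph_iso :: "('e \<times> ('e \<Rightarrow>\<^sub>L real)) \<times> ('e \<times> ('e \<Rightarrow>\<^sub>L real)) \<times> ('e \<times> ('e \<Rightarrow>\<^sub>L real)) \<Rightarrow>
    ('e \<times> 'e \<times> 'e) \<times> (('e \<times> 'e \<times> 'e) \<Rightarrow>\<^sub>L real)" where
  "graph_iso = join_iso (\<lambda>v. v) (flip_form \<circ> join_iso (\<lambda>v. v) (\<lambda>v. v))"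

lemma courant_iso_graph_iso: "courant_iso (\<T> G \<times>\<^sub>C opp_courant (\<T> G \<times>\<^sub>C \<T> G)) graph_iso"
  unfolding graph_iso_def
  by (intro courant_iso_prod courant_iso_opp courant_iso_std AM)

lemma graph_iso_apply:
  "fst (graph_iso ((Z, \<gamma>), (X, \<alpha>), (Y, \<beta>))) = (Z, X, Y)"
  "blinfun_apply (snd (graph_iso ((Z, \<gamma>), (X, \<alpha>), (Y, \<beta>)))) (z, x, y) = blinfun_apply \<gamma> z -
      (blinfun_apply \<alpha> x + blinfun_apply \<beta> y)"
  by (simp_all add: graph_iso_def join_iso_def blinfun.minus_left)

lemma regroup_graph_pont_mult:
  "regroup ` graph_pont_mult G = {(x, v). (x, graph_iso v) \<in> conormal_dirac (M \<times>\<^sub>M M \<times>\<^sub>M M)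
      (graph_mult G)}"
proof -
  have "(((k, g, h), (Z, \<gamma>), (X, \<alpha>), (Y, \<beta>)) \<in> regroup ` graph_pont_mult G) \<longleftrightarrow>
      ((k, g, h), graph_iso ((Z, \<gamma>), (X, \<alpha>), (Y, \<beta>))) \<in> conormal_dirac (M \<times>\<^sub>M M \<times>\<^sub>M M) (graph_mult G)"
          for k g h Z \<gamma> X \<alpha> Y \<beta>
  proof -
    have "(((k, g, h), (Z, \<gamma>), (X, \<alpha>), (Y, \<beta>)) \<in> regroup ` graph_pont_mult G) \<longleftrightarrow>
        ((g, X, \<alpha>), (h, Y, \<beta>)) \<in> pont_composable G \<and> (k, Z, \<gamma>) = pont_mult G (g, X, \<alpha>) (h, Y, \<beta>)"
      by (force simp: regroup_def graph_pont_mult_def image_iff)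
    also have "\<dots> \<longleftrightarrow> (g, h) \<in> C \<and> k = m g h \<and> Ts g X = Tt h Y \<and> Z = Tm g h (X, Y) \<and>
        (cot_src G (g, \<alpha>) = cot_tgt G (h, \<beta>) \<and> \<gamma> = snd (cot_mult G (g, \<alpha>) (h, \<beta>)))"
      by (auto simp: pont_composable_def tan_composable_def pont_mult_def tan_mult_def comp_iff)
    \<comment> \<open>The quantified \<open>X\<close> and \<open>Y\<close> range over all composable
      vectors over \<open>(g, h)\<close> and shadow the given pair.\<close>
    also have "\<dots> \<longleftrightarrow> (g, h) \<in> C \<and> k = m g h \<and> Ts g X = Tt h Y \<and> Z = Tm g h (X, Y) \<and>
        (\<forall>X Y. Ts g X = Tt h Y \<longrightarrow> blinfun_apply \<gamma> (Tm g h (X, Y)) = blinfun_apply \<alpha> X + blinfun_apply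
            \<beta> Y)"
      using cot_mult_iff by blast
    also have "\<dots> \<longleftrightarrow> ((k, g, h), graph_iso ((Z, \<gamma>), (X, \<alpha>), (Y, \<beta>))) \<in> conormal_dirac (M \<times>\<^sub>M M \<times>\<^sub>M M)
        (graph_mult G)"
    \<comment> \<open>Off the graph of the multiplication both sides are false; on it
      \<open>tangent_space_graph_mult\<close> describes the fibre of
      \<open>conormal_dirac\<close>.\<close>
    proof (cases "(g, h) \<in> C \<and> k = m g h")
      case True
      then have gh: "(g, h) \<in> C" and k: "k = m g h" by auto
      have in_graph: "(m g h, g, h) \<in> graph_mult G" using gh by (auto simp: graph_mult_def)
      have "((k, g, h), graph_iso ((Z, \<gamma>), (X, \<alpha>), (Y, \<beta>))) \<in> conormal_dirac (M \<times>\<^sub>M M \<times>\<^sub>M M)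
          (graph_mult G) \<longleftrightarrow>
          (Z, X, Y) \<in> tangent_space (M \<times>\<^sub>M M \<times>\<^sub>M M) (graph_mult G) (m g h, g, h) \<and>
          (\<forall>w\<in>tangent_space (M \<times>\<^sub>M M \<times>\<^sub>M M) (graph_mult G) (m g h, g, h). blinfun_apply (snd
              (graph_iso ((Z, \<gamma>), (X, \<alpha>), (Y, \<beta>)))) w = 0)"
        by (cases "graph_iso ((Z, \<gamma>), (X, \<alpha>), (Y, \<beta>))")
          (use graph_iso_apply(1)[of Z \<gamma> X \<alpha> Y \<beta>] in_graph in \<open>auto simp: conormal_dirac_def k\<close>)
      then show ?thesis
        using gh k by (auto simp: tangent_space_graph_mult[OF gh] graph_iso_apply)
    next
      case False
      then show ?thesis by (auto simp: conormal_dirac_def graph_mult_def)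
    qed
    finally show ?thesis .
  qed
  then show ?thesis by (intro set_eqI) (simp add: split_paired_all)
qed

lemma dirac_structure_graph_pont_mult:
  "dirac_structure (\<T> G \<times>\<^sub>C opp_courant (\<T> G \<times>\<^sub>C \<T> G)) (graph_mult G) (regroup ` graph_pont_mult G)"
proof (rule dirac_structure_iso[OF courant_iso_graph_iso _ regroup_graph_pont_mult])
  show "dirac_structure (std_courant (base (\<T> G \<times>\<^sub>C opp_courant (\<T> G \<times>\<^sub>C \<T> G)))) (graph_mult G)
      (conormal_dirac (M \<times>\<^sub>M M \<times>\<^sub>M M) (graph_mult G))"
    using dirac_structure_conormal[OF P3 graph_mult_submanifold] by simp
qed

lemma courant_morphism_graph_pont_mult:
  "courant_morphism (\<T> G \<times>\<^sub>C \<T> G) (\<T> G) C (\<lambda>(g, h). m g h) (regroup ` graph_pont_mult G)"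
proof -
  have "{((\<lambda>(g, h). m g h) x, x) |x. x \<in> C} = graph_mult G" by (auto simp: graph_mult_def)
  then show ?thesis
    using composable_submanifold sm_m dirac_structure_graph_pont_mult
        by (simp add: courant_morphism_def)
qed

end

theorem proposition5p3:
  fixes G :: "('g, 'e::findim_space, 'm, 'f::findim_space) groupoid"
  assumes "lie_groupoid G"
  shows "dirac_structure (\<T> G \<times>\<^sub>C opp_courant (\<T> G \<times>\<^sub>C \<T> G))
           (graph_mult G) (regroup ` graph_pont_mult G)
    \<and> courant_morphism (\<T> G \<times>\<^sub>C \<T> G) (\<T> G) (composable G) (\<lambda>(g, h). mult G g h)
        (regroup ` graph_pont_mult G)"
  using dirac_structure_graph_pont_mult[OF assms] courant_morphism_graph_pont_mult[OF assms] by blast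

end
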